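(* Let $\alpha\in(1,2)$ and let $X$ be either (a) the Taqqu–Levy process with $\mathbb P(T_1\ge n)=L(n)n^{-\alpha}$ for all $n\ge1$ ($L$ slowly varying) and $\sigma_W^2<\infty$, or (b) Parke's process with $\mathbb P(N\ge j)=L(j)j^{-\alpha}$ for all $j\ge1$ ($L$ slowly varying) and $\mathbb E[\epsilon_0^2]<\infty$. Let $D_{n,j}=\sum_{t=1}^nX_te^{\mathrm i t 2\pi j/n}$, let $U=T_1$ in case (a), $U=N$ in case (b), and $\ell(n)=n^{-1/\alpha}\inf\{t>0:\mathbb P(U>t)<n^{-1}\}$. Let $j_1<\dots<j_q$ be fixed positive integers. Then $$\ell(n)^{-1}n^{-1/\alpha}(D_{n,j_1},\dots,D_{n,j_q})\xrightarrow{\ d\ }\Big(\int_0^1e^{2\mathrm i\pi j_1s}\,d\Lambda_\alpha(s),\dots,\int_0^1e^{2\mathrm i\pi j_qs}\,d\Lambda_\alpha(s)\Big),$$ where $\Lambda_\alpha$ is the $\alpha$-stable Lévy process with characteristic function $$\mathbb E[e^{\mathrm i u\Lambda_\alpha(t)}]=\exp\Big\{-t|u|^\alpha\mu^{-1}\mathbb E[|\xi|^\alpha]\,\Gamma(1-\alpha)\cos(\pi\alpha/2)\big(1-\mathrm i\,\beta\,\mathrm{sign}(u)\tan(\pi\alpha/2)\big)\Big\},$$ $\beta=(\mathbb E[\xi_+^\alpha]-\mathbb E[\xi_-^\alpha])/\mathbb E[|\xi|^\alpha]$, with $\xi=W_1$ in case (a) and $\xi=\epsilon_1$, $\mu=1$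 in case (b).
   Context: Taqqu–Levy process: $(T_k)_{k\ge1}$ are i.i.d. positive integer-valued random variables with mean $\mu$ and $\mathbb P(T_1=1)>0$; $S_0$ is a non-negative integer-valued random variable independent of $(T_k)$ with $\mathbb P(S_0=u)=\mu^{-1}\mathbb P(T_1\ge u+1)$, $u=0,1,\dots$; $(W_k)_{k\ge0}$ are i.i.d. with $\mathbb E[W_k]=0$, $\mathrm{var}(W_k)=\sigma_W^2$, independent of $S_0$ and $(T_k)$. Set $S_{-1}=-1$, $S_k=S_0+T_1+\dots+T_k$ ($k\ge1$), and $X_t=\sum_{k=0}^\infty W_k\mathbf 1_{\{S_{k-1}\le t<S_k\}}$. Parke's process: $(\epsilon_t)_{t\in\mathbb Z}$ i.i.d. with zero mean, $(n_s)_{s\in\mathbb Z}$ i.i.d. non-negative integer-valued, independent of $(\epsilon_t)$, with generic copy $N$; $g_{s,t}=1$ if $s\le t\le s+n_s$ and $0$ otherwise; $X_t=\sum_{s\le t}g_{s,t}\epsilon_s$. $x_+=\max(x,0)$, $x_-=\max(-x,0)$. The integrals $\int_0^1 e^{2\mathrm i\pi js}d\Lambda_\alpha(s)$ are stochastic integrals of deterministic continuous functions against the Lévy process (real and imaginary parts integrated separately). A function $L$ is slowly varying at infinity if it is bounded on finite intervals and $L(at)/L(t)\to1$ for all $a>0$. *)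

theory Defs
  imports "HOL-Probability.Probability"
begin

definition slowly_varying :: "(real \<Rightarrow> real) \<Rightarrow> bool" where
  "slowly_varying L \<longleftrightarrow>
     (\<forall>a b. bdd_above ((\<lambda>x. \<bar>L x\<bar>) ` {a..b})) \<and>
     (\<forall>a>0. ((\<lambda>t. L (a * t) / L t) \<longlongrightarrow> 1) at_top)"

definition tl_S :: "('a \<Rightarrow> nat) \<Rightarrow> (nat \<Rightarrow> 'a \<Rightarrow> nat) \<Rightarrow> nat \<Rightarrow> 'a \<Rightarrow> int" where
  "tl_S S0 T k \<omega> = int (S0 \<omega>) + (\<Sum>i\<in>{1..k}. int (T i \<omega>))"

definition tl_Sprev :: "('a \<Rightarrow> nat) \<Rightarrow> (nat \<Rightarrow> 'a \<Rightarrow> nat) \<Rightarrow> nat \<Rightarrow> 'a \<Rightarrow> int" where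
  "tl_Sprev S0 T k \<omega> = (if k = 0 then -1 else tl_S S0 T (k - 1) \<omega>)"

definition tl_X :: "('a \<Rightarrow> nat) \<Rightarrow> (nat \<Rightarrow> 'a \<Rightarrow> nat) \<Rightarrow> (nat \<Rightarrow> 'a \<Rightarrow> real) \<Rightarrow> int \<Rightarrow> 'a \<Rightarrow> real" where
  "tl_X S0 T W t \<omega> =
     (\<Sum>k. W k \<omega> * (if tl_Sprev S0 T k \<omega> \<le> t \<and> t < tl_S S0 T k \<omega> then 1 else 0))"

definition tl_family :: "('a \<Rightarrow> nat) \<Rightarrow> (nat \<Rightarrow> 'a \<Rightarrow> nat) \<Rightarrow> (nat \<Rightarrow> 'a \<Rightarrow> real)
    \<Rightarrow> unit + nat + nat \<Rightarrow> 'a \<Rightarrow> real" where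
  "tl_family S0 T W i \<omega> = (case i of Inl _ \<Rightarrow> real (S0 \<omega>)
                                  | Inr (Inl k) \<Rightarrow> real (T k \<omega>)
                                  | Inr (Inr k) \<Rightarrow> W k \<omega>)"

definition tl_index :: "(unit + nat + nat) set" where
  "tl_index = {i. case i of Inr (Inl k) \<Rightarrow> 1 \<le> k | _ \<Rightarrow> True}"

definition taqqu_levy_model ::
  "'a measure \<Rightarrow> ('a \<Rightarrow> nat) \<Rightarrow> (nat \<Rightarrow> 'a \<Rightarrow> nat) \<Rightarrow> (nat \<Rightarrow> 'a \<Rightarrow> real) \<Rightarrow> real \<Rightarrow> (real \<Rightarrow> real) \<Rightarrow> bool" where
  "taqqu_levy_model M S0 T W \<alpha> L \<longleftrightarrow>
     prob_space M \<and>
     prob_space.indep_vars M (\<lambda>_. borel) (tl_family S0 T W) tl_index \<and>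
     (\<forall>k\<ge>1. distr M borel (\<lambda>\<omega>. real (T k \<omega>)) = distr M borel (\<lambda>\<omega>. real (T 1 \<omega>))) \<and>
     (\<forall>k\<ge>1. AE \<omega> in M. 1 \<le> T k \<omega>) \<and>
     integrable M (\<lambda>\<omega>. real (T 1 \<omega>)) \<and>
     measure M {\<omega>\<in>space M. T 1 \<omega> = 1} > 0 \<and>
     (\<forall>u::nat. measure M {\<omega>\<in>space M. S0 \<omega> = u} =
         measure M {\<omega>\<in>space M. u + 1 \<le> T 1 \<omega>} / (\<integral>\<omega>. real (T 1 \<omega>) \<partial>M)) \<and>
     (\<forall>k. distr M borel (W k) = distr M borel (W 0)) \<and>
     integrable M (W 0) \<and> (\<integral>\<omega>. W 0 \<omega> \<partial>M) = 0 \<and>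
     integrable M (\<lambda>\<omega>. (W 0 \<omega>)\<^sup>2) \<and>
     slowly_varying L \<and>
     (\<forall>n::nat\<ge>1. measure M {\<omega>\<in>space M. n \<le> T 1 \<omega>} = L (real n) * real n powr (- \<alpha>))"

text \<open>X t = sum over s <= t of g(s,t) eps s, written with s = t - k; g(s,t)=1 iff k <= n_s.\<close>
definition parke_X :: "(int \<Rightarrow> 'a \<Rightarrow> real) \<Rightarrow> (int \<Rightarrow> 'a \<Rightarrow> nat) \<Rightarrow> int \<Rightarrow> 'a \<Rightarrow> real" where
  "parke_X eps nn t \<omega> = (\<Sum>k. eps (t - int k) \<omega> * (if k \<le> nn (t - int k) \<omega> then 1 else 0))"

definition parke_family :: "(int \<Rightarrow> 'a \<Rightarrow> real) \<Rightarrow> (int \<Rightarrow> 'a \<Rightarrow> nat) \<Rightarrow> int + int \<Rightarrow> 'a \<Rightarrow> real" where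
  "parke_family eps nn i \<omega> = (case i of Inl s \<Rightarrow> eps s \<omega> | Inr s \<Rightarrow> real (nn s \<omega>))"

definition parke_model ::
  "'a measure \<Rightarrow> (int \<Rightarrow> 'a \<Rightarrow> real) \<Rightarrow> (int \<Rightarrow> 'a \<Rightarrow> nat) \<Rightarrow> real \<Rightarrow> (real \<Rightarrow> real) \<Rightarrow> bool" where
  "parke_model M eps nn \<alpha> L \<longleftrightarrow>
     prob_space M \<and>
     prob_space.indep_vars M (\<lambda>_. borel) (parke_family eps nn) UNIV \<and>
     (\<forall>s. distr M borel (eps s) = distr M borel (eps 0)) \<and>
     (\<forall>s. distr M borel (\<lambda>\<omega>. real (nn s \<omega>)) = distr M borel (\<lambda>\<omega>. real (nn 0 \<omega>))) \<and>
     integrable M (eps 0) \<and> (\<integral>\<omega>. eps 0 \<omega> \<partial>M) = 0 \<and>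
     integrable M (\<lambda>\<omega>. (eps 0 \<omega>)\<^sup>2) \<and>
     slowly_varying L \<and>
     (\<forall>j::nat\<ge>1. measure M {\<omega>\<in>space M. j \<le> nn 0 \<omega>} = L (real j) * real j powr (- \<alpha>))"

definition dft :: "(int \<Rightarrow> 'a \<Rightarrow> real) \<Rightarrow> nat \<Rightarrow> nat \<Rightarrow> 'a \<Rightarrow> complex" where
  "dft X n j \<omega> = (\<Sum>t=1..n. complex_of_real (X (int t) \<omega>) * cis (2 * pi * real t * real j / real n))"

definition ell :: "'a measure \<Rightarrow> ('a \<Rightarrow> nat) \<Rightarrow> real \<Rightarrow> nat \<Rightarrow> real" where
  "ell M U \<alpha> n = real n powr (- 1 / \<alpha>) *
     Inf {t::real. 0 < t \<and> measure M {\<omega>\<in>space M. t < real (U \<omega>)} < 1 / real n}"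

definition stable_levy :: "'b measure \<Rightarrow> (real \<Rightarrow> 'b \<Rightarrow> real) \<Rightarrow> real \<Rightarrow> real \<Rightarrow> real \<Rightarrow> bool" where
  "stable_levy M \<Lambda> \<alpha> c \<beta> \<longleftrightarrow>
     prob_space M \<and>
     (\<forall>t\<ge>0. \<Lambda> t \<in> borel_measurable M) \<and>
     (AE \<omega> in M. \<Lambda> 0 \<omega> = 0) \<and>
     (\<forall>(t::nat \<Rightarrow> real) k. 0 \<le> t 0 \<and> incseq t \<longrightarrow>
        prob_space.indep_vars M (\<lambda>_. borel) (\<lambda>i \<omega>. \<Lambda> (t (Suc i)) \<omega> - \<Lambda> (t i) \<omega>) {..<k}) \<and>
     (\<forall>s t u. 0 \<le> s \<and> s \<le> t \<longrightarrow>
        (\<integral>\<omega>. cis (u * (\<Lambda> t \<omega> - \<Lambda> s \<omega>)) \<partial>M) =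
        exp (- (complex_of_real ((t - s) * \<bar>u\<bar> powr \<alpha> * c) *
                (1 - \<i> * complex_of_real (\<beta> * sgn u * tan (pi * \<alpha> / 2))))))"

definition riemann_sum :: "(real \<Rightarrow> 'b \<Rightarrow> real) \<Rightarrow> (real \<Rightarrow> complex) \<Rightarrow> nat \<Rightarrow> 'b \<Rightarrow> complex" where
  "riemann_sum \<Lambda> f m \<omega> =
     (\<Sum>k<m. f (real k / real m) *
        complex_of_real (\<Lambda> (real (Suc k) / real m) \<omega> - \<Lambda> (real k / real m) \<omega>))"

definition conv_in_prob :: "'b measure \<Rightarrow> (nat \<Rightarrow> 'b \<Rightarrow> complex) \<Rightarrow> ('b \<Rightarrow> complex) \<Rightarrow> bool" where
  "conv_in_prob M Y Z \<longleftrightarrow>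
     (\<forall>e>0. ((\<lambda>m. measure M {\<omega>\<in>space M. e < norm (Y m \<omega> - Z \<omega>)}) \<longlongrightarrow> 0) sequentially)"

text \<open>The stochastic integral over [0,1] of a deterministic continuous f against Lambda,
  as the limit in probability of Riemann--Stieltjes sums over uniform partitions.\<close>
definition stoch_integral :: "'b measure \<Rightarrow> (real \<Rightarrow> 'b \<Rightarrow> real) \<Rightarrow> (real \<Rightarrow> complex) \<Rightarrow> ('b \<Rightarrow> complex) \<Rightarrow> bool" where
  "stoch_integral M \<Lambda> f I \<longleftrightarrow>
     I \<in> borel_measurable M \<and> conv_in_prob M (riemann_sum \<Lambda> f) I"

definition conv_distr :: "'a measure \<Rightarrow> (nat \<Rightarrow> 'a \<Rightarrow> 'v::metric_space) \<Rightarrow> 'b measure \<Rightarrow> ('b \<Rightarrow> 'v) \<Rightarrow> bool" where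
  "conv_distr M Y M' Z \<longleftrightarrow>
     (\<forall>n. Y n \<in> borel_measurable M) \<and> Z \<in> borel_measurable M' \<and>
     (\<forall>f :: 'v \<Rightarrow> real. continuous_on UNIV f \<and> bounded (range f) \<longrightarrow>
        ((\<lambda>n. \<integral>\<omega>. f (Y n \<omega>) \<partial>M) \<longlongrightarrow> (\<integral>\<omega>. f (Z \<omega>) \<partial>M')) sequentially)"

end

theory Submission
  imports Defs
begin

text \<open>Both processes are superpositions of blocks: the \<open>k\<close>-th block occupies an interval of random length
  starting near time \<open>\<mu> k\<close>, and carries one centred square integrable mark \<open>\<xi> k\<close>. A linear functional of
  the discrete Fourier transforms is a sum over the blocks of the mark times the sum of a Lipschitz
  weight \<open>g (t / n)\<close> over the block. The normalisation is the \<open>1 / n\<close> tail quantile \<open>a n\<close> of the length,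
  which is \<open>o(n)\<close>, so a block sees an essentially constant weight, and \<open>g\<close> may be frozen at
  \<open>\<mu> k / n\<close>; the error is controlled in the second moment, truncated at 1, because the marks are
  orthogonal given the blocks. What remains is a sum of independent variables
  \<open>g (\<mu> k / n) \<xi> k len k / a n\<close>. Regular variation of the tail gives the limit of their characteristic
  functions: the exponents converge to a Riemann integral of the stable exponent along \<open>g\<close>. The
  Riemann--Stieltjes sums of the Levy process have the same limit, and characteristic functions
  determine weak convergence.\<close>

section \<open>Characteristic functions and weak convergence in Euclidean space\<close>

text \<open>Lengths have finite mean but infinite variance, and in the renewal case the start of a
  block is built from all earlier lengths. So the exact weights of different blocks are dependent,
  and their characteristic function does not factorise. What survives is that a mark is independent
  of the other marks and of all lengths and starts; this suffices for the comparison with frozen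
  weights, whose array does have independent terms. Lengths then enter only through
  \<open>n * G (a n * v)\<close>: a layer-cake formula writes functionals of a length as integrals
  of its tail, and Potter bounds dominate that tail by powers of \<open>v\<close> with exponents on
  both sides of \<alpha>, still in (1, 2) and so integrable against \<open>min 1 v\<close>. As the
  marks are centred, the linear compensator of the exponent has mean zero. The end of the sample
  becomes a cutoff of the weight at 1, and its jump forces a small window of indices to be estimated
  apart. About \<open>n / \<mu>\<close> blocks start before time \<open>n\<close>, whence the factor
  \<open>1 / \<mu>\<close>. Blocks cut by the beginning of the sample contribute a random variable
  that does not change with \<open>n\<close>, negligible after division by
  \<open>a n\<close>.\<close>

lemma borel_measurable_cis [measurable]: "cis \<in> borel_measurable borel"
  by (intro borel_measurable_continuous_onI continuous_intros)

inductive trig_poly :: "('v::euclidean_space \<Rightarrow> complex) \<Rightarrow> bool" where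
  char: "trig_poly (\<lambda>x. c * cis (\<theta> \<bullet> x))"
| add: "trig_poly f \<Longrightarrow> trig_poly g \<Longrightarrow> trig_poly (\<lambda>x. f x + g x)"

lemma trig_poly_const: "trig_poly (\<lambda>x. c)"
  using trig_poly.char[of c 0] by simp

lemma trig_poly_mult:
  assumes "trig_poly f" "trig_poly g"
  shows "trig_poly (\<lambda>x. f x * g x)"
  using assms
proof (induction f)
  case (char c \<theta>)
  from char.prems show ?case
  proof (induction g)
    case (char d \<eta>)
    have "(\<lambda>x. c * cis (\<theta> \<bullet> x) * (d * cis (\<eta> \<bullet> x))) = (\<lambda>x. (c * d) * cis ((\<theta> + \<eta>) \<bullet> x))"
      by (simp add: fun_eq_iff inner_add_left cis_mult[symmetric] mult_ac)
    then show ?case using trig_poly.char[of "c * d" "\<theta> + \<eta>"] by simp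
  next
    case (add f g)
    then show ?case by (simp add: ring_distribs trig_poly.add)
  qed
next
  case (add f1 f2)
  then show ?case by (simp add: ring_distribs trig_poly.add)
qed

lemma trig_poly_sum:
  assumes "finite A" "\<And>i. i \<in> A \<Longrightarrow> trig_poly (f i)"
  shows "trig_poly (\<lambda>x. \<Sum>i\<in>A. f i x)"
  using assms by (induction A) (auto intro: trig_poly_const[of 0, simplified] trig_poly.add)

lemma trig_poly_sin: "trig_poly (\<lambda>x. complex_of_real (sin (\<theta> \<bullet> x)))"
proof -
  have "(\<lambda>x. complex_of_real (sin (\<theta> \<bullet> x))) =
        (\<lambda>x. (- \<i> / 2) * cis (\<theta> \<bullet> x) + (\<i> / 2) * cis ((- \<theta>) \<bullet> x))"
    by (auto simp: fun_eq_iff complex_eq_iff)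
  then show ?thesis by (simp only: trig_poly.intros)
qed

text \<open>Polynomial functions are generated from linear functionals and constants by sums and
  products, and \<open>trig_poly\<close> is an algebra, so it suffices that the coordinates of
  \<open>s\<close> are trigonometric polynomials.\<close>

lemma trig_poly_real_polynomial:
  fixes s :: "'v::euclidean_space \<Rightarrow> 'v"
  assumes "real_polynomial_function p"
    and "\<And>b. b \<in> Basis \<Longrightarrow> trig_poly (\<lambda>x. complex_of_real (s x \<bullet> b))"
  shows "trig_poly (\<lambda>x. complex_of_real (p (s x)))"
  using assms
proof (induction p)
  case (linear f)
  interpret bounded_linear f by fact
  have "f (s x) = (\<Sum>b\<in>Basis. (s x \<bullet> b) * f b)" for x
    by (subst euclidean_representation[symmetric, of "s x"]) (simp only: sum scale real_scaleR_def)
  then show ?case using linear.prems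
    by (simp add: trig_poly_sum trig_poly_mult trig_poly_const)
qed (auto intro!: trig_poly_mult trig_poly_const trig_poly.add)

lemma trig_poly_integrable:
  assumes "prob_space M" and [measurable]: "Y \<in> borel_measurable M" and "trig_poly f"
  shows "integrable M (\<lambda>\<omega>. f (Y \<omega>))"
proof -
  interpret prob_space M by fact
  have "integrable M (\<lambda>\<omega>. c * cis (\<theta> \<bullet> Y \<omega>))" for c :: complex and \<theta>
    by (intro integrable_const_bound[where B="norm c"]) (auto simp: norm_mult)
  with assms(3) show ?thesis by (induction f) auto
qed

text \<open>The one-dimensional continuity theorem gives weak convergence, which is tested against a
  continuous ramp in place of the indicator of a tail. The form "eventually in \<open>K\<close>"
  lets the bounds for finitely many coordinates and for the limit be intersected.\<close>

lemma cf_conv_tightness: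
  fixes Y :: "nat \<Rightarrow> 'a \<Rightarrow> real" and Z :: "'b \<Rightarrow> real"
  assumes "prob_space M" "prob_space M'"
    and Y: "\<And>n. Y n \<in> borel_measurable M" and Z: "Z \<in> borel_measurable M'"
    and cf: "\<And>t. (\<lambda>n. \<integral>\<omega>. cis (t * Y n \<omega>) \<partial>M) \<longlonglongrightarrow> (\<integral>\<omega>. cis (t * Z \<omega>) \<partial>M')"
    and e: "0 < e"
  shows "\<forall>\<^sub>F K in at_top. \<forall>\<^sub>F n in sequentially. measure M {\<omega>\<in>space M. K < \<bar>Y n \<omega>\<bar>} < e"
proof -
  interpret M: prob_space M by fact
  interpret M': prob_space M' by fact
  note [measurable] = Y Z
  have "weak_conv_m (\<lambda>n. distr M borel (Y n)) (distr M' borel Z)"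
  proof (rule levy_continuity)
    show "real_distribution (distr M borel (Y n))" for n by (rule M.real_distribution_distr) (rule Y)
    show "real_distribution (distr M' borel Z)" by (rule M'.real_distribution_distr) (rule Z)
    show "(\<lambda>n. char (distr M borel (Y n)) t) \<longlonglongrightarrow> char (distr M' borel Z) t" for t
      using cf[of t] by (simp add: char_def integral_distr cis_conv_exp)
  qed
  then have wc: "(\<lambda>n. \<integral>\<omega>. h (Y n \<omega>) \<partial>M) \<longlonglongrightarrow> (\<integral>\<omega>. h (Z \<omega>) \<partial>M')"
    if "\<And>x. isCont h x" "\<And>x. norm (h x) \<le> 1" for h :: "real \<Rightarrow> real"
  proof -
    have [measurable]: "h \<in> borel_measurable borel"
      using that by (intro borel_measurable_continuous_onI) (auto simp: continuous_at_imp_continuous_on)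
    show ?thesis
      using weak_conv_imp_integral_bdd_continuous_conv[of "\<lambda>n. distr M borel (Y n)" "distr M' borel Z" h 1]
        that M.real_distribution_distr[OF Y] M'.real_distribution_distr[OF Z]
        \<open>weak_conv_m (\<lambda>n. distr M borel (Y n)) (distr M' borel Z)\<close>
      by (simp add: integral_distr)
  qed
  \<comment> \<open>The ramp vanishes for \<open>\<bar>x\<bar> \<le> K - 1\<close> and equals 1 for
    \<open>\<bar>x\<bar> \<ge> K\<close>, so it dominates the tail indicator and still tends to 0
    pointwise as \<open>K\<close> grows.\<close>
  define h where "h K x = min 1 (max 0 (\<bar>x\<bar> - (K - 1)))" for K x :: real
  have h01: "0 \<le> h K x" "h K x \<le> 1" for K x by (auto simp: h_def)
  have hc: "isCont (h K) x" for K x unfolding h_def by (intro continuous_intros)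
  have [measurable]: "h K \<in> borel_measurable borel" for K unfolding h_def by measurable
  have lim0: "((\<lambda>K. \<integral>\<omega>. h K (Z \<omega>) \<partial>M') \<longlongrightarrow> (\<integral>\<omega>. 0 \<partial>M')) at_top"
  proof (rule integral_dominated_convergence_at_top[where w="\<lambda>_. 1"])
    show "AE \<omega> in M'. ((\<lambda>K. h K (Z \<omega>)) \<longlongrightarrow> 0) at_top"
    proof (rule AE_I2)
      fix \<omega>
      show "((\<lambda>K. h K (Z \<omega>)) \<longlongrightarrow> 0) at_top"
        by (rule tendsto_eventually, rule eventually_mono[OF eventually_ge_at_top[of "\<bar>Z \<omega>\<bar> + 1"]])
           (auto simp: h_def)
    qed
  qed (use h01 in auto)
  then have "\<forall>\<^sub>F K in at_top. (\<integral>\<omega>. h K (Z \<omega>) \<partial>M') < e"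
    using e by (auto dest: order_tendstoD)
  then show ?thesis
  proof eventually_elim
    case (elim K)
    have "(\<lambda>n. \<integral>\<omega>. h K (Y n \<omega>) \<partial>M) \<longlonglongrightarrow> (\<integral>\<omega>. h K (Z \<omega>) \<partial>M')"
      using h01 hc by (intro wc) auto
    then have "\<forall>\<^sub>F n in sequentially. (\<integral>\<omega>. h K (Y n \<omega>) \<partial>M) < e"
      using elim by (auto dest: order_tendstoD)
    then show ?case
    proof eventually_elim
      case (elim n)
      have "measure M {\<omega>\<in>space M. K < \<bar>Y n \<omega>\<bar>} = (\<integral>\<omega>. indicator {\<omega>\<in>space M. K < \<bar>Y n \<omega>\<bar>} \<omega> \<partial>M)"
        by simp
      also have "\<dots> \<le> (\<integral>\<omega>. h K (Y n \<omega>) \<partial>M)"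
        using h01 by (intro integral_mono M.integrable_const_bound[where B=1])
          (auto simp: h_def indicator_def)
      finally show ?case using elim by simp
    qed
  qed
qed

lemma cf_conv_imp_trig_poly_conv:
  assumes "prob_space M" "prob_space M'"
    and Y: "\<And>n. Y n \<in> borel_measurable M" and Z: "Z \<in> borel_measurable M'"
    and cf: "\<And>\<theta>. (\<lambda>n. \<integral>\<omega>. cis (\<theta> \<bullet> Y n \<omega>) \<partial>M) \<longlonglongrightarrow> (\<integral>\<omega>. cis (\<theta> \<bullet> Z \<omega>) \<partial>M')"
    and "trig_poly f"
  shows "(\<lambda>n. \<integral>\<omega>. f (Y n \<omega>) \<partial>M) \<longlonglongrightarrow> (\<integral>\<omega>. f (Z \<omega>) \<partial>M')"
  using assms(6)
proof induction
  case (char c \<theta>)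
  then show ?case using cf by (auto intro!: tendsto_intros)
next
  case (add f g)
  then show ?case
    by (simp add: trig_poly_integrable[OF assms(1) Y] trig_poly_integrable[OF assms(2) Z] tendsto_add)
qed

text \<open>On the cube of side \<open>K\<pi>\<close>, the test function is a function of
  the sines of the rescaled coordinates, hence uniformly close to a trigonometric polynomial
  that stays bounded on the whole space; tightness controls the complement of the cube.\<close>

theorem cf_conv_imp_conv_distr:
  fixes Y :: "nat \<Rightarrow> 'a \<Rightarrow> 'v::euclidean_space" and Z :: "'b \<Rightarrow> 'v"
  assumes "prob_space M" "prob_space M'"
    and Y: "\<And>n. Y n \<in> borel_measurable M" and Z: "Z \<in> borel_measurable M'"
    and cf: "\<And>\<theta>. (\<lambda>n. \<integral>\<omega>. cis (\<theta> \<bullet> Y n \<omega>) \<partial>M) \<longlonglongrightarrow> (\<integral>\<omega>. cis (\<theta> \<bullet> Z \<omega>) \<partial>M')"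
  shows "conv_distr M Y M' Z"
  unfolding conv_distr_def
proof (intro conjI allI impI Y Z)
  interpret M: prob_space M by fact
  interpret M': prob_space M' by fact
  note [measurable] = Y Z
  fix f :: "'v \<Rightarrow> real" assume f: "continuous_on UNIV f \<and> bounded (range f)"
  have [measurable]: "f \<in> borel_measurable borel"
    using f by (auto intro: borel_measurable_continuous_onI)
  obtain B where B: "0 < B" "\<And>x. \<bar>f x\<bar> \<le> B"
    using f by (auto simp: bounded_pos)
  show "(\<lambda>n. \<integral>\<omega>. f (Y n \<omega>) \<partial>M) \<longlonglongrightarrow> (\<integral>\<omega>. f (Z \<omega>) \<partial>M')"
  proof (rule LIMSEQ_I)
    fix r :: real assume r: "0 < r"
    define d where "d = real DIM('v)"
    have d: "1 \<le> d" by (simp add: d_def Suc_leI)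
    \<comment> \<open>Error budget: two replacements of \<open>f\<close> by \<open>T\<close>, each
      costing \<open>e + (2 * B + 1) * d * e\<close>, and one \<open>e\<close> for comparing the two
      laws; the last summand 3 leaves strict slack. The cap at 1 keeps \<open>T\<close> below
      \<open>B + 1\<close>.\<close>
    define e where "e = min 1 (r / (3 + 2 * (2 * B + 1) * d + 3))"
    have e: "0 < e" "e \<le> 1" using r B d by (auto simp: e_def intro!: divide_pos_pos add_pos_nonneg)
    have tail: "\<forall>\<^sub>F K in at_top. \<forall>\<^sub>F n in sequentially. measure M {\<omega>\<in>space M. K < \<bar>Y n \<omega> \<bullet> b\<bar>} < e" for b
      using cf[of "_ *\<^sub>R b"] e
      by (intro cf_conv_tightness[OF assms(1,2), where Z="\<lambda>\<omega>. Z \<omega> \<bullet> b"]) (auto simp: inner_commute)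
    \<comment> \<open>The constant sequence with value \<open>Z\<close> converges to
      \<open>Z\<close>, so the same lemma bounds the tails of the limit.\<close>
    have tailZ: "\<forall>\<^sub>F K in at_top. measure M' {\<omega>\<in>space M'. K < \<bar>Z \<omega> \<bullet> b\<bar>} < e" for b
      using cf_conv_tightness[OF assms(2,2), where Y="\<lambda>_ \<omega>. Z \<omega> \<bullet> b" and Z="\<lambda>\<omega>. Z \<omega> \<bullet> b" and e=e] e
      by auto
    have "\<forall>\<^sub>F K in at_top. (\<forall>b\<in>Basis. \<forall>\<^sub>F n in sequentially. measure M {\<omega>\<in>space M. K < \<bar>Y n \<omega> \<bullet> b\<bar>} < e) \<and>
       (\<forall>b\<in>Basis. measure M' {\<omega>\<in>space M'. K < \<bar>Z \<omega> \<bullet> b\<bar>} < e) \<and> 1 \<le> (K::real)"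
      using tail tailZ by (intro eventually_conj) (auto simp: eventually_ball_finite_distrib)
    then obtain K :: real where K: "1 \<le> K" "\<And>b. b \<in> Basis \<Longrightarrow> measure M' {\<omega>\<in>space M'. K < \<bar>Z \<omega> \<bullet> b\<bar>} < e"
      "\<And>b. b \<in> Basis \<Longrightarrow> \<forall>\<^sub>F n in sequentially. measure M {\<omega>\<in>space M. K < \<bar>Y n \<omega> \<bullet> b\<bar>} < e"
      by (auto dest!: eventually_happens)
    define s :: "'v \<Rightarrow> 'v" where "s x = (\<Sum>b\<in>Basis. sin ((x \<bullet> b) / K) *\<^sub>R b)" for x
    \<comment> \<open>\<open>F\<close> reads \<open>f\<close> through arcsines, so that
      \<open>F (s x) = f x\<close> whenever \<open>\<bar>x \<bullet> b\<bar> \<le> K\<close> for all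
      basis vectors: the arguments of the sines are then at most 1, below
      \<open>pi / 2\<close>.\<close>
    define F :: "'v \<Rightarrow> real" where "F y = f (\<Sum>b\<in>Basis. (K * arcsin (y \<bullet> b)) *\<^sub>R b)" for y
    have sb: "s x \<bullet> b = sin ((x \<bullet> b) / K)" if "b \<in> Basis" for x b
      using that by (simp add: s_def inner_sum_left inner_Basis if_distrib sum.delta cong: if_cong)
    have s_cube: "s x \<in> cbox (- One) One" for x
      by (auto simp: mem_box sb)
    have "continuous_on (cbox (- One) (One::'v)) F"
      unfolding F_def
    proof (rule continuous_on_compose2[where t=UNIV and g=f])
      show "continuous_on (cbox (- One) (One::'v)) (\<lambda>y. \<Sum>b\<in>Basis. (K * arcsin (y \<bullet> b)) *\<^sub>R b)"
        by (intro continuous_intros) (auto simp: mem_box)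
    qed (use f in auto)
    then obtain p where p: "real_polynomial_function p" "\<And>y. y \<in> cbox (- One) One \<Longrightarrow> \<bar>F y - p y\<bar> < e"
      using Stone_Weierstrass_real_polynomial_function[OF compact_cbox _ e(1)] by blast
    define T where "T x = p (s x)" for x
    have T: "trig_poly (\<lambda>x. complex_of_real (T x))"
      unfolding T_def
    proof (rule trig_poly_real_polynomial[OF p(1)])
      fix b :: 'v assume "b \<in> Basis"
      then have "(\<lambda>x. complex_of_real (s x \<bullet> b)) = (\<lambda>x. complex_of_real (sin (((1/K) *\<^sub>R b) \<bullet> x)))"
        by (simp only: sb) (simp add: inner_commute)
      then show "trig_poly (\<lambda>x. complex_of_real (s x \<bullet> b))" by (simp only: trig_poly_sin)
    qed
    have sm[measurable]: "s \<in> borel_measurable borel" unfolding s_def by measurable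
    have [measurable]: "T \<in> borel_measurable borel"
      unfolding T_def using p(1)
      by (intro measurable_compose[OF sm] borel_measurable_continuous_onI
            continuous_on_polymonial_function) (auto simp: real_polynomial_function_eq)
    have TB: "\<bar>T x\<bar> \<le> B + 1" for x
    proof -
      have "\<bar>F (s x)\<bar> \<le> B" unfolding F_def by (rule B)
      with p(2)[OF s_cube[of x]] e show ?thesis by (auto simp: T_def)
    qed
    have TF: "\<bar>f x - T x\<bar> \<le> e" if small: "\<And>b. b \<in> Basis \<Longrightarrow> \<bar>x \<bullet> b\<bar> \<le> K" for x
    proof -
      have "K * arcsin (s x \<bullet> b) = x \<bullet> b" if b: "b \<in> Basis" for b
      proof -
        have "\<bar>(x \<bullet> b) / K\<bar> \<le> 1" using small[OF b] K(1) by (simp add: abs_divide)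
        then have "- (pi/2) \<le> (x \<bullet> b) / K" "(x \<bullet> b) / K \<le> pi/2" using pi_ge_two by linarith+
        then show ?thesis using b K(1) by (simp add: sb arcsin_sin)
      qed
      then have "F (s x) = f x" by (simp add: F_def euclidean_representation)
      with p(2)[OF s_cube[of x]] show ?thesis by (auto simp: T_def)
    qed
    \<comment> \<open>Stated for any probability space because it serves both the prelimit and the
      limit. Outside the cube the two functions are bounded by \<open>B\<close> and
      \<open>B + 1\<close>, and a union over the basis bounds the probability of leaving it.\<close>
    have diff: "\<bar>(\<integral>\<omega>. f (V \<omega>) \<partial>N) - (\<integral>\<omega>. T (V \<omega>) \<partial>N)\<bar> \<le> e + (2 * B + 1) * d * e"
      if N: "prob_space N" and V[measurable]: "V \<in> borel_measurable N"
        and tl: "\<And>b. b \<in> Basis \<Longrightarrow> measure N {\<omega>\<in>space N. K < \<bar>V \<omega> \<bullet> b\<bar>} < e"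
      for N :: "'c measure" and V
    proof -
      interpret N: prob_space N by fact
      let ?E = "\<lambda>b. {\<omega>\<in>space N. K < \<bar>V \<omega> \<bullet> b\<bar>}"
      have i1: "integrable N (\<lambda>\<omega>. f (V \<omega>))" by (rule N.integrable_const_bound[where B=B]) (use B in auto)
      have i2: "integrable N (\<lambda>\<omega>. T (V \<omega>))" by (rule N.integrable_const_bound[where B="B+1"]) (use TB in auto)
      have "\<bar>(\<integral>\<omega>. f (V \<omega>) \<partial>N) - (\<integral>\<omega>. T (V \<omega>) \<partial>N)\<bar> = \<bar>\<integral>\<omega>. f (V \<omega>) - T (V \<omega>) \<partial>N\<bar>"
        by (simp add: i1 i2)
      also have "\<dots> \<le> (\<integral>\<omega>. \<bar>f (V \<omega>) - T (V \<omega>)\<bar> \<partial>N)" by (rule integral_abs_bound)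
      also have "\<dots> \<le> (\<integral>\<omega>. e + (2 * B + 1) * (\<Sum>b\<in>Basis. indicator (?E b) \<omega>) \<partial>N)"
      proof (rule integral_mono)
        show "integrable N (\<lambda>\<omega>. \<bar>f (V \<omega>) - T (V \<omega>)\<bar>)" using i1 i2 by auto
        show "integrable N (\<lambda>\<omega>. e + (2 * B + 1) * (\<Sum>b\<in>Basis. indicator (?E b) \<omega>))"
          by (intro Bochner_Integration.integrable_add integrable_mult_right Bochner_Integration.integrable_sum)
             (auto simp: N.emeasure_eq_measure)
        fix \<omega> assume \<omega>: "\<omega> \<in> space N"
        show "\<bar>f (V \<omega>) - T (V \<omega>)\<bar> \<le> e + (2 * B + 1) * (\<Sum>b\<in>Basis. indicator (?E b) \<omega>)"
        proof (cases "\<forall>b\<in>Basis. \<bar>V \<omega> \<bullet> b\<bar> \<le> K")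
          case True
          then have "\<bar>f (V \<omega>) - T (V \<omega>)\<bar> \<le> e" by (intro TF) auto
          moreover have "0 \<le> (2 * B + 1) * (\<Sum>b\<in>Basis. indicator (?E b) \<omega>)"
            using B by (intro mult_nonneg_nonneg sum_nonneg) auto
          ultimately show ?thesis by linarith
        next
          case False
          then obtain b where b: "b \<in> Basis" "K < \<bar>V \<omega> \<bullet> b\<bar>" by force
          have "\<bar>f (V \<omega>) - T (V \<omega>)\<bar> \<le> 2 * B + 1" using B(2)[of "V \<omega>"] TB[of "V \<omega>"] by linarith
          also have "(1::real) \<le> (\<Sum>b\<in>Basis. indicator (?E b) \<omega>)"
          proof -
            have "(1::real) = indicator (?E b) \<omega>" using b \<omega> by simp
            also have "\<dots> \<le> (\<Sum>b\<in>Basis. indicator (?E b) \<omega>)"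
              by (rule member_le_sum) (use b in auto)
            finally show ?thesis .
          qed
          then have "2 * B + 1 \<le> (2 * B + 1) * (\<Sum>b\<in>Basis. indicator (?E b) \<omega>)"
            using B by (simp add: mult_le_cancel_left1)
          finally show ?thesis using e by linarith
        qed
      qed
      also have "\<dots> = e + (2 * B + 1) * (\<Sum>b\<in>Basis. measure N (?E b))"
        by (subst Bochner_Integration.integral_add)
           (auto simp: N.emeasure_eq_measure N.prob_space intro!: integrable_mult_right Bochner_Integration.integrable_sum)
      also have "\<dots> \<le> e + (2 * B + 1) * (\<Sum>b\<in>(Basis::'v set). e)"
        using tl B by (intro add_left_mono mult_left_mono sum_mono) (auto intro: less_imp_le)
      also have "\<dots> = e + (2 * B + 1) * d * e" by (simp add: d_def)
      finally show ?thesis .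
    qed
    have "(\<lambda>n. \<integral>\<omega>. complex_of_real (T (Y n \<omega>)) \<partial>M) \<longlonglongrightarrow> (\<integral>\<omega>. complex_of_real (T (Z \<omega>)) \<partial>M')"
      by (rule cf_conv_imp_trig_poly_conv[OF assms(1-4) cf T])
    then have "(\<lambda>n. \<integral>\<omega>. T (Y n \<omega>) \<partial>M) \<longlonglongrightarrow> (\<integral>\<omega>. T (Z \<omega>) \<partial>M')"
      by (simp add: tendsto_of_real_iff)
    then have "\<forall>\<^sub>F n in sequentially. dist (\<integral>\<omega>. T (Y n \<omega>) \<partial>M) (\<integral>\<omega>. T (Z \<omega>) \<partial>M') < e"
      using e by (auto dest: tendstoD)
    moreover have "\<forall>\<^sub>F n in sequentially. \<forall>b\<in>Basis. measure M {\<omega>\<in>space M. K < \<bar>Y n \<omega> \<bullet> b\<bar>} < e"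
      using K(3) by (simp add: eventually_ball_finite_distrib)
    ultimately have "\<forall>\<^sub>F n in sequentially. norm ((\<integral>\<omega>. f (Y n \<omega>) \<partial>M) - (\<integral>\<omega>. f (Z \<omega>) \<partial>M')) < r"
    proof eventually_elim
      case (elim n)
      have "\<bar>(\<integral>\<omega>. f (Y n \<omega>) \<partial>M) - (\<integral>\<omega>. T (Y n \<omega>) \<partial>M)\<bar> \<le> e + (2 * B + 1) * d * e"
        using elim by (intro diff assms(1) Y) auto
      moreover have "\<bar>(\<integral>\<omega>. f (Z \<omega>) \<partial>M') - (\<integral>\<omega>. T (Z \<omega>) \<partial>M')\<bar> \<le> e + (2 * B + 1) * d * e"
        using K by (intro diff assms(2) Z) auto
      ultimately have "norm ((\<integral>\<omega>. f (Y n \<omega>) \<partial>M) - (\<integral>\<omega>. f (Z \<omega>) \<partial>M')) < 3 * e + 2 * ((2 * B + 1) * d * e)"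
        using elim(1) unfolding dist_real_def real_norm_def by linarith
      also have "\<dots> < (3 + 2 * (2 * B + 1) * d + 3) * e" using e by (simp add: algebra_simps)
      also have "\<dots> \<le> r"
      proof -
        have "e \<le> r / (3 + 2 * (2 * B + 1) * d + 3)" by (simp add: e_def)
        moreover have "0 < 3 + 2 * (2 * B + 1) * d + 3" using B d by (intro add_pos_nonneg) auto
        ultimately show ?thesis by (simp add: field_simps)
      qed
      finally show ?case .
    qed
    then show "\<exists>no. \<forall>n\<ge>no. norm ((\<integral>\<omega>. f (Y n \<omega>) \<partial>M) - (\<integral>\<omega>. f (Z \<omega>) \<partial>M')) < r"
      by (simp add: eventually_sequentially)
  qed
qed

section \<open>The exponent of a stable law\<close>

text \<open>Power and Gamma integrals are known as gauge integrals; nonnegativity turns them into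
  Lebesgue integrals, to which domination and Fubini apply.\<close>

lemma has_integral_nonneg_lborel:
  fixes f :: "real \<Rightarrow> real"
  assumes [measurable]: "f \<in> borel_measurable borel" "S \<in> sets borel"
    and nn: "\<And>x. x \<in> S \<Longrightarrow> 0 \<le> f x" and I: "(f has_integral I) S"
  shows "has_bochner_integral lborel (\<lambda>x. indicator S x * f x) I"
proof (rule has_bochner_integral_nn_integral)
  show "0 \<le> I" using has_integral_nonneg[OF I] nn by auto
  show "(\<integral>\<^sup>+x. ennreal (indicator S x * f x) \<partial>lborel) = ennreal I"
    by (rule nn_integral_has_integral_lebesgue[OF nn I])
  show "AE x in lborel. 0 \<le> indicator S x * f x" using nn by (auto simp: indicator_def)
qed measurable

lemma Gamma_moment:
  assumes "0 < (s::real)"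
  shows "has_bochner_integral lborel (\<lambda>v. indicator {0<..} v * (v powr (s - 1) * exp (- v))) (Gamma s)"
proof -
  have "((\<lambda>v. v powr (s - 1) * exp (- v)) has_integral Gamma s) {0..}"
    using Gamma_integral_real[OF assms] by (simp add: exp_minus divide_inverse)
  then have "has_bochner_integral lborel (\<lambda>v. indicator {0..} v * (v powr (s - 1) * exp (- v))) (Gamma s)"
    by (intro has_integral_nonneg_lborel) auto
  moreover have "(\<lambda>v. indicator {0..} v * (v powr (s - 1) * exp (- v))) =
     (\<lambda>v. indicator {0<..} v * (v powr (s - 1) * exp (- v)))"
    by (auto simp: fun_eq_iff indicator_def)
  ultimately show ?thesis by simp
qed

text \<open>Near 0 the integrand is \<open>v powr (1 - a)\<close>, integrable since
  \<open>a < 2\<close>; at infinity it is \<open>v powr (- a)\<close>, integrable since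
  \<open>1 < a\<close>. This is the dominating function in all limits in which the tail of a length
  is integrated.\<close>

lemma integrable_min_one_powr:
  assumes "1 < a" "a < (2::real)"
  shows "integrable lborel (\<lambda>v. indicator {0<..} v * (min 1 v * v powr (- a)))"
proof -
  have 1: "((\<lambda>v. v powr (1 - a)) has_integral (1 powr (1 - a + 1) / (1 - a + 1))) {0..1}"
    using assms by (intro has_integral_powr_from_0) auto
  have 2: "((\<lambda>v. v powr (- a)) has_integral (- (1 powr (- a + 1)) / (- a + 1))) {1..}"
    using assms by (intro has_integral_powr_to_inf) auto
  have "integrable lborel (\<lambda>v. indicator {0..1} v * v powr (1 - a) + indicator {1..} v * v powr (- a))"
    using has_integral_nonneg_lborel[OF _ _ _ 1] has_integral_nonneg_lborel[OF _ _ _ 2]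
    by (intro Bochner_Integration.integrable_add) (auto simp: has_bochner_integral_iff)
  then show ?thesis
  proof (rule Bochner_Integration.integrable_bound)
    show "AE v in lborel. norm (indicator {0<..} v * (min 1 v * v powr (- a)))
        \<le> norm (indicator {0..1} v * v powr (1 - a) + indicator {1..} v * v powr (- a))"
    proof (rule AE_I2)
      fix v :: real
      have "v * v powr (- a) = v powr (1 - a)" if "0 < v"
        using that powr_add[of v 1 "- a"] by simp
      then show "norm (indicator {0<..} v * (min 1 v * v powr (- a)))
        \<le> norm (indicator {0..1} v * v powr (1 - a) + indicator {1..} v * v powr (- a))"
        by (auto simp: indicator_def min_def)
    qed
  qed measurable
qed

section \<open>The regularised Gamma integral behind the stable exponent\<close>

text \<open>The Gamma integral at the negative argument \<open>1 - a\<close>, its divergence at 0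
  removed by subtracting 1; the expected value is \<open>Gamma (1 - a) * z powr (a - 1)\<close>. At
  \<open>z = - \<i> * y\<close> and up to a factor \<open>\<i> * y\<close> it is the compensated
  exponent of a one-sided stable law after an integration by parts.\<close>

definition exp_transform :: "real \<Rightarrow> complex \<Rightarrow> complex" where
  "exp_transform a z = (\<integral>v. indicator {0<..} v *\<^sub>R ((exp (- z * of_real v) - 1) * of_real (v powr (- a))) \<partial>lborel)"

text \<open>On the closed left half-plane, which is convex, the derivative of the exponential has
  norm at most 1; the mean value inequality gives the linear bound and the triangle inequality gives
  2.\<close>

lemma norm_exp_minus_one_le:
  assumes "0 \<le> Re z"
  shows "norm (exp (- z) - 1) \<le> min 2 (norm z)"
proof -
  have "norm (exp (- z) - exp 0) \<le> 1 * norm (- z - 0)"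
  proof (rule field_differentiable_bound)
    show "convex {w::complex. Re w \<le> 0}" by (rule convex_halfspace_Re_le)
    show "norm (exp w) \<le> 1" if "w \<in> {w. Re w \<le> 0}" for w using that by simp
  qed (use assms in \<open>auto intro!: derivative_eq_intros\<close>)
  have "norm (exp (- z) - 1) \<le> norm (exp (- z)) + norm (1::complex)"
    by (rule norm_triangle_ineq4)
  moreover have "norm (exp (- z)) \<le> 1" using assms by simp
  ultimately have "norm (exp (- z) - 1) \<le> 2" unfolding norm_one by linarith
  with \<open>norm (exp (- z) - exp 0) \<le> 1 * norm (- z - 0)\<close> show ?thesis by simp
qed

lemma exp_transform_bound:
  assumes "0 \<le> Re z"
  shows "norm (indicator {0<..} v *\<^sub>R ((exp (- z * of_real v) - 1) * of_real (v powr (- a))))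
    \<le> (2 + norm z) * (indicator {0<..} v * (min 1 v * v powr (- a)))"
proof (cases "0 < v")
  case True
  have "norm (exp (- (z * of_real v)) - 1) \<le> min 2 (norm (z * of_real v))"
    using True assms by (intro norm_exp_minus_one_le) auto
  also have "\<dots> \<le> (2 + norm z) * min 1 v"
  proof (cases "v \<le> 1")
    case True
    have "norm z * v \<le> (2 + norm z) * v" using \<open>0 < v\<close> by (intro mult_right_mono) auto
    then show ?thesis using True \<open>0 < v\<close> by (auto simp: norm_mult min.coboundedI2)
  next
    case False
    then show ?thesis by (auto intro!: min.coboundedI1)
  qed
  finally have "norm (exp (- (z * of_real v)) - 1) * v powr (- a) \<le> (2 + norm z) * min 1 v * v powr (- a)"
    by (rule mult_right_mono) auto
  with True show ?thesis by (simp add: norm_mult mult_ac)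
qed auto

lemma exp_transform_integrable:
  assumes "1 < a" "a < 2" "0 \<le> Re z"
  shows "integrable lborel (\<lambda>v. indicator {0<..} v *\<^sub>R ((exp (- z * of_real v) - 1) * complex_of_real (v powr (- a))))"
proof (rule Bochner_Integration.integrable_bound)
  show "integrable lborel (\<lambda>v. (2 + norm z) * (indicator {0<..} v * (min 1 v * v powr (- a))))"
    using assms by (intro integrable_mult_right integrable_min_one_powr)
  show "AE v in lborel. norm (indicator {0<..} v *\<^sub>R ((exp (- z * of_real v) - 1) * complex_of_real (v powr (- a))))
     \<le> norm ((2 + norm z) * (indicator {0<..} v * (min 1 v * v powr (- a))))"
  proof (rule AE_I2)
    fix v
    show "norm (indicator {0<..} v *\<^sub>R ((exp (- z * of_real v) - 1) * complex_of_real (v powr (- a))))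
      \<le> norm ((2 + norm z) * (indicator {0<..} v * (min 1 v * v powr (- a))))"
      by (rule order_trans[OF exp_transform_bound[OF assms(3)]]) simp
  qed
qed measurable

text \<open>Substitution in \<open>v\<close>. This homogeneity of degree \<open>a - 1\<close> fixes
  the value at 1 and carries the disc around 1 to the whole half-plane.\<close>

lemma exp_transform_scale:
  assumes "0 < r"
  shows "exp_transform a (of_real r * z) = of_real (r powr (a - 1)) * exp_transform a z"
proof -
  have "exp_transform a z = \<bar>r\<bar> *\<^sub>R (\<integral>v. indicator {0<..} (0 + r * v) *\<^sub>R
      ((exp (- z * of_real (0 + r * v)) - 1) * of_real ((0 + r * v) powr (- a))) \<partial>lborel)"
    unfolding exp_transform_def using assms by (intro lborel_integral_real_affine) auto
  also have "(\<lambda>v. indicator {0<..} (0 + r * v) *\<^sub>R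
      ((exp (- z * of_real (0 + r * v)) - 1) * of_real ((0 + r * v) powr (- a)))) =
    (\<lambda>v. of_real (r powr (- a)) * (indicator {0<..} v *\<^sub>R ((exp (- (of_real r * z) * of_real v) - 1) * complex_of_real (v powr (- a)))))"
    using assms by (auto simp: fun_eq_iff indicator_def powr_mult zero_less_mult_iff mult_ac)
  also have "\<bar>r\<bar> *\<^sub>R (\<integral>v. of_real (r powr (- a)) * (indicator {0<..} v *\<^sub>R ((exp (- (of_real r * z) * of_real v) - 1) * complex_of_real (v powr (- a)))) \<partial>lborel)
     = of_real (r powr (1 - a)) * exp_transform a (of_real r * z)"
    using assms powr_add[of r 1 "- a"] unfolding exp_transform_def by (simp add: scaleR_conv_of_real)
  finally have "of_real (r powr (a - 1)) * exp_transform a z =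
     of_real (r powr (a - 1) * r powr (1 - a)) * exp_transform a (of_real r * z)" by simp
  also have "r powr (a - 1) * r powr (1 - a) = 1" using assms by (simp flip: powr_add)
  finally show ?thesis by simp
qed

text \<open>Expand \<open>exp (w v)\<close> into its power series; the moments are Gamma values and resum to a
  binomial series.\<close>

lemma exp_transform_near_1:
  assumes a: "1 < a" "a < 2" and w: "norm w < 1"
  shows "exp_transform a (1 - w) = exp_transform a 1 + of_real (Gamma (1 - a)) * ((1 - w) powr of_real (a - 1) - 1)"
proof -
  \<comment> \<open>The series starts at \<open>Suc n\<close>: the constant term of
    \<open>exp (w * v)\<close> cancels against \<open>exp_transform a 1\<close>, and its moment
    would diverge at 0.\<close>
  let ?f = "\<lambda>(n::nat) v. (w ^ Suc n / fact (Suc n)) * of_real (indicator {0<..} v * (v powr (real (Suc n) - a) * exp (- v)))"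
  have Gm: "has_bochner_integral lborel (\<lambda>v. indicator {0<..} v * (v powr (real (Suc n) - a) * exp (- v))) (Gamma (1 - a + real (Suc n)))" for n
  proof -
    have *: "real (Suc n) - a = (1 - a + real (Suc n)) - 1" by simp
    show ?thesis unfolding * by (rule Gamma_moment) (use a in simp)
  qed
  have nz: "1 - a \<notin> \<int>\<^sub>\<le>\<^sub>0"
  proof
    assume "1 - a \<in> \<int>\<^sub>\<le>\<^sub>0"
    then obtain n :: nat where n: "1 - a = - real n" by (auto elim: nonpos_Ints_cases')
    then have "a = 1 + real n" by simp
    then have "real 0 < real n" "real n < real 1" using a by auto
    then show False unfolding of_nat_less_iff by simp
  qed
  \<comment> \<open>The quotient of two Gamma values at integer distance is a Pochhammer symbol,
    here a signed binomial coefficient; this is why the moments resum to a binomial series.\<close>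
  have Gp: "Gamma (1 - a + real n) / fact n = Gamma (1 - a) * ((-1) ^ n * ((a - 1) gchoose n))" for n
    using pochhammer_Gamma[OF nz, of n] nz
    by (simp add: gbinomial_pochhammer field_simps Gamma_eq_zero_iff power_mult_distrib[symmetric])
  have fi: "integrable lborel (?f n)" for n
    using Gm[of n] by (intro integrable_mult_right integrable_of_real) (auto simp: has_bochner_integral_iff)
  have fI: "integral\<^sup>L lborel (?f n) = of_real (Gamma (1 - a)) * (of_real (a - 1) gchoose Suc n) * (- w) ^ Suc n" for n
  proof -
    have "integral\<^sup>L lborel (?f n) = w ^ Suc n / fact (Suc n) * of_real (Gamma (1 - a + real (Suc n)))"
      using Gm[of n] by (simp add: has_bochner_integral_iff del: of_real_mult)
    also have "\<dots> = w ^ Suc n * of_real (Gamma (1 - a + real (Suc n)) / fact (Suc n))"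
      by simp
    also have "\<dots> = of_real (Gamma (1 - a)) * (of_real (a - 1) gchoose Suc n) * (- w) ^ Suc n"
      unfolding Gp gbinomial_pochhammer
      by (simp add: pochhammer_of_real[symmetric] power_minus[of w] del: power_Suc fact_Suc)
    finally show ?thesis .
  qed
  have fN: "(\<integral>v. norm (?f n v) \<partial>lborel) = norm w ^ Suc n / fact (Suc n) * Gamma (1 - a + real (Suc n))" for n
  proof -
    have "(\<lambda>v. norm (?f n v)) = (\<lambda>v. norm w ^ Suc n / fact (Suc n) * (indicator {0<..} v * (v powr (real (Suc n) - a) * exp (- v))))"
      by (auto simp: fun_eq_iff norm_mult norm_divide norm_power indicator_def simp del: fact_Suc of_nat_Suc power_Suc)
    then show ?thesis using Gm[of n] by (simp add: has_bochner_integral_iff)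
  qed
  \<comment> \<open>Up to a constant factor the integrals of the norms are the terms of the same
    binomial series at \<open>- norm w\<close>, convergent inside the unit disc. This licenses the
    exchange of sum and integral.\<close>
  have sumN: "summable (\<lambda>n. \<integral>v. norm (?f n v) \<partial>lborel)"
  proof -
    have "summable (\<lambda>n. ((a - 1) gchoose n) * (- norm w) ^ n)"
      using gen_binomial_real[of "- norm w" "a - 1"] w by (auto simp: sums_iff)
    then have "summable (\<lambda>n. Gamma (1 - a) * (((a - 1) gchoose Suc n) * (- norm w) ^ Suc n))"
      by (intro summable_mult iffD2[OF summable_Suc_iff])
    also have "(\<lambda>n. Gamma (1 - a) * (((a - 1) gchoose Suc n) * (- norm w) ^ Suc n)) =
       (\<lambda>n. norm w ^ Suc n * (Gamma (1 - a + real (Suc n)) / fact (Suc n)))"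
      unfolding Gp by (simp add: fun_eq_iff power_minus[of "norm w"] del: power_Suc)
    finally show ?thesis unfolding fN by simp
  qed
  have pw: "(\<lambda>n. ?f n v) sums (indicator {0<..} v *\<^sub>R ((exp (- (1 - w) * of_real v) - 1) * of_real (v powr (- a)))
      - indicator {0<..} v *\<^sub>R ((exp (- 1 * of_real v) - 1) * of_real (v powr (- a))))" for v
  proof (cases "0 < v")
    case True
    have "(\<lambda>n. (w * of_real v) ^ Suc n /\<^sub>R fact (Suc n)) sums (exp (w * of_real v) - 1)"
      using exp_converges[of "w * of_real v"] by (subst sums_Suc_iff) auto
    then have "(\<lambda>n. of_real (v powr (- a) * exp (- v)) * ((w * of_real v) ^ Suc n /\<^sub>R fact (Suc n)))
        sums (of_real (v powr (- a) * exp (- v)) * (exp (w * of_real v) - 1))"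
      by (rule sums_mult)
    also have "(\<lambda>n. of_real (v powr (- a) * exp (- v)) * ((w * of_real v) ^ Suc n /\<^sub>R fact (Suc n))) = (\<lambda>n. ?f n v)"
    proof
      fix n
      have "v powr (real (Suc n) - a) = v ^ Suc n * v powr (- a)"
        using True powr_add[of v "real (Suc n)" "- a"] powr_realpow[of v "Suc n"] by (simp del: power_Suc of_nat_Suc)
      then show "of_real (v powr (- a) * exp (- v)) * ((w * of_real v) ^ Suc n /\<^sub>R fact (Suc n)) = ?f n v"
        using True by (simp add: power_mult_distrib scaleR_conv_of_real divide_inverse mult_ac del: power_Suc of_nat_Suc fact_Suc)
    qed
    also have "of_real (v powr (- a) * exp (- v)) * (exp (w * of_real v) - 1) =
      (exp (- (1 - w) * of_real v) - 1) * complex_of_real (v powr (- a)) - (exp (- 1 * of_real v) - 1) * of_real (v powr (- a))"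
    proof -
      have "exp (- (1 - w) * of_real v) = exp (of_real (- v)) * exp (w * of_real v)"
        by (simp flip: exp_add add: algebra_simps)
      then show ?thesis by (simp add: exp_of_real[symmetric] algebra_simps)
    qed
    finally show ?thesis using True by simp
  qed (auto simp: sums_0)
  have sn: "AE v in lborel. summable (\<lambda>n. norm (?f n v))"
  proof (rule AE_I2)
    fix v :: real
    show "summable (\<lambda>n. norm (?f n v))"
    proof (cases "0 < v")
      case True
      have "summable (\<lambda>n. (v powr (- a) * exp (- v)) * ((norm w * v) ^ Suc n /\<^sub>R fact (Suc n)))"
        using summable_exp_generic[of "norm w * v"]
        by (intro summable_mult iffD2[OF summable_Suc_iff])
      also have "(\<lambda>n. (v powr (- a) * exp (- v)) * ((norm w * v) ^ Suc n /\<^sub>R fact (Suc n))) = (\<lambda>n. norm (?f n v))"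
      proof
        fix n
        have "v powr (real (Suc n) - a) = v ^ Suc n * v powr (- a)"
          using True powr_add[of v "real (Suc n)" "- a"] powr_realpow[of v "Suc n"] by (simp del: power_Suc of_nat_Suc)
        then show "(v powr (- a) * exp (- v)) * ((norm w * v) ^ Suc n /\<^sub>R fact (Suc n)) = norm (?f n v)"
          using True by (simp add: power_mult_distrib divide_inverse norm_mult norm_power norm_inverse mult_ac del: power_Suc of_nat_Suc fact_Suc)
      qed
      finally show ?thesis .
    qed auto
  qed
  have "exp_transform a (1 - w) - exp_transform a 1 = (\<integral>v. (\<Sum>n. ?f n v) \<partial>lborel)"
    unfolding sums_unique[OF pw, symmetric] exp_transform_def using w abs_Re_le_cmod[of w]
      exp_transform_integrable[OF a, of "1 - w"] exp_transform_integrable[OF a, of 1]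
    by (subst Bochner_Integration.integral_diff) auto
  also have "(\<lambda>n. integral\<^sup>L lborel (?f n)) sums \<dots>"
    by (rule sums_integral[OF fi sn sumN])
  then have "(\<integral>v. (\<Sum>n. ?f n v) \<partial>lborel) = (\<Sum>n. integral\<^sup>L lborel (?f n))"
    by (simp add: sums_unique)
  also have "(\<lambda>n. integral\<^sup>L lborel (?f n)) sums (of_real (Gamma (1 - a)) * ((1 - w) powr of_real (a - 1) - 1))"
  proof -
    have "(\<lambda>n. (of_real (a - 1) gchoose n) * (- w) ^ n) sums (1 + (- w)) powr of_real (a - 1)"
      using w by (intro gen_binomial_complex) auto
    then have "(\<lambda>n. (of_real (a - 1) gchoose Suc n) * (- w) ^ Suc n) sums ((1 - w) powr of_real (a - 1) - 1)"
      by (subst sums_Suc_iff) auto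
    from sums_mult[OF this, of "of_real (Gamma (1 - a))"] show ?thesis
      unfolding fI by (simp only: mult.assoc)
  qed
  then have "(\<Sum>n. integral\<^sup>L lborel (?f n)) = of_real (Gamma (1 - a)) * ((1 - w) powr of_real (a - 1) - 1)"
    by (rule sums_unique[symmetric])
  finally show ?thesis by (simp add: algebra_simps)
qed

text \<open>The expansion at \<open>w = 1/2\<close> and homogeneity give two expressions for the
  value at \<open>1/2\<close>; since \<open>(1/2) powr (a - 1)\<close> is not 1, they determine the
  value at 1. Any point of the half-plane is then scaled into the unit disc around 1, where the
  expansion applies.\<close>

lemma exp_transform_halfplane:
  assumes a: "1 < a" "a < 2" and z: "0 < Re z"
  shows "exp_transform a z = of_real (Gamma (1 - a)) * z powr of_real (a - 1)"
proof -
  have J1: "exp_transform a 1 = of_real (Gamma (1 - a))"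
  proof -
    let ?c = "(1/2::real) powr (a - 1)"
    have p: "(1/2 :: complex) powr of_real (a - 1) = of_real ?c"
      using powr_of_real[of "1/2" "a - 1"] by simp
    have "exp_transform a (1/2) = of_real ?c * exp_transform a 1"
      using exp_transform_scale[of "1/2" a 1] by simp
    moreover have "exp_transform a (1/2) = exp_transform a 1 + of_real (Gamma (1 - a)) * (of_real ?c - 1)"
      using exp_transform_near_1[OF a, of "1/2"] unfolding p[symmetric] by simp
    ultimately have "(of_real ?c - 1) * exp_transform a 1 = (of_real ?c - 1) * of_real (Gamma (1 - a))"
      by (simp add: algebra_simps)
    moreover have "?c < (1/2) powr 0" using a by (intro powr_less_mono') auto
    then have "complex_of_real ?c - 1 \<noteq> 0" by (metis eq_iff_diff_eq_0 of_real_1 of_real_eq_iff less_irrefl powr_zero_eq_one zero_neq_numeral divide_eq_0_iff zero_neq_one)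
    ultimately show ?thesis by simp
  qed
  \<comment> \<open>Chosen so that \<open>R * Re z\<close> is the squared norm of \<open>z\<close>.
    Then the squared norm of \<open>R - z\<close> equals \<open>R\<close> squared minus the squared
    norm of \<open>z\<close>, and \<open>u = z / R\<close> lies strictly within distance 1 of the
    point 1.\<close>
  define R where "R = (norm z)\<^sup>2 / Re z"
  define u where "u = z / of_real R"
  have nz: "z \<noteq> 0" using z by auto
  then have R: "0 < R" using z by (simp add: R_def)
  have zu: "z = of_real R * u" using R by (simp add: u_def)
  have "norm (1 - u) < 1"
  proof -
    have "(norm (of_real R - z))\<^sup>2 = R\<^sup>2 - 2 * R * Re z + (norm z)\<^sup>2"
      unfolding cmod_power2 by (simp add: power2_eq_square algebra_simps)
    also have "2 * R * Re z = 2 * (R * Re z)" by simp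
    also have "R * Re z = (norm z)\<^sup>2" using z by (simp add: R_def)
    finally have "(norm (of_real R - z))\<^sup>2 < R\<^sup>2" using nz by simp
    then have "norm (of_real R - z) < R" using R by (meson less_imp_le power_less_imp_less_base)
    moreover have "1 - u = (of_real R - z) / of_real R" using R by (simp add: u_def field_simps)
    ultimately show ?thesis using R by (simp add: norm_divide)
  qed
  then have "exp_transform a u = of_real (Gamma (1 - a)) * u powr of_real (a - 1)"
    using exp_transform_near_1[OF a, of "1 - u"] J1 by (simp add: algebra_simps)
  moreover have "z powr of_real (a - 1) = of_real (R powr (a - 1)) * u powr of_real (a - 1)"
  proof -
    have "u \<noteq> 0" using nz R by (simp add: u_def)
    then have "Ln z = of_real (ln R) + Ln u" unfolding zu using R by (simp add: Ln_times_of_real Ln_of_real)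
    then show ?thesis using nz \<open>u \<noteq> 0\<close> R
      by (simp add: powr_def exp_add[symmetric] ring_distribs flip: exp_of_real)
  qed
  moreover have "exp_transform a z = of_real (R powr (a - 1)) * exp_transform a u"
    unfolding zu by (rule exp_transform_scale[OF R])
  ultimately show ?thesis by (simp add: mult_ac)
qed

text \<open>The boundary value is approached from the right. The point \<open>- \<i> * y\<close> is
  off the branch cut, so the closed form is continuous there, and the integrals converge by
  domination.\<close>

lemma exp_transform_imaginary:
  assumes a: "1 < a" "a < 2" and y: "y \<noteq> (0::real)"
  shows "exp_transform a (- \<i> * of_real y) = of_real (Gamma (1 - a)) * (- \<i> * of_real y) powr of_real (a - 1)"
proof (rule LIMSEQ_unique)
  let ?z = "\<lambda>m::nat. of_real (inverse (real (Suc m))) + (- \<i> * complex_of_real y)"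
  have lz: "?z \<longlonglongrightarrow> 0 + (- \<i> * of_real y)"
    using tendsto_of_real[OF LIMSEQ_inverse_real_of_nat, where 'a=complex]
    by (intro tendsto_add tendsto_const) simp
  have nl: "- \<i> * of_real y \<notin> \<real>\<^sub>\<le>\<^sub>0" using y by (auto simp: complex_nonpos_Reals_iff)
  have "(\<lambda>m. exp_transform a (?z m)) = (\<lambda>m. of_real (Gamma (1 - a)) * ?z m powr of_real (a - 1))"
    using a by (intro ext exp_transform_halfplane) auto
  moreover have "\<dots> \<longlonglongrightarrow> of_real (Gamma (1 - a)) * (- \<i> * of_real y) powr of_real (a - 1)"
    using lz nl by (intro tendsto_intros) auto
  ultimately show "(\<lambda>m. exp_transform a (?z m)) \<longlonglongrightarrow> of_real (Gamma (1 - a)) * (- \<i> * of_real y) powr of_real (a - 1)"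
    by simp
  show "(\<lambda>m. exp_transform a (?z m)) \<longlonglongrightarrow> exp_transform a (- \<i> * of_real y)"
    unfolding exp_transform_def
  proof (rule integral_dominated_convergence)
    show "integrable lborel (\<lambda>v. (3 + \<bar>y\<bar>) * (indicator {0<..} v * (min 1 v * v powr (- a))))"
      using a by (intro integrable_mult_right integrable_min_one_powr)
    show "AE v in lborel. (\<lambda>m. indicator {0<..} v *\<^sub>R ((exp (- ?z m * of_real v) - 1) * of_real (v powr (- a))))
      \<longlonglongrightarrow> indicator {0<..} v *\<^sub>R ((exp (- (- \<i> * of_real y) * of_real v) - 1) * of_real (v powr (- a)))"
      using lz by (intro AE_I2 tendsto_intros) auto
    show "AE v in lborel. norm (indicator {0<..} v *\<^sub>R ((exp (- ?z m * of_real v) - 1) * of_real (v powr (- a))))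
        \<le> (3 + \<bar>y\<bar>) * (indicator {0<..} v * (min 1 v * v powr (- a)))" for m
    proof (rule AE_I2)
      fix v :: real
      have "norm (?z m) \<le> norm (complex_of_real (inverse (real (Suc m)))) + norm (- \<i> * complex_of_real y)"
        by (rule norm_triangle_ineq)
      also have "norm (complex_of_real (inverse (real (Suc m)))) \<le> 1" by (simp only: norm_of_real) (simp add: inverse_eq_divide)
      finally have nz: "2 + norm (?z m) \<le> 3 + \<bar>y\<bar>" by (simp add: norm_mult)
      have "norm (indicator {0<..} v *\<^sub>R ((exp (- ?z m * of_real v) - 1) * of_real (v powr (- a))))
        \<le> (2 + norm (?z m)) * (indicator {0<..} v * (min 1 v * v powr (- a)))"
        by (rule exp_transform_bound) simp
      also have "\<dots> \<le> (3 + \<bar>y\<bar>) * (indicator {0<..} v * (min 1 v * v powr (- a)))"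
        using nz by (intro mult_right_mono) (auto simp: indicator_def)
      finally show "norm (indicator {0<..} v *\<^sub>R ((exp (- ?z m * of_real v) - 1) * of_real (v powr (- a))))
        \<le> (3 + \<bar>y\<bar>) * (indicator {0<..} v * (min 1 v * v powr (- a)))" .
    qed
  qed measurable
qed

text \<open>The number \<open>- \<i> * y\<close> has modulus \<open>\<bar>y\<bar>\<close> and
  argument \<open>- sgn y * pi / 2\<close>, so its power \<open>a\<close> has argument
  \<open>- sgn y * pi * a / 2\<close>. Factoring out the cosine, nonzero because
  \<open>pi * a / 2\<close> lies between \<open>pi / 2\<close> and \<open>pi\<close>, produces the
  tangent.\<close>

lemma stable_exponent:
  assumes a: "1 < a" "a < 2"
  shows "\<i> * of_real y * exp_transform a (- \<i> * of_real y) =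
     - (of_real (\<bar>y\<bar> powr a * (Gamma (1 - a) * cos (pi * a / 2))) * (1 - \<i> * of_real (sgn y * tan (pi * a / 2))))"
proof (cases "y = 0")
  case False
  define z where "z = - \<i> * complex_of_real y"
  have z0: "z \<noteq> 0" using False by (simp add: z_def)
  have cosn: "cos (pi * a / 2) \<noteq> 0"
  proof -
    have "cos (pi * a / 2) = - sin (pi * (a - 1) / 2)"
      using cos_add[of "pi * (a - 1) / 2" "pi / 2"] by (simp add: field_simps)
    moreover have "0 < sin (pi * (a - 1) / 2)" using a by (intro sin_gt_zero) auto
    ultimately show ?thesis by simp
  qed
  have "z * z powr of_real (a - 1) = z powr of_real a"
    using z0 powr_add[of z 1 "of_real (a - 1)"] by simp
  also have "\<dots> = of_real (\<bar>y\<bar> powr a) * cis (- (sgn y * (pi * a / 2)))"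
  proof -
    have LnZ: "Ln z = of_real (ln \<bar>y\<bar>) + of_real (- (sgn y * (pi / 2))) * \<i>"
    proof -
      have "z = of_real \<bar>y\<bar> * (of_real (- sgn y) * \<i>)"
        using False by (simp add: z_def sgn_if)
      also have "Ln \<dots> = of_real (ln \<bar>y\<bar>) + Ln (of_real (- sgn y) * \<i>)"
        using False by (subst Ln_times_of_real) (auto simp: sgn_if Ln_of_real)
      also have "Ln (of_real (- sgn y) * \<i>) = of_real (- (sgn y * (pi / 2))) * \<i>"
        using False by (auto simp: sgn_if)
      finally show ?thesis .
    qed
    then have "of_real a * Ln z = of_real (a * ln \<bar>y\<bar>) + \<i> * of_real (- (sgn y * (pi * a / 2)))"
      unfolding LnZ by (simp add: algebra_simps)
    then have "z powr of_real a = exp (of_real (a * ln \<bar>y\<bar>)) * exp (\<i> * of_real (- (sgn y * (pi * a / 2))))"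
      using z0 by (simp only: powr_def exp_add) simp
    then show ?thesis using False by (simp add: cis_conv_exp powr_def exp_of_real[symmetric])
  qed
  also have "cis (- (sgn y * (pi * a / 2))) = of_real (cos (pi * a / 2)) * (1 - \<i> * of_real (sgn y * tan (pi * a / 2)))"
    using cosn False by (auto simp: complex_eq_iff tan_def sgn_if)
  finally have *: "z * z powr of_real (a - 1) =
      of_real (\<bar>y\<bar> powr a) * (of_real (cos (pi * a / 2)) * (1 - \<i> * of_real (sgn y * tan (pi * a / 2))))" .
  have "\<i> * of_real y * exp_transform a z = - (of_real (Gamma (1 - a)) * (z * z powr of_real (a - 1)))"
    unfolding z_def exp_transform_imaginary[OF a False] by (simp add: mult_ac)
  also have "\<dots> = - (of_real (\<bar>y\<bar> powr a * (Gamma (1 - a) * cos (pi * a / 2))) * (1 - \<i> * of_real (sgn y * tan (pi * a / 2))))"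
    unfolding * by (simp add: mult_ac)
  finally show ?thesis by (simp add: z_def)
qed auto

section \<open>Regularly varying tails\<close>

text \<open>Positivity is part of the notion so that all ratios are meaningful, and monotonicity
  stands in for uniformity statements on slowly varying functions.\<close>

definition reg_tail :: "real \<Rightarrow> (real \<Rightarrow> real) \<Rightarrow> bool" where
  "reg_tail \<alpha> G \<longleftrightarrow> antimono G \<and> (\<forall>x. 0 < G x \<and> G x \<le> 1) \<and>
     (\<forall>c>0. ((\<lambda>x. G (c * x) / G x) \<longlongrightarrow> c powr (- \<alpha>)) at_top)"

lemma reg_tailD:
  assumes "reg_tail \<alpha> G"
  shows "x \<le> y \<Longrightarrow> G y \<le> G x" "0 < G x" "G x \<le> 1"
    "0 < c \<Longrightarrow> ((\<lambda>x. G (c * x) / G x) \<longlongrightarrow> c powr (- \<alpha>)) at_top"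
  using assms by (auto simp: reg_tail_def antimono_def)

text \<open>Only the integer values of \<open>L\<close> are tied to the tail; monotonicity interpolates between the
  ratios along multiples of \<open>q\<close>.\<close>

lemma reg_tail_of_nat:
  fixes Q :: "nat \<Rightarrow> real"
  assumes \<alpha>: "0 < \<alpha>" and mono: "antimono Q" and Q0: "\<And>n. 0 \<le> Q n"
    and L: "slowly_varying L" and QL: "\<And>n. 1 \<le> n \<Longrightarrow> Q n = L (real n) * real n powr (- \<alpha>)"
    and G: "antimono G" "\<And>x. G x \<le> 1" and GQ: "\<And>x. 0 \<le> x \<Longrightarrow> G x = Q (nat \<lfloor>x\<rfloor> + 1)"
  shows "reg_tail \<alpha> G"
proof -
  have Lc: "((\<lambda>t. L (c * t) / L t) \<longlongrightarrow> 1) at_top" if "0 < c" for c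
    using L that by (auto simp: slowly_varying_def)
  have Qm: "Q n \<le> Q m" if "m \<le> n" for m n using mono that by (auto simp: antimono_def)
  \<comment> \<open>Division by zero yields 0, so convergence of \<open>L (1 * t) / L t\<close> to 1
    forces \<open>L t\<close> to be eventually nonzero; by monotonicity the tail is then positive
    everywhere.\<close>
  have ev: "\<forall>\<^sub>F n in sequentially. Q n \<noteq> 0"
  proof -
    have "\<forall>\<^sub>F t in at_top. L (1 * t) / L t > 1/2"
      using Lc[of 1] by (intro order_tendstoD) auto
    then have "\<forall>\<^sub>F t in at_top. L t \<noteq> 0" by eventually_elim auto
    then have "\<forall>\<^sub>F n in sequentially. L (real n) \<noteq> 0"
      using filterlim_real_sequentially by (rule eventually_compose_filterlim)
    then show ?thesis
      using eventually_ge_at_top[of 1] by eventually_elim (auto simp: QL)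
  qed
  have Qpos: "0 < Q n" for n
  proof -
    have "\<exists>m. m \<ge> n \<and> Q m \<noteq> 0"
      using eventually_happens[OF eventually_conj[OF ev eventually_ge_at_top[of n]]] by auto
    then obtain m where "m \<ge> n" "Q m \<noteq> 0" by blast
    then show ?thesis using Qm[of n m] Q0[of m] by linarith
  qed
  have Gpos: "0 < G x" for x
  proof -
    have "G (max x 0) \<le> G x" using G by (auto simp: antimono_def)
    then show ?thesis using GQ[of "max x 0"] Qpos[of "nat \<lfloor>max x 0\<rfloor> + 1"] by simp
  qed
  have ratio: "(\<lambda>n. Q (p * n) / Q (r * n)) \<longlonglongrightarrow> (real p / real r) powr (- \<alpha>)" if "1 \<le> p" "1 \<le> r" for p r
  proof -
    have fl: "filterlim (\<lambda>n. real (r * n)) at_top sequentially"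
      using that by (intro filterlim_compose[OF filterlim_real_sequentially] mult_nat_left_at_top) auto
    have "(\<lambda>n. L (real p / real r * real (r * n)) / L (real (r * n))) \<longlonglongrightarrow> 1"
      using that by (intro filterlim_compose[OF Lc fl]) auto
    then have "(\<lambda>n. L (real p / real r * real (r * n)) / L (real (r * n)) * (real p / real r) powr (- \<alpha>))
        \<longlonglongrightarrow> 1 * (real p / real r) powr (- \<alpha>)"
      by (intro tendsto_intros)
    moreover have "\<forall>\<^sub>F n in sequentially. L (real p / real r * real (r * n)) / L (real (r * n)) * (real p / real r) powr (- \<alpha>)
       = Q (p * n) / Q (r * n)"
      using eventually_ge_at_top[of 1]
    proof eventually_elim
      case (elim n)
      have "real p / real r * real (r * n) = real (p * n)" using that by simp
      moreover have "1 \<le> p * n" "1 \<le> r * n" using that elim by auto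
      moreover have "(real p / real r) powr (- \<alpha>) = real (p * n) powr (- \<alpha>) / real (r * n) powr (- \<alpha>)"
        using that elim by (simp add: powr_divide[symmetric])
      ultimately show ?case by (simp only: QL) simp
    qed
    ultimately show ?thesis by (auto dest: Lim_transform_eventually)
  qed
  have lim: "((\<lambda>x. G (c * x) / G x) \<longlongrightarrow> c powr (- \<alpha>)) at_top" if c: "0 < c" for c
  proof -
    \<comment> \<open>\<open>P q / q\<close> approximates \<open>c\<close> from below. If
      \<open>n\<close> is the integer part of \<open>x / q\<close> and large, then \<open>x\<close>
      lies between \<open>q * n\<close> and \<open>(q + 1) * n\<close>, and \<open>c * x\<close>
      between \<open>P q * n\<close> and \<open>(P q + 2) * n\<close>. All four bounds are multiples
      of the same \<open>n\<close>, along which \<open>ratio\<close> applies, and as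
      \<open>q\<close> grows both resulting limits approach
      \<open>c powr (- \<alpha>)\<close>.\<close>
    define P where "P q = nat \<lfloor>c * real q\<rfloor>" for q
    have P: "c * real q - 1 < real (P q)" "real (P q) \<le> c * real q" for q
    proof -
      have "0 \<le> \<lfloor>c * real q\<rfloor>" using c by simp
      then have "real (P q) = of_int \<lfloor>c * real q\<rfloor>" by (simp add: P_def)
      then show "c * real q - 1 < real (P q)" "real (P q) \<le> c * real q" by linarith+
    qed
    have lo: "(\<lambda>q. real (P q) / real (q + 1)) \<longlonglongrightarrow> c"
    proof (rule Lim_transform_bound[THEN Lim_null[THEN iffD2]])
      show "(\<lambda>q. (1 + c) / real (q + 1)) \<longlonglongrightarrow> 0"
        using LIMSEQ_ignore_initial_segment[OF lim_const_over_n[of "1 + c"], of 1] by simp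
      show "\<forall>\<^sub>F q in sequentially. norm (real (P q) / real (q + 1) - c) \<le> norm ((1 + c) / real (q + 1))"
      proof (rule always_eventually, rule allI)
        fix q
        have "real (P q) / real (q + 1) - c = (real (P q) - c * real q - c) / real (q + 1)"
          by (simp add: field_simps)
        moreover have "\<bar>real (P q) - c * real q - c\<bar> \<le> 1 + c" using P[of q] c by linarith
        ultimately show "norm (real (P q) / real (q + 1) - c) \<le> norm ((1 + c) / real (q + 1))"
          using c by (simp add: divide_right_mono)
      qed
    qed
    have hi: "(\<lambda>q. real (P q + 2) / real q) \<longlonglongrightarrow> c"
    proof (rule Lim_transform_bound[THEN Lim_null[THEN iffD2]])
      show "(\<lambda>q. 2 / real q) \<longlonglongrightarrow> 0" by (rule lim_const_over_n)
      show "\<forall>\<^sub>F q in sequentially. norm (real (P q + 2) / real q - c) \<le> norm (2 / real q)"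
        using eventually_ge_at_top[of 1]
      proof eventually_elim
        case (elim q)
        then have "real (P q + 2) / real q - c = (real (P q) - c * real q + 2) / real q"
          by (simp add: field_simps)
        moreover have "\<bar>real (P q) - c * real q + 2\<bar> \<le> 2" using P[of q] c by linarith
        ultimately show "norm (real (P q + 2) / real q - c) \<le> norm (2 / real q)"
          using c by (simp add: divide_right_mono)
      qed
    qed
    have fn: "filterlim (\<lambda>x. nat \<lfloor>x / real q\<rfloor>) sequentially at_top" if "1 \<le> q" for q
    proof -
      have "filterlim (\<lambda>x. (1 / real q) * x) at_top at_top"
        using that by (intro filterlim_tendsto_pos_mult_at_top[OF tendsto_const]) (auto simp: filterlim_ident)
      then show ?thesis
        by (intro filterlim_compose[OF filterlim_nat_sequentially] filterlim_compose[OF filterlim_floor_sequentially]) auto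
    qed
    have bnd: "Q ((P q + 2) * n) / Q (q * n) \<le> G (c * x) / G x \<and> G (c * x) / G x \<le> Q (P q * n) / Q ((q + 1) * n)"
      if q: "1 \<le> q" and x: "0 \<le> x" and n: "n = nat \<lfloor>x / real q\<rfloor>" "q \<le> n" "P q + 1 \<le> n" for q n x
    proof -
      have "of_int \<lfloor>x / real q\<rfloor> = real n" using n q by simp
      then have "real n \<le> x / real q" "x / real q < real n + 1" by linarith+
      then have xn: "real n * real q \<le> x" "x < (real n + 1) * real q" using q by (auto simp: field_simps)
      have fl: "nat \<lfloor>y\<rfloor> + 1 \<le> m \<longleftrightarrow> y < real m" "m \<le> nat \<lfloor>y\<rfloor> \<longleftrightarrow> real m \<le> y" if "0 \<le> y" for y m
        using that by (linarith)+
      have cx: "0 \<le> c * x" using c x by simp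
      have a1: "P q * n \<le> nat \<lfloor>c * x\<rfloor>"
      proof -
        have "real (P q * n) \<le> c * real q * real n" using P(2)[of q] by (simp add: mult_right_mono)
        also have "\<dots> = c * (real n * real q)" by simp
        also have "\<dots> \<le> c * x" using xn c by (intro mult_left_mono) auto
        finally show ?thesis using fl(2)[OF cx] by simp
      qed
      have a2: "nat \<lfloor>x\<rfloor> + 1 \<le> (q + 1) * n"
      proof -
        have "x < real n * real q + real q" using xn by (simp add: algebra_simps)
        also have "\<dots> \<le> real n * real q + real n" using n by simp
        also have "\<dots> = real ((q + 1) * n)" by (simp add: algebra_simps)
        finally show ?thesis using fl(1)[OF x] by simp
      qed
      have a3: "nat \<lfloor>c * x\<rfloor> + 1 \<le> (P q + 2) * n"
      proof -
        have "c * x < c * ((real n + 1) * real q)" using xn c by (intro mult_strict_left_mono) auto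
        also have "\<dots> = (c * real q) * (real n + 1)" by simp
        also have "\<dots> \<le> (real (P q) + 1) * (real n + 1)" using P(1)[of q] by (intro mult_right_mono) auto
        also have "\<dots> = (real (P q) + 1) * real n + real (P q + 1)" by (simp add: algebra_simps)
        also have "\<dots> \<le> (real (P q) + 1) * real n + real n" using n(3) by (intro add_left_mono) simp
        also have "\<dots> = real ((P q + 2) * n)" by (simp add: algebra_simps)
        finally show ?thesis using fl(1)[OF cx] by simp
      qed
      have a4: "q * n \<le> nat \<lfloor>x\<rfloor>" using fl(2)[OF x] xn by (simp add: mult.commute)
      have "Q ((P q + 2) * n) / Q (q * n) \<le> Q (nat \<lfloor>c * x\<rfloor> + 1) / Q (nat \<lfloor>x\<rfloor> + 1)"
        using a3 a4 Qpos Q0 by (intro frac_le Qm) auto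
      moreover have "Q (nat \<lfloor>c * x\<rfloor> + 1) / Q (nat \<lfloor>x\<rfloor> + 1) \<le> Q (P q * n) / Q ((q + 1) * n)"
        using a1 a2 Qpos Q0 by (intro frac_le Qm) auto
      ultimately show ?thesis using GQ[OF x] GQ[OF cx] by simp
    qed
    have evb: "\<forall>\<^sub>F x in at_top. Q ((P q + 2) * nat \<lfloor>x / real q\<rfloor>) / Q (q * nat \<lfloor>x / real q\<rfloor>) \<le> G (c * x) / G x \<and>
        G (c * x) / G x \<le> Q (P q * nat \<lfloor>x / real q\<rfloor>) / Q ((q + 1) * nat \<lfloor>x / real q\<rfloor>)" if q: "1 \<le> q" for q
    proof -
      have "\<forall>\<^sub>F x in at_top. max q (P q + 1) \<le> nat \<lfloor>x / real q\<rfloor>"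
        using fn[OF q] unfolding filterlim_at_top by blast
      then show ?thesis using eventually_ge_at_top[of 0]
        by eventually_elim (intro bnd[OF q], auto)
    qed
    show ?thesis
    proof (rule order_tendstoI)
      fix u assume u: "c powr (- \<alpha>) < u"
      have "(\<lambda>q. (real (P q) / real (q + 1)) powr (- \<alpha>)) \<longlonglongrightarrow> c powr (- \<alpha>)"
        using lo c by (intro tendsto_intros) auto
      then have "\<forall>\<^sub>F q in sequentially. (real (P q) / real (q + 1)) powr (- \<alpha>) < u" using u by (rule order_tendstoD)
      moreover have "\<forall>\<^sub>F q in sequentially. real (P q) / real (q + 1) > 0" using lo c by (rule order_tendstoD)
      ultimately have "\<forall>\<^sub>F q in sequentially. (real (P q) / real (q + 1)) powr (- \<alpha>) < u \<and> 1 \<le> P q \<and> 1 \<le> q"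
        using eventually_ge_at_top[of 1] by eventually_elim (auto simp: zero_less_divide_iff)
      then obtain q where q: "(real (P q) / real (q + 1)) powr (- \<alpha>) < u" "1 \<le> P q" "1 \<le> q"
        by (auto dest!: eventually_happens)
      have "\<forall>\<^sub>F n in sequentially. Q (P q * n) / Q ((q + 1) * n) < u"
        using ratio[of "P q" "q + 1"] q by (intro order_tendstoD) auto
      then have "\<forall>\<^sub>F x in at_top. Q (P q * nat \<lfloor>x / real q\<rfloor>) / Q ((q + 1) * nat \<lfloor>x / real q\<rfloor>) < u"
        using fn[OF q(3)] by (rule eventually_compose_filterlim)
      with evb[OF q(3)] show "\<forall>\<^sub>F x in at_top. G (c * x) / G x < u" by eventually_elim linarith
    next
      fix u assume u: "u < c powr (- \<alpha>)"
      have "(\<lambda>q. (real (P q + 2) / real q) powr (- \<alpha>)) \<longlonglongrightarrow> c powr (- \<alpha>)"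
        using hi c by (intro tendsto_intros) auto
      then have "\<forall>\<^sub>F q in sequentially. u < (real (P q + 2) / real q) powr (- \<alpha>)" using u by (rule order_tendstoD)
      then have "\<forall>\<^sub>F q in sequentially. u < (real (P q + 2) / real q) powr (- \<alpha>) \<and> 1 \<le> q"
        using eventually_ge_at_top[of 1] by eventually_elim auto
      then obtain q where q: "u < (real (P q + 2) / real q) powr (- \<alpha>)" "1 \<le> q"
        by (auto dest!: eventually_happens)
      have "\<forall>\<^sub>F n in sequentially. u < Q ((P q + 2) * n) / Q (q * n)"
        using ratio[of "P q + 2" q] q by (intro order_tendstoD) auto
      then have "\<forall>\<^sub>F x in at_top. u < Q ((P q + 2) * nat \<lfloor>x / real q\<rfloor>) / Q (q * nat \<lfloor>x / real q\<rfloor>)"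
        using fn[OF q(2)] by (rule eventually_compose_filterlim)
      with evb[OF q(2)] show "\<forall>\<^sub>F x in at_top. u < G (c * x) / G x" by eventually_elim linarith
    qed
  qed
  show ?thesis unfolding reg_tail_def using G Gpos lim by auto
qed

section \<open>Unit shifts, Potter bounds and tail quantiles\<close>

text \<open>For every \<open>c < 1\<close> the point \<open>x - 1\<close> is at least
  \<open>c * x\<close> once \<open>x\<close> is large, so the ratio is eventually below any number
  above \<open>c powr (- \<alpha>)\<close>, which tends to 1 with \<open>c\<close>. This absorbs the
  extra 1 in the block lengths of Parke's process.\<close>

lemma reg_tail_shift_ratio:
  assumes G: "reg_tail \<alpha> G"
  shows "((\<lambda>x. G (x - 1) / G x) \<longlongrightarrow> 1) at_top"
proof (rule order_tendstoI)
  fix u :: real assume "u < 1"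
  show "\<forall>\<^sub>F x in at_top. u < G (x - 1) / G x"
  proof (intro always_eventually allI)
    fix x
    have "1 \<le> G (x - 1) / G x" using reg_tailD[OF G] by simp
    then show "u < G (x - 1) / G x" using \<open>u < 1\<close> by linarith
  qed
next
  fix u :: real assume u: "1 < u"
  have "((\<lambda>c. c powr (- \<alpha>)) \<longlongrightarrow> 1 powr (- \<alpha>)) (at_left 1)"
    by (intro tendsto_intros) auto
  then have "\<forall>\<^sub>F c in at_left 1. c powr (- \<alpha>) < u"
    using u by (intro order_tendstoD) auto
  moreover have "\<forall>\<^sub>F c in at_left 1. c \<in> {0<..<1::real}"
    by (rule eventually_at_left_field[THEN iffD2]) (auto intro!: exI[of _ 0])
  ultimately have "\<forall>\<^sub>F c in at_left 1. c powr (- \<alpha>) < u \<and> c \<in> {0<..<1::real}"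
    by eventually_elim auto
  then obtain c where c: "c powr (- \<alpha>) < u" "0 < c" "c < 1"
    by (auto dest!: eventually_happens)
  have "\<forall>\<^sub>F x in at_top. G (c * x) / G x < u"
    using reg_tailD(4)[OF G c(2)] c(1) by (rule order_tendstoD)
  then show "\<forall>\<^sub>F x in at_top. G (x - 1) / G x < u"
    using eventually_ge_at_top[of "1 / (1 - c)"]
  proof eventually_elim
    case (elim x)
    then have "c * x \<le> x - 1" using c by (simp add: field_simps)
    then have "G (x - 1) / G x \<le> G (c * x) / G x"
      using reg_tailD(1,2)[OF G] by (intro divide_right_mono) (auto intro: less_imp_le)
    then show ?case using elim by linarith
  qed
qed

lemma reg_tail_shift:
  assumes G: "reg_tail \<alpha> G"
  shows "reg_tail \<alpha> (\<lambda>x. G (x - 1))"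
proof -
  have "((\<lambda>x. G (c * x - 1) / G (x - 1)) \<longlongrightarrow> c powr (- \<alpha>)) at_top" if c: "0 < c" for c
  proof -
    have "filterlim (\<lambda>x. c * x) at_top at_top"
      using c by (intro filterlim_tendsto_pos_mult_at_top[OF tendsto_const]) (auto simp: filterlim_ident)
    then have "((\<lambda>x. G (c * x - 1) / G (c * x)) \<longlongrightarrow> 1) at_top"
      by (rule filterlim_compose[OF reg_tail_shift_ratio[OF G]])
    from tendsto_divide[OF tendsto_mult[OF this reg_tailD(4)[OF G c]] reg_tail_shift_ratio[OF G]]
    have "((\<lambda>x. (G (c * x - 1) / G (c * x)) * (G (c * x) / G x) / (G (x - 1) / G x)) \<longlongrightarrow> c powr (- \<alpha>)) at_top"
      by simp
    moreover have "(G (c * x - 1) / G (c * x)) * (G (c * x) / G x) / (G (x - 1) / G x) = G (c * x - 1) / G (x - 1)" for x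
      using reg_tailD(2)[OF G, of x] reg_tailD(2)[OF G, of "x - 1"] reg_tailD(2)[OF G, of "c * x"]
      by (simp add: field_simps)
    ultimately show ?thesis by (simp only:)
  qed
  then show ?thesis using G by (auto simp: reg_tail_def antimono_def)
qed

text \<open>Iteration of the ratio at 2: beyond \<open>x0\<close> each doubling multiplies the tail
  by a factor between \<open>2 powr (- q)\<close> and \<open>2 powr (- p)\<close>. The constant 4
  pays for the incomplete last doubling: it bounds \<open>2 powr p\<close> and
  \<open>2 powr q\<close>, both exponents being at most 2.\<close>

lemma reg_tail_Potter:
  assumes G: "reg_tail \<alpha> G" and p: "0 < p" "p < \<alpha>" "\<alpha> < q" "q \<le> 2"
  obtains x0 where "0 < x0"
    "\<And>x y. x0 \<le> x \<Longrightarrow> x \<le> y \<Longrightarrow> G y \<le> 4 * (y / x) powr (- p) * G x"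
    "\<And>x y. x0 \<le> x \<Longrightarrow> x \<le> y \<Longrightarrow> (y / x) powr (- q) * G x \<le> 4 * G y"
proof -
  have "\<forall>\<^sub>F x in at_top. G (2 * x) / G x < 2 powr (- p)" "\<forall>\<^sub>F x in at_top. 2 powr (- q) < G (2 * x) / G x"
    using p reg_tailD(4)[OF G, of 2] by (auto intro!: order_tendstoD(1) order_tendstoD(2))
  then have "\<forall>\<^sub>F x in at_top. G (2 * x) / G x < 2 powr (- p) \<and> 2 powr (- q) < G (2 * x) / G x"
    by (rule eventually_conj)
  then obtain x1 where x1: "\<And>x. x1 \<le> x \<Longrightarrow> G (2 * x) / G x < 2 powr (- p) \<and> 2 powr (- q) < G (2 * x) / G x"
    by (auto simp: eventually_at_top_linorder)
  define x0 where "x0 = max 1 x1"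
  have step: "G (2 * x) \<le> 2 powr (- p) * G x" "2 powr (- q) * G x \<le> G (2 * x)" if "x0 \<le> x" for x
    using x1[of x] that reg_tailD(2)[OF G, of x] by (auto simp: x0_def field_simps)
  have iter: "G (2 ^ k * x) \<le> (2 powr (- p)) ^ k * G x \<and> (2 powr (- q)) ^ k * G x \<le> G (2 ^ k * x)" if x: "x0 \<le> x" for k x
  proof (induction k)
    case (Suc k)
    have "0 < x" using x by (simp add: x0_def)
    then have "1 * x \<le> 2 ^ k * x" by (intro mult_right_mono) auto
    then have kx: "x0 \<le> 2 ^ k * x" using x by simp
    have "G (2 ^ Suc k * x) \<le> 2 powr (- p) * G (2 ^ k * x)" using step(1)[OF kx] by (simp add: mult.assoc)
    also have "\<dots> \<le> 2 powr (- p) * ((2 powr (- p)) ^ k * G x)" using Suc by (intro mult_left_mono) auto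
    finally have 1: "G (2 ^ Suc k * x) \<le> (2 powr (- p)) ^ Suc k * G x" by (simp add: mult.assoc)
    have "2 powr (- q) * ((2 powr (- q)) ^ k * G x) \<le> 2 powr (- q) * G (2 ^ k * x)" using Suc by (intro mult_left_mono) auto
    also have "\<dots> \<le> G (2 ^ Suc k * x)" using step(2)[OF kx] by (simp add: mult.assoc)
    finally show ?case using 1 by (simp add: mult.assoc)
  qed simp
  have pw: "(2 powr r) ^ k = (2 ^ k) powr r" for r :: real and k :: nat
  proof -
    have "(2 powr r) ^ k = 2 powr (r * real k)" by (simp add: powr_powr[symmetric] powr_realpow)
    also have "\<dots> = (2 powr real k) powr r" by (simp add: powr_powr mult.commute)
    finally show ?thesis by (simp add: powr_realpow)
  qed
  show ?thesis
  proof
    show "0 < x0" by (simp add: x0_def)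
    fix x y assume xy: "x0 \<le> x" "x \<le> y"
    have x0: "0 < x" using xy by (simp add: x0_def)
    have yx: "1 \<le> y / x" using xy x0 by simp
    \<comment> \<open>The number of complete doublings between \<open>x\<close> and
      \<open>y\<close>.\<close>
    define k where "k = nat \<lfloor>log 2 (y / x)\<rfloor>"
    have "real k \<le> log 2 (y / x)" "log 2 (y / x) < real k + 1"
      using yx by (auto simp: k_def)
    then have k1: "2 ^ k \<le> y / x" and k2: "y / x \<le> 2 ^ Suc k"
      using yx by (auto simp: le_log_iff log_less_iff powr_add powr_realpow)
    have "G y \<le> G (2 ^ k * x)" using k1 x0 by (intro reg_tailD(1)[OF G]) (simp add: field_simps)
    also have "\<dots> \<le> (2 ^ k) powr (- p) * G x" using iter[OF xy(1)] by (simp add: pw)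
    also have "(2 ^ k) powr (- p) = 2 powr p * (2 ^ Suc k) powr (- p)"
    proof -
      have "(2 ^ Suc k) powr (- p) = 2 powr (- p) * (2 ^ k) powr (- p)" by (simp add: powr_mult)
      then show ?thesis by (simp add: powr_add[symmetric] mult.assoc[symmetric])
    qed
    also have "\<dots> \<le> 4 * (y / x) powr (- p)"
    proof (rule mult_mono)
      have "2 powr p \<le> 2 powr 2" using p by (intro powr_mono) auto
      then show "2 powr p \<le> 4" by simp
      show "(2 ^ Suc k) powr (- p) \<le> (y / x) powr (- p)" using k2 yx p by (intro powr_mono2') auto
    qed auto
    finally show "G y \<le> 4 * (y / x) powr (- p) * G x" using reg_tailD(2)[OF G, of x] by simp
    have "(y / x) powr (- q) * G x \<le> (2 ^ k) powr (- q) * G x"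
      using k1 p reg_tailD(2)[OF G, of x] by (intro mult_right_mono powr_mono2') auto
    also have "\<dots> = 2 powr q * (2 ^ Suc k) powr (- q) * G x"
    proof -
      have "(2 ^ Suc k) powr (- q) = 2 powr (- q) * (2 ^ k) powr (- q)" by (simp add: powr_mult)
      then show ?thesis by (simp add: powr_add[symmetric] mult.assoc[symmetric])
    qed
    also have "\<dots> = 2 powr q * ((2 ^ Suc k) powr (- q) * G x)" by simp
    also have "\<dots> \<le> 4 * G y"
    proof (rule mult_mono)
      have "2 powr q \<le> 2 powr 2" using p by (intro powr_mono) auto
      then show "2 powr q \<le> 4" by simp
      have "(2 ^ Suc k) powr (- q) * G x \<le> G (2 ^ Suc k * x)" using iter[OF xy(1), of "Suc k"] by (simp only: pw)
      also have "\<dots> \<le> G y" using k2 x0 by (intro reg_tailD(1)[OF G]) (simp add: field_simps)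
      finally show "(2 ^ Suc k) powr (- q) * G x \<le> G y" .
    qed (use reg_tailD(2)[OF G, of x] in auto)
    finally show "(y / x) powr (- q) * G x \<le> 4 * G y" .
  qed
qed

lemma reg_tail_to_0:
  assumes G: "reg_tail \<alpha> G" and \<alpha>: "1 < \<alpha>" "\<alpha> < 2"
  shows "(G \<longlongrightarrow> 0) at_top"
proof -
  obtain x0 where x0: "0 < x0" "\<And>x y. x0 \<le> x \<Longrightarrow> x \<le> y \<Longrightarrow> G y \<le> 4 * (y / x) powr (- 1) * G x"
    by (rule reg_tail_Potter[OF G zero_less_one \<alpha> order_refl]) (rule that, assumption+)
  show ?thesis
  proof (rule tendsto_sandwich)
    show "((\<lambda>_. 0) \<longlongrightarrow> (0::real)) at_top" by simp
    show "\<forall>\<^sub>F y in at_top. 0 \<le> G y" using reg_tailD(2)[OF G] by (auto intro!: always_eventually less_imp_le)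
    show "\<forall>\<^sub>F y in at_top. G y \<le> 4 * (y / x0) powr (- 1) * G x0"
      using eventually_ge_at_top[of x0] by eventually_elim (use x0 in auto)
    have "filterlim (\<lambda>y. (1 / x0) * y) at_top at_top"
      using x0 by (intro filterlim_tendsto_pos_mult_at_top[OF tendsto_const]) (auto simp: filterlim_ident)
    then have "((\<lambda>y. 4 * ((1 / x0) * y) powr (- 1) * G x0) \<longlongrightarrow> 4 * 0 * G x0) at_top"
      by (intro tendsto_intros tendsto_neg_powr) auto
    then show "((\<lambda>y. 4 * (y / x0) powr (- 1) * G x0) \<longlongrightarrow> 0) at_top" by simp
  qed
qed

definition tail_quantile :: "(real \<Rightarrow> real) \<Rightarrow> nat \<Rightarrow> real" where
  "tail_quantile G n = Inf {t. 0 < t \<and> G t < 1 / real n}"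

text \<open>The tail may jump, so \<open>n * G\<close> need not equal 1 at the quantile. For
  \<open>c > 1\<close> the quantile times \<open>c\<close> is strictly above the infimum, for
  \<open>c < 1\<close> strictly below, which bounds \<open>n * G\<close> by 1 at that point from
  above or from below; regular variation moves the bound to the quantile at the price of a factor
  near \<open>c powr \<alpha>\<close>, and \<open>c\<close> may be taken close to 1.\<close>

lemma tail_quantile:
  assumes G: "reg_tail \<alpha> G" and \<alpha>: "1 < \<alpha>" "\<alpha> < 2"
  shows tail_quantile_at_top: "filterlim (tail_quantile G) at_top sequentially"
    and tail_quantile_tendsto: "(\<lambda>n. real n * G (tail_quantile G n)) \<longlonglongrightarrow> 1"
proof -
  let ?S = "\<lambda>n. {t. 0 < t \<and> G t < 1 / real n}"
  have ne: "?S n \<noteq> {}" if "1 \<le> n" for n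
  proof -
    have "\<forall>\<^sub>F t in at_top. G t < 1 / real n" using reg_tail_to_0[OF assms] that by (intro order_tendstoD) auto
    then have "\<forall>\<^sub>F t in at_top. 0 < t \<and> G t < 1 / real n" using eventually_gt_at_top[of 0] by eventually_elim auto
    then show ?thesis by (auto dest!: eventually_happens)
  qed
  have bd: "bdd_below (?S n)" for n by (rule bdd_belowI[of _ 0]) auto
  have above: "G t < 1 / real n" if n: "1 \<le> n" "tail_quantile G n < t" for n t
  proof -
    obtain s where "s \<in> ?S n" "s < t"
      using n(2) ne[OF n(1)] unfolding tail_quantile_def by (meson cInf_lessD)
    then show ?thesis using reg_tailD(1)[OF G, of s t] by force
  qed
  have below: "1 / real n \<le> G t" if "0 < t" "t < tail_quantile G n" for n t
  proof (rule ccontr)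
    assume "\<not> 1 / real n \<le> G t"
    then have "tail_quantile G n \<le> t" unfolding tail_quantile_def using that bd by (intro cInf_lower) auto
    with that show False by simp
  qed
  show top: "filterlim (tail_quantile G) at_top sequentially"
    unfolding filterlim_at_top
  proof
    fix Z
    have "\<forall>\<^sub>F n in sequentially. 1 / real n < G Z"
      using lim_const_over_n[of 1] reg_tailD(2)[OF G, of Z] by (rule order_tendstoD)
    then show "\<forall>\<^sub>F n in sequentially. Z \<le> tail_quantile G n"
      using eventually_ge_at_top[of 1]
    proof eventually_elim
      case (elim n)
      show ?case using above[of n Z] elim by linarith
    qed
  qed
  have pos: "\<forall>\<^sub>F n in sequentially. 0 < tail_quantile G n \<and> 1 \<le> n"
    using top eventually_ge_at_top[of 1] by (auto simp: filterlim_at_top_dense intro: eventually_conj)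
  show "(\<lambda>n. real n * G (tail_quantile G n)) \<longlonglongrightarrow> 1"
  proof (rule order_tendstoI)
    fix u :: real assume u: "u < 1"
    show "\<forall>\<^sub>F n in sequentially. u < real n * G (tail_quantile G n)"
    proof -
      have "((\<lambda>c. c powr \<alpha>) \<longlongrightarrow> 1 powr \<alpha>) (at_left 1)"
        by (intro tendsto_intros) auto
      then have "\<forall>\<^sub>F c in at_left 1. u < c powr \<alpha>" using u by (intro order_tendstoD) auto
      moreover have "\<forall>\<^sub>F c in at_left 1. c \<in> {0<..<1::real}"
        by (rule eventually_at_left_field[THEN iffD2]) (auto intro!: exI[of _ 0])
      ultimately have "\<forall>\<^sub>F c in at_left 1. u < c powr \<alpha> \<and> c \<in> {0<..<1::real}" by eventually_elim auto
      then obtain c where c: "u < c powr \<alpha>" "0 < c" "c < 1"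
        by (auto dest!: eventually_happens)
      have "((\<lambda>x. inverse (G (c * x) / G x)) \<longlongrightarrow> inverse (c powr (- \<alpha>))) at_top"
        using c by (intro tendsto_inverse reg_tailD(4)[OF G]) auto
      then have "\<forall>\<^sub>F x in at_top. u < inverse (G (c * x) / G x)"
        using c by (intro order_tendstoD) (auto simp: powr_minus)
      then have "\<forall>\<^sub>F n in sequentially. u < inverse (G (c * tail_quantile G n) / G (tail_quantile G n))"
        using top by (rule eventually_compose_filterlim)
      with pos show ?thesis
      proof eventually_elim
        case (elim n)
        have "1 / real n \<le> G (c * tail_quantile G n)" using elim c by (intro below) auto
        then have "1 \<le> real n * G (c * tail_quantile G n)" using elim by (simp add: field_simps)
        then have "inverse (G (c * tail_quantile G n) / G (tail_quantile G n)) \<le> real n * G (tail_quantile G n)"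
          using reg_tailD(2)[OF G, of "c * tail_quantile G n"] reg_tailD(2)[OF G, of "tail_quantile G n"]
          by (simp add: field_simps)
        then show ?case using elim by linarith
      qed
    qed
  next
    fix u :: real assume u: "1 < u"
    show "\<forall>\<^sub>F n in sequentially. real n * G (tail_quantile G n) < u"
    proof -
      have "((\<lambda>c. c powr \<alpha>) \<longlongrightarrow> 1 powr \<alpha>) (at_right 1)"
        by (intro tendsto_intros) auto
      then have "\<forall>\<^sub>F c in at_right 1. c powr \<alpha> < u" using u by (intro order_tendstoD) auto
      moreover have "\<forall>\<^sub>F c in at_right 1. 1 < (c::real)"
        by (simp add: eventually_at_right_less)
      ultimately have "\<forall>\<^sub>F c in at_right 1. c powr \<alpha> < u \<and> 1 < (c::real)" by eventually_elim auto
      then obtain c where c: "c powr \<alpha> < u" "1 < c"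
        by (auto dest!: eventually_happens)
      have "((\<lambda>x. inverse (G (c * x) / G x)) \<longlongrightarrow> inverse (c powr (- \<alpha>))) at_top"
        using c by (intro tendsto_inverse reg_tailD(4)[OF G]) auto
      then have "\<forall>\<^sub>F x in at_top. inverse (G (c * x) / G x) < u"
        using c by (intro order_tendstoD) (auto simp: powr_minus)
      then have "\<forall>\<^sub>F n in sequentially. inverse (G (c * tail_quantile G n) / G (tail_quantile G n)) < u"
        using top by (rule eventually_compose_filterlim)
      with pos show ?thesis
      proof eventually_elim
        case (elim n)
        have "G (c * tail_quantile G n) < 1 / real n" using elim c by (intro above) auto
        then have "real n * G (c * tail_quantile G n) \<le> 1" using elim by (simp add: field_simps)
        then have "real n * G (tail_quantile G n) \<le> inverse (G (c * tail_quantile G n) / G (tail_quantile G n))"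
          using reg_tailD(2)[OF G, of "c * tail_quantile G n"] reg_tailD(2)[OF G, of "tail_quantile G n"]
          by (simp add: field_simps)
        then show ?case using elim by linarith
      qed
    qed
  qed
qed

lemma scaled_tail_limit:
  assumes G: "reg_tail \<alpha> G" and a: "filterlim a at_top sequentially"
    and scaled_tail_1: "(\<lambda>n. real n * G (a n)) \<longlonglongrightarrow> 1" and v: "0 < v"
  shows "(\<lambda>n. real n * G (a n * v)) \<longlonglongrightarrow> v powr (- \<alpha>)"
proof -
  have "(\<lambda>n. (real n * G (a n)) * (G (v * a n) / G (a n))) \<longlonglongrightarrow> 1 * v powr (- \<alpha>)"
    by (intro tendsto_mult scaled_tail_1 filterlim_compose[OF reg_tailD(4)[OF G v] a])
  moreover have "(real n * G (a n)) * (G (v * a n) / G (a n)) = real n * G (a n * v)" for n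
    using reg_tailD(2)[OF G, of "a n"] by (simp add: mult.commute)
  ultimately show ?thesis by simp
qed

text \<open>Three regimes: for \<open>v \<ge> 1\<close> the upper Potter bound starting at
  \<open>a n\<close>; for \<open>v < 1\<close> with \<open>a n * v \<ge> x0\<close> the lower one
  between \<open>a n * v\<close> and \<open>a n\<close>; below \<open>x0\<close> the trivial bound
  \<open>G \<le> 1\<close>, compared with the lower one between \<open>x0\<close> and
  \<open>a n\<close>. The outcome holds for all \<open>v > 0\<close> at once, as dominated
  convergence in \<open>v\<close> requires.\<close>

lemma scaled_tail_bound:
  assumes G: "reg_tail \<alpha> G" and a: "filterlim a at_top sequentially"
    and scaled_tail_1: "(\<lambda>n. real n * G (a n)) \<longlonglongrightarrow> 1" and p: "0 < p" "p < \<alpha>" "\<alpha> < q" "q \<le> 2"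
  obtains C where "0 < C"
    "\<forall>\<^sub>F n in sequentially. \<forall>v>0. real n * G (a n * v) \<le> C * (v powr (- p) + v powr (- q))"
proof -
  obtain x0 where x0: "0 < x0"
    and up: "\<And>x y. x0 \<le> x \<Longrightarrow> x \<le> y \<Longrightarrow> G y \<le> 4 * (y / x) powr (- p) * G x"
    and dn: "\<And>x y. x0 \<le> x \<Longrightarrow> x \<le> y \<Longrightarrow> (y / x) powr (- q) * G x \<le> 4 * G y"
    using reg_tail_Potter[OF G p] by blast
  note Gp = reg_tailD(2)[OF G]
  \<comment> \<open>8 is the Potter constant 4 times the bound 2 for \<open>n * G (a n)\<close>;
    \<open>8 / G x0\<close> serves the range below \<open>x0\<close>, where 1 is compared with
    \<open>G x0\<close>.\<close>
  define C where "C = max 8 (8 / G x0)"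
  have C: "8 \<le> C" "8 / G x0 \<le> C" by (auto simp: C_def)
  have *: "real n * G (a n * v) \<le> C * (v powr (- p) + v powr (- q))"
    if n: "real n * G (a n) < 2" "x0 \<le> a n" and v: "0 < v" for n v
  proof (cases "1 \<le> v")
    case True
    have an: "0 < a n" using n x0 by simp
    have "G (a n * v) \<le> 4 * (a n * v / a n) powr (- p) * G (a n)"
      using True n an by (intro up) auto
    then have "real n * G (a n * v) \<le> real n * (4 * v powr (- p) * G (a n))"
      using an by (intro mult_left_mono) auto
    also have "\<dots> = 4 * v powr (- p) * (real n * G (a n))" by simp
    also have "\<dots> \<le> 4 * v powr (- p) * 2" using n by (intro mult_left_mono) auto
    also have "\<dots> = 8 * v powr (- p)" by simp
    also have "\<dots> \<le> C * (v powr (- p) + v powr (- q))"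
      using C by (intro mult_mono) auto
    finally show ?thesis .
  next
    case False
    have an: "0 < a n" using n x0 by simp
    have key: "G (a n * v) \<le> (C / 2) * v powr (- q) * G (a n)"
    proof (cases "x0 \<le> a n * v")
      case True
      have "(a n / (a n * v)) powr (- q) * G (a n * v) \<le> 4 * G (a n)"
        using True False an by (intro dn) auto
      moreover have "(a n / (a n * v)) powr (- q) = v powr q"
        using an v by (simp add: powr_minus powr_divide inverse_eq_divide)
      ultimately have "v powr (- q) * (v powr q * G (a n * v)) \<le> v powr (- q) * (4 * G (a n))"
        by (intro mult_left_mono) auto
      moreover have "v powr (- q) * (v powr q * G (a n * v)) = G (a n * v)"
        using v by (simp add: powr_add[symmetric] mult.assoc[symmetric])
      ultimately have "G (a n * v) \<le> 4 * v powr (- q) * G (a n)" by simp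
      also have "\<dots> \<le> (C / 2) * v powr (- q) * G (a n)"
        using C Gp[of "a n"] by (intro mult_right_mono) auto
      finally show ?thesis .
    next
      case small: False
      have "a n / x0 \<le> 1 / v" using small x0 v by (simp add: field_simps)
      then have "(1 / v) powr (- q) \<le> (a n / x0) powr (- q)"
        using p an x0 by (intro powr_mono2') auto
      then have "v powr q * G x0 \<le> (a n / x0) powr (- q) * G x0"
        using v Gp[of x0] by (intro mult_right_mono) (auto simp: powr_minus powr_divide inverse_eq_divide)
      also have "\<dots> \<le> 4 * G (a n)" using n by (intro dn) auto
      finally have "v powr (- q) * (v powr q * G x0) \<le> v powr (- q) * (4 * G (a n))"
        by (intro mult_left_mono) auto
      moreover have "v powr (- q) * (v powr q * G x0) = G x0"
        using v by (simp add: powr_add[symmetric] mult.assoc[symmetric])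
      ultimately have "1 \<le> (4 / G x0) * v powr (- q) * G (a n)" using Gp[of x0] by (simp add: field_simps)
      also have "\<dots> \<le> (C / 2) * v powr (- q) * G (a n)"
        using C Gp[of "a n"] by (intro mult_right_mono) auto
      finally show ?thesis using reg_tailD(3)[OF G, of "a n * v"] by linarith
    qed
    have "real n * G (a n * v) \<le> real n * ((C / 2) * v powr (- q) * G (a n))"
      using key by (intro mult_left_mono) auto
    also have "\<dots> = (C / 2) * v powr (- q) * (real n * G (a n))" by simp
    also have "\<dots> \<le> (C / 2) * v powr (- q) * 2" using n C by (intro mult_left_mono) auto
    also have "\<dots> = C * v powr (- q)" by simp
    also have "\<dots> \<le> C * (v powr (- p) + v powr (- q))" using C by (intro mult_left_mono) auto
    finally show ?thesis .
  qed
  have "\<forall>\<^sub>F n in sequentially. real n * G (a n) < 2" using scaled_tail_1 by (rule order_tendstoD) simp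
  moreover have "\<forall>\<^sub>F n in sequentially. x0 \<le> a n" using a by (simp add: filterlim_at_top)
  ultimately have "\<forall>\<^sub>F n in sequentially. \<forall>v>0. real n * G (a n * v) \<le> C * (v powr (- p) + v powr (- q))"
    by eventually_elim (use * in auto)
  then show ?thesis using C by (intro that[of C]) auto
qed

text \<open>With a Potter exponent \<open>p\<close> between 1 and \<alpha>, \<open>G (a n)\<close>
  is at most a constant times \<open>a n powr (- p)\<close>, while \<open>n * G (a n)\<close> stays
  above 1/2; hence \<open>a n / n\<close> is at most a constant times
  \<open>a n powr (1 - p)\<close>.\<close>

lemma scaled_tail_sublinear:
  assumes G: "reg_tail \<alpha> G" and a: "filterlim a at_top sequentially"
    and scaled_tail_1: "(\<lambda>n. real n * G (a n)) \<longlonglongrightarrow> 1" and \<alpha>: "1 < \<alpha>" "\<alpha> < 2"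
  shows "(\<lambda>n. a n / real n) \<longlonglongrightarrow> 0"
proof -
  define p where "p = (1 + \<alpha>) / 2"
  have p: "1 < p" "p < \<alpha>" using \<alpha> by (auto simp: p_def)
  obtain x0 where x0: "0 < x0"
    and up: "\<And>x y. x0 \<le> x \<Longrightarrow> x \<le> y \<Longrightarrow> G y \<le> 4 * (y / x) powr (- p) * G x"
    using reg_tail_Potter[OF G, of p 2] p \<alpha> by (metis order.strict_trans zero_less_one order_refl)
  show ?thesis
  proof (rule tendsto_sandwich)
    show "(\<lambda>_. 0) \<longlonglongrightarrow> (0::real)" by simp
    show "\<forall>\<^sub>F n in sequentially. 0 \<le> a n / real n"
      using a unfolding filterlim_at_top by (auto elim!: allE[of _ 0] eventually_mono)
    show "\<forall>\<^sub>F n in sequentially. a n / real n \<le> 8 * x0 powr p * a n powr (1 - p)"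
    proof -
      have "\<forall>\<^sub>F n in sequentially. 1/2 < real n * G (a n)" using scaled_tail_1 by (rule order_tendstoD) simp
      moreover have "\<forall>\<^sub>F n in sequentially. x0 \<le> a n" using a by (simp add: filterlim_at_top)
      ultimately show ?thesis using eventually_ge_at_top[of 1]
      proof eventually_elim
        case (elim n)
        have an: "0 < a n" using elim x0 by simp
        have "G (a n) \<le> 4 * (a n / x0) powr (- p) * G x0" using elim by (intro up) auto
        also have "\<dots> \<le> 4 * (a n / x0) powr (- p) * 1"
          using reg_tailD(3)[OF G] by (intro mult_left_mono) auto
        also have "(a n / x0) powr (- p) = x0 powr p * a n powr (- p)"
          using an x0 by (simp add: powr_divide powr_minus field_simps)
        finally have "real n * G (a n) \<le> real n * (4 * (x0 powr p * a n powr (- p)))"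
          by (intro mult_left_mono) auto
        then have "1 \<le> real n * (8 * (x0 powr p * a n powr (- p)))" using elim(1) by simp
        then have "a n * 1 \<le> a n * (real n * (8 * (x0 powr p * a n powr (- p))))"
          using an by (intro mult_left_mono) auto
        also have "\<dots> = real n * (8 * x0 powr p * (a n powr 1 * a n powr (- p)))" using an by simp
        also have "a n powr 1 * a n powr (- p) = a n powr (1 - p)" by (simp only: powr_add[symmetric]) simp
        finally show ?case using elim by (simp add: field_simps)
      qed
    qed
    have "(\<lambda>n. a n powr (1 - p)) \<longlonglongrightarrow> 0" using p a by (intro tendsto_neg_powr) auto
    from tendsto_mult_left[OF this, of "8 * x0 powr p"]
    show "(\<lambda>n. 8 * x0 powr p * a n powr (1 - p)) \<longlonglongrightarrow> 0" by simp
  qed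
qed

section \<open>Sums of independent marks with random weights\<close>

definition trunc1 :: "real \<Rightarrow> real" where "trunc1 x = (if \<bar>x\<bar> \<le> 1 then x else 0)"

lemma trunc1_measurable [measurable]: "trunc1 \<in> borel_measurable borel"
  unfolding trunc1_def by measurable

lemma trunc1_le: "\<bar>trunc1 x\<bar> \<le> 1" "(trunc1 x)\<^sup>2 \<le> min 1 (x\<^sup>2)"
  by (auto simp: trunc1_def abs_square_le_1)

text \<open>Truncating the weights at 1 changes the sum only if some weight exceeds 1, an event of
  probability at most \<open>A\<close>, and there the loss is at most 2. The truncated sum has
  orthogonal terms: mark \<open>j\<close> is centred and independent of mark \<open>k\<close> times
  both truncated weights, so the weights may depend on each other. \<open>min 2\<close> is the form
  in which differences of \<open>cis\<close> are bounded.\<close>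

lemma (in prob_space) weighted_sum_bound:
  fixes \<xi> d :: "nat \<Rightarrow> 'a \<Rightarrow> real"
  assumes J: "finite J" and s: "0 \<le> s"
    and [measurable]: "\<And>k. k \<in> J \<Longrightarrow> random_variable borel (\<xi> k)" "\<And>k. k \<in> J \<Longrightarrow> random_variable borel (d k)"
    and int: "\<And>k. k \<in> J \<Longrightarrow> integrable M (\<xi> k)" "\<And>k. k \<in> J \<Longrightarrow> integrable M (\<lambda>\<omega>. (\<xi> k \<omega>)\<^sup>2)"
    and mean: "\<And>k. k \<in> J \<Longrightarrow> expectation (\<xi> k) = 0" and var: "\<And>k. k \<in> J \<Longrightarrow> expectation (\<lambda>\<omega>. (\<xi> k \<omega>)\<^sup>2) \<le> s"
    and ind1: "\<And>k. k \<in> J \<Longrightarrow> indep_var borel (\<xi> k) borel (d k)"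
    and ind2: "\<And>j k. j \<in> J \<Longrightarrow> k \<in> J \<Longrightarrow> j \<noteq> k \<Longrightarrow>
      indep_var borel (\<xi> j) borel (\<lambda>\<omega>. \<xi> k \<omega> * (trunc1 (d j \<omega>) * trunc1 (d k \<omega>)))"
    and A: "(\<Sum>k\<in>J. expectation (\<lambda>\<omega>. min 1 ((d k \<omega>)\<^sup>2))) \<le> A"
  shows "expectation (\<lambda>\<omega>. min 2 \<bar>\<Sum>k\<in>J. \<xi> k \<omega> * d k \<omega>\<bar>) \<le> 2 * A + sqrt (s * A)"
proof -
  define t where "t k \<omega> = trunc1 (d k \<omega>)" for k \<omega>
  have [measurable]: "\<And>k. k \<in> J \<Longrightarrow> random_variable borel (t k)" unfolding t_def by measurable
  define Z where "Z \<omega> = (\<Sum>k\<in>J. \<xi> k \<omega> * t k \<omega>)" for \<omega>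
  have [measurable]: "random_variable borel Z" unfolding Z_def by measurable
  have diag: "integrable M (\<lambda>\<omega>. (\<xi> k \<omega> * t k \<omega>) * (\<xi> k \<omega> * t k \<omega>)) \<and>
      expectation (\<lambda>\<omega>. (\<xi> k \<omega> * t k \<omega>) * (\<xi> k \<omega> * t k \<omega>)) \<le> s * expectation (\<lambda>\<omega>. min 1 ((d k \<omega>)\<^sup>2))"
    if k: "k \<in> J" for k
  proof -
    have i: "indep_var borel ((\<lambda>x. x\<^sup>2) \<circ> \<xi> k) borel ((\<lambda>x. (trunc1 x)\<^sup>2) \<circ> d k)"
      by (rule indep_var_compose[OF ind1[OF k]]) measurable
    have it: "integrable M ((\<lambda>x. (trunc1 x)\<^sup>2) \<circ> d k)"
      using k trunc1_le by (intro integrable_const_bound[where B=1]) (auto simp: comp_def abs_square_le_1)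
    have ix: "integrable M ((\<lambda>x. x\<^sup>2) \<circ> \<xi> k)" using int(2)[OF k] by (simp add: comp_def)
    have e: "(\<lambda>\<omega>. (\<xi> k \<omega> * t k \<omega>) * (\<xi> k \<omega> * t k \<omega>)) = (\<lambda>\<omega>. ((\<lambda>x. x\<^sup>2) \<circ> \<xi> k) \<omega> * ((\<lambda>x. (trunc1 x)\<^sup>2) \<circ> d k) \<omega>)"
      by (auto simp: fun_eq_iff t_def power2_eq_square)
    have le: "expectation ((\<lambda>x. (trunc1 x)\<^sup>2) \<circ> d k) \<le> expectation (\<lambda>\<omega>. min 1 ((d k \<omega>)\<^sup>2))"
      using k trunc1_le by (intro integral_mono it integrable_const_bound[where B=1]) auto
    have s0: "0 \<le> s" using var[OF k] by (rule order_trans[rotated]) simp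
    have "expectation ((\<lambda>x. x\<^sup>2) \<circ> \<xi> k) * expectation ((\<lambda>x. (trunc1 x)\<^sup>2) \<circ> d k) \<le> s * expectation (\<lambda>\<omega>. min 1 ((d k \<omega>)\<^sup>2))"
      using le var[OF k] s0 by (intro mult_mono) (auto simp: comp_def)
    then show ?thesis
      unfolding e using indep_var_integrable[OF i ix it] indep_var_lebesgue_integral[OF i ix it]
      by (simp add: comp_def)
  qed
  have off: "integrable M (\<lambda>\<omega>. (\<xi> j \<omega> * t j \<omega>) * (\<xi> k \<omega> * t k \<omega>)) \<and>
      expectation (\<lambda>\<omega>. (\<xi> j \<omega> * t j \<omega>) * (\<xi> k \<omega> * t k \<omega>)) = 0"
    if jk: "j \<in> J" "k \<in> J" "j \<noteq> k" for j k
  proof -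
    have it: "integrable M (\<lambda>\<omega>. \<xi> k \<omega> * (trunc1 (d j \<omega>) * trunc1 (d k \<omega>)))"
    proof (rule Bochner_Integration.integrable_bound[OF int(1)[OF jk(2)]])
      show "AE \<omega> in M. norm (\<xi> k \<omega> * (trunc1 (d j \<omega>) * trunc1 (d k \<omega>))) \<le> norm (\<xi> k \<omega>)"
      proof (rule AE_I2)
        fix \<omega>
        have "\<bar>trunc1 (d j \<omega>)\<bar> * \<bar>trunc1 (d k \<omega>)\<bar> \<le> 1 * 1"
          by (intro mult_mono trunc1_le) auto
        then show "norm (\<xi> k \<omega> * (trunc1 (d j \<omega>) * trunc1 (d k \<omega>))) \<le> norm (\<xi> k \<omega>)"
          by (simp add: abs_mult mult_left_le)
      qed
    qed (use jk in measurable)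
    have e: "(\<lambda>\<omega>. (\<xi> j \<omega> * t j \<omega>) * (\<xi> k \<omega> * t k \<omega>)) = (\<lambda>\<omega>. \<xi> j \<omega> * (\<xi> k \<omega> * (trunc1 (d j \<omega>) * trunc1 (d k \<omega>))))"
      by (auto simp: fun_eq_iff t_def)
    show ?thesis unfolding e
      using indep_var_integrable[OF ind2[OF jk] int(1)[OF jk(1)] it]
        indep_var_lebesgue_integral[OF ind2[OF jk] int(1)[OF jk(1)] it] mean[OF jk(1)] by simp
  qed
  have Z2: "(\<lambda>\<omega>. (Z \<omega>)\<^sup>2) = (\<lambda>\<omega>. \<Sum>j\<in>J. \<Sum>k\<in>J. (\<xi> j \<omega> * t j \<omega>) * (\<xi> k \<omega> * t k \<omega>))"
    by (simp add: Z_def power2_eq_square sum_product)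
  have inn: "integrable M (\<lambda>\<omega>. (\<xi> j \<omega> * t j \<omega>) * (\<xi> k \<omega> * t k \<omega>))" if "j \<in> J" "k \<in> J" for j k
    using diag off that by (cases "j = k") auto
  have iZ2: "integrable M (\<lambda>\<omega>. (Z \<omega>)\<^sup>2)"
    unfolding Z2 by (intro Bochner_Integration.integrable_sum inn)
  have s0: "0 \<le> s" if "k \<in> J" for k using var[OF that] by (rule order_trans[rotated]) simp
  have "expectation (\<lambda>\<omega>. (Z \<omega>)\<^sup>2) = (\<Sum>j\<in>J. \<Sum>k\<in>J. expectation (\<lambda>\<omega>. (\<xi> j \<omega> * t j \<omega>) * (\<xi> k \<omega> * t k \<omega>)))"
    unfolding Z2 using inn by (simp add: Bochner_Integration.integral_sum)
  also have "\<dots> = (\<Sum>j\<in>J. \<Sum>k\<in>J. if k = j then expectation (\<lambda>\<omega>. (\<xi> j \<omega> * t j \<omega>) * (\<xi> j \<omega> * t j \<omega>)) else 0)"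
    using off by (intro sum.cong) auto
  also have "\<dots> = (\<Sum>j\<in>J. expectation (\<lambda>\<omega>. (\<xi> j \<omega> * t j \<omega>) * (\<xi> j \<omega> * t j \<omega>)))"
    using J by (simp add: sum.delta)
  also have "\<dots> \<le> (\<Sum>j\<in>J. s * expectation (\<lambda>\<omega>. min 1 ((d j \<omega>)\<^sup>2)))"
    using diag by (intro sum_mono) auto
  also have "\<dots> = s * (\<Sum>j\<in>J. expectation (\<lambda>\<omega>. min 1 ((d j \<omega>)\<^sup>2)))" by (simp add: sum_distrib_left)
  finally have EZ2: "expectation (\<lambda>\<omega>. (Z \<omega>)\<^sup>2) \<le> s * A \<or> J = {}"
    using A s0 by (fastforce intro: order_trans mult_left_mono)
  have iZ: "integrable M Z"
    unfolding Z_def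
  proof (intro Bochner_Integration.integrable_sum Bochner_Integration.integrable_bound[OF int(1)] AE_I2)
    fix k \<omega> assume "k \<in> J"
    show "norm (\<xi> k \<omega> * t k \<omega>) \<le> norm (\<xi> k \<omega>)"
      using trunc1_le(1)[of "d k \<omega>"] by (simp add: t_def abs_mult mult_left_le)
  qed auto
  \<comment> \<open>Nonnegativity of the variance of \<open>\<bar>Z\<bar>\<close> serves as the
    Cauchy-Schwarz inequality between first and second moment.\<close>
  have EZ: "expectation (\<lambda>\<omega>. \<bar>Z \<omega>\<bar>) \<le> sqrt (s * A)" if "J \<noteq> {}"
  proof (rule real_le_rsqrt)
    have "0 \<le> variance (\<lambda>\<omega>. \<bar>Z \<omega>\<bar>)" by simp
    also have "variance (\<lambda>\<omega>. \<bar>Z \<omega>\<bar>) = expectation (\<lambda>\<omega>. (\<bar>Z \<omega>\<bar>)\<^sup>2) - (expectation (\<lambda>\<omega>. \<bar>Z \<omega>\<bar>))\<^sup>2"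
      using iZ iZ2 by (intro variance_eq) auto
    finally show "(expectation (\<lambda>\<omega>. \<bar>Z \<omega>\<bar>))\<^sup>2 \<le> s * A" using EZ2 that by simp
  qed
  have i1: "integrable M (\<lambda>\<omega>. min 1 ((d k \<omega>)\<^sup>2))" if "k \<in> J" for k
    using that by (intro integrable_const_bound[where B=1]) auto
  have pw: "min 2 \<bar>\<Sum>k\<in>J. \<xi> k \<omega> * d k \<omega>\<bar> \<le> 2 * (\<Sum>k\<in>J. min 1 ((d k \<omega>)\<^sup>2)) + \<bar>Z \<omega>\<bar>" for \<omega>
  proof (cases "\<forall>k\<in>J. \<bar>d k \<omega>\<bar> \<le> 1")
    case True
    then have "(\<Sum>k\<in>J. \<xi> k \<omega> * d k \<omega>) = Z \<omega>" by (auto simp: Z_def t_def trunc1_def)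
    moreover have "0 \<le> 2 * (\<Sum>k\<in>J. min 1 ((d k \<omega>)\<^sup>2))" by (auto intro: sum_nonneg)
    ultimately show ?thesis by (simp add: min.coboundedI2)
  next
    case False
    then obtain k where k: "k \<in> J" "1 < \<bar>d k \<omega>\<bar>" by force
    then have "1 = min 1 ((d k \<omega>)\<^sup>2)" using one_less_power[of "\<bar>d k \<omega>\<bar>" 2] by simp
    also have "\<dots> \<le> (\<Sum>k\<in>J. min 1 ((d k \<omega>)\<^sup>2))" using k J by (intro member_le_sum) auto
    finally show ?thesis by (simp add: min.coboundedI1)
  qed
  have "expectation (\<lambda>\<omega>. min 2 \<bar>\<Sum>k\<in>J. \<xi> k \<omega> * d k \<omega>\<bar>) \<le>
     expectation (\<lambda>\<omega>. 2 * (\<Sum>k\<in>J. min 1 ((d k \<omega>)\<^sup>2)) + \<bar>Z \<omega>\<bar>)"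
  proof (rule integral_mono)
    show "integrable M (\<lambda>\<omega>. min 2 \<bar>\<Sum>k\<in>J. \<xi> k \<omega> * d k \<omega>\<bar>)"
      by (intro integrable_const_bound[where B=2]) auto
    show "integrable M (\<lambda>\<omega>. 2 * (\<Sum>k\<in>J. min 1 ((d k \<omega>)\<^sup>2)) + \<bar>Z \<omega>\<bar>)"
      using i1 iZ by (intro Bochner_Integration.integrable_add integrable_mult_right Bochner_Integration.integrable_sum integrable_abs)
  qed (rule pw)
  also have "\<dots> = 2 * (\<Sum>k\<in>J. expectation (\<lambda>\<omega>. min 1 ((d k \<omega>)\<^sup>2))) + expectation (\<lambda>\<omega>. \<bar>Z \<omega>\<bar>)"
    using i1 iZ by (simp add: Bochner_Integration.integral_sum)
  also have "\<dots> \<le> 2 * A + sqrt (s * A)"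
  proof (cases "J = {}")
    case True
    then have "Z = (\<lambda>_. 0)" by (simp add: Z_def fun_eq_iff)
    then show ?thesis using A True s by simp
  qed (use A EZ in linarith)
  finally show ?thesis .
qed

section \<open>Weights summed over a block and the error of freezing them\<close>

lemma cis_diff_le: "norm (cis x - cis y) \<le> min 2 \<bar>x - y\<bar>"
proof -
  have "norm (cis x - cis y) \<le> norm (cis x) + norm (cis y)" by (rule norm_triangle_ineq4)
  moreover have "norm (cis x - cis y) \<le> \<bar>x - y\<bar>"
  proof -
    have "cis x - cis y = cis y * (cis (x - y) - 1)" by (simp add: right_diff_distrib cis_mult)
    then have "norm (cis x - cis y) = norm (iexp (x - y) - (\<Sum>k\<le>0. (\<i> * (x - y)) ^ k / fact k))"
      by (simp add: norm_mult cis_conv_exp)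
    also have "\<dots> \<le> \<bar>x - y\<bar> ^ Suc 0 / fact (Suc 0)" by (rule iexp_approx1)
    finally show ?thesis by simp
  qed
  ultimately show ?thesis by simp
qed

text \<open>The end of the sample is made part of the weight: \<open>t / n \<le> 1\<close> means
  \<open>t \<le> n\<close>, so a block running past time \<open>n\<close> keeps its full random
  length.\<close>

definition cutoff :: "(real \<Rightarrow> real) \<Rightarrow> real \<Rightarrow> real" where
  "cutoff g s = (if s \<le> 1 then g s else 0)"

definition block_sum :: "(real \<Rightarrow> real) \<Rightarrow> nat \<Rightarrow> nat \<Rightarrow> int \<Rightarrow> real" where
  "block_sum g n l p = (\<Sum>t\<in>{p..<p + int l}. cutoff g (real_of_int t / real n))"

lemma block_sum_close:
  assumes g: "\<And>x. \<bar>g x\<bar> \<le> B" "\<And>x y. \<bar>g x - g y\<bar> \<le> K * \<bar>x - y\<bar>" and n: "1 \<le> n" and \<eta>: "0 < \<eta>" "\<eta> \<le> 1"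
  shows "\<bar>block_sum g n l p - real l * cutoff g s\<bar> \<le> 2 * B * real l"
    and "\<eta> \<le> \<bar>s - 1\<bar> \<Longrightarrow> \<bar>block_sum g n l p - real l * cutoff g s\<bar>
      \<le> (2 * B + K) * (real l * min 1 (((\<bar>real_of_int p - real n * s\<bar> + real l) / real n) / \<eta>))"
proof -
  have B0: "0 \<le> B" using g(1)[of 0] by linarith
  have K0: "0 \<le> K" using order_trans[OF abs_ge_zero g(2)[of 0 1]] by simp
  have eq: "block_sum g n l p - real l * cutoff g s = (\<Sum>t\<in>{p..<p + int l}. cutoff g (real_of_int t / real n) - cutoff g s)"
    by (simp add: block_sum_def sum_subtractf)
  have cB: "\<bar>cutoff g x\<bar> \<le> B" for x using g(1)[of x] B0 by (simp add: cutoff_def)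
  have "\<bar>\<Sum>t\<in>{p..<p + int l}. cutoff g (real_of_int t / real n) - cutoff g s\<bar> \<le> (\<Sum>t\<in>{p..<p + int l}. 2 * B)"
  proof (rule order_trans[OF sum_abs sum_mono])
    fix t
    show "\<bar>cutoff g (real_of_int t / real n) - cutoff g s\<bar> \<le> 2 * B"
      using cB[of "real_of_int t / real n"] cB[of s] by linarith
  qed
  then show "\<bar>block_sum g n l p - real l * cutoff g s\<bar> \<le> 2 * B * real l" unfolding eq by (simp add: mult_ac)
  assume s: "\<eta> \<le> \<bar>s - 1\<bar>"
  define e where "e = (\<bar>real_of_int p - real n * s\<bar> + real l) / real n"
  have "\<bar>\<Sum>t\<in>{p..<p + int l}. cutoff g (real_of_int t / real n) - cutoff g s\<bar> \<le> (\<Sum>t\<in>{p..<p + int l}. (2 * B + K) * min 1 (e / \<eta>))"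
  proof (rule order_trans[OF sum_abs sum_mono])
    fix t assume t: "t \<in> {p..<p + int l}"
    define x where "x = real_of_int t / real n"
    have xs: "\<bar>x - s\<bar> \<le> e"
    proof -
      have "x - s = (real_of_int t - real n * s) / real n" using n by (simp add: x_def field_simps)
      moreover have "\<bar>real_of_int t - real n * s\<bar> \<le> \<bar>real_of_int p - real n * s\<bar> + real l" using t by auto
      ultimately show ?thesis using n by (simp add: e_def abs_divide divide_right_mono)
    qed
    have bd: "\<bar>cutoff g x - cutoff g s\<bar> \<le> (2 * B + K) * 1"
      using cB[of x] cB[of s] K0 by simp
    show "\<bar>cutoff g (real_of_int t / real n) - cutoff g s\<bar> \<le> (2 * B + K) * min 1 (e / \<eta>)"
    proof (cases "e < \<eta>")
      case False
      then have "min 1 (e / \<eta>) = 1" using \<eta> by simp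
      then show ?thesis using bd by (simp add: x_def)
    next
      case True
      then have both: "x \<le> 1 \<longleftrightarrow> s \<le> 1" using xs s by auto
      have e0: "0 \<le> e" using xs by linarith
      have "\<bar>cutoff g x - cutoff g s\<bar> \<le> K * \<bar>x - s\<bar>" using both g(2)[of x s] K0 by (auto simp: cutoff_def)
      also have "\<dots> \<le> K * e" using xs K0 by (intro mult_left_mono)
      also have "\<dots> \<le> K * (e / \<eta>)" using e0 K0 \<eta> by (intro mult_left_mono) (simp add: field_simps mult_left_le_one_le)
      also have "\<dots> \<le> (2 * B + K) * (e / \<eta>)" using B0 e0 \<eta> by (intro mult_right_mono) auto
      also have "min 1 (e / \<eta>) = e / \<eta>" using True \<eta> by simp
      then have "(2 * B + K) * (e / \<eta>) = (2 * B + K) * min 1 (e / \<eta>)" by simp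
      finally show ?thesis by (simp add: x_def)
    qed
  qed
  also have "\<dots> = (2 * B + K) * (real l * min 1 (e / \<eta>))" by simp
  finally show "\<bar>block_sum g n l p - real l * cutoff g s\<bar> \<le> (2 * B + K) * (real l * min 1 (((\<bar>real_of_int p - real n * s\<bar> + real l) / real n) / \<eta>))"
    unfolding eq e_def .
qed

text \<open>\<open>z\<close> is a rescaled length, \<open>b1\<close> the rescaled drift of its
  start, and \<open>r * z\<close> the length relative to the sample. The only moment at hand is that
  of \<open>min z (z^2)\<close>, so the truncated square has to be made linear in it with small
  factors in front. For \<open>z > 1\<close> the square of \<open>z * (r * z)\<close> is the fourth
  power of \<open>sqrt r * z\<close>: where that number is at most 1 it dominates its fourth power,
  elsewhere it dominates the truncation at 1. Hence the square root.\<close>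

lemma min_one_square_split:
  fixes z b1 r C d :: real
  assumes z: "0 \<le> z" and b1: "0 \<le> b1" and r: "0 \<le> r" "r \<le> 1" and C: "1 \<le> C"
    and d: "\<bar>d\<bar> \<le> C * (z * min 1 (b1 + r * z))"
  shows "min 1 (d\<^sup>2) \<le> 2 * C\<^sup>2 * (min 1 b1 * min z (z\<^sup>2) + sqrt r * min z (z\<^sup>2))"
proof -
  define m where "m = min z (z\<^sup>2)"
  have m0: "0 \<le> m" using z by (simp add: m_def)
  have A: "min 1 (z\<^sup>2 * b) \<le> b * m" if b: "0 \<le> b" "b \<le> 1" "min 1 (z\<^sup>2 * b) \<le> b * z" for b
    using that by (auto simp: m_def min_def mult.commute)
  define u where "u = min 1 b1"
  have u: "0 \<le> u" "u \<le> 1" using b1 by (auto simp: u_def)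
  have h1: "min 1 ((z * u)\<^sup>2) \<le> u * m"
  proof (cases "z \<le> 1")
    case True
    have "(z * u)\<^sup>2 = u * (u * z\<^sup>2)" by (simp add: power2_eq_square)
    also have "\<dots> \<le> u * z\<^sup>2" using u by (intro mult_left_mono) (auto simp: mult_left_le_one_le)
    also have "z\<^sup>2 = m" using True z by (simp add: m_def power2_eq_square mult_left_le min_absorb2)
    finally show ?thesis by (simp add: min.coboundedI2)
  next
    case False
    then have mz: "m = z" by (simp add: m_def min_def power2_eq_square)
    have "min 1 ((z * u)\<^sup>2) \<le> z * u"
    proof (cases "z * u \<le> 1")
      case True
      then have "(z * u)\<^sup>2 \<le> z * u" using z u by (simp add: power2_eq_square mult_left_le)
      then show ?thesis by (simp add: min.coboundedI2)
    qed (simp add: min.coboundedI1)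
    then show ?thesis by (simp add: mz mult.commute)
  qed
  have h2: "min 1 ((z * (r * z))\<^sup>2) \<le> sqrt r * m"
  proof (cases "z \<le> 1")
    case True
    have rr: "r\<^sup>2 \<le> sqrt r"
    proof (rule real_le_rsqrt)
      have "(r\<^sup>2)\<^sup>2 = r ^ 4" by simp
      also have "\<dots> \<le> r ^ 1" using r by (intro power_decreasing) auto
      finally show "(r\<^sup>2)\<^sup>2 \<le> r" by simp
    qed
    have "(z * (r * z))\<^sup>2 = r\<^sup>2 * (z\<^sup>2 * z\<^sup>2)" by (simp add: power2_eq_square)
    also have "\<dots> \<le> sqrt r * (z\<^sup>2 * 1)"
      using rr True z r by (intro mult_mono) (auto simp: abs_square_le_1)
    also have "z\<^sup>2 * 1 = m" using True z by (simp add: m_def power2_eq_square mult_left_le min_absorb2)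
    finally show ?thesis by (simp add: min.coboundedI2)
  next
    case False
    then have mz: "m = z" by (simp add: m_def min_def power2_eq_square)
    have e: "(sqrt r * z)\<^sup>2 = z * (r * z)" using r by (simp add: power2_eq_square real_sqrt_mult_self algebra_simps)
    show ?thesis
    proof (cases "sqrt r * z \<le> 1")
      case True
      then have "(z * (r * z))\<^sup>2 \<le> sqrt r * z"
        unfolding e[symmetric] using z r
        by (simp add: power_le_one power_mult[symmetric]) (metis mult_nonneg_nonneg power_decreasing power_one_right real_sqrt_ge_zero numeral_le_iff one_le_numeral)
      then show ?thesis by (simp add: mz min.coboundedI2)
    qed (simp add: mz min.coboundedI1)
  qed
  have "d\<^sup>2 \<le> (C * (z * min 1 (b1 + r * z)))\<^sup>2" using d by (rule abs_le_square_iff[THEN iffD1, OF order_trans]) simp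
  also have "\<dots> \<le> (C * (z * (u + r * z)))\<^sup>2"
  proof (intro power_mono mult_left_mono)
    have "min 1 (b1 + y) \<le> min 1 b1 + y" if "0 \<le> y" for y using that by (auto simp: min_def)
    then show "min 1 (b1 + r * z) \<le> u + r * z" using z r by (simp add: u_def)
  qed (use z C b1 r in auto)
  also have "\<dots> = C\<^sup>2 * (z * u + z * (r * z))\<^sup>2" by (simp add: power2_eq_square algebra_simps)
  also have "\<dots> \<le> C\<^sup>2 * (2 * (z * u)\<^sup>2 + 2 * (z * (r * z))\<^sup>2)"
  proof (rule mult_left_mono)
    have "0 \<le> (z * u - z * (r * z))\<^sup>2" by simp
    then show "(z * u + z * (r * z))\<^sup>2 \<le> 2 * (z * u)\<^sup>2 + 2 * (z * (r * z))\<^sup>2"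
      by (simp add: power2_sum power2_diff)
  qed simp
  finally have "min 1 (d\<^sup>2) \<le> min 1 (2 * C\<^sup>2 * (z * u)\<^sup>2 + 2 * C\<^sup>2 * (z * (r * z))\<^sup>2)"
    by (simp add: algebra_simps min.coboundedI2)
  also have "\<dots> \<le> 2 * C\<^sup>2 * min 1 ((z * u)\<^sup>2) + 2 * C\<^sup>2 * min 1 ((z * (r * z))\<^sup>2)"
  proof -
    have C2: "1 \<le> 2 * C\<^sup>2" using one_le_power[OF C, of 2] by simp
    have *: "min 1 (K * x + K * y) \<le> K * min 1 x + K * min 1 y" if "1 \<le> K" "0 \<le> x" "0 \<le> y" for K x y :: real
    proof -
      have "0 \<le> K * min 1 x" "0 \<le> K * min 1 y" using that by auto
      show ?thesis
      proof (cases "x \<le> 1 \<and> y \<le> 1")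
        case True
        then show ?thesis by (simp add: min.coboundedI2)
      next
        case False
        then have "K * min 1 x = K \<or> K * min 1 y = K" by auto
        then have "1 \<le> K * min 1 x + K * min 1 y"
          using that(1) \<open>0 \<le> K * min 1 x\<close> \<open>0 \<le> K * min 1 y\<close> by linarith
        then show ?thesis by (rule min.coboundedI1)
      qed
    qed
    show ?thesis by (rule *[OF C2]) auto
  qed
  also have "\<dots> \<le> 2 * C\<^sup>2 * (u * m) + 2 * C\<^sup>2 * (sqrt r * m)"
    using h1 h2 by (intro add_mono mult_left_mono) auto
  finally show ?thesis by (simp add: u_def m_def algebra_simps)
qed

section \<open>The layer-cake formula\<close>

text \<open>An integral over \<open>v\<close> from 0 to \<open>L / c\<close> is one over all
  \<open>v > 0\<close> against the indicator of \<open>c * v < L\<close>; Fubini and independence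
  turn its expectation into an integral against the tail of \<open>L\<close>. The law of a length
  thus enters only through its tail. \<open>W\<close> is the integrable majorant that justifies
  Fubini.\<close>

lemma (in prob_space) layer_cake_indep:
  fixes h :: "real \<Rightarrow> real \<Rightarrow> 'c::{real_normed_field,banach,second_countable_topology}"
  assumes [measurable]: "random_variable borel L" "random_variable borel X"
    and ind: "indep_var borel X borel L"
    and h[measurable]: "case_prod h \<in> borel_measurable (borel \<Otimes>\<^sub>M borel)"
    and hint: "\<And>v. 0 < v \<Longrightarrow> integrable M (\<lambda>\<omega>. h v (X \<omega>))"
    and bound: "\<And>v. 0 < v \<Longrightarrow> prob {\<omega>\<in>space M. c * v < L \<omega>} * expectation (\<lambda>\<omega>. norm (h v (X \<omega>))) \<le> W v"
    and W: "integrable lborel (\<lambda>v. indicator {0<..} v * W v)"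
  shows "expectation (\<lambda>\<omega>. \<integral>v. indicator {v. 0 < v \<and> c * v < L \<omega>} v *\<^sub>R h v (X \<omega>) \<partial>lborel) =
      (\<integral>v. indicator {0<..} v *\<^sub>R (of_real (prob {\<omega>\<in>space M. c * v < L \<omega>}) * expectation (\<lambda>\<omega>. h v (X \<omega>))) \<partial>lborel)"
    and "integrable M (\<lambda>\<omega>. \<integral>v. indicator {v. 0 < v \<and> c * v < L \<omega>} v *\<^sub>R h v (X \<omega>) \<partial>lborel)"
proof -
  interpret P: pair_sigma_finite lborel M ..
  define f where "f v \<omega> = indicator {v. 0 < v \<and> c * v < L \<omega>} v *\<^sub>R h v (X \<omega>)" for v \<omega>
  have hX[measurable]: "(\<lambda>(v, \<omega>). h v (X \<omega>)) \<in> borel_measurable (lborel \<Otimes>\<^sub>M M)"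
  proof -
    have "(\<lambda>(v, \<omega>). (v, X \<omega>)) \<in> lborel \<Otimes>\<^sub>M M \<rightarrow>\<^sub>M borel \<Otimes>\<^sub>M borel" by measurable
    from measurable_compose[OF this h] show ?thesis by (simp add: case_prod_beta')
  qed
  have hv[measurable]: "h v \<in> borel_measurable borel" for v
    using measurable_Pair2[OF h, of v] by simp
  have fm[measurable]: "case_prod f \<in> borel_measurable (lborel \<Otimes>\<^sub>M M)"
  proof -
    have "(\<lambda>x. if 0 < fst x \<and> c * fst x < L (snd x) then 1 else 0 :: real) \<in> borel_measurable (lborel \<Otimes>\<^sub>M M)"
      by measurable
    from borel_measurable_scaleR[OF this hX] show ?thesis
      by (simp add: f_def case_prod_beta' indicator_def)
  qed
  have fv: "f v = (\<lambda>\<omega>. if 0 < v then h v (X \<omega>) * of_real (indicator {c * v<..} (L \<omega>)) else 0)" for v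
    by (auto simp: f_def fun_eq_iff indicator_def scaleR_conv_of_real)
  have P1: "expectation (\<lambda>\<omega>. indicator {c * v<..} (L \<omega>)) = prob {\<omega>\<in>space M. c * v < L \<omega>}" for v
  proof -
    have "expectation (\<lambda>\<omega>. indicator {c * v<..} (L \<omega>) :: real) = expectation (indicator {\<omega>\<in>space M. c * v < L \<omega>})"
      by (intro Bochner_Integration.integral_cong) (auto simp: indicator_def)
    then show ?thesis by simp
  qed
  have i1: "integrable M (\<lambda>\<omega>. indicator {c * v<..} (L \<omega>) :: real)" for v
    by (intro integrable_const_bound[where B=1]) auto
  have fi: "integrable M (f v) \<and> integral\<^sup>L M (f v) =
      indicator {0<..} v *\<^sub>R (of_real (prob {\<omega>\<in>space M. c * v < L \<omega>}) * expectation (\<lambda>\<omega>. h v (X \<omega>)))" for v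
  proof (cases "0 < v")
    case True
    have ii: "indep_var borel (h v \<circ> X) borel ((\<lambda>l. of_real (indicator {c * v<..} l) :: 'c) \<circ> L)"
      by (rule indep_var_compose[OF ind]) measurable
    have a1: "integrable M ((\<lambda>l. of_real (indicator {c * v<..} l) :: 'c) \<circ> L)"
      using integrable_of_real[OF i1[of v]] by (simp add: comp_def)
    have a2: "integrable M (h v \<circ> X)" using hint[OF True] by (simp add: comp_def)
    show ?thesis
      using indep_var_integrable[OF ii a2 a1] indep_var_lebesgue_integral[OF ii a2 a1] True P1[of v]
        integral_of_real[OF i1[of v], where 'a='c]
      by (simp add: fv comp_def mult.commute)
  qed (simp add: fv)
  have nv: "(\<integral>\<omega>. norm (f v \<omega>) \<partial>M) = indicator {0<..} v * (prob {\<omega>\<in>space M. c * v < L \<omega>} * expectation (\<lambda>\<omega>. norm (h v (X \<omega>))))" for v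
  proof (cases "0 < v")
    case True
    have ii: "indep_var borel ((\<lambda>x. norm (h v x)) \<circ> X) borel (indicator {c * v<..} \<circ> L :: 'a \<Rightarrow> real)"
      by (rule indep_var_compose[OF ind]) measurable
    have a1: "integrable M (indicator {c * v<..} \<circ> L :: 'a \<Rightarrow> real)"
      using i1[of v] by (simp add: comp_def)
    have a2: "integrable M ((\<lambda>x. norm (h v x)) \<circ> X)" using hint[OF True] by (simp add: comp_def)
    show ?thesis
      using indep_var_lebesgue_integral[OF ii a2 a1] True P1[of v]
      by (simp add: fv comp_def norm_mult mult.commute)
  qed (simp add: fv)
  have W0: "0 \<le> W v" if "0 < v" for v
  proof -
    have "0 \<le> prob {\<omega>\<in>space M. c * v < L \<omega>} * expectation (\<lambda>\<omega>. norm (h v (X \<omega>)))"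
      by (intro mult_nonneg_nonneg) auto
    then show ?thesis using bound[OF that] by linarith
  qed
  have fI: "integrable (lborel \<Otimes>\<^sub>M M) (case_prod f)"
  proof (rule P.Fubini_integrable[OF fm])
    show "integrable lborel (\<lambda>v. \<integral>\<omega>. norm (case (v, \<omega>) of (v, \<omega>) \<Rightarrow> f v \<omega>) \<partial>M)"
    proof (rule Bochner_Integration.integrable_bound[OF W])
      show "AE v in lborel. norm (\<integral>\<omega>. norm (case (v, \<omega>) of (v, \<omega>) \<Rightarrow> f v \<omega>) \<partial>M) \<le> norm (indicator {0<..} v * W v)"
      proof (rule AE_I2)
        fix v
        have "(\<integral>\<omega>. norm (f v \<omega>) \<partial>M) \<le> indicator {0<..} v * W v"
          unfolding nv using bound[of v] by (auto simp: indicator_def)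
        moreover have "0 \<le> (\<integral>\<omega>. norm (f v \<omega>) \<partial>M)" by simp
        ultimately show "norm (\<integral>\<omega>. norm (case (v, \<omega>) of (v, \<omega>) \<Rightarrow> f v \<omega>) \<partial>M) \<le> norm (indicator {0<..} v * W v)"
          unfolding real_norm_def case_prod_conv by linarith
      qed
      have "(\<lambda>(v, \<omega>). norm (f v \<omega>)) \<in> borel_measurable (lborel \<Otimes>\<^sub>M M)"
        using measurable_compose[OF fm borel_measurable_norm] by (simp add: case_prod_beta')
      then show "(\<lambda>v. \<integral>\<omega>. norm (case (v, \<omega>) of (v, \<omega>) \<Rightarrow> f v \<omega>) \<partial>M) \<in> borel_measurable lborel"
        by (simp add: borel_measurable_lebesgue_integral)
    qed
    show "AE v in lborel. integrable M (\<lambda>\<omega>. case (v, \<omega>) of (v, \<omega>) \<Rightarrow> f v \<omega>)"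
      using fi by simp
  qed
  have "(\<integral>\<omega>. (\<integral>v. f v \<omega> \<partial>lborel) \<partial>M) = (\<integral>v. (\<integral>\<omega>. f v \<omega> \<partial>M) \<partial>lborel)"
    by (rule P.Fubini_integral[OF fI])
  also have "\<dots> = (\<integral>v. indicator {0<..} v *\<^sub>R (of_real (prob {\<omega>\<in>space M. c * v < L \<omega>}) * expectation (\<lambda>\<omega>. h v (X \<omega>))) \<partial>lborel)"
    using fi by simp
  finally show "expectation (\<lambda>\<omega>. \<integral>v. indicator {v. 0 < v \<and> c * v < L \<omega>} v *\<^sub>R h v (X \<omega>) \<partial>lborel) =
      (\<integral>v. indicator {0<..} v *\<^sub>R (of_real (prob {\<omega>\<in>space M. c * v < L \<omega>}) * expectation (\<lambda>\<omega>. h v (X \<omega>))) \<partial>lborel)"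
    unfolding f_def .
  show "integrable M (\<lambda>\<omega>. \<integral>v. indicator {v. 0 < v \<and> c * v < L \<omega>} v *\<^sub>R h v (X \<omega>) \<partial>lborel)"
    using P.integrable_snd[OF fI] unfolding f_def .
qed

text \<open>Evaluates the inner integral of the layer-cake formula; the open interval in the
  indicator differs from the closed one by two endpoints, a null set.\<close>

lemma indicator_integral_FTC:
  fixes f F :: "real \<Rightarrow> 'c::euclidean_space"
  assumes c: "0 < c" and x: "0 \<le> x" and F: "\<And>v. 0 \<le> v \<Longrightarrow> (F has_vector_derivative f v) (at v within {0..x / c})"
    and f: "continuous_on {0..x / c} f"
  shows "(\<integral>v. indicator {v. 0 < v \<and> c * v < x} v *\<^sub>R f v \<partial>lborel) = F (x / c) - F 0"
proof -
  have "(\<integral>v. indicator {v. 0 < v \<and> c * v < x} v *\<^sub>R f v \<partial>lborel) = (\<integral>v. indicator {0..x / c} v *\<^sub>R f v \<partial>lborel)"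
  proof (rule integral_cong_AE)
    define k where "k v = indicator {0..x / c} v *\<^sub>R f v" for v
    have [measurable]: "k \<in> borel_measurable borel"
      unfolding k_def using f by (intro borel_measurable_continuous_on_indicator) auto
    have "{v. 0 < v \<and> c * v < x} = {0<..<x / c}" using c by (auto simp: field_simps)
    then have *: "(\<lambda>v. indicator {v. 0 < v \<and> c * v < x} v *\<^sub>R f v) = (\<lambda>v. indicator {0<..<x / c} v *\<^sub>R k v)"
      by (auto simp: fun_eq_iff indicator_def k_def)
    show "(\<lambda>v. indicator {v. 0 < v \<and> c * v < x} v *\<^sub>R f v) \<in> borel_measurable lborel"
      unfolding * by measurable
    show "(\<lambda>v. indicator {0..x / c} v *\<^sub>R f v) \<in> borel_measurable lborel"
      unfolding k_def[symmetric] by measurable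
    have "AE v in lborel. v \<noteq> 0 \<and> v \<noteq> x / c"
      using AE_lborel_singleton[of 0] AE_lborel_singleton[of "x / c"] by eventually_elim auto
    then show "AE v in lborel. indicator {v. 0 < v \<and> c * v < x} v *\<^sub>R f v = indicator {0..x / c} v *\<^sub>R f v"
      by eventually_elim (use c in \<open>auto simp: indicator_def field_simps\<close>)
  qed
  also have "\<dots> = F (x / c) - F 0"
    using x c F f by (intro integral_FTC_Icc) auto
  finally show ?thesis .
qed

section \<open>Arrays of independent marked blocks\<close>

text \<open>The drift condition is stated with \<open>min 1\<close> because the first renewal time of the
  Taqqu--Levy process has infinite mean.\<close>

locale stable_array = prob_space M for M :: "'a measure" +
  fixes \<xi> :: "nat \<Rightarrow> 'a \<Rightarrow> real" and len :: "nat \<Rightarrow> 'a \<Rightarrow> nat" and pos :: "nat \<Rightarrow> 'a \<Rightarrow> int"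
    and a :: "nat \<Rightarrow> real" and G :: "real \<Rightarrow> real" and \<alpha> \<mu> :: real
  assumes \<alpha>: "1 < \<alpha>" "\<alpha> < 2" and \<mu>: "1 \<le> \<mu>"
    and \<xi>_meas: "\<And>k. 1 \<le> k \<Longrightarrow> random_variable borel (\<xi> k)"
    and len_meas: "\<And>k. 1 \<le> k \<Longrightarrow> len k \<in> M \<rightarrow>\<^sub>M count_space UNIV"
    and pos_meas: "\<And>k. 1 \<le> k \<Longrightarrow> pos k \<in> M \<rightarrow>\<^sub>M count_space UNIV"
    and \<xi>_distr: "\<And>k. 1 \<le> k \<Longrightarrow> distr M borel (\<xi> k) = distr M borel (\<xi> 1)"
    and len_distr: "\<And>k. 1 \<le> k \<Longrightarrow> distr M borel (\<lambda>\<omega>. real (len k \<omega>)) = distr M borel (\<lambda>\<omega>. real (len 1 \<omega>))"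
    and \<xi>_int: "integrable M (\<xi> 1)" and \<xi>_mean: "expectation (\<xi> 1) = 0"
    and \<xi>_sq: "integrable M (\<lambda>\<omega>. (\<xi> 1 \<omega>)\<^sup>2)"
    and len_int: "integrable M (\<lambda>\<omega>. real (len 1 \<omega>))"
    and ind_block: "\<And>k F. 1 \<le> k \<Longrightarrow> indep_var borel (\<xi> k) borel (\<lambda>\<omega>. F (len k \<omega>) (pos k \<omega>) :: real)"
    and ind_pair: "\<And>j k F. 1 \<le> j \<Longrightarrow> 1 \<le> k \<Longrightarrow> j \<noteq> k \<Longrightarrow>
      indep_var borel (\<xi> j) borel (\<lambda>\<omega>. \<xi> k \<omega> * F (len j \<omega>) (pos j \<omega>) (len k \<omega>) (pos k \<omega>))"
    and ind_len_pos: "\<And>k f h. 1 \<le> k \<Longrightarrow> indep_var borel (\<lambda>\<omega>. f (len k \<omega>) :: real) borel (\<lambda>\<omega>. h (pos k \<omega>) :: real)"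
    and ind_marks: "indep_vars (\<lambda>_. borel) (\<lambda>k \<omega>. \<xi> k \<omega> * real (len k \<omega>)) {1..}"
    and tail: "reg_tail \<alpha> G" "\<And>x. 0 \<le> x \<Longrightarrow> prob {\<omega>\<in>space M. x < real (len 1 \<omega>)} = G x"
    and a_top: "filterlim a at_top sequentially" and scaled_tail_1: "(\<lambda>n. real n * G (a n)) \<longlonglongrightarrow> 1"
    and drift: "\<And>e. 0 < e \<Longrightarrow> \<forall>\<^sub>F n in sequentially. \<forall>k\<in>{1..n+1}.
      expectation (\<lambda>\<omega>. min 1 (\<bar>real_of_int (pos k \<omega>) - real k * \<mu>\<bar> / real n)) \<le> e"
begin

lemma \<xi>1_meas [measurable]: "random_variable borel (\<xi> 1)" by (rule \<xi>_meas) simp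

lemma real_len_meas: "1 \<le> k \<Longrightarrow> random_variable borel (\<lambda>\<omega>. real (len k \<omega>))"
  by (rule measurable_compose[OF len_meas]) auto

lemma len1_meas [measurable]: "random_variable borel (\<lambda>\<omega>. real (len 1 \<omega>))"
  by (rule real_len_meas) simp

lemmas [measurable] = \<xi>1_meas[unfolded One_nat_def] len1_meas[unfolded One_nat_def]

lemma ind_\<xi>_len: "indep_var borel (\<xi> 1) borel (\<lambda>\<omega>. real (len 1 \<omega>))"
  using ind_block[of 1 "\<lambda>l p. real l"] by simp

section \<open>The characteristic function of a single block with constant weight\<close>

text \<open>The midpoints of (1, \<alpha>) and, below, of (\<alpha>, 2) are the Potter exponents;
  both lie in (1, 2), so the resulting envelope is integrable against
  \<open>min 1 v\<close>.\<close>

definition low_index where "low_index = (1 + \<alpha>) / 2"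
definition high_index where "high_index = (2 + \<alpha>) / 2"

lemma pq: "1 < low_index" "low_index < \<alpha>" "\<alpha> < high_index" "high_index < 2"
  using \<alpha> by (auto simp: low_index_def high_index_def)

definition tail_env :: "real \<Rightarrow> real" where
  "tail_env v = v powr (- low_index) + v powr (- high_index)"

lemma tail_env_measurable [measurable]: "tail_env \<in> borel_measurable borel"
  unfolding tail_env_def by measurable

lemma tail_env_integrable: "integrable lborel (\<lambda>v. indicator {0<..} v * (min 1 v * tail_env v))"
proof -
  have "(\<lambda>v. indicator {0<..} v * (min 1 v * tail_env v)) =
    (\<lambda>v. indicator {0<..} v * (min 1 v * v powr (- low_index)) + indicator {0<..} v * (min 1 v * v powr (- high_index)))"
    by (simp add: fun_eq_iff tail_env_def algebra_simps)
  then show ?thesis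
    using integrable_min_one_powr[of low_index] integrable_min_one_powr[of high_index] pq \<alpha> by simp
qed

lemma tail_bound:
  obtains C N where "0 < C" "\<And>n v. N \<le> n \<Longrightarrow> 0 < v \<Longrightarrow> real n * G (a n * v) \<le> C * tail_env v"
    "\<And>n. N \<le> n \<Longrightarrow> 0 < a n \<and> 1 \<le> n"
proof -
  obtain C where C: "0 < C" "\<forall>\<^sub>F n in sequentially. \<forall>v>0. real n * G (a n * v) \<le> C * (v powr (- low_index) + v powr (- high_index))"
    by (rule scaled_tail_bound[OF tail(1) a_top scaled_tail_1, of low_index high_index]) (use pq in auto)
  have "\<forall>\<^sub>F n in sequentially. 0 < a n" using a_top by (simp add: filterlim_at_top_dense)
  with C(2) have "\<forall>\<^sub>F n in sequentially. (\<forall>v>0. real n * G (a n * v) \<le> C * (v powr (- low_index) + v powr (- high_index))) \<and> 0 < a n \<and> 1 \<le> n"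
    using eventually_ge_at_top[of 1] by eventually_elim auto
  then obtain N where "\<And>n. N \<le> n \<Longrightarrow> (\<forall>v>0. real n * G (a n * v) \<le> C * (v powr (- low_index) + v powr (- high_index))) \<and> 0 < a n \<and> 1 \<le> n"
    by (auto simp: eventually_sequentially)
  then show ?thesis using C(1) by (intro that[of C N]) (auto simp: tail_env_def)
qed

text \<open>Substitute for the infinite second moment of a length: of order \<open>1 / n\<close> for
  one block, so that the blocks of a sample have a bounded total. The minimum is replaced by a
  comparable smooth function, whose derivative is integrated against the tail.\<close>

lemma min_moment_bound:
  obtains \<kappa> N where "0 < \<kappa>" "\<And>n. N \<le> n \<Longrightarrow>
    expectation (\<lambda>\<omega>. min (real (len 1 \<omega>) / a n) ((real (len 1 \<omega>) / a n)\<^sup>2)) \<le> \<kappa> / real n"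
proof -
  obtain C N where C: "0 < C" "\<And>n v. N \<le> n \<Longrightarrow> 0 < v \<Longrightarrow> real n * G (a n * v) \<le> C * tail_env v"
    "\<And>n. N \<le> n \<Longrightarrow> 0 < a n \<and> 1 \<le> n"
    by (rule tail_bound) (rule that, assumption+)
  \<comment> \<open>The derivative of \<open>v + 1 / (1 + v)\<close>, whose increment from 0 to
    \<open>x\<close> is \<open>x^2 / (1 + x)\<close>, comparable with \<open>min x (x^2)\<close> up
    to a factor 2. It is at most \<open>2 * min 1 v\<close>, as the envelope requires.\<close>
  define w where "w v = 1 - 1 / (1 + v)\<^sup>2" for v :: real
  have w: "0 \<le> w v" "w v \<le> 2 * min 1 v" if "0 < v" for v
  proof -
    have "1 \<le> (1 + v)\<^sup>2" using that by (simp add: power2_eq_square algebra_simps)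
    then show "0 \<le> w v" by (simp add: w_def divide_le_eq_1)
    have "1 - 2 * v \<le> 1 / (1 + v)\<^sup>2"
    proof -
      have "(1 - 2 * v) * (1 + v)\<^sup>2 = 1 - 3 * v\<^sup>2 - 2 * v ^ 3" by (simp add: power2_eq_square power3_eq_cube algebra_simps)
      also have "\<dots> \<le> 1" using zero_le_power2[of v] zero_le_power[of v 3] that by linarith
      finally show ?thesis using that by (simp add: pos_le_divide_eq)
    qed
    moreover have "0 \<le> 1 / (1 + v)\<^sup>2" by simp
    ultimately show "w v \<le> 2 * min 1 v" unfolding w_def by linarith
  qed
  have wm[measurable]: "w \<in> borel_measurable borel" unfolding w_def by measurable
  define I0 where "I0 = (\<integral>v. indicator {0<..} v * (min 1 v * tail_env v) \<partial>lborel)"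
  have I00: "0 \<le> I0" unfolding I0_def by (intro integral_nonneg_AE) (auto simp: tail_env_def indicator_def)
  define \<kappa> where "\<kappa> = 4 * C * I0 + 1"
  have *: "expectation (\<lambda>\<omega>. min (real (len 1 \<omega>) / a n) ((real (len 1 \<omega>) / a n)\<^sup>2)) \<le> \<kappa> / real n"
    if n: "N \<le> n" for n
  proof -
    have an: "0 < a n" "1 \<le> n" using C(3)[OF n] by auto
    let ?L = "\<lambda>\<omega>. real (len 1 \<omega>)"
    have Wi: "integrable lborel (\<lambda>v. indicator {0<..} v * (2 * C / real n * (min 1 v * tail_env v)))"
      using integrable_mult_right[OF tail_env_integrable, of "2 * C / real n"] by (simp add: mult_ac)
    have Wb: "prob {\<omega>\<in>space M. a n * v < ?L \<omega>} * expectation (\<lambda>\<omega>. norm (w v)) \<le> 2 * C / real n * (min 1 v * tail_env v)"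
      if v: "0 < v" for v
    proof -
      have "prob {\<omega>\<in>space M. a n * v < ?L \<omega>} = G (a n * v)" using an v by (intro tail(2)) auto
      also have "\<dots> \<le> C * tail_env v / real n" using C(2)[OF n v] an by (simp add: field_simps)
      finally have "prob {\<omega>\<in>space M. a n * v < ?L \<omega>} * w v \<le> (C * tail_env v / real n) * (2 * min 1 v)"
        using w[OF v] by (intro mult_mono) (auto simp: tail_env_def C(1) less_imp_le)
      then show ?thesis using w[OF v] by (simp add: prob_space mult_ac)
    qed
    have hm: "case_prod (\<lambda>v x. w v) \<in> borel_measurable (borel \<Otimes>\<^sub>M (borel :: real measure))"
      by (simp add: case_prod_beta')
    note lc = layer_cake_indep[OF len1_meas \<xi>1_meas ind_\<xi>_len hm _ Wb Wi]
    have ge: "min (?L \<omega> / a n) ((?L \<omega> / a n)\<^sup>2) \<le> 2 * (\<integral>v. indicator {v. 0 < v \<and> a n * v < ?L \<omega>} v *\<^sub>R w v \<partial>lborel)" for \<omega>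
    proof -
      let ?x = "?L \<omega> / a n"
      have x0: "0 \<le> ?x" using an by simp
      have "(\<integral>v. indicator {v. 0 < v \<and> a n * v < ?L \<omega>} v *\<^sub>R w v \<partial>lborel) = (?x + 1 / (1 + ?x)) - (0 + 1 / (1 + 0))"
      proof (rule indicator_integral_FTC[OF an(1)])
        show "((\<lambda>v. v + 1 / (1 + v)) has_vector_derivative w v) (at v within {0..?x})" if "0 \<le> v" for v
          using that unfolding has_real_derivative_iff_has_vector_derivative[symmetric]
          by (auto intro!: derivative_eq_intros simp: w_def power2_eq_square divide_inverse)
        show "continuous_on {0..?x} w" unfolding w_def by (intro continuous_intros) auto
      qed auto
      also have "\<dots> = ?x\<^sup>2 / (1 + ?x)"
      proof -
        have "y + 1 / (1 + y) - (0 + 1 / (1 + 0)) = y\<^sup>2 / (1 + y)" if "0 \<le> y" for y :: real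
        proof -
          have "1 + y \<noteq> 0" using that by linarith
          then show ?thesis by (simp add: divide_simps) (simp add: algebra_simps power2_eq_square)
        qed
        then show ?thesis using x0 by blast
      qed
      finally have e: "(\<integral>v. indicator {v. 0 < v \<and> a n * v < ?L \<omega>} v *\<^sub>R w v \<partial>lborel) = ?x\<^sup>2 / (1 + ?x)" .
      have "min x (x\<^sup>2) \<le> 2 * (x\<^sup>2 / (1 + x))" if "0 \<le> x" for x :: real
      proof -
        have "min x (x\<^sup>2) * (1 + x) \<le> 2 * x\<^sup>2"
        proof (cases "x \<le> 1")
          case True
          have "min x (x\<^sup>2) * (1 + x) \<le> x\<^sup>2 * 2" using True that by (intro mult_mono) auto
          then show ?thesis by simp
        next
          case False
          have "min x (x\<^sup>2) * (1 + x) \<le> x * (2 * x)" using False that by (intro mult_mono) auto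
          then show ?thesis by (simp add: power2_eq_square)
        qed
        then show ?thesis using that by (simp add: field_simps)
      qed
      then show ?thesis using x0 e by simp
    qed
    have i: "integrable M (\<lambda>\<omega>. \<integral>v. indicator {v. 0 < v \<and> a n * v < ?L \<omega>} v *\<^sub>R w v \<partial>lborel)"
      using lc(2) by simp
    have "expectation (\<lambda>\<omega>. min (?L \<omega> / a n) ((?L \<omega> / a n)\<^sup>2)) \<le>
       expectation (\<lambda>\<omega>. 2 * (\<integral>v. indicator {v. 0 < v \<and> a n * v < ?L \<omega>} v *\<^sub>R w v \<partial>lborel))"
    proof (rule integral_mono)
      show "integrable M (\<lambda>\<omega>. min (?L \<omega> / a n) ((?L \<omega> / a n)\<^sup>2))"
      proof (rule Bochner_Integration.integrable_bound)
        show "integrable M (\<lambda>\<omega>. ?L \<omega> / a n)" using len_int by simp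
      qed (use an in auto)
    qed (use i ge in auto)
    also have "\<dots> = 2 * (\<integral>v. indicator {0<..} v * (prob {\<omega>\<in>space M. a n * v < ?L \<omega>} * w v) \<partial>lborel)"
      using lc(1) by (simp add: prob_space)
    also have "\<dots> \<le> 2 * (\<integral>v. indicator {0<..} v * (2 * C / real n * (min 1 v * tail_env v)) \<partial>lborel)"
    proof (intro mult_left_mono integral_mono_AE')
      show "AE v in lborel. indicator {0<..} v * (prob {\<omega>\<in>space M. a n * v < ?L \<omega>} * w v)
         \<le> indicator {0<..} v * (2 * C / real n * (min 1 v * tail_env v))"
        using Wb w by (intro AE_I2) (auto simp: indicator_def prob_space)
      show "AE v in lborel. 0 \<le> indicator {0<..} v * (2 * C / real n * (min 1 v * tail_env v))"
        using C(1) by (intro AE_I2) (auto simp: indicator_def tail_env_def)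
    qed (use Wi in auto)
    also have "(\<integral>v. indicator {0<..} v * (2 * C / real n * (min 1 v * tail_env v)) \<partial>lborel) = 2 * C / real n * I0"
      unfolding I0_def integral_mult_right_zero[symmetric] by (intro Bochner_Integration.integral_cong) (auto simp: mult_ac)
    also have "2 * (2 * C / real n * I0) \<le> \<kappa> / real n" using an by (simp add: \<kappa>_def field_simps)
    finally show ?thesis .
  qed
  have "0 < \<kappa>" using C(1) I00 by (simp add: \<kappa>_def add_nonneg_pos)
  then show ?thesis by (rule that) (rule *)
qed

text \<open>Formally the derivative in \<open>v\<close> of the expectation of
  \<open>cis (u * \<xi> * v) - 1 - \<i> * u * \<xi> * v\<close>: the kernel against which the tail
  of the length is integrated.\<close>

definition mark_kernel :: "real \<Rightarrow> real \<Rightarrow> complex" where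
  "mark_kernel u v = expectation (\<lambda>\<omega>. \<i> * of_real (u * \<xi> 1 \<omega>) * (cis (u * \<xi> 1 \<omega> * v) - 1))"

definition phi :: "nat \<Rightarrow> real \<Rightarrow> complex" where
  "phi n u = expectation (\<lambda>\<omega>. cis (u * (\<xi> 1 \<omega> * real (len 1 \<omega>) / a n)))"

text \<open>Collects the mark moments that arise when the kernel is bounded by a multiple of
  \<open>min 1 v\<close>: the second moment for \<open>v \<le> 1\<close>, the first absolute moment
  beyond.\<close>

definition growth :: "real \<Rightarrow> real" where
  "growth u = 2 * \<bar>u\<bar> * expectation (\<lambda>\<omega>. \<bar>\<xi> 1 \<omega>\<bar>) + u\<^sup>2 * expectation (\<lambda>\<omega>. (\<xi> 1 \<omega>)\<^sup>2)"

lemma growth_mono: "\<bar>u\<bar> \<le> B \<Longrightarrow> growth u \<le> growth B" "0 \<le> growth u"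
proof -
  have e: "0 \<le> expectation (\<lambda>\<omega>. \<bar>\<xi> 1 \<omega>\<bar>)" "0 \<le> expectation (\<lambda>\<omega>. (\<xi> 1 \<omega>)\<^sup>2)" by simp_all
  then show "0 \<le> growth u" by (simp add: growth_def)
  assume u: "\<bar>u\<bar> \<le> B"
  then have "u\<^sup>2 \<le> B\<^sup>2" using abs_le_square_iff[of u B] by simp
  with u e show "growth u \<le> growth B" unfolding growth_def by (intro add_mono mult_right_mono) auto
qed

lemma mark_kernel_term:
  "norm (\<i> * of_real y * (cis (y * v) - 1)) \<le> 2 * \<bar>y\<bar>"
  "0 < v \<Longrightarrow> norm (\<i> * of_real y * (cis (y * v) - 1)) \<le> (2 * \<bar>y\<bar> + y\<^sup>2) * min 1 v"
proof -
  have n: "norm (cis (y * v) - 1) \<le> min 2 \<bar>y * v\<bar>" using cis_diff_le[of "y * v" 0] by simp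
  have "norm (\<i> * of_real y * (cis (y * v) - 1)) = \<bar>y\<bar> * norm (cis (y * v) - 1)" by (simp add: norm_mult)
  also have "\<dots> \<le> \<bar>y\<bar> * min 2 \<bar>y * v\<bar>" using n by (rule mult_left_mono) simp
  finally have m: "norm (\<i> * of_real y * (cis (y * v) - 1)) \<le> \<bar>y\<bar> * min 2 \<bar>y * v\<bar>" .
  also have "\<dots> \<le> \<bar>y\<bar> * 2" by (rule mult_left_mono) auto
  finally show "norm (\<i> * of_real y * (cis (y * v) - 1)) \<le> 2 * \<bar>y\<bar>" by simp
  assume v: "0 < v"
  have "\<bar>y\<bar> * min 2 \<bar>y * v\<bar> \<le> (2 * \<bar>y\<bar> + y\<^sup>2) * min 1 v"
  proof (cases "v \<le> 1")
    case True
    have "\<bar>y\<bar> * min 2 \<bar>y * v\<bar> \<le> \<bar>y\<bar> * \<bar>y * v\<bar>" by (rule mult_left_mono) auto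
    also have "\<dots> = y\<^sup>2 * v" using v by (simp add: abs_mult power2_eq_square)
    also have "\<dots> \<le> (2 * \<bar>y\<bar> + y\<^sup>2) * min 1 v" using True v by (auto intro: mult_right_mono)
    finally show ?thesis .
  next
    case False
    have "\<bar>y\<bar> * min 2 \<bar>y * v\<bar> \<le> \<bar>y\<bar> * 2" by (rule mult_left_mono) auto
    also have "\<dots> \<le> (2 * \<bar>y\<bar> + y\<^sup>2) * min 1 v" using False by simp
    finally show ?thesis .
  qed
  with m show "norm (\<i> * of_real y * (cis (y * v) - 1)) \<le> (2 * \<bar>y\<bar> + y\<^sup>2) * min 1 v" by linarith
qed

lemma mark_kernel_int: "integrable M (\<lambda>\<omega>. \<i> * of_real (u * \<xi> 1 \<omega>) * (cis (u * \<xi> 1 \<omega> * v) - 1))"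
proof (rule Bochner_Integration.integrable_bound)
  show "integrable M (\<lambda>\<omega>. 2 * (\<bar>u\<bar> * \<bar>\<xi> 1 \<omega>\<bar>))" using \<xi>_int by simp
  show "AE \<omega> in M. norm (\<i> * of_real (u * \<xi> 1 \<omega>) * (cis (u * \<xi> 1 \<omega> * v) - 1)) \<le> norm (2 * (\<bar>u\<bar> * \<bar>\<xi> 1 \<omega>\<bar>))"
  proof (rule AE_I2)
    fix \<omega>
    show "norm (\<i> * of_real (u * \<xi> 1 \<omega>) * (cis (u * \<xi> 1 \<omega> * v) - 1)) \<le> norm (2 * (\<bar>u\<bar> * \<bar>\<xi> 1 \<omega>\<bar>))"
      by (rule order_trans[OF mark_kernel_term(1)]) (simp add: abs_mult)
  qed
qed measurable

lemma mark_kernel_norm: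
  assumes v: "0 < v"
  shows "expectation (\<lambda>\<omega>. norm (\<i> * of_real (u * \<xi> 1 \<omega>) * (cis (u * \<xi> 1 \<omega> * v) - 1))) \<le> growth u * min 1 v"
proof -
  have "expectation (\<lambda>\<omega>. norm (\<i> * of_real (u * \<xi> 1 \<omega>) * (cis (u * \<xi> 1 \<omega> * v) - 1)))
     \<le> expectation (\<lambda>\<omega>. (2 * (\<bar>u\<bar> * \<bar>\<xi> 1 \<omega>\<bar>) + u\<^sup>2 * (\<xi> 1 \<omega>)\<^sup>2) * min 1 v)"
  proof (rule integral_mono)
    show "integrable M (\<lambda>\<omega>. norm (\<i> * of_real (u * \<xi> 1 \<omega>) * (cis (u * \<xi> 1 \<omega> * v) - 1)))"
      using mark_kernel_int by (rule integrable_norm)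
    show "integrable M (\<lambda>\<omega>. (2 * (\<bar>u\<bar> * \<bar>\<xi> 1 \<omega>\<bar>) + u\<^sup>2 * (\<xi> 1 \<omega>)\<^sup>2) * min 1 v)"
      using \<xi>_int \<xi>_sq by auto
    show "norm (\<i> * of_real (u * \<xi> 1 \<omega>) * (cis (u * \<xi> 1 \<omega> * v) - 1)) \<le> (2 * (\<bar>u\<bar> * \<bar>\<xi> 1 \<omega>\<bar>) + u\<^sup>2 * (\<xi> 1 \<omega>)\<^sup>2) * min 1 v" for \<omega>
      by (rule order_trans[OF mark_kernel_term(2)[OF v]]) (simp add: abs_mult power_mult_distrib)
  qed
  also have "\<dots> = growth u * min 1 v"
    using \<xi>_int \<xi>_sq by (simp add: growth_def)
  finally show ?thesis .
qed

lemma mark_kernel_bound: "0 < v \<Longrightarrow> norm (mark_kernel u v) \<le> growth u * min 1 v"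
  unfolding mark_kernel_def by (rule order_trans[OF integral_norm_bound mark_kernel_norm])

lemma mark_kernel_measurable [measurable]: "mark_kernel u \<in> borel_measurable borel"
proof -
  have "(\<lambda>(v, \<omega>). \<i> * of_real (u * \<xi> 1 \<omega>) * (cis (u * \<xi> 1 \<omega> * v) - 1)) \<in> borel_measurable (borel \<Otimes>\<^sub>M M)"
    by measurable
  then show ?thesis unfolding mark_kernel_def by (rule borel_measurable_lebesgue_integral)
qed

text \<open>Continuity in \<open>u\<close> along sequences, because the weight seen by a block
  varies with \<open>n\<close> in the Riemann sums.\<close>

lemma mark_kernel_tendsto:
  assumes "u \<longlonglongrightarrow> u0" shows "(\<lambda>n. mark_kernel (u n) v) \<longlonglongrightarrow> mark_kernel u0 v"
proof -
  obtain B where B: "\<And>n. \<bar>u n\<bar> \<le> B"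
    using convergent_imp_Bseq[OF convergentI[OF assms]] by (auto simp: Bseq_def)
  show ?thesis unfolding mark_kernel_def
  proof (rule integral_dominated_convergence)
    show "integrable M (\<lambda>\<omega>. 2 * (B * \<bar>\<xi> 1 \<omega>\<bar>))" using \<xi>_int by simp
    show "AE \<omega> in M. (\<lambda>n. \<i> * of_real (u n * \<xi> 1 \<omega>) * (cis (u n * \<xi> 1 \<omega> * v) - 1))
       \<longlonglongrightarrow> \<i> * of_real (u0 * \<xi> 1 \<omega>) * (cis (u0 * \<xi> 1 \<omega> * v) - 1)"
      using assms by (intro AE_I2 tendsto_intros)
    show "AE \<omega> in M. norm (\<i> * of_real (u n * \<xi> 1 \<omega>) * (cis (u n * \<xi> 1 \<omega> * v) - 1)) \<le> 2 * (B * \<bar>\<xi> 1 \<omega>\<bar>)" for n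
    proof (rule AE_I2)
      fix \<omega>
      show "norm (\<i> * of_real (u n * \<xi> 1 \<omega>) * (cis (u n * \<xi> 1 \<omega> * v) - 1)) \<le> 2 * (B * \<bar>\<xi> 1 \<omega>\<bar>)"
        by (rule order_trans[OF mark_kernel_term(1)]) (use B[of n] in \<open>auto simp: abs_mult intro: mult_right_mono\<close>)
    qed
  qed measurable
qed

end

lemma has_vector_derivative_cis_scaled:
  "((\<lambda>v. cis (y * v) - \<i> * of_real (y * v)) has_vector_derivative \<i> * of_real y * (cis (y * v) - 1)) (at v within S)"
  unfolding has_vector_derivative_complex_iff by (auto intro!: derivative_eq_intros simp: algebra_simps)

context stable_array
begin

text \<open>Mark and length are independent and the mark is centred, so the linear term has mean
  zero and may be subtracted at no cost. The layer-cake formula with the kernel then gives an exact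
  identity, in which \<open>n\<close> occurs on the right only through the scaled tail.\<close>

lemma phi_expansion:
  assumes C: "0 < C" "\<And>v. 0 < v \<Longrightarrow> real n * G (a n * v) \<le> C * tail_env v" and an: "0 < a n" "1 \<le> n"
  shows "of_nat n * (phi n u - 1) = (\<integral>v. indicator {0<..} v *\<^sub>R (of_real (real n * G (a n * v)) * mark_kernel u v) \<partial>lborel)"
proof -
  let ?L = "\<lambda>\<omega>. real (len 1 \<omega>)"
  define h where "h v x = \<i> * of_real (u * x) * (cis (u * x * v) - 1)" for v x :: real
  have hm: "case_prod h \<in> borel_measurable (borel \<Otimes>\<^sub>M borel)"
    unfolding h_def by measurable
  have Wi: "integrable lborel (\<lambda>v. indicator {0<..} v * (C / real n * growth u * (min 1 v * tail_env v)))"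
    using integrable_mult_right[OF tail_env_integrable, of "C / real n * growth u"] by (simp add: mult_ac)
  have hi: "integrable M (\<lambda>\<omega>. h v (\<xi> 1 \<omega>))" for v using mark_kernel_int[of u v] by (simp add: h_def)
  have Wb: "prob {\<omega>\<in>space M. a n * v < ?L \<omega>} * expectation (\<lambda>\<omega>. norm (h v (\<xi> 1 \<omega>))) \<le> C / real n * growth u * (min 1 v * tail_env v)"
    if v: "0 < v" for v
  proof -
    have "prob {\<omega>\<in>space M. a n * v < ?L \<omega>} = G (a n * v)" using an v by (intro tail(2)) auto
    also have "\<dots> \<le> C * tail_env v / real n" using C(2)[OF v] an by (simp add: field_simps)
    finally have "prob {\<omega>\<in>space M. a n * v < ?L \<omega>} * expectation (\<lambda>\<omega>. norm (h v (\<xi> 1 \<omega>))) \<le> (C * tail_env v / real n) * (growth u * min 1 v)"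
      using mark_kernel_norm[OF v, of u] C(1) by (intro mult_mono) (auto simp: h_def tail_env_def)
    then show ?thesis by (simp add: mult_ac)
  qed
  note lc = layer_cake_indep[OF len1_meas \<xi>1_meas ind_\<xi>_len hm hi Wb Wi]
  have inner: "(\<integral>v. indicator {v. 0 < v \<and> a n * v < ?L \<omega>} v *\<^sub>R h v (\<xi> 1 \<omega>) \<partial>lborel) =
      cis (u * (\<xi> 1 \<omega> * ?L \<omega> / a n)) - 1 - \<i> * of_real (u / a n * (\<xi> 1 \<omega> * ?L \<omega>))" for \<omega>
  proof -
    have "(\<integral>v. indicator {v. 0 < v \<and> a n * v < ?L \<omega>} v *\<^sub>R h v (\<xi> 1 \<omega>) \<partial>lborel) =
       (cis (u * \<xi> 1 \<omega> * (?L \<omega> / a n)) - \<i> * of_real (u * \<xi> 1 \<omega> * (?L \<omega> / a n))) - (cis (u * \<xi> 1 \<omega> * 0) - \<i> * of_real (u * \<xi> 1 \<omega> * 0))"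
      unfolding h_def
      by (rule indicator_integral_FTC[OF an(1) _ has_vector_derivative_cis_scaled]) (auto intro!: continuous_intros)
    then show ?thesis by (simp add: mult_ac)
  qed
  have ic: "integrable M (\<lambda>\<omega>. cis (u * (\<xi> 1 \<omega> * ?L \<omega> / a n)))"
    by (intro integrable_const_bound[where B=1]) auto
  have ixl: "integrable M (\<lambda>\<omega>. \<xi> 1 \<omega> * ?L \<omega>)" "expectation (\<lambda>\<omega>. \<xi> 1 \<omega> * ?L \<omega>) = 0"
    using indep_var_integrable[OF ind_\<xi>_len \<xi>_int len_int] indep_var_lebesgue_integral[OF ind_\<xi>_len \<xi>_int len_int] \<xi>_mean by auto
  have iR: "integrable M (\<lambda>\<omega>. \<i> * complex_of_real (u / a n * (\<xi> 1 \<omega> * ?L \<omega>)))"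
    "expectation (\<lambda>\<omega>. \<i> * complex_of_real (u / a n * (\<xi> 1 \<omega> * ?L \<omega>))) = 0"
  proof -
    have i: "integrable M (\<lambda>\<omega>. complex_of_real (u / a n * (\<xi> 1 \<omega> * ?L \<omega>)))"
      by (intro integrable_of_real integrable_mult_right ixl)
    then show "integrable M (\<lambda>\<omega>. \<i> * complex_of_real (u / a n * (\<xi> 1 \<omega> * ?L \<omega>)))" by (rule integrable_mult_right)
    have "expectation (\<lambda>\<omega>. complex_of_real (u / a n * (\<xi> 1 \<omega> * ?L \<omega>))) = of_real (u / a n * expectation (\<lambda>\<omega>. \<xi> 1 \<omega> * ?L \<omega>))"
      by (simp only: integral_complex_of_real integral_mult_right_zero)
    then show "expectation (\<lambda>\<omega>. \<i> * complex_of_real (u / a n * (\<xi> 1 \<omega> * ?L \<omega>))) = 0"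
      using ixl(2) by (simp only: integral_mult_right_zero) simp
  qed
  have "phi n u - 1 = expectation (\<lambda>\<omega>. cis (u * (\<xi> 1 \<omega> * ?L \<omega> / a n)) - 1 - \<i> * of_real (u / a n * (\<xi> 1 \<omega> * ?L \<omega>)))"
    using ic iR by (simp only: Bochner_Integration.integral_diff Bochner_Integration.integrable_diff integrable_const)
      (simp add: phi_def prob_space)
  also have "\<dots> = (\<integral>v. indicator {0<..} v *\<^sub>R (of_real (prob {\<omega>\<in>space M. a n * v < ?L \<omega>}) * expectation (\<lambda>\<omega>. h v (\<xi> 1 \<omega>))) \<partial>lborel)"
    using lc(1) unfolding inner .
  also have "\<dots> = (\<integral>v. indicator {0<..} v *\<^sub>R (of_real (G (a n * v)) * mark_kernel u v) \<partial>lborel)"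
    using an tail(2) by (intro Bochner_Integration.integral_cong) (auto simp: indicator_def h_def mark_kernel_def)
  finally have "of_nat n * (phi n u - 1) = of_nat n * (\<integral>v. indicator {0<..} v *\<^sub>R (of_real (G (a n * v)) * mark_kernel u v) \<partial>lborel)"
    by simp
  also have "\<dots> = (\<integral>v. indicator {0<..} v *\<^sub>R (of_real (real n * G (a n * v)) * mark_kernel u v) \<partial>lborel)"
    unfolding integral_mult_right_zero[symmetric] by (intro Bochner_Integration.integral_cong) (auto simp: indicator_def)
  finally show ?thesis .
qed

definition qlim :: "real \<Rightarrow> complex" where
  "qlim u = (\<integral>v. indicator {0<..} v *\<^sub>R (of_real (v powr (- \<alpha>)) * mark_kernel u v) \<partial>lborel)"

lemma G_measurable [measurable]: "G \<in> borel_measurable borel"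
proof -
  have "(\<lambda>x. - G x) \<in> borel_measurable borel"
    using reg_tailD(1)[OF tail(1)] by (intro borel_measurable_mono) (auto simp: mono_def)
  then show ?thesis by simp
qed

text \<open>The scaled tail converges to \<open>v powr (- \<alpha>)\<close> under a fixed envelope,
  so dominated convergence applies in the expansion. The argument may vary with \<open>n\<close>, as
  does the weight of the block \<open>k\<close> with \<open>k / n\<close> near a given time.\<close>

lemma phi_limit:
  assumes u: "u \<longlonglongrightarrow> u0"
  shows "(\<lambda>n. of_nat n * (phi n (u n) - 1)) \<longlonglongrightarrow> qlim u0"
proof -
  obtain C N where C: "0 < C" "\<And>n v. N \<le> n \<Longrightarrow> 0 < v \<Longrightarrow> real n * G (a n * v) \<le> C * tail_env v"
    "\<And>n. N \<le> n \<Longrightarrow> 0 < a n \<and> 1 \<le> n"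
    by (rule tail_bound) (rule that, assumption+)
  obtain B where B: "\<And>n. \<bar>u n\<bar> \<le> B"
    using convergent_imp_Bseq[OF convergentI[OF u]] by (auto simp: Bseq_def)
  have "(\<lambda>n. of_nat (n + N) * (phi (n + N) (u (n + N)) - 1)) =
     (\<lambda>n. \<integral>v. indicator {0<..} v *\<^sub>R (of_real (real (n + N) * G (a (n + N) * v)) * mark_kernel (u (n + N)) v) \<partial>lborel)"
    by (intro ext phi_expansion[OF C(1) C(2)]) (use C(3) in auto)
  also have "\<dots> \<longlonglongrightarrow> qlim u0"
    unfolding qlim_def
  proof (rule integral_dominated_convergence)
    show "integrable lborel (\<lambda>v. C * growth B * (indicator {0<..} v * (min 1 v * tail_env v)))"
      by (intro integrable_mult_right tail_env_integrable)
    show "AE v in lborel. (\<lambda>n. indicator {0<..} v *\<^sub>R (of_real (real (n + N) * G (a (n + N) * v)) * mark_kernel (u (n + N)) v))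
       \<longlonglongrightarrow> indicator {0<..} v *\<^sub>R (of_real (v powr (- \<alpha>)) * mark_kernel u0 v)"
    proof (rule AE_I2)
      fix v :: real
      show "(\<lambda>n. indicator {0<..} v *\<^sub>R (of_real (real (n + N) * G (a (n + N) * v)) * mark_kernel (u (n + N)) v))
        \<longlonglongrightarrow> indicator {0<..} v *\<^sub>R (of_real (v powr (- \<alpha>)) * mark_kernel u0 v)"
      proof (cases "0 < v")
        case True
        have "(\<lambda>n. real (n + N) * G (a (n + N) * v)) \<longlonglongrightarrow> v powr (- \<alpha>)"
          by (rule LIMSEQ_ignore_initial_segment[OF scaled_tail_limit[OF tail(1) a_top scaled_tail_1 True]])
        moreover have "(\<lambda>n. mark_kernel (u (n + N)) v) \<longlonglongrightarrow> mark_kernel u0 v"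
          by (rule mark_kernel_tendsto[OF LIMSEQ_ignore_initial_segment[OF u]])
        ultimately show ?thesis by (intro tendsto_intros)
      qed simp
    qed
    show "AE v in lborel. norm (indicator {0<..} v *\<^sub>R (of_real (real (n + N) * G (a (n + N) * v)) * mark_kernel (u (n + N)) v))
      \<le> C * growth B * (indicator {0<..} v * (min 1 v * tail_env v))" for n
    proof (rule AE_I2)
      fix v :: real
      show "norm (indicator {0<..} v *\<^sub>R (of_real (real (n + N) * G (a (n + N) * v)) * mark_kernel (u (n + N)) v))
        \<le> C * growth B * (indicator {0<..} v * (min 1 v * tail_env v))"
      proof (cases "0 < v")
        case True
        have "norm (mark_kernel (u (n + N)) v) \<le> growth (u (n + N)) * min 1 v" by (rule mark_kernel_bound[OF True])
        also have "\<dots> \<le> growth B * min 1 v" using growth_mono(1)[OF B] True by (intro mult_right_mono) auto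
        finally have kb: "norm (mark_kernel (u (n + N)) v) \<le> growth B * min 1 v" .
        have "(real (n + N) * G (a (n + N) * v)) * norm (mark_kernel (u (n + N)) v) \<le> (C * tail_env v) * (growth B * min 1 v)"
        proof (rule mult_mono)
          show "real (n + N) * G (a (n + N) * v) \<le> C * tail_env v" using True by (intro C(2)) auto
        qed (use C(1) kb in \<open>auto simp: tail_env_def\<close>)
        moreover have "norm (indicator {0<..} v *\<^sub>R (of_real (real (n + N) * G (a (n + N) * v)) * mark_kernel (u (n + N)) v)) =
            real (n + N) * G (a (n + N) * v) * norm (mark_kernel (u (n + N)) v)"
          using True reg_tailD(2)[OF tail(1), of "a (n + N) * v"]
          by (simp only: norm_scaleR norm_mult norm_of_real) (simp add: abs_mult)
        ultimately show ?thesis using True by (simp add: mult_ac)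
      qed simp
    qed
  qed measurable
  finally show ?thesis by (rule LIMSEQ_offset)
qed

text \<open>Uniformity over bounded arguments has two uses: it dominates the Riemann sums of
  \<open>n * (phi n - 1)\<close>, and it makes the squared deviations of all factors sum to order
  \<open>1 / n\<close>.\<close>

lemma phi_bound:
  obtains K N where "0 < K" "\<And>n u. N \<le> n \<Longrightarrow> \<bar>u\<bar> \<le> B \<Longrightarrow> 1 \<le> n \<and> norm (phi n u - 1) \<le> K / real n"
proof -
  obtain C N where C: "0 < C" "\<And>n v. N \<le> n \<Longrightarrow> 0 < v \<Longrightarrow> real n * G (a n * v) \<le> C * tail_env v"
    "\<And>n. N \<le> n \<Longrightarrow> 0 < a n \<and> 1 \<le> n"
    by (rule tail_bound) (rule that, assumption+)
  define I0 where "I0 = (\<integral>v. indicator {0<..} v * (min 1 v * tail_env v) \<partial>lborel)"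
  have I00: "0 \<le> I0" unfolding I0_def by (intro integral_nonneg_AE) (auto simp: tail_env_def indicator_def)
  define K where "K = C * growth B * I0 + 1"
  have K0: "0 < K" using C I00 growth_mono(2)[of B] by (simp add: K_def add_nonneg_pos)
  have "1 \<le> n \<and> norm (phi n u - 1) \<le> K / real n" if n: "N \<le> n" and u: "\<bar>u\<bar> \<le> B" for n u
  proof -
    have n1: "0 < a n" "1 \<le> n" using C(3)[OF n] by auto
    have e: "of_nat n * (phi n u - 1) = (\<integral>v. indicator {0<..} v *\<^sub>R (of_real (real n * G (a n * v)) * mark_kernel u v) \<partial>lborel)"
      by (rule phi_expansion[OF C(1) C(2)[OF n] n1])
    have "norm (of_nat n * (phi n u - 1)) \<le> (\<integral>v. norm (indicator {0<..} v *\<^sub>R (of_real (real n * G (a n * v)) * mark_kernel u v)) \<partial>lborel)"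
      unfolding e by (rule integral_norm_bound)
    also have "\<dots> \<le> (\<integral>v. C * growth B * (indicator {0<..} v * (min 1 v * tail_env v)) \<partial>lborel)"
    proof (rule integral_mono_AE')
      show "integrable lborel (\<lambda>v. C * growth B * (indicator {0<..} v * (min 1 v * tail_env v)))"
        by (intro integrable_mult_right tail_env_integrable)
      show "AE v in lborel. norm (indicator {0<..} v *\<^sub>R (of_real (real n * G (a n * v)) * mark_kernel u v))
        \<le> C * growth B * (indicator {0<..} v * (min 1 v * tail_env v))"
      proof (rule AE_I2)
        fix v :: real
        show "norm (indicator {0<..} v *\<^sub>R (of_real (real n * G (a n * v)) * mark_kernel u v))
          \<le> C * growth B * (indicator {0<..} v * (min 1 v * tail_env v))"
        proof (cases "0 < v")
          case True
          have "norm (mark_kernel u v) \<le> growth u * min 1 v" by (rule mark_kernel_bound[OF True])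
          also have "\<dots> \<le> growth B * min 1 v" using growth_mono(1)[OF u] True by (intro mult_right_mono) auto
          finally have kb: "norm (mark_kernel u v) \<le> growth B * min 1 v" .
          have "(real n * G (a n * v)) * norm (mark_kernel u v) \<le> (C * tail_env v) * (growth B * min 1 v)"
            by (rule mult_mono[OF C(2)[OF n True]]) (use C(1) kb in \<open>auto simp: tail_env_def\<close>)
          then show ?thesis using True reg_tailD(2)[OF tail(1), of "a n * v"]
            by (simp add: norm_mult mult_ac abs_mult)
        qed simp
      qed
    qed (use C(1) growth_mono(2)[of B] in \<open>auto simp: indicator_def tail_env_def\<close>)
    also have "\<dots> \<le> K" by (simp add: K_def I0_def)
    finally have "real n * norm (phi n u - 1) \<le> K" by (simp add: norm_mult)
    then show ?thesis using n1 by (simp add: field_simps)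
  qed
  then show ?thesis using K0 by (intro that[of K N]) auto
qed

text \<open>Fubini brings the mark outside: for a fixed mark the integral over \<open>v\<close> is
  the stable exponent at \<open>u * \<xi>\<close>, in which the power and the sign factorise.
  Averaging \<open>sgn \<xi>\<close> times the \<alpha>-th absolute power gives the difference of
  the moments of positive and negative part, hence the skewness.\<close>

lemma qlim_eq:
  "qlim u = - (of_real (\<bar>u\<bar> powr \<alpha> * (expectation (\<lambda>\<omega>. \<bar>\<xi> 1 \<omega>\<bar> powr \<alpha>) * Gamma (1 - \<alpha>) * cos (pi * \<alpha> / 2)))
     * (1 - \<i> * of_real (((expectation (\<lambda>\<omega>. max (\<xi> 1 \<omega>) 0 powr \<alpha>) - expectation (\<lambda>\<omega>. max (- \<xi> 1 \<omega>) 0 powr \<alpha>)) /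
         expectation (\<lambda>\<omega>. \<bar>\<xi> 1 \<omega>\<bar> powr \<alpha>)) * sgn u * tan (pi * \<alpha> / 2))))"
proof -
  interpret P: pair_sigma_finite lborel M ..
  define f where "f v \<omega> = indicator {0<..} v *\<^sub>R (of_real (v powr (- \<alpha>)) * (\<i> * of_real (u * \<xi> 1 \<omega>) * (cis (u * \<xi> 1 \<omega> * v) - 1)))" for v :: real and \<omega>
  have fm[measurable]: "case_prod f \<in> borel_measurable (lborel \<Otimes>\<^sub>M M)"
    unfolding f_def by measurable
  have fI: "integrable (lborel \<Otimes>\<^sub>M M) (case_prod f)"
  proof (rule P.Fubini_integrable[OF fm])
    show "integrable lborel (\<lambda>v. \<integral>\<omega>. norm (case (v, \<omega>) of (v, \<omega>) \<Rightarrow> f v \<omega>) \<partial>M)"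
    proof (rule Bochner_Integration.integrable_bound)
      show "integrable lborel (\<lambda>v. growth u * (indicator {0<..} v * (min 1 v * v powr (- \<alpha>))))"
        using \<alpha> by (intro integrable_mult_right integrable_min_one_powr)
      show "AE v in lborel. norm (\<integral>\<omega>. norm (case (v, \<omega>) of (v, \<omega>) \<Rightarrow> f v \<omega>) \<partial>M) \<le> norm (growth u * (indicator {0<..} v * (min 1 v * v powr (- \<alpha>))))"
      proof (rule AE_I2)
        fix v :: real
        show "norm (\<integral>\<omega>. norm (case (v, \<omega>) of (v, \<omega>) \<Rightarrow> f v \<omega>) \<partial>M) \<le> norm (growth u * (indicator {0<..} v * (min 1 v * v powr (- \<alpha>))))"
        proof (cases "0 < v")
          case True
          have "(\<integral>\<omega>. norm (f v \<omega>) \<partial>M) = v powr (- \<alpha>) * (\<integral>\<omega>. norm (\<i> * of_real (u * \<xi> 1 \<omega>) * (cis (u * \<xi> 1 \<omega> * v) - 1)) \<partial>M)"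
            using True by (simp add: f_def norm_mult)
          also have "\<dots> \<le> v powr (- \<alpha>) * (growth u * min 1 v)"
            by (intro mult_left_mono mark_kernel_norm[OF True]) auto
          finally show ?thesis using True growth_mono(2)[of u] by (simp add: mult_ac abs_mult)
        qed (simp add: f_def)
      qed
      have "(\<lambda>(v, \<omega>). norm (f v \<omega>)) \<in> borel_measurable (lborel \<Otimes>\<^sub>M M)"
        using measurable_compose[OF fm borel_measurable_norm] by (simp add: case_prod_beta')
      then show "(\<lambda>v. \<integral>\<omega>. norm (case (v, \<omega>) of (v, \<omega>) \<Rightarrow> f v \<omega>) \<partial>M) \<in> borel_measurable lborel"
        by (simp add: borel_measurable_lebesgue_integral)
    qed
    have "integrable M (\<lambda>\<omega>. f v \<omega>)" for v
      unfolding f_def by (intro integrable_scaleR_right integrable_mult_right mark_kernel_int)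
    then show "AE v in lborel. integrable M (\<lambda>\<omega>. case (v, \<omega>) of (v, \<omega>) \<Rightarrow> f v \<omega>)"
      by simp
  qed
  let ?c = "Gamma (1 - \<alpha>) * cos (pi * \<alpha> / 2)" and ?t = "tan (pi * \<alpha> / 2)"
  let ?A = "\<lambda>\<omega>. \<bar>\<xi> 1 \<omega>\<bar> powr \<alpha>" and ?P = "\<lambda>\<omega>. max (\<xi> 1 \<omega>) 0 powr \<alpha>" and ?N = "\<lambda>\<omega>. max (- \<xi> 1 \<omega>) 0 powr \<alpha>"
  have mom: "integrable M ?A"
  proof (rule Bochner_Integration.integrable_bound)
    show "integrable M (\<lambda>\<omega>. 1 + (\<xi> 1 \<omega>)\<^sup>2)" using \<xi>_sq by simp
    show "AE \<omega> in M. norm (\<bar>\<xi> 1 \<omega>\<bar> powr \<alpha>) \<le> norm (1 + (\<xi> 1 \<omega>)\<^sup>2)"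
    proof (rule AE_I2)
      fix \<omega>
      have "x powr \<alpha> \<le> 1 + x\<^sup>2" if "0 \<le> x" for x :: real
      proof (cases "x \<le> 1")
        case True
        have "x powr \<alpha> \<le> 1 powr \<alpha>" using True that \<alpha> by (intro powr_mono2) auto
        then show ?thesis by (simp add: add_increasing2)
      next
        case False
        have "x powr \<alpha> \<le> x powr 2" using False \<alpha> by (intro powr_mono) auto
        then show ?thesis using False by simp
      qed
      from this[of "\<bar>\<xi> 1 \<omega>\<bar>"] show "norm (\<bar>\<xi> 1 \<omega>\<bar> powr \<alpha>) \<le> norm (1 + (\<xi> 1 \<omega>)\<^sup>2)" by simp
    qed
  qed measurable
  have momP: "integrable M ?P" "integrable M ?N"
  proof -
    have "norm (max x 0 powr \<alpha>) \<le> norm (\<bar>x\<bar> powr \<alpha>)" for x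
      using \<alpha> powr_mono2[of \<alpha> "max x 0" "\<bar>x\<bar>"] by simp
    from this[of "\<xi> 1 _"] this[of "- \<xi> 1 _"] show "integrable M ?P" "integrable M ?N"
      by (auto intro!: Bochner_Integration.integrable_bound[OF mom])
  qed
  have diff: "?P \<omega> - ?N \<omega> = sgn (\<xi> 1 \<omega>) * ?A \<omega>" for \<omega>
    using \<alpha> by (auto simp: sgn_if max_def)
  have isg: "integrable M (\<lambda>\<omega>. sgn (\<xi> 1 \<omega>) * ?A \<omega>)"
    using momP unfolding diff[symmetric] by (rule Bochner_Integration.integrable_diff)
  have esg: "expectation (\<lambda>\<omega>. sgn (\<xi> 1 \<omega>) * ?A \<omega>) = expectation ?P - expectation ?N"
    using momP unfolding diff[symmetric] by (rule Bochner_Integration.integral_diff)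
  have inner: "(\<integral>v. f v \<omega> \<partial>lborel) = - of_real (\<bar>u\<bar> powr \<alpha> * ?c) * of_real (?A \<omega>)
      + \<i> * of_real (\<bar>u\<bar> powr \<alpha> * ?c * sgn u * ?t) * of_real (sgn (\<xi> 1 \<omega>) * ?A \<omega>)" for \<omega>
  proof -
    let ?y = "u * \<xi> 1 \<omega>"
    have "f v \<omega> = \<i> * of_real ?y * (indicator {0<..} v *\<^sub>R ((exp (- (- \<i> * of_real ?y) * of_real v) - 1) * of_real (v powr (- \<alpha>))))" for v
      by (auto simp: f_def indicator_def cis_conv_exp mult_ac)
    then have "(\<integral>v. f v \<omega> \<partial>lborel) = \<i> * of_real ?y * exp_transform \<alpha> (- \<i> * of_real ?y)"
      unfolding exp_transform_def by (simp only: integral_mult_right_zero)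
    also have "\<dots> = - (of_real (\<bar>?y\<bar> powr \<alpha> * ?c) * (1 - \<i> * of_real (sgn ?y * ?t)))"
      by (rule stable_exponent[OF \<alpha>])
    also have "\<dots> = - of_real (\<bar>u\<bar> powr \<alpha> * ?c) * of_real (?A \<omega>)
      + \<i> * of_real (\<bar>u\<bar> powr \<alpha> * ?c * sgn u * ?t) * of_real (sgn (\<xi> 1 \<omega>) * ?A \<omega>)"
      by (simp add: abs_mult powr_mult sgn_mult algebra_simps)
    finally show ?thesis .
  qed
  have "qlim u = (\<integral>v. (\<integral>\<omega>. f v \<omega> \<partial>M) \<partial>lborel)"
    unfolding qlim_def f_def mark_kernel_def by simp
  also have "\<dots> = (\<integral>\<omega>. (\<integral>v. f v \<omega> \<partial>lborel) \<partial>M)"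
    by (rule P.Fubini_integral[OF fI, symmetric])
  also have "\<dots> = - of_real (\<bar>u\<bar> powr \<alpha> * ?c) * of_real (expectation ?A)
      + \<i> * of_real (\<bar>u\<bar> powr \<alpha> * ?c * sgn u * ?t) * of_real (expectation ?P - expectation ?N)"
    unfolding inner esg[symmetric] using integrable_of_real[OF mom, where 'a=complex] integrable_of_real[OF isg, where 'a=complex]
    by (subst Bochner_Integration.integral_add)
       (auto simp only: integral_mult_right_zero integral_complex_of_real intro!: integrable_mult_right)
  also have "of_real (expectation ?P - expectation ?N) =
     complex_of_real (expectation ?A) * of_real ((expectation ?P - expectation ?N) / expectation ?A)"
  \<comment> \<open>If the \<alpha>-moment vanishes, the mark is almost surely 0 and both sides are
    0, in agreement with the value 0 of a division by zero.\<close>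
  proof (cases "expectation ?A = 0")
    case True
    have "AE \<omega> in M. ?A \<omega> = 0" using True integral_nonneg_eq_0_iff_AE[OF mom] by auto
    then have "AE \<omega> in M. sgn (\<xi> 1 \<omega>) * ?A \<omega> = 0" by eventually_elim auto
    then have "expectation (\<lambda>\<omega>. sgn (\<xi> 1 \<omega>) * ?A \<omega>) = expectation (\<lambda>\<omega>. 0)" by (intro integral_cong_AE) auto
    then show ?thesis using esg True by simp
  qed simp
  finally show ?thesis by (simp add: algebra_simps)
qed

end

section \<open>Riemann sums and products over a triangular array\<close>

text \<open>The Riemann sum is the integral of a step function whose value at \<open>s\<close> is
  that of \<open>f n\<close> at the right end of the cell containing \<open>s\<close>. Convergence
  of \<open>f n\<close> along every sequence tending to \<open>s\<close> gives pointwise convergence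
  of the step functions, and domination does the rest. The exceptional point \<open>e\<close>
  accommodates the jump of the cutoff.\<close>

lemma riemann_limit:
  fixes f :: "nat \<Rightarrow> real \<Rightarrow> complex"
  assumes bd: "\<And>n s. N \<le> n \<Longrightarrow> norm (f n s) \<le> K"
    and conv: "\<And>s u. 0 < s \<Longrightarrow> s < 1 \<Longrightarrow> s \<noteq> e \<Longrightarrow> u \<longlonglongrightarrow> s \<Longrightarrow> (\<lambda>n. f n (u n)) \<longlonglongrightarrow> F s"
    and [measurable]: "F \<in> borel_measurable borel"
  shows "(\<lambda>n. (1 / real n) *\<^sub>R (\<Sum>k\<in>{1..n}. f n (real k / real n))) \<longlonglongrightarrow> (\<integral>s. indicator {0<..<1} s *\<^sub>R F s \<partial>lborel)"
proof -
  define I where "I n k = {(real k - 1) / real n<..real k / real n}" for n k :: nat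
  define T where "T n s = (\<Sum>k\<in>{1..n}. indicator (I n k) s *\<^sub>R f n (real k / real n))" for n s
  have [measurable]: "T n \<in> borel_measurable borel" for n
    unfolding T_def I_def by measurable
  have T_int: "(\<integral>s. T n s \<partial>lborel) = (1 / real n) *\<^sub>R (\<Sum>k\<in>{1..n}. f n (real k / real n))" for n
  proof -
    have e: "integrable lborel (\<lambda>s. indicator (I n k) s *\<^sub>R f n (real k / real n)) \<and>
       (\<integral>s. indicator (I n k) s *\<^sub>R f n (real k / real n) \<partial>lborel) = (1 / real n) *\<^sub>R f n (real k / real n)"
      if k: "k \<in> {1..n}" for k
    proof -
      have le: "(real k - 1) / real n \<le> real k / real n" by (simp add: divide_right_mono)
      have i: "integrable lborel (indicator (I n k) :: real \<Rightarrow> real)"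
        unfolding I_def using le by (intro integrable_real_indicator) auto
      have "measure lborel (I n k) = 1 / real n" unfolding I_def using le by (simp add: diff_divide_distrib)
      then show ?thesis using i by simp
    qed
    show ?thesis unfolding T_def using e by (subst Bochner_Integration.integral_sum) (auto simp: scaleR_sum_right)
  qed
  have T_val: "T n s = (if 0 < s \<and> s \<le> 1 then f n (real_of_int \<lceil>real n * s\<rceil> / real n) else 0)" if n: "1 \<le> n" for n s
  proof -
    have mem: "s \<in> I n k \<longleftrightarrow> int k = \<lceil>real n * s\<rceil>" for k
    proof -
      have "s \<in> I n k \<longleftrightarrow> real k - 1 < real n * s \<and> real n * s \<le> real k"
        using n by (simp add: I_def divide_less_eq pos_le_divide_eq mult.commute)
      also have "\<dots> \<longleftrightarrow> \<lceil>real n * s\<rceil> = int k" by (simp add: ceiling_eq_iff)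
      finally show ?thesis by auto
    qed
    show ?thesis
    proof (cases "0 < s \<and> s \<le> 1")
      case True
      define c where "c = nat \<lceil>real n * s\<rceil>"
      have "0 < real n * s" "real n * s \<le> real n" using True n by auto
      then have c: "int c = \<lceil>real n * s\<rceil>" "c \<in> {1..n}"
        unfolding c_def by (auto simp: le_nat_iff nat_le_iff ceiling_le_iff)
      have "T n s = (\<Sum>k\<in>{1..n}. if k = c then f n (real c / real n) else 0)"
        unfolding T_def by (intro sum.cong refl) (use mem c in \<open>auto simp: indicator_def\<close>)
      also have "\<dots> = f n (real c / real n)" using c by (simp add: sum.delta)
      also have "real c = real_of_int \<lceil>real n * s\<rceil>" using c(1) by (metis of_int_of_nat_eq)
      finally show ?thesis using True by simp
    next
      case False
      have "s \<notin> I n k" if "k \<in> {1..n}" for k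
      proof
        assume "s \<in> I n k"
        then have "(real k - 1) / real n < s" "s \<le> real k / real n" by (auto simp: I_def)
        moreover have "0 \<le> (real k - 1) / real n" "real k / real n \<le> 1" using that n by auto
        ultimately show False using False by linarith
      qed
      then show ?thesis using False by (auto simp: T_def)
    qed
  qed
  \<comment> \<open>The shift by \<open>max 1 N\<close> makes both the bound and the formula for the
    step function valid at every index.\<close>
  have "(\<lambda>n. \<integral>s. T (n + max 1 N) s \<partial>lborel) \<longlonglongrightarrow> (\<integral>s. indicator {0<..<1} s *\<^sub>R F s \<partial>lborel)"
  proof (rule integral_dominated_convergence)
    show "integrable lborel (\<lambda>s::real. K * indicator {0<..1} s)"
      by (intro integrable_mult_right integrable_real_indicator) auto
    have "AE s in lborel. s \<noteq> e \<and> s \<noteq> 1" using AE_lborel_singleton[of e] AE_lborel_singleton[of 1] by eventually_elim auto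
    then show "AE s in lborel. (\<lambda>n. T (n + max 1 N) s) \<longlonglongrightarrow> indicator {0<..<1} s *\<^sub>R F s"
    proof eventually_elim
      case (elim s)
      show ?case
      proof (cases "0 < s \<and> s < 1")
        case True
        let ?u = "\<lambda>n. real_of_int \<lceil>real n * s\<rceil> / real n"
        have "?u \<longlonglongrightarrow> s"
        proof (rule Lim_transform_bound[THEN Lim_null[THEN iffD2]])
          show "(\<lambda>n. 1 / real n) \<longlonglongrightarrow> 0" by (rule lim_const_over_n)
          show "\<forall>\<^sub>F n in sequentially. norm (?u n - s) \<le> norm (1 / real n)"
            using eventually_ge_at_top[of 1]
          proof eventually_elim
            case (elim n)
            then have "?u n - s = (real_of_int \<lceil>real n * s\<rceil> - real n * s) / real n" by (simp add: field_simps)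
            moreover have "\<bar>real_of_int \<lceil>real n * s\<rceil> - real n * s\<bar> \<le> 1" by linarith
            ultimately show ?case by (simp add: divide_right_mono)
          qed
        qed
        then have "(\<lambda>n. f n (?u n)) \<longlonglongrightarrow> F s" using True elim by (intro conv) auto
        then have "(\<lambda>n. f (n + max 1 N) (?u (n + max 1 N))) \<longlonglongrightarrow> F s" by (rule LIMSEQ_ignore_initial_segment)
        then show ?thesis using True by (simp add: T_val)
      next
        case False
        then show ?thesis using elim by (auto simp: T_val)
      qed
    qed
    show "AE s in lborel. norm (T (n + max 1 N) s) \<le> K * indicator {0<..1} s" for n
      using bd by (intro AE_I2) (auto simp: T_val)
  qed measurable
  then have "(\<lambda>n. \<integral>s. T n s \<partial>lborel) \<longlonglongrightarrow> (\<integral>s. indicator {0<..<1} s *\<^sub>R F s \<partial>lborel)"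
    by (rule LIMSEQ_offset)
  then show ?thesis unfolding T_int .
qed

text \<open>Both \<open>z k\<close> and \<open>exp (z k - 1)\<close> lie in the unit disc, so the
  difference of the products is at most the sum of the differences, each quadratic in
  \<open>z k - 1\<close> by Taylor. The factor \<open>exp 2\<close> comes from
  \<open>\<bar>Re (z k - 1)\<bar> \<le> 2\<close>.\<close>

lemma prod_near_exp:
  fixes z :: "nat \<Rightarrow> complex"
  assumes "\<And>k. k \<in> J \<Longrightarrow> norm (z k) \<le> 1"
  shows "norm ((\<Prod>k\<in>J. z k) - exp (\<Sum>k\<in>J. z k - 1)) \<le> (\<Sum>k\<in>J. exp 2 * (norm (z k - 1))\<^sup>2)"
proof (cases "finite J")
  case True
  have "norm ((\<Prod>k\<in>J. z k) - (\<Prod>k\<in>J. exp (z k - 1))) \<le> (\<Sum>k\<in>J. norm (z k - exp (z k - 1)))"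
  proof (rule norm_prod_diff)
    fix k assume k: "k \<in> J"
    show "norm (z k) \<le> 1" by (rule assms[OF k])
    show "norm (exp (z k - 1)) \<le> 1" using assms[OF k] complex_Re_le_cmod[of "z k"] by simp
  qed
  also have "\<dots> \<le> (\<Sum>k\<in>J. exp 2 * (norm (z k - 1))\<^sup>2)"
  proof (rule sum_mono)
    fix k assume k: "k \<in> J"
    have "norm (exp (z k - 1) - (\<Sum>i\<le>1. (z k - 1) ^ i / fact i)) \<le> exp \<bar>Re (z k - 1)\<bar> * norm (z k - 1) ^ Suc 1 / fact 1"
      by (rule Taylor_exp)
    moreover have "\<bar>Re (z k - 1)\<bar> \<le> 2"
      using assms[OF k] abs_Re_le_cmod[of "z k"] by simp
    ultimately have "norm (exp (z k - 1) - z k) \<le> exp \<bar>Re (z k - 1)\<bar> * (norm (z k - 1))\<^sup>2" "exp \<bar>Re (z k - 1)\<bar> \<le> exp 2"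
      by (simp_all add: numeral_2_eq_2)
    then have "norm (exp (z k - 1) - z k) \<le> exp 2 * (norm (z k - 1))\<^sup>2"
      by (meson mult_right_mono order_trans zero_le_power2)
    then show "norm (z k - exp (z k - 1)) \<le> exp 2 * (norm (z k - 1))\<^sup>2" by (simp add: norm_minus_commute)
  qed
  finally show ?thesis using True by (simp add: exp_sum)
qed simp

lemma (in prob_space) integrable_cis: "random_variable borel f \<Longrightarrow> integrable M (\<lambda>\<omega>. cis (f \<omega>))"
  by (intro integrable_const_bound[where B=1]) auto

lemma card_le_interval:
  fixes S :: "nat set"
  assumes "\<And>k. k \<in> S \<Longrightarrow> x \<le> real k \<and> real k \<le> x + l" "finite S" "0 \<le> l"
  shows "real (card S) \<le> l + 1"
proof (cases "S = {}")
  case False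
  have "S \<subseteq> {Min S..Max S}" using assms(2) by auto
  then have "card S \<le> card {Min S..Max S}" by (intro card_mono) auto
  also have "\<dots> = Suc (Max S) - Min S" by simp
  finally have "real (card S) \<le> real (Max S) + 1 - real (Min S)"
    using Min_le[OF assms(2) Max_in[OF assms(2) False]] by (simp add: of_nat_diff)
  then show ?thesis using assms(1)[OF Max_in[OF assms(2) False]] assms(1)[OF Min_in[OF assms(2) False]] by linarith
qed (use assms in simp)

context stable_array
begin

lemma len_transfer:
  fixes f :: "real \<Rightarrow> real"
  assumes k: "1 \<le> k" and [measurable]: "f \<in> borel_measurable borel"
  shows "expectation (\<lambda>\<omega>. f (real (len k \<omega>))) = expectation (\<lambda>\<omega>. f (real (len 1 \<omega>)))"
    "integrable M (\<lambda>\<omega>. f (real (len k \<omega>))) \<longleftrightarrow> integrable M (\<lambda>\<omega>. f (real (len 1 \<omega>)))"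
  using arg_cong[OF len_distr[OF k], of "\<lambda>N. integral\<^sup>L N f"] arg_cong[OF len_distr[OF k], of "\<lambda>N. integrable N f"]
    real_len_meas[OF k] len1_meas
  by (simp_all add: integral_distr integrable_distr_eq)

lemma \<xi>_transfer:
  fixes f :: "real \<Rightarrow> real"
  assumes k: "1 \<le> k" and [measurable]: "f \<in> borel_measurable borel"
  shows "expectation (\<lambda>\<omega>. f (\<xi> k \<omega>)) = expectation (\<lambda>\<omega>. f (\<xi> 1 \<omega>))"
    "integrable M (\<lambda>\<omega>. f (\<xi> k \<omega>)) \<longleftrightarrow> integrable M (\<lambda>\<omega>. f (\<xi> 1 \<omega>))"
  using arg_cong[OF \<xi>_distr[OF k], of "\<lambda>N. integral\<^sup>L N f"] arg_cong[OF \<xi>_distr[OF k], of "\<lambda>N. integrable N f"]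
    \<xi>_meas[OF k] \<xi>1_meas
  by (simp_all add: integral_distr integrable_distr_eq)

text \<open>Independence of mark and length makes their joint law the product of the marginals, and
  these do not depend on \<open>k\<close>.\<close>

lemma phi_any:
  assumes k: "1 \<le> k"
  shows "expectation (\<lambda>\<omega>. cis (c * (\<xi> k \<omega> * real (len k \<omega>)) / a n)) = phi n c"
proof -
  have ik: "indep_var borel (\<xi> k) borel (\<lambda>\<omega>. real (len k \<omega>))"
    using ind_block[OF k, of "\<lambda>l p. real l"] by simp
  have "distr M (borel \<Otimes>\<^sub>M borel) (\<lambda>\<omega>. (\<xi> k \<omega>, real (len k \<omega>))) = distr M (borel \<Otimes>\<^sub>M borel) (\<lambda>\<omega>. (\<xi> 1 \<omega>, real (len 1 \<omega>)))"
    using ik ind_\<xi>_len \<xi>_distr[OF k] len_distr[OF k] unfolding indep_var_distribution_eq by metis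
  then have "integral\<^sup>L (distr M (borel \<Otimes>\<^sub>M borel) (\<lambda>\<omega>. (\<xi> k \<omega>, real (len k \<omega>)))) (\<lambda>(x, l). cis (c * (x * l) / a n))
     = integral\<^sup>L (distr M (borel \<Otimes>\<^sub>M borel) (\<lambda>\<omega>. (\<xi> 1 \<omega>, real (len 1 \<omega>)))) (\<lambda>(x, l). cis (c * (x * l) / a n))"
    by simp
  moreover have "(\<lambda>(x, l). cis (c * (x * l) / a n)) \<in> borel_measurable (borel \<Otimes>\<^sub>M borel)" by measurable
  moreover have "(\<lambda>\<omega>. (\<xi> k \<omega>, real (len k \<omega>))) \<in> M \<rightarrow>\<^sub>M borel \<Otimes>\<^sub>M borel" using \<xi>_meas[OF k] real_len_meas[OF k] by measurable
  moreover have "(\<lambda>\<omega>. (\<xi> 1 \<omega>, real (len 1 \<omega>))) \<in> M \<rightarrow>\<^sub>M borel \<Otimes>\<^sub>M borel" by measurable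
  ultimately show ?thesis by (simp add: integral_distr phi_def)
qed

lemma cf_marks:
  "expectation (\<lambda>\<omega>. cis (\<Sum>k\<in>{1..m}. \<xi> k \<omega> * (real (len k \<omega>) * c k / a n))) = (\<Prod>k\<in>{1..m}. phi n (c k))"
proof -
  define X where "X k \<omega> = c k * (\<xi> k \<omega> * real (len k \<omega>)) / a n" for k \<omega>
  have iv: "indep_vars (\<lambda>_. borel) X {1..m}"
    unfolding X_def
    by (rule indep_vars_compose2[OF indep_vars_subset[OF ind_marks], where Y="\<lambda>k x. c k * x / a n"]) auto
  then have [measurable]: "random_variable borel (X k)" if "k \<in> {1..m}" for k
    using that by (auto simp: indep_vars_def)
  have "char (distr M borel (\<lambda>\<omega>. \<Sum>k\<in>{1..m}. X k \<omega>)) 1 = (\<Prod>k\<in>{1..m}. char (distr M borel (X k)) 1)"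
    by (rule char_distr_sum[OF iv])
  also have "char (distr M borel (\<lambda>\<omega>. \<Sum>k\<in>{1..m}. X k \<omega>)) 1 = expectation (\<lambda>\<omega>. cis (\<Sum>k\<in>{1..m}. X k \<omega>))"
    unfolding char_def cis_conv_exp by (subst integral_distr) auto
  also have "(\<Prod>k\<in>{1..m}. char (distr M borel (X k)) 1) = (\<Prod>k\<in>{1..m}. phi n (c k))"
  proof (rule prod.cong[OF refl])
    fix k assume k: "k \<in> {1..m}"
    then have "char (distr M borel (X k)) 1 = expectation (\<lambda>\<omega>. cis (X k \<omega>))"
      unfolding char_def cis_conv_exp by (subst integral_distr) auto
    also have "\<dots> = phi n (c k)" unfolding X_def using k by (intro phi_any) auto
    finally show "char (distr M borel (X k)) 1 = phi n (c k)" .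
  qed
  finally show ?thesis by (simp add: X_def mult_ac)
qed

lemma phi_norm: "norm (phi n u) \<le> 1"
proof -
  have "norm (phi n u) \<le> expectation (\<lambda>\<omega>. norm (cis (u * (\<xi> 1 \<omega> * real (len 1 \<omega>) / a n))))"
    unfolding phi_def by (rule integral_norm_bound)
  then show ?thesis by (simp add: prob_space)
qed

lemma phi_0 [simp]: "phi n 0 = 1"
  by (simp add: phi_def prob_space)

lemma qlim_measurable [measurable]: "qlim \<in> borel_measurable borel"
proof -
  have "(\<lambda>u. qlim u) \<in> borel_measurable borel" unfolding qlim_eq by measurable
  then show ?thesis by simp
qed

text \<open>The characteristic function factorises over the blocks; replacing each factor by the
  exponential of its deviation from 1 leaves a Riemann sum of \<open>n * (phi n - 1)\<close>. With
  \<open>\<mu> * k / n\<close> as rescaled time of block \<open>k\<close>, the cutoff retains the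
  indices up to \<open>n / \<mu>\<close>, which the change of variables turns into the factor
  \<open>1 / \<mu>\<close>.\<close>

lemma frozen_limit:
  assumes g: "\<And>x. \<bar>g x\<bar> \<le> B" "continuous_on UNIV g"
  shows "(\<lambda>n. expectation (\<lambda>\<omega>. cis (\<Sum>k\<in>{1..n+1}. \<xi> k \<omega> * (real (len k \<omega>) * cutoff g (real k * \<mu> / real n) / a n))))
    \<longlonglongrightarrow> exp ((1 / \<mu>) *\<^sub>R (\<integral>s. indicator {0<..<1} s *\<^sub>R qlim (g s) \<partial>lborel))"
proof -
  have gm[measurable]: "g \<in> borel_measurable borel" using g(2) by (rule borel_measurable_continuous_onI)
  have B0: "0 \<le> B" using g(1)[of 0] by linarith
  have cB: "\<bar>cutoff g x\<bar> \<le> B" for x using g(1)[of x] B0 by (simp add: cutoff_def)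
  obtain K N where K: "0 < K" "\<And>n u. N \<le> n \<Longrightarrow> \<bar>u\<bar> \<le> B \<Longrightarrow> 1 \<le> n \<and> norm (phi n u - 1) \<le> K / real n"
    by (rule phi_bound[of B]) (rule that, assumption+)
  define z where "z n k = phi n (cutoff g (real k * \<mu> / real n))" for n k
  \<comment> \<open>Block \<open>n + 1\<close> is beyond the cutoff because
    \<open>1 \<le> \<mu>\<close>; so the sum over \<open>n + 1\<close> blocks is a Riemann sum with
    \<open>n\<close> points.\<close>
  have last: "z n (n + 1) = 1" if "1 \<le> n" for n
  proof -
    have "real n < real (n + 1) * 1" by simp
    also have "\<dots> \<le> real (n + 1) * \<mu>" using \<mu> by (intro mult_left_mono) auto
    finally have "\<not> real (n + 1) * \<mu> / real n \<le> 1" using that by (simp add: field_simps)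
    then show ?thesis by (simp add: z_def cutoff_def)
  qed
  define F where "F s = qlim (cutoff g (s * \<mu>))" for s
  define f where "f n s = of_nat n * (phi n (cutoff g (s * \<mu>)) - 1)" for n s
  have [measurable]: "F \<in> borel_measurable borel" unfolding F_def cutoff_def by measurable
  have lim: "(\<lambda>n. (1 / real n) *\<^sub>R (\<Sum>k\<in>{1..n}. f n (real k / real n))) \<longlonglongrightarrow> (\<integral>s. indicator {0<..<1} s *\<^sub>R F s \<partial>lborel)"
  proof (rule riemann_limit[where N=N and K=K and e="1 / \<mu>"])
    fix n s assume n: "N \<le> n"
    have "norm (f n s) = real n * norm (phi n (cutoff g (s * \<mu>)) - 1)"
      by (simp only: f_def norm_mult norm_of_nat)
    also have "\<dots> \<le> K"
      using conjunct1[OF K(2)[OF n cB]] conjunct2[OF K(2)[OF n cB], of "s * \<mu>"] by (simp add: field_simps)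
    finally show "norm (f n s) \<le> K" .
  next
    fix s u assume s: "0 < s" "s < 1" "s \<noteq> 1 / \<mu>" "u \<longlonglongrightarrow> s"
    have um: "(\<lambda>n. u n * \<mu>) \<longlonglongrightarrow> s * \<mu>" by (intro tendsto_intros s)
    have "s * \<mu> \<noteq> 1" using s \<mu> by (auto simp: field_simps)
    have "(\<lambda>n. cutoff g (u n * \<mu>)) \<longlonglongrightarrow> cutoff g (s * \<mu>)"
    proof (cases "s * \<mu> < 1")
      case True
      then have "\<forall>\<^sub>F n in sequentially. u n * \<mu> < 1" using um by (intro order_tendstoD)
      then have "\<forall>\<^sub>F n in sequentially. g (u n * \<mu>) = cutoff g (u n * \<mu>)" by eventually_elim (simp add: cutoff_def)
      moreover have "(\<lambda>n. g (u n * \<mu>)) \<longlonglongrightarrow> g (s * \<mu>)"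
        using um g(2) by (intro continuous_on_tendsto_compose[of UNIV g]) auto
      ultimately have "(\<lambda>n. cutoff g (u n * \<mu>)) \<longlonglongrightarrow> g (s * \<mu>)" by (rule Lim_transform_eventually[rotated])
      then show ?thesis using True by (simp add: cutoff_def)
    next
      case False
      then have "1 < s * \<mu>" using \<open>s * \<mu> \<noteq> 1\<close> by simp
      then have "\<forall>\<^sub>F n in sequentially. 1 < u n * \<mu>" using um by (intro order_tendstoD)
      then have "\<forall>\<^sub>F n in sequentially. cutoff g (u n * \<mu>) = 0" by eventually_elim (simp add: cutoff_def)
      then show ?thesis using \<open>1 < s * \<mu>\<close> by (simp add: cutoff_def tendsto_eventually)
    qed
    from phi_limit[OF this] show "(\<lambda>n. f n (u n)) \<longlonglongrightarrow> F s" unfolding f_def F_def .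
  qed measurable
  have sum_eq: "(1 / real n) *\<^sub>R (\<Sum>k\<in>{1..n}. f n (real k / real n)) = (\<Sum>k\<in>{1..n+1}. z n k - 1)" if "1 \<le> n" for n
  proof -
    have "(\<Sum>k\<in>{1..n+1}. z n k - 1) = (\<Sum>k\<in>{1..n}. z n k - 1)" using last[OF that] by simp
    also have "\<dots> = (1 / real n) *\<^sub>R (\<Sum>k\<in>{1..n}. f n (real k / real n))"
      unfolding scaleR_sum_right
      by (intro sum.cong refl) (use that in \<open>simp add: f_def z_def scaleR_conv_of_real\<close>)
    finally show ?thesis by simp
  qed
  \<comment> \<open>The substitution carries (0, 1) to \<open>(0, 1 / \<mu>)\<close>, contained in
    (0, 1) since \<open>1 \<le> \<mu>\<close>; on the remainder the cutoff is 0 and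
    \<open>qlim 0 = 0\<close>.\<close>
  have F_int: "(\<integral>s. indicator {0<..<1} s *\<^sub>R F s \<partial>lborel) = (1 / \<mu>) *\<^sub>R (\<integral>s. indicator {0<..<1} s *\<^sub>R qlim (g s) \<partial>lborel)"
  proof -
    have q0: "qlim 0 = 0" by (simp add: qlim_eq)
    have "(\<integral>s. indicator {0<..<1} s *\<^sub>R qlim (g s) \<partial>lborel) = \<bar>\<mu>\<bar> *\<^sub>R (\<integral>s. indicator {0<..<1} (0 + \<mu> * s) *\<^sub>R qlim (g (0 + \<mu> * s)) \<partial>lborel)"
      using \<mu> by (intro lborel_integral_real_affine) auto
    also have "(\<integral>s. indicator {0<..<1} (0 + \<mu> * s) *\<^sub>R qlim (g (0 + \<mu> * s)) \<partial>lborel) = (\<integral>s. indicator {0<..<1} s *\<^sub>R F s \<partial>lborel)"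
    proof (rule integral_cong_AE)
      have "AE s in lborel. s \<noteq> 1 / \<mu>" by (rule AE_lborel_singleton)
      then show "AE s in lborel. indicator {0<..<1} (0 + \<mu> * s) *\<^sub>R qlim (g (0 + \<mu> * s)) = indicator {0<..<1} s *\<^sub>R F s"
      proof eventually_elim
        case (elim s)
        have m: "0 < \<mu> * s \<longleftrightarrow> 0 < s" "\<mu> * s \<noteq> 1" using \<mu> elim by (auto simp: zero_less_mult_iff field_simps)
        have "s < 1" if "0 < s" "\<mu> * s < 1"
        proof -
          have "1 * s \<le> \<mu> * s" using \<mu> that by (intro mult_right_mono) auto
          then show ?thesis using that by linarith
        qed
        then show ?case using m q0 by (auto simp: indicator_def F_def cutoff_def mult.commute[of s])
      qed
    qed measurable
    finally show ?thesis using \<mu> by simp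
  qed
  have lim2: "(\<lambda>n. exp (\<Sum>k\<in>{1..n+1}. z n k - 1)) \<longlonglongrightarrow> exp ((1 / \<mu>) *\<^sub>R (\<integral>s. indicator {0<..<1} s *\<^sub>R qlim (g s) \<partial>lborel))"
  proof (rule tendsto_exp)
    have "\<forall>\<^sub>F n in sequentially. (1 / real n) *\<^sub>R (\<Sum>k\<in>{1..n}. f n (real k / real n)) = (\<Sum>k\<in>{1..n+1}. z n k - 1)"
      using eventually_ge_at_top[of 1] by eventually_elim (rule sum_eq)
    then show "(\<lambda>n. \<Sum>k\<in>{1..n+1}. z n k - 1) \<longlonglongrightarrow> (1 / \<mu>) *\<^sub>R (\<integral>s. indicator {0<..<1} s *\<^sub>R qlim (g s) \<partial>lborel)"
      using lim unfolding F_int by (rule Lim_transform_eventually[rotated])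
  qed
  have diff: "(\<lambda>n. (\<Prod>k\<in>{1..n+1}. z n k) - exp (\<Sum>k\<in>{1..n+1}. z n k - 1)) \<longlonglongrightarrow> 0"
  proof (rule Lim_null_comparison)
    show "\<forall>\<^sub>F n in sequentially. norm ((\<Prod>k\<in>{1..n+1}. z n k) - exp (\<Sum>k\<in>{1..n+1}. z n k - 1)) \<le> exp 2 * K\<^sup>2 * (2 / real n)"
      using eventually_ge_at_top[of N]
    proof eventually_elim
      case (elim n)
      have n: "1 \<le> n" using K(2)[OF elim cB] by auto
      have "norm ((\<Prod>k\<in>{1..n+1}. z n k) - exp (\<Sum>k\<in>{1..n+1}. z n k - 1)) \<le> (\<Sum>k\<in>{1..n+1}. exp 2 * (norm (z n k - 1))\<^sup>2)"
        by (rule prod_near_exp) (simp add: z_def phi_norm)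
      also have "\<dots> \<le> (\<Sum>k\<in>{1..n+1}. exp 2 * (K / real n)\<^sup>2)"
        using K(2)[OF elim cB] by (intro sum_mono mult_left_mono power_mono) (auto simp: z_def)
      also have "\<dots> = exp 2 * K\<^sup>2 * (real (n + 1) / (real n)\<^sup>2)" by (simp add: power_divide)
      also have "real (n + 1) / (real n)\<^sup>2 \<le> 2 / real n" using n by (simp add: power2_eq_square field_simps)
      finally show ?case by (simp add: mult_left_mono)
    qed
    have "(\<lambda>n. exp 2 * K\<^sup>2 * (2 / real n)) \<longlonglongrightarrow> exp 2 * K\<^sup>2 * 0"
      by (intro tendsto_mult_left lim_const_over_n)
    then show "(\<lambda>n. exp 2 * K\<^sup>2 * (2 / real n)) \<longlonglongrightarrow> 0" by simp
  qed
  from tendsto_add[OF diff lim2] show ?thesis unfolding cf_marks z_def by simp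
qed


section \<open>Replacing block sums by frozen weights\<close>

definition rescaled :: "nat \<Rightarrow> nat \<Rightarrow> real" where "rescaled n l = real l / a n"

lemma min_moment:
  obtains \<kappa> N where "0 < \<kappa>" "\<And>n k. N \<le> n \<Longrightarrow> 1 \<le> k \<Longrightarrow>
    expectation (\<lambda>\<omega>. min (rescaled n (len k \<omega>)) ((rescaled n (len k \<omega>))\<^sup>2)) \<le> \<kappa> / real n"
    "\<And>n. N \<le> n \<Longrightarrow> 0 < a n \<and> 1 \<le> n"
proof -
  obtain \<kappa> N1 where k: "0 < \<kappa>" "\<And>n. N1 \<le> n \<Longrightarrow>
    expectation (\<lambda>\<omega>. min (real (len 1 \<omega>) / a n) ((real (len 1 \<omega>) / a n)\<^sup>2)) \<le> \<kappa> / real n"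
    by (rule min_moment_bound) (rule that, assumption+)
  obtain C N2 where C: "0 < C" "\<And>n v. N2 \<le> n \<Longrightarrow> 0 < v \<Longrightarrow> real n * G (a n * v) \<le> C * tail_env v"
    "\<And>n. N2 \<le> n \<Longrightarrow> 0 < a n \<and> 1 \<le> n"
    by (rule tail_bound) (rule that, assumption+)
  show ?thesis
  proof (rule that[of \<kappa> "max N1 N2"])
    fix n k assume "max N1 N2 \<le> n" "1 \<le> (k::nat)"
    then show "expectation (\<lambda>\<omega>. min (rescaled n (len k \<omega>)) ((rescaled n (len k \<omega>))\<^sup>2)) \<le> \<kappa> / real n"
      unfolding rescaled_def using k(2)[of n] len_transfer(1)[of k "\<lambda>x. min (x / a n) ((x / a n)\<^sup>2)"] by simp
  qed (use k C in auto)
qed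

text \<open>Near the jump of the cutoff only the trivial estimate is available, with factor 1;
  elsewhere the squared error is small through the drift of the start and through the length
  relative to the sample. The drift appears multiplied by the length moment, and the expectations
  separate because a length is independent of its own starting point.\<close>

lemma block_term_bound:
  assumes g: "\<And>x. \<bar>g x\<bar> \<le> B" "\<And>x y. \<bar>g x - g y\<bar> \<le> K * \<bar>x - y\<bar>" and \<eta>: "0 < \<eta>" "\<eta> \<le> 1"
    and k: "1 \<le> k" and n: "1 \<le> n" "0 < a n" "a n / (real n * \<eta>) \<le> 1"
    and mom: "expectation (\<lambda>\<omega>. min (rescaled n (len k \<omega>)) ((rescaled n (len k \<omega>))\<^sup>2)) \<le> \<kappa> / real n" and \<kappa>: "0 < \<kappa>"
    and D: "1 \<le> D" "2 * B + K \<le> D"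
    and e1: "expectation (\<lambda>\<omega>. min 1 (\<bar>real_of_int (pos k \<omega>) - real k * \<mu>\<bar> / real n)) \<le> e1"
  shows "expectation (\<lambda>\<omega>. min 1 ((block_sum g n (len k \<omega>) (pos k \<omega>) / a n - real (len k \<omega>) * cutoff g (real k * \<mu> / real n) / a n)\<^sup>2))
     \<le> 2 * D\<^sup>2 * (\<kappa> / real n) * ((if \<bar>real k * \<mu> / real n - 1\<bar> < \<eta> then 1 else 0) + (e1 / \<eta> + sqrt (a n / (real n * \<eta>))))"
proof -
  let ?s = "real k * \<mu> / real n" and ?r = "a n / (real n * \<eta>)"
  define z where "z \<omega> = rescaled n (len k \<omega>)" for \<omega>
  define m where "m \<omega> = min (z \<omega>) ((z \<omega>)\<^sup>2)" for \<omega>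
  define b where "b \<omega> = (\<bar>real_of_int (pos k \<omega>) - real k * \<mu>\<bar> / real n) / \<eta>" for \<omega>
  define d where "d \<omega> = block_sum g n (len k \<omega>) (pos k \<omega>) / a n - real (len k \<omega>) * cutoff g ?s / a n" for \<omega>
  note [measurable] = len_meas[OF k] pos_meas[OF k]
  have [measurable]: "random_variable borel (\<lambda>\<omega>. f (len k \<omega>) (pos k \<omega>))" for f :: "nat \<Rightarrow> int \<Rightarrow> real"
    by (rule measurable_compose_countable[OF _ len_meas[OF k]], rule measurable_compose_countable[OF _ pos_meas[OF k]]) auto
  have zm[measurable]: "random_variable borel z" "random_variable borel b" "random_variable borel m" "random_variable borel d"
    unfolding z_def b_def m_def d_def rescaled_def by measurable
  have B0: "0 \<le> B" using g(1)[of 0] by linarith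
  have K0: "0 \<le> K" using order_trans[OF abs_ge_zero g(2)[of 0 1]] by simp
  have z0: "0 \<le> z \<omega>" for \<omega> using n by (simp add: z_def rescaled_def)
  have m0: "0 \<le> m \<omega>" for \<omega> using z0 by (simp add: m_def)
  have b0: "0 \<le> b \<omega>" for \<omega> using \<eta> by (simp add: b_def)
  have zi: "integrable M z"
    unfolding z_def rescaled_def using len_int len_transfer(2)[OF k, of "\<lambda>x. x"] by simp
  have mi: "integrable M m"
    by (rule Bochner_Integration.integrable_bound[OF zi]) (use z0 m0 in \<open>auto simp: m_def\<close>)
  have "m = (\<lambda>\<omega>. min (rescaled n (len k \<omega>)) ((rescaled n (len k \<omega>))\<^sup>2))"
    by (simp add: fun_eq_iff m_def z_def)
  then have mle: "expectation m \<le> \<kappa> / real n" using mom by simp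
  have nz: "real n * ?s = real k * \<mu>" using n by simp
  have dz: "\<bar>d \<omega>\<bar> = \<bar>block_sum g n (len k \<omega>) (pos k \<omega>) - real (len k \<omega>) * cutoff g ?s\<bar> / a n" for \<omega>
    using n by (simp add: d_def abs_divide flip: diff_divide_distrib)
  show ?thesis
  proof (cases "\<bar>?s - 1\<bar> < \<eta>")
    case True
    have pw: "min 1 ((d \<omega>)\<^sup>2) \<le> 2 * D\<^sup>2 * m \<omega>" for \<omega>
    proof -
      have "\<bar>d \<omega>\<bar> \<le> 2 * B * real (len k \<omega>) / a n"
        unfolding dz using block_sum_close(1)[OF g n(1) \<eta>] n by (intro divide_right_mono) auto
      also have "\<dots> = 2 * B * z \<omega>" by (simp add: z_def rescaled_def)
      \<comment> \<open>Taking \<open>b1 = 1\<close> and \<open>r = 0\<close> makes the splitting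
        lemma reproduce the trivial bound.\<close>
      also have "\<dots> \<le> D * (z \<omega> * min 1 (1 + 0 * z \<omega>))" using z0[of \<omega>] D K0 by (simp add: mult_right_mono)
      finally have "min 1 ((d \<omega>)\<^sup>2) \<le> 2 * D\<^sup>2 * (min 1 1 * min (z \<omega>) ((z \<omega>)\<^sup>2) + sqrt 0 * min (z \<omega>) ((z \<omega>)\<^sup>2))"
        by (intro min_one_square_split z0 D) auto
      then show ?thesis by (simp add: m_def)
    qed
    have "expectation (\<lambda>\<omega>. min 1 ((d \<omega>)\<^sup>2)) \<le> expectation (\<lambda>\<omega>. 2 * D\<^sup>2 * m \<omega>)"
    proof (rule integral_mono)
      show "integrable M (\<lambda>\<omega>. min 1 ((d \<omega>)\<^sup>2))" by (intro integrable_const_bound[where B=1]) auto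
    qed (use pw mi in auto)
    also have "\<dots> = 2 * D\<^sup>2 * expectation m" by simp
    also have "\<dots> \<le> 2 * D\<^sup>2 * (\<kappa> / real n)" using mle by (intro mult_left_mono) auto
    also have "\<dots> * 1 \<le> 2 * D\<^sup>2 * (\<kappa> / real n) * (1 + (e1 / \<eta> + sqrt ?r))"
    proof (rule mult_left_mono)
      have "0 \<le> expectation (\<lambda>\<omega>. min 1 (\<bar>real_of_int (pos k \<omega>) - real k * \<mu>\<bar> / real n))" by simp
      then have "0 \<le> e1" using e1 by linarith
      then show "1 \<le> 1 + (e1 / \<eta> + sqrt ?r)" using \<eta> n by simp
    qed (use \<kappa> in simp)
    finally show ?thesis using True by (simp add: d_def)
  next
    case False
    then have far: "\<eta> \<le> \<bar>?s - 1\<bar>" by simp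
    have pw: "min 1 ((d \<omega>)\<^sup>2) \<le> 2 * D\<^sup>2 * (min 1 (b \<omega>) * m \<omega> + sqrt ?r * m \<omega>)" for \<omega>
    proof -
      let ?q = "((\<bar>real_of_int (pos k \<omega>) - real n * ?s\<bar> + real (len k \<omega>)) / real n) / \<eta>"
      have q: "?q = b \<omega> + ?r * z \<omega>"
        using n \<eta> unfolding nz by (simp add: b_def z_def rescaled_def field_simps)
      have "\<bar>d \<omega>\<bar> \<le> (2 * B + K) * (real (len k \<omega>) * min 1 ?q) / a n"
        unfolding dz using block_sum_close(2)[OF g n(1) \<eta> far] n by (intro divide_right_mono) auto
      also have "\<dots> = (2 * B + K) * (z \<omega> * min 1 ?q)" by (simp add: z_def rescaled_def)
      also have "\<dots> \<le> D * (z \<omega> * min 1 ?q)"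
      proof (rule mult_right_mono[OF D(2)])
        have "0 \<le> ?q" unfolding q using b0[of \<omega>] z0[of \<omega>] n \<eta> by auto
        then show "0 \<le> z \<omega> * min 1 ?q" using z0[of \<omega>] by (intro mult_nonneg_nonneg) auto
      qed
      finally have "\<bar>d \<omega>\<bar> \<le> D * (z \<omega> * min 1 (b \<omega> + ?r * z \<omega>))" unfolding q .
      then show ?thesis unfolding m_def
        using n \<eta> by (intro min_one_square_split z0 b0 D) auto
    qed
    have ibm: "indep_var borel (\<lambda>\<omega>. m \<omega>) borel (\<lambda>\<omega>. min 1 (b \<omega>))"
      unfolding m_def z_def b_def
      by (rule ind_len_pos[OF k, where f="\<lambda>l. min (rescaled n l) ((rescaled n l)\<^sup>2)" and h="\<lambda>p. min 1 ((\<bar>real_of_int p - real k * \<mu>\<bar> / real n) / \<eta>)"])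
    have bi: "integrable M (\<lambda>\<omega>. min 1 (b \<omega>))"
      using b0 by (intro integrable_const_bound[where B=1]) auto
    have Eb: "expectation (\<lambda>\<omega>. min 1 (b \<omega>)) \<le> e1 / \<eta>"
    proof -
      have "expectation (\<lambda>\<omega>. min 1 (b \<omega>)) \<le> expectation (\<lambda>\<omega>. min 1 (\<bar>real_of_int (pos k \<omega>) - real k * \<mu>\<bar> / real n) / \<eta>)"
      proof (rule integral_mono[OF bi])
        show "integrable M (\<lambda>\<omega>. min 1 (\<bar>real_of_int (pos k \<omega>) - real k * \<mu>\<bar> / real n) / \<eta>)"
          by (intro integrable_divide integrable_const_bound[where B=1]) auto
        fix \<omega>
        show "min 1 (b \<omega>) \<le> min 1 (\<bar>real_of_int (pos k \<omega>) - real k * \<mu>\<bar> / real n) / \<eta>"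
        proof -
          \<comment> \<open>Since \<open>\<eta> \<le> 1\<close>, dividing after the truncation gives
            the larger value; this brings in the drift bound, which is stated without
            \<eta>.\<close>
          have "min 1 (x / \<eta>) \<le> min 1 x / \<eta>" for x
          proof (cases "x \<le> 1")
            case False
            have "min 1 (x / \<eta>) \<le> 1" by simp
            also have "\<dots> \<le> 1 / \<eta>" using \<eta> by simp
            finally show ?thesis using False by simp
          qed simp
          then show ?thesis unfolding b_def by blast
        qed
      qed
      also have "\<dots> \<le> e1 / \<eta>" using e1 \<eta> by (simp add: divide_right_mono)
      finally show ?thesis .
    qed
    have "expectation (\<lambda>\<omega>. min 1 ((d \<omega>)\<^sup>2)) \<le> expectation (\<lambda>\<omega>. 2 * D\<^sup>2 * (m \<omega> * min 1 (b \<omega>) + sqrt ?r * m \<omega>))"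
    proof (rule integral_mono)
      show "integrable M (\<lambda>\<omega>. min 1 ((d \<omega>)\<^sup>2))" by (intro integrable_const_bound[where B=1]) auto
      show "integrable M (\<lambda>\<omega>. 2 * D\<^sup>2 * (m \<omega> * min 1 (b \<omega>) + sqrt ?r * m \<omega>))"
        using indep_var_integrable[OF ibm mi bi] mi by auto
      show "min 1 ((d \<omega>)\<^sup>2) \<le> 2 * D\<^sup>2 * (m \<omega> * min 1 (b \<omega>) + sqrt ?r * m \<omega>)" for \<omega>
        using pw[of \<omega>] by (simp add: mult.commute[of "min 1 (b \<omega>)"])
    qed
    also have "\<dots> = 2 * D\<^sup>2 * (expectation m * expectation (\<lambda>\<omega>. min 1 (b \<omega>)) + sqrt ?r * expectation m)"
      using indep_var_integrable[OF ibm mi bi] indep_var_lebesgue_integral[OF ibm mi bi] mi by simp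
    also have "\<dots> \<le> 2 * D\<^sup>2 * (\<kappa> / real n * (e1 / \<eta>) + sqrt ?r * (\<kappa> / real n))"
      using mle Eb m0 b0 n \<eta> \<kappa> by (intro mult_left_mono add_mono mult_mono integral_nonneg_AE) auto
    also have "\<dots> = 2 * D\<^sup>2 * (\<kappa> / real n) * (0 + (e1 / \<eta> + sqrt ?r))"
    proof -
      have "y * (c * x + w * c) = y * c * (0 + (x + w))" for y c x w :: real by (simp add: algebra_simps)
      then show ?thesis by blast
    qed
    finally show ?thesis using False by (simp add: d_def)
  qed
qed

lemma block_total_small:
  assumes g: "\<And>x. \<bar>g x\<bar> \<le> B" "\<And>x y. \<bar>g x - g y\<bar> \<le> K * \<bar>x - y\<bar>" and e: "0 < e"
  shows "\<forall>\<^sub>F n in sequentially. (\<Sum>k\<in>{1..n+1}. expectation (\<lambda>\<omega>. min 1 ((block_sum g n (len k \<omega>) (pos k \<omega>) / a n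
      - real (len k \<omega>) * cutoff g (real k * \<mu> / real n) / a n)\<^sup>2))) \<le> e"
proof -
  obtain \<kappa> N where \<kappa>: "0 < \<kappa>" "\<And>n k. N \<le> n \<Longrightarrow> 1 \<le> k \<Longrightarrow>
    expectation (\<lambda>\<omega>. min (rescaled n (len k \<omega>)) ((rescaled n (len k \<omega>))\<^sup>2)) \<le> \<kappa> / real n"
    "\<And>n. N \<le> n \<Longrightarrow> 0 < a n \<and> 1 \<le> n"
    by (rule min_moment) (rule that, assumption+)
  define D where "D = max 1 (2 * B + K)"
  have D: "1 \<le> D" "2 * B + K \<le> D" by (auto simp: D_def)
  define H where "H = 2 * D\<^sup>2 * \<kappa>"
  have H0: "0 < H" using D \<kappa> by (simp add: H_def)
  \<comment> \<open>Budget: the window costs \<open>2 * H * \<eta> \<le> e / 4\<close> and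
    \<open>H / n \<le> e / 4\<close>; drift and relative length cost \<open>e / (8 * H)\<close> each
    on at most \<open>2 * n\<close> indices, together \<open>e / 2\<close>. As the drift is divided
    by \<eta>, it must be below \<open>\<eta> * (e / (8 * H))\<close>.\<close>
  define \<eta> where "\<eta> = min 1 (e / (8 * H))"
  have \<eta>: "0 < \<eta>" "\<eta> \<le> 1" "\<eta> \<le> e / (8 * H)" using e H0 by (auto simp: \<eta>_def)
  define e1 where "e1 = \<eta> * (e / (8 * H))"
  have e1: "0 < e1" using \<eta> e H0 by (simp add: e1_def)
  have an: "(\<lambda>n. a n / real n) \<longlonglongrightarrow> 0" by (rule scaled_tail_sublinear[OF tail(1) a_top scaled_tail_1 \<alpha>])
  have "(\<lambda>n. a n / real n / \<eta>) \<longlonglongrightarrow> 0 / \<eta>" using \<eta> by (intro tendsto_divide an) auto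
  then have r0: "(\<lambda>n. a n / (real n * \<eta>)) \<longlonglongrightarrow> 0" by simp
  have "(\<lambda>n. sqrt (a n / (real n * \<eta>))) \<longlonglongrightarrow> sqrt 0" by (rule tendsto_real_sqrt[OF r0])
  then have ev2: "\<forall>\<^sub>F n in sequentially. sqrt (a n / (real n * \<eta>)) < e / (8 * H)"
    using e H0 by (intro order_tendstoD) auto
  have ev1: "\<forall>\<^sub>F n in sequentially. a n / (real n * \<eta>) < 1" using r0 by (rule order_tendstoD) simp
  have ev3: "\<forall>\<^sub>F n in sequentially. H / real n < e / 4"
    using lim_const_over_n[of H] e by (intro order_tendstoD) auto
  show ?thesis
    using drift[OF e1] ev1 ev2 ev3 eventually_ge_at_top[of N]
  proof eventually_elim
    case (elim n)
    have n: "0 < a n" "1 \<le> n" using \<kappa>(3)[OF elim(5)] by auto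
    let ?w = "\<lambda>k. \<bar>real k * \<mu> / real n - 1\<bar> < \<eta>"
    let ?r = "a n / (real n * \<eta>)"
    have "(\<Sum>k\<in>{1..n+1}. expectation (\<lambda>\<omega>. min 1 ((block_sum g n (len k \<omega>) (pos k \<omega>) / a n
      - real (len k \<omega>) * cutoff g (real k * \<mu> / real n) / a n)\<^sup>2))) \<le>
      (\<Sum>k\<in>{1..n+1}. 2 * D\<^sup>2 * (\<kappa> / real n) * ((if ?w k then 1 else 0) + (e1 / \<eta> + sqrt ?r)))"
      using elim n by (intro sum_mono block_term_bound[OF g \<eta>(1,2) _ n(2,1) _ \<kappa>(2)[OF elim(5)] \<kappa>(1) D]) auto
    also have "\<dots> = H / real n * ((\<Sum>k\<in>{1..n+1}. if ?w k then 1 else 0) + real (n + 1) * (e1 / \<eta> + sqrt ?r))"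
    proof -
      have "(\<Sum>k\<in>{1..n+1}. c * (f k + d)) = c * ((\<Sum>k\<in>{1..n+1}. f k) + real (n + 1) * d)" for c d :: real and f
        by (simp only: sum_distrib_left[symmetric] sum.distrib sum_constant) simp
      then show ?thesis by (simp only: H_def times_divide_eq_right)
    qed
    also have "(\<Sum>k\<in>{1..n+1}. if ?w k then 1 else 0) = real (card {k\<in>{1..n+1}. ?w k})"
      by (simp only: sum.If_cases[OF finite_atLeastAtMost]) (simp add: Int_def)
    also have "H / real n * (real (card {k\<in>{1..n+1}. ?w k}) + real (n + 1) * (e1 / \<eta> + sqrt ?r))
       \<le> H / real n * ((2 * \<eta> * real n + 1) + real (n + 1) * (e / (8 * H) + e / (8 * H)))"
    proof (intro mult_left_mono add_mono)
      show "real (card {k\<in>{1..n+1}. ?w k}) \<le> 2 * \<eta> * real n + 1"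
      proof (rule card_le_interval[where x="real n * (1 - \<eta>) / \<mu>"])
        fix k assume "k \<in> {k\<in>{1..n+1}. ?w k}"
        then have "?w k" by simp
        then have "1 - \<eta> < real k * \<mu> / real n" "real k * \<mu> / real n < 1 + \<eta>" by (simp_all add: abs_less_iff)
        then have k: "real n * (1 - \<eta>) < real k * \<mu>" "real k * \<mu> < real n * (1 + \<eta>)" using n by (auto simp: field_simps)
        have \<mu>0: "0 < \<mu>" using \<mu> by simp
        show "real n * (1 - \<eta>) / \<mu> \<le> real k \<and> real k \<le> real n * (1 - \<eta>) / \<mu> + 2 * \<eta> * real n"
        proof
          show "real n * (1 - \<eta>) / \<mu> \<le> real k" using k(1) \<mu>0 by (simp add: pos_divide_le_eq)
          have "real k < real n * (1 + \<eta>) / \<mu>" using k(2) \<mu>0 by (simp add: pos_less_divide_eq)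
          also have "\<dots> = real n * (1 - \<eta>) / \<mu> + 2 * \<eta> * real n / \<mu>" by (simp add: add_divide_distrib[symmetric] algebra_simps)
          also have "2 * \<eta> * real n / \<mu> \<le> 2 * \<eta> * real n / 1" using \<mu> \<eta> by (intro divide_left_mono) auto
          finally show "real k \<le> real n * (1 - \<eta>) / \<mu> + 2 * \<eta> * real n" by simp
        qed
      qed (use \<eta> in auto)
      show "e1 / \<eta> \<le> e / (8 * H)" using \<eta> by (simp add: e1_def)
    qed (use elim H0 in auto)
    also have "\<dots> = 2 * H * \<eta> + H / real n + (real (n + 1) / real n) * (e / 4)"
      using n H0 by (simp add: field_simps)
    also have "\<dots> \<le> e / 4 + e / 4 + 2 * (e / 4)"
    proof (intro add_mono mult_right_mono)
      show "2 * H * \<eta> \<le> e / 4" using mult_left_mono[OF \<eta>(3), of "2 * H"] H0 by simp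
      show "real (n + 1) / real n \<le> 2" using n by (simp add: field_simps)
    qed (use elim e in auto)
    finally show ?case by simp
  qed
qed

lemma block_cf_limit:
  assumes g: "\<And>x. \<bar>g x\<bar> \<le> B" "\<And>x y. \<bar>g x - g y\<bar> \<le> K * \<bar>x - y\<bar>"
  shows "(\<lambda>n. expectation (\<lambda>\<omega>. cis (\<Sum>k\<in>{1..n+1}. \<xi> k \<omega> * (block_sum g n (len k \<omega>) (pos k \<omega>) / a n))))
    \<longlonglongrightarrow> exp ((1 / \<mu>) *\<^sub>R (\<integral>s. indicator {0<..<1} s *\<^sub>R qlim (g s) \<partial>lborel))"
proof -
  let ?X = "\<lambda>n k \<omega>. block_sum g n (len k \<omega>) (pos k \<omega>) / a n"
  let ?Y = "\<lambda>n k \<omega>. real (len k \<omega>) * cutoff g (real k * \<mu> / real n) / a n"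
  let ?s = "expectation (\<lambda>\<omega>. (\<xi> 1 \<omega>)\<^sup>2)"
  have K0: "0 \<le> K" using order_trans[OF abs_ge_zero g(2)[of 0 1]] by simp
  have gc: "continuous_on UNIV g"
  proof -
    have "K-lipschitz_on UNIV g" using g(2) K0 by (intro lipschitz_onI) (auto simp: dist_real_def)
    then show ?thesis by (rule lipschitz_on_continuous_on)
  qed
  have fm: "random_variable borel (\<lambda>\<omega>. f (len k \<omega>) (pos k \<omega>))" if "1 \<le> k" for f :: "nat \<Rightarrow> int \<Rightarrow> real" and k
    by (rule measurable_compose_countable[OF _ len_meas[OF that]], rule measurable_compose_countable[OF _ pos_meas[OF that]]) auto
  have diff: "(\<lambda>n. expectation (\<lambda>\<omega>. cis (\<Sum>k\<in>{1..n+1}. \<xi> k \<omega> * ?X n k \<omega>)) - expectation (\<lambda>\<omega>. cis (\<Sum>k\<in>{1..n+1}. \<xi> k \<omega> * ?Y n k \<omega>))) \<longlonglongrightarrow> 0"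
  proof (rule LIMSEQ_I)
    fix r :: real assume r: "0 < r"
    have "((\<lambda>e. 2 * e + sqrt (?s * e)) \<longlongrightarrow> 2 * 0 + sqrt (?s * 0)) (at_right 0)" by (intro tendsto_intros)
    then have "\<forall>\<^sub>F e in at_right 0. 2 * e + sqrt (?s * e) < r" using r by (intro order_tendstoD) auto
    then have "\<forall>\<^sub>F e in at_right 0. 2 * e + sqrt (?s * e) < r \<and> 0 < e"
      using eventually_at_right_less[of 0] by eventually_elim auto
    then obtain e where e: "2 * e + sqrt (?s * e) < r" "0 < e" by (auto dest!: eventually_happens)
    have "\<forall>\<^sub>F n in sequentially. norm (expectation (\<lambda>\<omega>. cis (\<Sum>k\<in>{1..n+1}. \<xi> k \<omega> * ?X n k \<omega>)) - expectation (\<lambda>\<omega>. cis (\<Sum>k\<in>{1..n+1}. \<xi> k \<omega> * ?Y n k \<omega>)) - 0) < r"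
      using block_total_small[OF g e(2)]
    proof eventually_elim
      case (elim n)
      let ?J = "{1..n+1}"
      have [measurable]: "random_variable borel (\<xi> k)" "random_variable borel (?X n k)" "random_variable borel (?Y n k)" if "k \<in> ?J" for k
        using that \<xi>_meas fm[of k] by auto
      have i: "integrable M (\<lambda>\<omega>. cis (\<Sum>k\<in>?J. \<xi> k \<omega> * ?X n k \<omega>))" "integrable M (\<lambda>\<omega>. cis (\<Sum>k\<in>?J. \<xi> k \<omega> * ?Y n k \<omega>))"
        by (rule integrable_cis, measurable)+
      have "norm (expectation (\<lambda>\<omega>. cis (\<Sum>k\<in>?J. \<xi> k \<omega> * ?X n k \<omega>)) - expectation (\<lambda>\<omega>. cis (\<Sum>k\<in>?J. \<xi> k \<omega> * ?Y n k \<omega>)))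
         = norm (expectation (\<lambda>\<omega>. cis (\<Sum>k\<in>?J. \<xi> k \<omega> * ?X n k \<omega>) - cis (\<Sum>k\<in>?J. \<xi> k \<omega> * ?Y n k \<omega>)))"
        by (subst Bochner_Integration.integral_diff[OF i]) simp
      also have "\<dots> \<le> expectation (\<lambda>\<omega>. norm (cis (\<Sum>k\<in>?J. \<xi> k \<omega> * ?X n k \<omega>) - cis (\<Sum>k\<in>?J. \<xi> k \<omega> * ?Y n k \<omega>)))"
        by (rule integral_norm_bound)
      also have "\<dots> \<le> expectation (\<lambda>\<omega>. min 2 \<bar>\<Sum>k\<in>?J. \<xi> k \<omega> * (?X n k \<omega> - ?Y n k \<omega>)\<bar>)"
      proof (rule integral_mono)
        show "integrable M (\<lambda>\<omega>. norm (cis (\<Sum>k\<in>?J. \<xi> k \<omega> * ?X n k \<omega>) - cis (\<Sum>k\<in>?J. \<xi> k \<omega> * ?Y n k \<omega>)))"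
          using i by (intro integrable_norm Bochner_Integration.integrable_diff)
        show "integrable M (\<lambda>\<omega>. min 2 \<bar>\<Sum>k\<in>?J. \<xi> k \<omega> * (?X n k \<omega> - ?Y n k \<omega>)\<bar>)"
        proof (rule integrable_const_bound[where B=2])
          have "\<bar>min 2 \<bar>x\<bar>\<bar> \<le> 2" for x :: real by simp
          then show "AE \<omega> in M. norm (min 2 \<bar>\<Sum>k\<in>?J. \<xi> k \<omega> * (?X n k \<omega> - ?Y n k \<omega>)\<bar>) \<le> 2"
            unfolding real_norm_def by blast
        qed measurable
        show "norm (cis (\<Sum>k\<in>?J. \<xi> k \<omega> * ?X n k \<omega>) - cis (\<Sum>k\<in>?J. \<xi> k \<omega> * ?Y n k \<omega>)) \<le> min 2 \<bar>\<Sum>k\<in>?J. \<xi> k \<omega> * (?X n k \<omega> - ?Y n k \<omega>)\<bar>" for \<omega>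
          by (rule order_trans[OF cis_diff_le]) (simp only: sum_subtractf[symmetric] right_diff_distrib order_refl)
      qed
      also have "\<dots> \<le> 2 * e + sqrt (?s * e)"
      proof (rule weighted_sum_bound)
        fix k assume k: "k \<in> ?J"
        then have k1: "1 \<le> k" by simp
        show "integrable M (\<xi> k)" using \<xi>_transfer(2)[OF k1, of "\<lambda>x. x"] \<xi>_int by simp
        show "integrable M (\<lambda>\<omega>. (\<xi> k \<omega>)\<^sup>2)" using \<xi>_transfer(2)[OF k1, of "\<lambda>x. x\<^sup>2"] \<xi>_sq by simp
        show "expectation (\<xi> k) = 0" using \<xi>_transfer(1)[OF k1, of "\<lambda>x. x"] \<xi>_mean by simp
        show "expectation (\<lambda>\<omega>. (\<xi> k \<omega>)\<^sup>2) \<le> ?s" using \<xi>_transfer(1)[OF k1, of "\<lambda>x. x\<^sup>2"] by simp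
        show "indep_var borel (\<xi> k) borel (\<lambda>\<omega>. ?X n k \<omega> - ?Y n k \<omega>)"
          by (rule ind_block[OF k1, where F="\<lambda>l p. block_sum g n l p / a n - real l * cutoff g (real k * \<mu> / real n) / a n"])
      next
        fix j k assume jk: "j \<in> ?J" "k \<in> ?J" "j \<noteq> k"
        then show "indep_var borel (\<xi> j) borel (\<lambda>\<omega>. \<xi> k \<omega> * (trunc1 (?X n j \<omega> - ?Y n j \<omega>) * trunc1 (?X n k \<omega> - ?Y n k \<omega>)))"
          by (intro ind_pair[where F="\<lambda>l p l' p'. trunc1 (block_sum g n l p / a n - real l * cutoff g (real j * \<mu> / real n) / a n)
            * trunc1 (block_sum g n l' p' / a n - real l' * cutoff g (real k * \<mu> / real n) / a n)"]) auto
      qed (use elim in auto)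
      finally show ?case using e(1) by simp
    qed
    then show "\<exists>no. \<forall>n\<ge>no. norm (expectation (\<lambda>\<omega>. cis (\<Sum>k\<in>{1..n+1}. \<xi> k \<omega> * ?X n k \<omega>)) - expectation (\<lambda>\<omega>. cis (\<Sum>k\<in>{1..n+1}. \<xi> k \<omega> * ?Y n k \<omega>)) - 0) < r"
      by (simp add: eventually_sequentially)
  qed
  have "(\<lambda>n. expectation (\<lambda>\<omega>. cis (\<Sum>k\<in>{1..n+1}. \<xi> k \<omega> * ?Y n k \<omega>)))
     \<longlonglongrightarrow> exp ((1 / \<mu>) *\<^sub>R (\<integral>s. indicator {0<..<1} s *\<^sub>R qlim (g s) \<partial>lborel))"
    using frozen_limit[OF g(1) gc] by simp
  from tendsto_add[OF diff this] show ?thesis by simp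
qed

end

section \<open>From the models to the array\<close>

text \<open>The common shape of the conditions that isolate one mark or one length: a coordinate of
  the independent family against a measurable function of the remaining ones.\<close>

lemma (in prob_space) indep_var_one_vs_rest:
  fixes X :: "'i \<Rightarrow> 'a \<Rightarrow> real"
  assumes "indep_vars (\<lambda>_. borel) X I" "i \<in> I" "f \<in> borel_measurable borel"
    and "h \<in> borel_measurable (PiM (I - {i}) (\<lambda>_. borel))"
  shows "indep_var borel (\<lambda>\<omega>. f (X i \<omega>)) borel (\<lambda>\<omega>. h (restrict (\<lambda>j. X j \<omega>) (I - {i})))"
proof -
  have 1: "indep_var (PiM {i} (\<lambda>_. borel)) (\<lambda>\<omega>. restrict (\<lambda>j. X j \<omega>) {i}) (PiM (I - {i}) (\<lambda>_. borel)) (\<lambda>\<omega>. restrict (\<lambda>j. X j \<omega>) (I - {i}))"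
    using assms by (intro indep_var_restrict) auto
  have "(\<lambda>x. f (x i)) \<in> borel_measurable (PiM {i} (\<lambda>_. borel :: real measure))"
    using assms by (intro measurable_compose[OF measurable_component_singleton]) auto
  from indep_var_compose[OF 1 this assms(4)] show ?thesis by (simp add: comp_def)
qed

lemma measurable_nat_of_real:
  assumes "(\<lambda>\<omega>. real (f \<omega>)) \<in> borel_measurable M"
  shows "f \<in> M \<rightarrow>\<^sub>M count_space UNIV"
proof -
  have "(\<lambda>\<omega>. nat \<lfloor>real (f \<omega>)\<rfloor>) \<in> M \<rightarrow>\<^sub>M count_space UNIV"
    using assms by measurable
  then show ?thesis by simp
qed

lemma reg_tail_of_model:
  fixes U :: "'a \<Rightarrow> nat"
  assumes "prob_space M" and U: "(\<lambda>\<omega>. real (U \<omega>)) \<in> borel_measurable M" and \<alpha>: "0 < \<alpha>"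
    and L: "slowly_varying L" "\<And>n. 1 \<le> n \<Longrightarrow> measure M {\<omega>\<in>space M. n \<le> U \<omega>} = L (real n) * real n powr (- \<alpha>)"
  shows "reg_tail \<alpha> (\<lambda>x. measure M {\<omega>\<in>space M. x < real (U \<omega>)})"
proof -
  interpret prob_space M by fact
  have [measurable]: "U \<in> M \<rightarrow>\<^sub>M count_space UNIV" by (rule measurable_nat_of_real[OF U])
  show ?thesis
  proof (rule reg_tail_of_nat[where Q="\<lambda>n. measure M {\<omega>\<in>space M. n \<le> U \<omega>}", OF \<alpha> _ _ L])
    show "antimono (\<lambda>n. prob {\<omega> \<in> space M. n \<le> U \<omega>})"
      by (intro antimonoI finite_measure_mono) auto
    show "antimono (\<lambda>x. prob {\<omega> \<in> space M. x < real (U \<omega>)})"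
      by (intro antimonoI finite_measure_mono) auto
    fix x :: real assume "0 \<le> x"
    then have "x < real u \<longleftrightarrow> nat \<lfloor>x\<rfloor> + 1 \<le> u" for u by linarith
    then show "prob {\<omega> \<in> space M. x < real (U \<omega>)} = prob {\<omega> \<in> space M. nat \<lfloor>x\<rfloor> + 1 \<le> U \<omega>}" by simp
  qed auto
qed

text \<open>The powers of \<open>n\<close> cancel: the normalisation of the theorem is the tail
  quantile itself.\<close>

lemma ell_eq_quantile:
  assumes "1 \<le> n" "0 < \<alpha>"
  shows "ell M U \<alpha> n * real n powr (1 / \<alpha>) = tail_quantile (\<lambda>x. measure M {\<omega>\<in>space M. x < real (U \<omega>)}) n"
proof -
  have "real n powr (- 1 / \<alpha>) * real n powr (1 / \<alpha>) = 1"
    using assms by (simp flip: powr_add)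
  then show ?thesis unfolding ell_def tail_quantile_def by (simp add: mult_ac)
qed

text \<open>As \<open>1 < \<alpha>\<close>, a Potter exponent above 1 is available. For Parke's
  process this yields the finite mean of a length and, through Borel-Cantelli, that only finitely
  many old blocks survive.\<close>

lemma summable_reg_tail:
  assumes G: "reg_tail \<alpha> G" and \<alpha>: "1 < \<alpha>" "\<alpha> < 2"
  shows "summable (\<lambda>m. G (real m))"
proof -
  define p where "p = (1 + \<alpha>) / 2"
  have p: "0 < p" "1 < p" "p < \<alpha>" using \<alpha> by (auto simp: p_def)
  obtain x0 where x0: "0 < x0" "\<And>x y. x0 \<le> x \<Longrightarrow> x \<le> y \<Longrightarrow> G y \<le> 4 * (y / x) powr (- p) * G x"
    by (rule reg_tail_Potter[OF G p(1) p(3) \<alpha>(2) order_refl]) (rule that, assumption+)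
  show ?thesis
  proof (rule summable_comparison_test_ev)
    show "summable (\<lambda>m. 4 * x0 powr p * G x0 * real m powr (- p))"
      using p by (intro summable_mult) (simp add: summable_real_powr_iff)
    show "\<forall>\<^sub>F m in sequentially. norm (G (real m)) \<le> 4 * x0 powr p * G x0 * real m powr (- p)"
      using eventually_ge_at_top[of "nat \<lceil>x0\<rceil>"]
    proof eventually_elim
      case (elim m)
      then have m: "x0 \<le> real m" by linarith
      have "norm (G (real m)) = G (real m)" using reg_tailD(2)[OF G, of "real m"] by simp
      also have "\<dots> \<le> 4 * (real m / x0) powr (- p) * G x0" using x0 m by auto
      also have "(real m / x0) powr (- p) = x0 powr p * real m powr (- p)"
        using m x0 by (simp add: powr_divide powr_minus field_simps)
      finally show ?case by (simp add: mult_ac)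
    qed
  qed
qed

lemma block_sum_alt:
  assumes n: "1 \<le> n" and p: "0 \<le> p"
  shows "block_sum g n l p = (\<Sum>t\<in>{0..n}. if p \<le> int t \<and> int t < p + int l then g (real t / real n) else 0)"
proof -
  have "block_sum g n l p = (\<Sum>t\<in>{p..<p + int l} \<inter> {0..int n}. g (real_of_int t / real n))"
    unfolding block_sum_def
    by (rule sum.mono_neutral_cong_right) (use n p in \<open>auto simp: cutoff_def\<close>)
  also have "\<dots> = (\<Sum>t\<in>{0..n} \<inter> {t. p \<le> int t \<and> int t < p + int l}. g (real t / real n))"
  proof (rule sum.reindex_bij_witness[of _ int nat])
  qed (use p in auto)
  also have "\<dots> = (\<Sum>t\<in>{0..n}. if p \<le> int t \<and> int t < p + int l then g (real t / real n) else 0)"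
    by (simp add: sum.inter_restrict)
  finally show ?thesis .
qed

text \<open>The edge effects are bounded by a random variable that does not change with
  \<open>n\<close>, while \<open>a n\<close> tends to infinity; so the two sums merge almost surely.
  Since \<open>cis\<close> is bounded, dominated convergence applies whatever the moments of
  \<open>R\<close>.\<close>

lemma (in stable_array) cf_limit_remainder:
  assumes g: "\<And>x. \<bar>g x\<bar> \<le> B" "\<And>x y. \<bar>g x - g y\<bar> \<le> K * \<bar>x - y\<bar>"
    and Z: "\<And>n. random_variable borel (Z n)" and R: "random_variable borel R"
    and close: "AE \<omega> in M. \<forall>n\<ge>1. \<bar>Z n \<omega> - (\<Sum>k\<in>{1..n+1}. \<xi> k \<omega> * (block_sum g n (len k \<omega>) (pos k \<omega>) / a n))\<bar> \<le> R \<omega> / \<bar>a n\<bar>"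
  shows "(\<lambda>n. expectation (\<lambda>\<omega>. cis (Z n \<omega>))) \<longlonglongrightarrow> exp ((1 / \<mu>) *\<^sub>R (\<integral>s. indicator {0<..<1} s *\<^sub>R qlim (g s) \<partial>lborel))"
proof -
  note [measurable] = Z R
  define S where "S = (\<lambda>n \<omega>. \<Sum>k\<in>{1..n+1}. \<xi> k \<omega> * (block_sum g n (len k \<omega>) (pos k \<omega>) / a n))"
  have fm: "random_variable borel (\<lambda>\<omega>. f (len k \<omega>) (pos k \<omega>))" if "1 \<le> k" for f :: "nat \<Rightarrow> int \<Rightarrow> real" and k
    by (rule measurable_compose_countable[OF _ len_meas[OF that]], rule measurable_compose_countable[OF _ pos_meas[OF that]]) auto
  have Sm[measurable]: "random_variable borel (S n)" for n
    unfolding S_def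
  proof (rule borel_measurable_sum)
    fix k assume "k \<in> {1..n+1}"
    then show "random_variable borel (\<lambda>\<omega>. \<xi> k \<omega> * (block_sum g n (len k \<omega>) (pos k \<omega>) / a n))"
      using \<xi>_meas[of k] fm[of k "\<lambda>l p. block_sum g n l p / a n"] by (intro borel_measurable_times) auto
  qed
  have close': "AE \<omega> in M. \<forall>n\<ge>1. \<bar>Z n \<omega> - S n \<omega>\<bar> \<le> R \<omega> / \<bar>a n\<bar>"
    using close unfolding S_def .
  have d0: "(\<lambda>n. expectation (\<lambda>\<omega>. cis (Z n \<omega>) - cis (S n \<omega>))) \<longlonglongrightarrow> expectation (\<lambda>\<omega>. 0)"
  proof (rule integral_dominated_convergence[where w="\<lambda>_. 2"])
    show "AE \<omega> in M. (\<lambda>n. cis (Z n \<omega>) - cis (S n \<omega>)) \<longlonglongrightarrow> 0"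
      using close'
    proof eventually_elim
      case (elim \<omega>)
      show ?case
      proof (rule Lim_null_comparison)
        show "\<forall>\<^sub>F n in sequentially. norm (cis (Z n \<omega>) - cis (S n \<omega>)) \<le> R \<omega> / \<bar>a n\<bar>"
          using eventually_ge_at_top[of 1]
        proof eventually_elim
          case (elim n)
          have "norm (cis (Z n \<omega>) - cis (S n \<omega>)) \<le> \<bar>Z n \<omega> - S n \<omega>\<bar>"
            using cis_diff_le[of "Z n \<omega>" "S n \<omega>"] by simp
          with \<open>\<forall>n\<ge>1. \<bar>Z n \<omega> - S n \<omega>\<bar> \<le> R \<omega> / \<bar>a n\<bar>\<close> elim show ?case by (meson order_trans)
        qed
        show "(\<lambda>n. R \<omega> / \<bar>a n\<bar>) \<longlonglongrightarrow> 0"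
          using a_top by (intro tendsto_divide_0[OF tendsto_const] filterlim_at_top_imp_at_infinity filterlim_compose[OF filterlim_abs_real])
      qed
    qed
    show "AE \<omega> in M. norm (cis (Z n \<omega>) - cis (S n \<omega>)) \<le> 2" for n
    proof (rule AE_I2)
      fix \<omega> show "norm (cis (Z n \<omega>) - cis (S n \<omega>)) \<le> 2" using cis_diff_le[of "Z n \<omega>" "S n \<omega>"] by simp
    qed
    show "(\<lambda>\<omega>. cis (Z n \<omega>) - cis (S n \<omega>)) \<in> borel_measurable M" for n by measurable
  qed auto
  have "expectation (\<lambda>\<omega>. cis (Z n \<omega>) - cis (S n \<omega>)) = expectation (\<lambda>\<omega>. cis (Z n \<omega>)) - expectation (\<lambda>\<omega>. cis (S n \<omega>))" for n
    by (rule Bochner_Integration.integral_diff[OF integrable_cis[OF Z] integrable_cis[OF Sm]])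
  then have "(\<lambda>n. expectation (\<lambda>\<omega>. cis (Z n \<omega>)) - expectation (\<lambda>\<omega>. cis (S n \<omega>))) \<longlonglongrightarrow> 0"
    using d0 by simp
  then have "(\<lambda>n. expectation (\<lambda>\<omega>. cis (Z n \<omega>)) - expectation (\<lambda>\<omega>. cis (\<Sum>k\<in>{1..n+1}. \<xi> k \<omega> * (block_sum g n (len k \<omega>) (pos k \<omega>) / a n)))) \<longlonglongrightarrow> 0"
    unfolding S_def .
  from tendsto_add[OF this block_cf_limit[OF g]] show ?thesis by simp
qed

section \<open>A law of large numbers in mean\<close>

text \<open>Orthogonality bounds the second moment of the sum by \<open>card J\<close> times
  \<open>c\<close> squared, and the first absolute moment by the root of that.\<close>

lemma (in prob_space) uncorrelated_sum_abs_bound: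
  fixes Y :: "nat \<Rightarrow> 'a \<Rightarrow> real"
  assumes J: "finite J" and iv: "indep_vars (\<lambda>_. borel) Y J" and bd: "\<And>i \<omega>. i \<in> J \<Longrightarrow> \<bar>Y i \<omega>\<bar> \<le> c"
    and mean: "\<And>i. i \<in> J \<Longrightarrow> expectation (Y i) = 0"
  shows "expectation (\<lambda>\<omega>. \<bar>\<Sum>i\<in>J. Y i \<omega>\<bar>) \<le> sqrt (real (card J)) * \<bar>c\<bar>"
proof -
  have Ym[measurable]: "random_variable borel (Y i)" if "i \<in> J" for i
    using iv that by (auto simp: indep_vars_def)
  have Yi: "integrable M (Y i)" if "i \<in> J" for i
    using that bd by (intro integrable_const_bound[where B=c]) auto
  have prodi: "integrable M (\<lambda>\<omega>. Y i \<omega> * Y j \<omega>)" if "i \<in> J" "j \<in> J" for i j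
  proof (rule integrable_const_bound[where B="c * c"])
    show "AE \<omega> in M. norm (Y i \<omega> * Y j \<omega>) \<le> c * c"
    proof (rule AE_I2)
      fix \<omega>
      have "\<bar>Y i \<omega>\<bar> * \<bar>Y j \<omega>\<bar> \<le> c * c" using bd[OF that(1), of \<omega>] bd[OF that(2), of \<omega>] by (intro mult_mono) auto
      then show "norm (Y i \<omega> * Y j \<omega>) \<le> c * c" by (simp add: abs_mult)
    qed
  qed (use that in measurable)
  have off: "expectation (\<lambda>\<omega>. Y i \<omega> * Y j \<omega>) = 0" if "i \<in> J" "j \<in> J" "i \<noteq> j" for i j
  proof -
    have "expectation (\<lambda>\<omega>. \<Prod>k\<in>{i, j}. Y k \<omega>) = (\<Prod>k\<in>{i, j}. expectation (Y k))"
      using that by (intro indep_vars_lebesgue_integral indep_vars_subset[OF iv] Yi) auto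
    then show ?thesis using that mean by simp
  qed
  let ?S = "\<lambda>\<omega>. \<Sum>i\<in>J. Y i \<omega>"
  have Si: "integrable M ?S" using Yi by (rule Bochner_Integration.integrable_sum)
  have S2: "(\<lambda>\<omega>. (?S \<omega>)\<^sup>2) = (\<lambda>\<omega>. \<Sum>i\<in>J. \<Sum>j\<in>J. Y i \<omega> * Y j \<omega>)" by (simp add: power2_eq_square sum_product)
  have S2i: "integrable M (\<lambda>\<omega>. (?S \<omega>)\<^sup>2)" unfolding S2 by (intro Bochner_Integration.integrable_sum prodi)
  have "expectation (\<lambda>\<omega>. (?S \<omega>)\<^sup>2) = (\<Sum>i\<in>J. \<Sum>j\<in>J. expectation (\<lambda>\<omega>. Y i \<omega> * Y j \<omega>))"
    unfolding S2 using prodi by (simp add: Bochner_Integration.integral_sum)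
  also have "\<dots> = (\<Sum>i\<in>J. \<Sum>j\<in>J. if j = i then expectation (\<lambda>\<omega>. Y i \<omega> * Y i \<omega>) else 0)"
    using off by (intro sum.cong refl) auto
  also have "\<dots> = (\<Sum>i\<in>J. expectation (\<lambda>\<omega>. Y i \<omega> * Y i \<omega>))" using J by (simp add: sum.delta)
  also have "\<dots> \<le> (\<Sum>i\<in>J. c\<^sup>2)"
  proof (rule sum_mono)
    fix i assume i: "i \<in> J"
    have "expectation (\<lambda>\<omega>. Y i \<omega> * Y i \<omega>) \<le> expectation (\<lambda>\<omega>. c\<^sup>2)"
    proof (rule integral_mono[OF prodi[OF i i]])
      fix \<omega> show "Y i \<omega> * Y i \<omega> \<le> c\<^sup>2"
        using abs_le_square_iff[of "Y i \<omega>" c] bd[OF i, of \<omega>] by (simp add: power2_eq_square)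
    qed simp
    then show "expectation (\<lambda>\<omega>. Y i \<omega> * Y i \<omega>) \<le> c\<^sup>2" by (simp add: prob_space)
  qed
  finally have v: "expectation (\<lambda>\<omega>. (?S \<omega>)\<^sup>2) \<le> real (card J) * c\<^sup>2" by simp
  have "0 \<le> variance (\<lambda>\<omega>. \<bar>?S \<omega>\<bar>)" by simp
  also have "variance (\<lambda>\<omega>. \<bar>?S \<omega>\<bar>) = expectation (\<lambda>\<omega>. (\<bar>?S \<omega>\<bar>)\<^sup>2) - (expectation (\<lambda>\<omega>. \<bar>?S \<omega>\<bar>))\<^sup>2"
    using Si S2i by (intro variance_eq) auto
  finally have "(expectation (\<lambda>\<omega>. \<bar>?S \<omega>\<bar>))\<^sup>2 \<le> real (card J) * c\<^sup>2" using v by simp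
  then have "expectation (\<lambda>\<omega>. \<bar>?S \<omega>\<bar>) \<le> sqrt (real (card J) * c\<^sup>2)" by (rule real_le_rsqrt)
  then show ?thesis by (simp add: real_sqrt_mult)
qed

text \<open>Truncate at a high level and use orthogonality for the bounded part.\<close>

lemma (in prob_space) iid_sum_L1_bound:
  fixes X :: "nat \<Rightarrow> 'a \<Rightarrow> real"
  assumes iv: "indep_vars (\<lambda>_. borel) X {1..}" and id: "\<And>k. 1 \<le> k \<Longrightarrow> distr M borel (X k) = distr M borel (X 1)"
    and int: "integrable M (X 1)" and e: "0 < e"
  shows "\<forall>\<^sub>F n in sequentially. \<forall>m\<le>n. expectation (\<lambda>\<omega>. \<bar>\<Sum>i\<in>{1..m}. (X i \<omega> - expectation (X 1))\<bar>) \<le> e * real n"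
proof -
  have Xm[measurable]: "random_variable borel (X i)" if "1 \<le> i" for i
    using iv that by (auto simp: indep_vars_def)
  have [measurable]: "random_variable borel (X (Suc 0))" using Xm[of 1] by simp
  define hi where "hi c x = (if \<bar>x\<bar> \<le> c then 0 else x)" for c x :: real
  define lo where "lo c x = (if \<bar>x\<bar> \<le> c then x else 0)" for c x :: real
  have [measurable]: "hi c \<in> borel_measurable borel" "lo c \<in> borel_measurable borel" for c
    unfolding hi_def lo_def by measurable
  have split: "x = lo c x + hi c x" for c x by (simp add: hi_def lo_def)
  have tr: "integrable M (\<lambda>\<omega>. f (X i \<omega>)) \<longleftrightarrow> integrable M (\<lambda>\<omega>. f (X 1 \<omega>))"
    "expectation (\<lambda>\<omega>. f (X i \<omega>)) = expectation (\<lambda>\<omega>. f (X 1 \<omega>))"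
    if "1 \<le> i" and [measurable]: "f \<in> borel_measurable borel" for i and f :: "real \<Rightarrow> real"
    using arg_cong[OF id[OF that(1)], of "\<lambda>N. integral\<^sup>L N f"] arg_cong[OF id[OF that(1)], of "\<lambda>N. integrable N f"] Xm[OF that(1)] Xm[of 1]
    by (simp_all add: integral_distr integrable_distr_eq)
  have Xi: "integrable M (X i)" if "1 \<le> i" for i using tr(1)[OF that, of "\<lambda>x. x"] int by simp
  have lim: "((\<lambda>c. expectation (\<lambda>\<omega>. \<bar>hi c (X 1 \<omega>)\<bar>)) \<longlongrightarrow> expectation (\<lambda>\<omega>. 0)) at_top"
  proof (rule integral_dominated_convergence_at_top[where w="\<lambda>\<omega>. \<bar>X 1 \<omega>\<bar>"])
    show "AE \<omega> in M. ((\<lambda>c. \<bar>hi c (X 1 \<omega>)\<bar>) \<longlongrightarrow> 0) at_top"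
    proof (rule AE_I2)
      fix \<omega>
      show "((\<lambda>c. \<bar>hi c (X 1 \<omega>)\<bar>) \<longlongrightarrow> 0) at_top"
        by (rule tendsto_eventually, rule eventually_mono[OF eventually_ge_at_top[of "\<bar>X 1 \<omega>\<bar>"]]) (auto simp: hi_def)
    qed
  qed (use int in \<open>auto simp: hi_def\<close>)
  have "\<forall>\<^sub>F c in at_top. expectation (\<lambda>\<omega>. \<bar>hi c (X 1 \<omega>)\<bar>) < e / 4"
    using lim e by (intro order_tendstoD) auto
  then have "\<forall>\<^sub>F c in at_top. expectation (\<lambda>\<omega>. \<bar>hi c (X 1 \<omega>)\<bar>) < e / 4 \<and> 0 < c"
    using eventually_gt_at_top[of 0] by (rule eventually_conj)
  \<comment> \<open>At this level the unbounded part costs \<open>e / 4\<close> per summand and its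
    mean another \<open>e / 4\<close>; the bounded part is of order \<open>sqrt m\<close> and
    vanishes against \<open>n\<close>.\<close>
  then obtain c where c: "expectation (\<lambda>\<omega>. \<bar>hi c (X 1 \<omega>)\<bar>) < e / 4" "0 < c"
    by (auto dest!: eventually_happens)
  have li: "integrable M (\<lambda>\<omega>. lo c (X i \<omega>))" if "1 \<le> i" for i
    using that c by (intro integrable_const_bound[where B=c]) (auto simp: lo_def)
  have hi1: "integrable M (\<lambda>\<omega>. hi c (X 1 \<omega>))"
    by (rule Bochner_Integration.integrable_bound[OF int]) (auto simp: hi_def)
  have hii: "integrable M (\<lambda>\<omega>. hi c (X i \<omega>))" if "1 \<le> i" for i
    using tr(1)[OF that, of "hi c"] hi1 by simp
  let ?l = "expectation (\<lambda>\<omega>. lo c (X 1 \<omega>))" and ?h = "expectation (\<lambda>\<omega>. hi c (X 1 \<omega>))"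
  have mu: "expectation (X 1) = ?l + ?h"
    using li[of 1] hi1 split[of _ c] by (subst Bochner_Integration.integral_add[symmetric]) auto
  have lb: "\<bar>?l\<bar> \<le> c"
  proof -
    have "\<bar>?l\<bar> \<le> expectation (\<lambda>\<omega>. \<bar>lo c (X 1 \<omega>)\<bar>)" by (rule integral_abs_bound)
    also have "\<dots> \<le> expectation (\<lambda>\<omega>. c)"
      using li[of 1] c by (intro integral_mono) (auto simp: lo_def)
    finally show ?thesis by (simp add: prob_space)
  qed
  have hb: "\<bar>?h\<bar> \<le> e / 4"
    using integral_abs_bound[of M "\<lambda>\<omega>. hi c (X 1 \<omega>)"] c by linarith
  have main: "expectation (\<lambda>\<omega>. \<bar>\<Sum>i\<in>{1..m}. (X i \<omega> - expectation (X 1))\<bar>) \<le> sqrt (real m) * (2 * c) + real m * (e / 2)" for m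
  proof -
    have iy: "indep_vars (\<lambda>_. borel) (\<lambda>i \<omega>. lo c (X i \<omega>) - ?l) {1..m}"
      by (rule indep_vars_compose2[OF indep_vars_subset[OF iv], where Y="\<lambda>i x. lo c x - ?l"]) auto
    have A: "expectation (\<lambda>\<omega>. \<bar>\<Sum>i\<in>{1..m}. (lo c (X i \<omega>) - ?l)\<bar>) \<le> sqrt (real (card {1..m})) * \<bar>2 * c\<bar>"
    proof (rule uncorrelated_sum_abs_bound[OF _ iy])
      fix i assume i: "i \<in> {1..m}"
      show "\<bar>lo c (X i \<omega>) - ?l\<bar> \<le> 2 * c" for \<omega>
      proof -
        have "\<bar>lo c (X i \<omega>)\<bar> \<le> c" using c by (simp add: lo_def)
        then show ?thesis using lb by linarith
      qed
      show "expectation (\<lambda>\<omega>. lo c (X i \<omega>) - ?l) = 0"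
        using i li[of i] tr(2)[of i "lo c"] by (simp add: prob_space)
    qed simp
    have i1: "integrable M (\<lambda>\<omega>. \<bar>\<Sum>i\<in>{1..m}. (lo c (X i \<omega>) - ?l)\<bar>)"
      using li by (intro integrable_abs Bochner_Integration.integrable_sum) auto
    have i2: "integrable M (\<lambda>\<omega>. \<Sum>i\<in>{1..m}. (\<bar>hi c (X i \<omega>)\<bar> + \<bar>?h\<bar>))"
      using hii by (intro Bochner_Integration.integrable_sum) auto
    have "expectation (\<lambda>\<omega>. \<bar>\<Sum>i\<in>{1..m}. (X i \<omega> - expectation (X 1))\<bar>) \<le>
       expectation (\<lambda>\<omega>. \<bar>\<Sum>i\<in>{1..m}. (lo c (X i \<omega>) - ?l)\<bar> + (\<Sum>i\<in>{1..m}. (\<bar>hi c (X i \<omega>)\<bar> + \<bar>?h\<bar>)))"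
    proof (rule integral_mono)
      show "integrable M (\<lambda>\<omega>. \<bar>\<Sum>i\<in>{1..m}. (X i \<omega> - expectation (X 1))\<bar>)"
        using Xi by (intro integrable_abs Bochner_Integration.integrable_sum Bochner_Integration.integrable_diff) auto
      show "integrable M (\<lambda>\<omega>. \<bar>\<Sum>i\<in>{1..m}. (lo c (X i \<omega>) - ?l)\<bar> + (\<Sum>i\<in>{1..m}. (\<bar>hi c (X i \<omega>)\<bar> + \<bar>?h\<bar>)))"
        using i1 i2 by (rule Bochner_Integration.integrable_add)
      fix \<omega>
      have "(\<Sum>i\<in>{1..m}. (X i \<omega> - expectation (X 1))) = (\<Sum>i\<in>{1..m}. (lo c (X i \<omega>) - ?l)) + (\<Sum>i\<in>{1..m}. (hi c (X i \<omega>) - ?h))"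
        unfolding mu sum.distrib[symmetric] by (intro sum.cong refl) (use split[of _ c] in \<open>simp add: algebra_simps\<close>)
      moreover have "\<bar>\<Sum>i\<in>{1..m}. (hi c (X i \<omega>) - ?h)\<bar> \<le> (\<Sum>i\<in>{1..m}. (\<bar>hi c (X i \<omega>)\<bar> + \<bar>?h\<bar>))"
        by (rule order_trans[OF sum_abs sum_mono[OF abs_triangle_ineq4]])
      ultimately show "\<bar>\<Sum>i\<in>{1..m}. (X i \<omega> - expectation (X 1))\<bar> \<le> \<bar>\<Sum>i\<in>{1..m}. (lo c (X i \<omega>) - ?l)\<bar> + (\<Sum>i\<in>{1..m}. (\<bar>hi c (X i \<omega>)\<bar> + \<bar>?h\<bar>))"
        by linarith
    qed
    also have "\<dots> = expectation (\<lambda>\<omega>. \<bar>\<Sum>i\<in>{1..m}. (lo c (X i \<omega>) - ?l)\<bar>) + (\<Sum>i\<in>{1..m}. expectation (\<lambda>\<omega>. \<bar>hi c (X i \<omega>)\<bar> + \<bar>?h\<bar>))"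
      using i1 i2 hii by (subst Bochner_Integration.integral_add) (auto simp: Bochner_Integration.integral_sum)
    also have "(\<Sum>i\<in>{1..m}. expectation (\<lambda>\<omega>. \<bar>hi c (X i \<omega>)\<bar> + \<bar>?h\<bar>)) \<le> (\<Sum>i\<in>{1..m}. e / 2)"
    proof (rule sum_mono)
      fix i assume i: "i \<in> {1..m}"
      have "expectation (\<lambda>\<omega>. \<bar>hi c (X i \<omega>)\<bar> + \<bar>?h\<bar>) = expectation (\<lambda>\<omega>. \<bar>hi c (X 1 \<omega>)\<bar>) + \<bar>?h\<bar>"
        using i hii[of i] tr(2)[of i "\<lambda>x. \<bar>hi c x\<bar>"] by (simp add: prob_space)
      then show "expectation (\<lambda>\<omega>. \<bar>hi c (X i \<omega>)\<bar> + \<bar>?h\<bar>) \<le> e / 2" using c hb by linarith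
    qed
    finally show ?thesis using A c by simp
  qed
  have "(\<lambda>n. 2 * c / sqrt (real n)) \<longlonglongrightarrow> 0"
    by (intro tendsto_divide_0[OF tendsto_const] filterlim_at_top_imp_at_infinity filterlim_compose[OF sqrt_at_top filterlim_real_sequentially])
  then have "\<forall>\<^sub>F n in sequentially. 2 * c / sqrt (real n) < e / 2" using e by (intro order_tendstoD) auto
  then show ?thesis using eventually_ge_at_top[of 1]
  proof eventually_elim
    case (elim n)
    show ?case
    proof (intro allI impI)
      fix m assume m: "m \<le> n"
      \<comment> \<open>The bound of \<open>main\<close> increases with \<open>m\<close>, which
        gives uniformity over \<open>m \<le> n\<close>.\<close>
      have "sqrt (real m) * (2 * c) \<le> sqrt (real n) * (2 * c)" using m c by (intro mult_right_mono) auto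
      also have "sqrt (real n) = real n / sqrt (real n)" by (simp add: real_div_sqrt)
      also have "real n / sqrt (real n) * (2 * c) = real n * (2 * c / sqrt (real n))" by simp
      also have "\<dots> \<le> real n * (e / 2)" using elim by (intro mult_left_mono) auto
      finally have "sqrt (real m) * (2 * c) + real m * (e / 2) \<le> real n * (e / 2) + real n * (e / 2)"
        using m e by (intro add_mono mult_right_mono) auto
      then show "expectation (\<lambda>\<omega>. \<bar>\<Sum>i\<in>{1..m}. (X i \<omega> - expectation (X 1))\<bar>) \<le> e * real n"
        using main[of m] by (simp add: mult.commute)
    qed
  qed
qed

section \<open>The Taqqu--Levy process\<close>

lemma measurable_sum_int:
  fixes f :: "'i \<Rightarrow> 'a \<Rightarrow> int"
  assumes "finite A" "\<And>i. i \<in> A \<Longrightarrow> f i \<in> N \<rightarrow>\<^sub>M count_space UNIV"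
  shows "(\<lambda>x. \<Sum>i\<in>A. f i x) \<in> N \<rightarrow>\<^sub>M count_space UNIV"
  using assms
proof (induction A)
  case (insert i A)
  have "(\<lambda>x. (\<lambda>m x. m + (\<Sum>i\<in>A. f i x)) (f i x) x) \<in> N \<rightarrow>\<^sub>M count_space UNIV"
  proof (rule measurable_compose_countable[where f="\<lambda>m x. m + (\<Sum>i\<in>A. f i x)" and g="f i"])
    show "(\<lambda>x. m + (\<Sum>i\<in>A. f i x)) \<in> N \<rightarrow>\<^sub>M count_space UNIV" for m
      using insert by (intro measurable_compose[of "\<lambda>x. \<Sum>i\<in>A. f i x" N "count_space UNIV" "\<lambda>s. m + s"]) auto
  qed (use insert in auto)
  then show ?case using insert by simp
qed simp

locale tl_model = prob_space M for M :: "'a measure" +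
  fixes S0 :: "'a \<Rightarrow> nat" and T :: "nat \<Rightarrow> 'a \<Rightarrow> nat" and W :: "nat \<Rightarrow> 'a \<Rightarrow> real"
    and \<alpha> :: real and L :: "real \<Rightarrow> real"
  assumes alpha: "1 < \<alpha>" "\<alpha> < 2" and model: "taqqu_levy_model M S0 T W \<alpha> L"
begin

lemma family_indep: "indep_vars (\<lambda>_. borel) (tl_family S0 T W) tl_index"
  and T_distr: "1 \<le> k \<Longrightarrow> distr M borel (\<lambda>\<omega>. real (T k \<omega>)) = distr M borel (\<lambda>\<omega>. real (T 1 \<omega>))"
  and T_ge: "1 \<le> k \<Longrightarrow> AE \<omega> in M. 1 \<le> T k \<omega>"
  and T_int: "integrable M (\<lambda>\<omega>. real (T 1 \<omega>))"
  and W_distr: "distr M borel (W k) = distr M borel (W 0)"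
  and W0: "integrable M (W 0)" "expectation (W 0) = 0" "integrable M (\<lambda>\<omega>. (W 0 \<omega>)\<^sup>2)"
  and L: "slowly_varying L" "1 \<le> n \<Longrightarrow> prob {\<omega>\<in>space M. n \<le> T 1 \<omega>} = L (real n) * real n powr (- \<alpha>)"
  using model unfolding taqqu_levy_model_def by blast+

lemma index_simps [simp]: "Inl u \<in> tl_index" "Inr (Inl k) \<in> tl_index \<longleftrightarrow> 1 \<le> k" "Inr (Inr k) \<in> tl_index"
  by (auto simp: tl_index_def)

lemma family_simps [simp]: "tl_family S0 T W (Inl u) = (\<lambda>\<omega>. real (S0 \<omega>))" "tl_family S0 T W (Inr (Inl k)) = (\<lambda>\<omega>. real (T k \<omega>))"
  "tl_family S0 T W (Inr (Inr k)) = W k"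
  by (auto simp: tl_family_def fun_eq_iff)

lemma fam_meas: "i \<in> tl_index \<Longrightarrow> random_variable borel (tl_family S0 T W i)"
  using family_indep by (auto simp: indep_vars_def)

lemma W_meas [measurable]: "random_variable borel (W k)"
  using fam_meas[of "Inr (Inr k)"] by simp

lemma T_real_meas: "1 \<le> k \<Longrightarrow> random_variable borel (\<lambda>\<omega>. real (T k \<omega>))"
  using fam_meas[of "Inr (Inl k)"] by simp

lemma T_meas: "1 \<le> k \<Longrightarrow> T k \<in> M \<rightarrow>\<^sub>M count_space UNIV"
  by (rule measurable_nat_of_real[OF T_real_meas])

lemma S0_meas [measurable]: "S0 \<in> M \<rightarrow>\<^sub>M count_space UNIV"
  using fam_meas[of "Inl ()"] by (intro measurable_nat_of_real) simp

lemma tl_S_meas [measurable]: "tl_S S0 T k \<in> M \<rightarrow>\<^sub>M count_space UNIV"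
proof -
  note [measurable] = T_meas
  have "(\<lambda>\<omega>. \<lfloor>real (S0 \<omega>) + (\<Sum>i\<in>{1..k}. real (T i \<omega>))\<rfloor>) \<in> M \<rightarrow>\<^sub>M count_space UNIV"
    by measurable
  moreover have "tl_S S0 T k = (\<lambda>\<omega>. \<lfloor>real (S0 \<omega>) + (\<Sum>i\<in>{1..k}. real (T i \<omega>))\<rfloor>)"
  proof
    fix \<omega>
    have "real (S0 \<omega>) + (\<Sum>i\<in>{1..k}. real (T i \<omega>)) = of_int (tl_S S0 T k \<omega>)" by (simp add: tl_S_def)
    then show "tl_S S0 T k \<omega> = \<lfloor>real (S0 \<omega>) + (\<Sum>i\<in>{1..k}. real (T i \<omega>))\<rfloor>" by (simp only: floor_of_int)
  qed
  ultimately show ?thesis by simp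
qed

text \<open>For \<open>k \<ge> 1\<close>, block \<open>k\<close> starts here and has length
  \<open>T k\<close>. The block with index 0, whose length has another law, is left to the boundary
  term.\<close>

definition start :: "nat \<Rightarrow> 'a \<Rightarrow> int" where "start k = tl_S S0 T (k - 1)"

definition mean where "mean = expectation (\<lambda>\<omega>. real (T 1 \<omega>))"

definition tailT where "tailT x = prob {\<omega>\<in>space M. x < real (T 1 \<omega>)}"

text \<open>Exhibits the start of a block as a function of the coordinates in \<open>J\<close>
  alone, the shape needed for independence from a coordinate outside \<open>J\<close>. The floors
  recover the integers from the real-valued family.\<close>

lemma start_rest:
  assumes "\<And>j. j \<in> {1..<k} \<Longrightarrow> Inr (Inl j) \<in> J" "Inl () \<in> J"
  shows "start k \<omega> = (let x = restrict (\<lambda>i. tl_family S0 T W i \<omega>) J in \<lfloor>x (Inl ())\<rfloor> + (\<Sum>i\<in>{1..<k}. \<lfloor>x (Inr (Inl i))\<rfloor>))"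
proof -
  have "{1..k - 1} = {1..<k}" by auto
  then have "start k \<omega> = int (S0 \<omega>) + (\<Sum>i\<in>{1..<k}. int (T i \<omega>))" by (simp add: start_def tl_S_def)
  then show ?thesis using assms by (simp add: Let_def)
qed

lemma start_rest_meas:
  fixes J :: "(unit + nat + nat) set"
  assumes "\<And>j. j \<in> {1..<k} \<Longrightarrow> Inr (Inl j) \<in> J" "Inl () \<in> J"
  shows "(\<lambda>x. \<lfloor>x (Inl ())\<rfloor> + (\<Sum>i\<in>{1..<k}. \<lfloor>x (Inr (Inl i))\<rfloor>)) \<in> PiM J (\<lambda>_. borel :: real measure) \<rightarrow>\<^sub>M count_space UNIV"
proof -
  have [measurable]: "(\<lambda>x. x i) \<in> borel_measurable (PiM J (\<lambda>_. borel :: real measure))" if "i \<in> J" for i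
    by (rule measurable_component_singleton[OF that])
  have "(\<lambda>x. \<lfloor>x (Inl ())\<rfloor>) \<in> PiM J (\<lambda>_. borel :: real measure) \<rightarrow>\<^sub>M count_space UNIV"
    using assms by measurable
  moreover have "(\<lambda>x. \<Sum>i\<in>{1..<k}. \<lfloor>x (Inr (Inl i))\<rfloor>) \<in> PiM J (\<lambda>_. borel :: real measure) \<rightarrow>\<^sub>M count_space UNIV"
  proof (rule measurable_sum_int)
    fix i assume "i \<in> {1..<k}"
    then have "Inr (Inl i) \<in> J" using assms by auto
    then show "(\<lambda>x. \<lfloor>x (Inr (Inl i))\<rfloor>) \<in> PiM J (\<lambda>_. borel :: real measure) \<rightarrow>\<^sub>M count_space UNIV"
      by measurable
  qed simp
  ultimately show ?thesis by measurable
qed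

lemma count_fun_meas:
  fixes F :: "nat \<Rightarrow> int \<Rightarrow> nat \<Rightarrow> int \<Rightarrow> real"
  assumes "l \<in> N \<rightarrow>\<^sub>M count_space UNIV" "p \<in> N \<rightarrow>\<^sub>M count_space UNIV" "l' \<in> N \<rightarrow>\<^sub>M count_space UNIV" "p' \<in> N \<rightarrow>\<^sub>M count_space UNIV"
  shows "(\<lambda>x. F (l x) (p x) (l' x) (p' x)) \<in> borel_measurable N"
  by (rule measurable_compose_countable[OF _ assms(1)], rule measurable_compose_countable[OF _ assms(2)],
      rule measurable_compose_countable[OF _ assms(3)], rule measurable_compose_countable[OF _ assms(4)]) auto

text \<open>Lengths and starts are functions of \<open>S0\<close> and the \<open>T\<close>, so the
  second variable avoids the coordinate of \<open>W j\<close>. The free function \<open>f\<close>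
  and index \<open>k'\<close> let one statement cover the condition on a single block, with constant
  \<open>f\<close>, and the one on pairs, with the identity.\<close>

lemma ind_W:
  fixes F :: "nat \<Rightarrow> int \<Rightarrow> nat \<Rightarrow> int \<Rightarrow> real"
  assumes "1 \<le> j" "1 \<le> k" "j \<noteq> k'" and f: "f \<in> borel_measurable borel"
  shows "indep_var borel (W j) borel (\<lambda>\<omega>. f (W k' \<omega>) * F (T j \<omega>) (start j \<omega>) (T k \<omega>) (start k \<omega>))"
proof -
  let ?J = "tl_index - {Inr (Inr j)}"
  let ?s = "\<lambda>(k::nat) (x :: unit + nat + nat \<Rightarrow> real). \<lfloor>x (Inl ())\<rfloor> + (\<Sum>i\<in>{1..<k}. \<lfloor>x (Inr (Inl i))\<rfloor>)"
  let ?h = "\<lambda>x. f (x (Inr (Inr k'))) * F (nat \<lfloor>x (Inr (Inl j))\<rfloor>) (?s j x) (nat \<lfloor>x (Inr (Inl k))\<rfloor>) (?s k x)"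
  have comp[measurable]: "(\<lambda>x. x i) \<in> borel_measurable (PiM ?J (\<lambda>_. borel :: real measure))" if "i \<in> ?J" for i
    by (rule measurable_component_singleton[OF that])
  have nm: "(\<lambda>x. nat \<lfloor>x i\<rfloor>) \<in> PiM ?J (\<lambda>_. borel :: real measure) \<rightarrow>\<^sub>M count_space UNIV" if "i \<in> ?J" for i
    using comp[OF that] by measurable
  have hm: "?h \<in> borel_measurable (PiM ?J (\<lambda>_. borel))"
  proof (rule borel_measurable_times)
    show "(\<lambda>x. f (x (Inr (Inr k')))) \<in> borel_measurable (PiM ?J (\<lambda>_. borel))"
      using assms by (intro measurable_compose[OF comp f]) auto
    show "(\<lambda>x. F (nat \<lfloor>x (Inr (Inl j))\<rfloor>) (?s j x) (nat \<lfloor>x (Inr (Inl k))\<rfloor>) (?s k x)) \<in> borel_measurable (PiM ?J (\<lambda>_. borel))"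
    proof (rule count_fun_meas[where F=F and l="\<lambda>x. nat \<lfloor>x (Inr (Inl j))\<rfloor>" and l'="\<lambda>x. nat \<lfloor>x (Inr (Inl k))\<rfloor>" and p="?s j" and p'="?s k"])
      show "(\<lambda>x. nat \<lfloor>x (Inr (Inl j))\<rfloor>) \<in> PiM ?J (\<lambda>_. borel :: real measure) \<rightarrow>\<^sub>M count_space UNIV"
        "(\<lambda>x. nat \<lfloor>x (Inr (Inl k))\<rfloor>) \<in> PiM ?J (\<lambda>_. borel :: real measure) \<rightarrow>\<^sub>M count_space UNIV"
        using assms by (auto intro!: nm)
      show "?s j \<in> PiM ?J (\<lambda>_. borel :: real measure) \<rightarrow>\<^sub>M count_space UNIV"
        "?s k \<in> PiM ?J (\<lambda>_. borel :: real measure) \<rightarrow>\<^sub>M count_space UNIV"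
        by (rule start_rest_meas; simp)+
    qed
  qed
  have "indep_var borel (\<lambda>\<omega>. tl_family S0 T W (Inr (Inr j)) \<omega>) borel (\<lambda>\<omega>. ?h (restrict (\<lambda>i. tl_family S0 T W i \<omega>) ?J))"
    by (rule indep_var_one_vs_rest[OF family_indep _ _ hm, where f="\<lambda>x. x"]) auto
  moreover have "?h (restrict (\<lambda>i. tl_family S0 T W i \<omega>) ?J) = f (W k' \<omega>) * F (T j \<omega>) (start j \<omega>) (T k \<omega>) (start k \<omega>)" for \<omega>
    using assms start_rest[of j ?J \<omega>] start_rest[of k ?J \<omega>] by (simp add: Let_def)
  ultimately show ?thesis by simp
qed

text \<open>The start of block \<open>k\<close> involves only \<open>S0\<close> and the lengths
  before \<open>T k\<close>.\<close>

lemma ind_T: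
  assumes k: "1 \<le> k"
  shows "indep_var borel (\<lambda>\<omega>. f (T k \<omega>) :: real) borel (\<lambda>\<omega>. h (start k \<omega>) :: real)"
proof -
  let ?J = "tl_index - {Inr (Inl k)}"
  let ?s = "\<lambda>(x :: unit + nat + nat \<Rightarrow> real). \<lfloor>x (Inl ())\<rfloor> + (\<Sum>i\<in>{1..<k}. \<lfloor>x (Inr (Inl i))\<rfloor>)"
  have "indep_var borel (\<lambda>\<omega>. f (nat \<lfloor>tl_family S0 T W (Inr (Inl k)) \<omega>\<rfloor>)) borel (\<lambda>\<omega>. h (?s (restrict (\<lambda>i. tl_family S0 T W i \<omega>) ?J)))"
  proof (rule indep_var_one_vs_rest[OF family_indep, where f="\<lambda>x. f (nat \<lfloor>x\<rfloor>)"])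
    show "(\<lambda>x. h (?s x)) \<in> borel_measurable (PiM ?J (\<lambda>_. borel))"
    proof (rule measurable_compose[where f="?s" and g=h and N="count_space UNIV"])
      show "?s \<in> PiM ?J (\<lambda>_. borel :: real measure) \<rightarrow>\<^sub>M count_space UNIV"
        by (rule start_rest_meas) auto
    qed auto
  qed (use k in auto)
  moreover have "h (?s (restrict (\<lambda>i. tl_family S0 T W i \<omega>) ?J)) = h (start k \<omega>)" for \<omega>
    using start_rest[of k ?J \<omega>] by (simp add: Let_def)
  ultimately show ?thesis by simp
qed

lemma ind_WT: "indep_vars (\<lambda>_. borel) (\<lambda>k \<omega>. W k \<omega> * real (T k \<omega>)) {1..}"
proof -
  let ?K = "\<lambda>k. {Inr (Inl k), Inr (Inr k)} :: (unit + nat + nat) set"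
  have "indep_vars (\<lambda>k. PiM (?K k) (\<lambda>_. borel)) (\<lambda>k \<omega>. restrict (\<lambda>i. tl_family S0 T W i \<omega>) (?K k)) {1..}"
    by (rule indep_vars_restrict[OF family_indep]) (auto simp: disjoint_family_on_def)
  then have "indep_vars (\<lambda>_. borel) (\<lambda>k \<omega>. (\<lambda>x. x (Inr (Inr k)) * x (Inr (Inl k))) (restrict (\<lambda>i. tl_family S0 T W i \<omega>) (?K k))) {1..}"
    by (rule indep_vars_compose2) (intro borel_measurable_times measurable_component_singleton, auto)
  then show ?thesis by simp
qed

lemma ind_Ts: "indep_vars (\<lambda>_. borel) (\<lambda>k \<omega>. real (T k \<omega>)) {1..}"
proof -
  let ?K = "\<lambda>k. {Inr (Inl k)} :: (unit + nat + nat) set"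
  have "indep_vars (\<lambda>k. PiM (?K k) (\<lambda>_. borel)) (\<lambda>k \<omega>. restrict (\<lambda>i. tl_family S0 T W i \<omega>) (?K k)) {1..}"
    by (rule indep_vars_restrict[OF family_indep]) (auto simp: disjoint_family_on_def)
  then have "indep_vars (\<lambda>_. borel) (\<lambda>k \<omega>. (\<lambda>x. x (Inr (Inl k))) (restrict (\<lambda>i. tl_family S0 T W i \<omega>) (?K k))) {1..}"
    by (rule indep_vars_compose2) (intro measurable_component_singleton, auto)
  then show ?thesis by simp
qed

lemma W_transfer:
  fixes f :: "real \<Rightarrow> real"
  assumes [measurable]: "f \<in> borel_measurable borel"
  shows "expectation (\<lambda>\<omega>. f (W k \<omega>)) = expectation (\<lambda>\<omega>. f (W 0 \<omega>))"
    "integrable M (\<lambda>\<omega>. f (W k \<omega>)) \<longleftrightarrow> integrable M (\<lambda>\<omega>. f (W 0 \<omega>))"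
proof -
  have "expectation (\<lambda>\<omega>. f (W k \<omega>)) = integral\<^sup>L (distr M borel (W k)) f" by (simp add: integral_distr)
  also have "\<dots> = expectation (\<lambda>\<omega>. f (W 0 \<omega>))" unfolding W_distr[of k] by (simp add: integral_distr)
  finally show "expectation (\<lambda>\<omega>. f (W k \<omega>)) = expectation (\<lambda>\<omega>. f (W 0 \<omega>))" .
  have "integrable M (\<lambda>\<omega>. f (W k \<omega>)) \<longleftrightarrow> integrable (distr M borel (W k)) f" by (simp add: integrable_distr_eq)
  also have "\<dots> \<longleftrightarrow> integrable M (\<lambda>\<omega>. f (W 0 \<omega>))" unfolding W_distr[of k] by (simp add: integrable_distr_eq)
  finally show "integrable M (\<lambda>\<omega>. f (W k \<omega>)) \<longleftrightarrow> integrable M (\<lambda>\<omega>. f (W 0 \<omega>))" .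
qed

lemma tailT: "reg_tail \<alpha> tailT"
  unfolding tailT_def using alpha L T_real_meas[of 1] prob_space_axioms by (intro reg_tail_of_model) auto

lemma mean_ge_1: "1 \<le> mean"
proof -
  have "expectation (\<lambda>\<omega>. 1) \<le> mean"
    unfolding mean_def using T_int T_ge[of 1] by (intro integral_mono_AE) auto
  then show ?thesis by (simp add: prob_space)
qed

text \<open>The start of block \<open>k\<close> is \<open>S0\<close> plus \<open>k - 1\<close>
  lengths. The truncation at 1 disposes of \<open>S0\<close> by dominated convergence, and the law
  of large numbers in mean handles the lengths uniformly in \<open>k\<close>. The one mean by which
  \<open>k * mean\<close> exceeds that of \<open>k - 1\<close> lengths is joined to
  \<open>S0\<close>.\<close>

lemma drift_TL:
  assumes e: "0 < e"
  shows "\<forall>\<^sub>F n in sequentially. \<forall>k\<in>{1..n+1}. expectation (\<lambda>\<omega>. min 1 (\<bar>real_of_int (start k \<omega>) - real k * mean\<bar> / real n)) \<le> e"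
proof -
  have s0: "(\<lambda>n. expectation (\<lambda>\<omega>. min 1 ((real (S0 \<omega>) + mean) / real n))) \<longlonglongrightarrow> expectation (\<lambda>\<omega>. 0)"
  proof (rule integral_dominated_convergence[where w="\<lambda>_. 1"])
    show "AE \<omega> in M. (\<lambda>n. min 1 ((real (S0 \<omega>) + mean) / real n)) \<longlonglongrightarrow> 0"
    proof (rule AE_I2)
      fix \<omega>
      have "(\<lambda>n. min 1 ((real (S0 \<omega>) + mean) / real n)) \<longlonglongrightarrow> min 1 0"
        by (intro tendsto_min tendsto_const lim_const_over_n)
      then show "(\<lambda>n. min 1 ((real (S0 \<omega>) + mean) / real n)) \<longlonglongrightarrow> 0" by simp
    qed
  qed (use mean_ge_1 in auto)
  then have ev1: "\<forall>\<^sub>F n in sequentially. expectation (\<lambda>\<omega>. min 1 ((real (S0 \<omega>) + mean) / real n)) < e / 2"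
    using e by (intro order_tendstoD) auto
  have ev2: "\<forall>\<^sub>F n in sequentially. \<forall>m\<le>n. expectation (\<lambda>\<omega>. \<bar>\<Sum>i\<in>{1..m}. (real (T i \<omega>) - mean)\<bar>) \<le> (e / 2) * real n"
    unfolding mean_def using e by (intro iid_sum_L1_bound[OF ind_Ts T_distr T_int]) auto
  show ?thesis using ev1 ev2 eventually_ge_at_top[of 1]
  proof eventually_elim
    case (elim n)
    show ?case
    proof
      fix k assume k: "k \<in> {1..n+1}"
      define m where "m = k - 1"
      have m: "m \<le> n" "real k = real m + 1" using k by (auto simp: m_def of_nat_diff)
      let ?A = "\<lambda>\<omega>. \<bar>\<Sum>i\<in>{1..m}. (real (T i \<omega>) - mean)\<bar>"
      have Ai: "integrable M ?A"
      proof (intro integrable_abs Bochner_Integration.integrable_sum Bochner_Integration.integrable_diff)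
        fix i assume "i \<in> {1..m}"
        then have i1: "1 \<le> i" by simp
        show "integrable M (\<lambda>\<omega>. real (T i \<omega>))"
          using arg_cong[OF T_distr[OF i1], of "\<lambda>N. integrable N (\<lambda>x. x)"] T_int T_real_meas[OF i1] T_real_meas[of 1]
          by (simp add: integrable_distr_eq)
      qed auto
      have st: "start k \<in> M \<rightarrow>\<^sub>M count_space UNIV" unfolding start_def by measurable
      have "expectation (\<lambda>\<omega>. min 1 (\<bar>real_of_int (start k \<omega>) - real k * mean\<bar> / real n))
         \<le> expectation (\<lambda>\<omega>. min 1 ((real (S0 \<omega>) + mean) / real n) + ?A \<omega> / real n)"
      proof (rule integral_mono)
        note [measurable] = st
        show "integrable M (\<lambda>\<omega>. min 1 (\<bar>real_of_int (start k \<omega>) - real k * mean\<bar> / real n))"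
          by (intro integrable_const_bound[where B=1]) auto
        have "integrable M (\<lambda>\<omega>. min 1 ((real (S0 \<omega>) + mean) / real n))"
          using mean_ge_1 by (intro integrable_const_bound[where B=1]) auto
        then show "integrable M (\<lambda>\<omega>. min 1 ((real (S0 \<omega>) + mean) / real n) + ?A \<omega> / real n)"
          using Ai by (intro Bochner_Integration.integrable_add integrable_divide)
        fix \<omega>
        have "real_of_int (start k \<omega>) - real k * mean = (real (S0 \<omega>) - mean) + (\<Sum>i\<in>{1..m}. (real (T i \<omega>) - mean))"
        proof -
          have "start k \<omega> = int (S0 \<omega>) + (\<Sum>i\<in>{1..m}. int (T i \<omega>))" by (simp add: start_def tl_S_def m_def)
          then show ?thesis by (simp add: sum_subtractf m(2) algebra_simps)
        qed
        then have "\<bar>real_of_int (start k \<omega>) - real k * mean\<bar> \<le> (real (S0 \<omega>) + mean) + ?A \<omega>"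
          using mean_ge_1 by linarith
        then have "\<bar>real_of_int (start k \<omega>) - real k * mean\<bar> / real n \<le> (real (S0 \<omega>) + mean) / real n + ?A \<omega> / real n"
          by (simp add: add_divide_distrib[symmetric] divide_right_mono)
        moreover have "min 1 x \<le> min 1 y + z" if "x \<le> y + z" "0 \<le> z" for x y z :: real using that by auto
        moreover have "0 \<le> ?A \<omega> / real n" by simp
        ultimately show "min 1 (\<bar>real_of_int (start k \<omega>) - real k * mean\<bar> / real n) \<le> min 1 ((real (S0 \<omega>) + mean) / real n) + ?A \<omega> / real n"
          by blast
      qed
      also have "\<dots> = expectation (\<lambda>\<omega>. min 1 ((real (S0 \<omega>) + mean) / real n)) + expectation ?A / real n"
      proof -
        have "integrable M (\<lambda>\<omega>. min 1 ((real (S0 \<omega>) + mean) / real n))"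
          using mean_ge_1 by (intro integrable_const_bound[where B=1]) auto
        then show ?thesis using Ai by simp
      qed
      also have "\<dots> \<le> e / 2 + e / 2"
      proof (rule add_mono)
        show "expectation ?A / real n \<le> e / 2" using elim m by (simp add: pos_divide_le_eq)
      qed (use elim in auto)
      finally show "expectation (\<lambda>\<omega>. min 1 (\<bar>real_of_int (start k \<omega>) - real k * mean\<bar> / real n)) \<le> e" by simp
    qed
  qed
qed

sublocale stable_array M W T start "tail_quantile tailT" tailT \<alpha> mean
proof
  fix k :: nat assume k: "1 \<le> k"
  show "T k \<in> M \<rightarrow>\<^sub>M count_space UNIV" by (rule T_meas[OF k])
  show "start k \<in> M \<rightarrow>\<^sub>M count_space UNIV" unfolding start_def by measurable
  show "distr M borel (W k) = distr M borel (W 1)" using W_distr[of k] W_distr[of 1] by simp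
  show "distr M borel (\<lambda>\<omega>. real (T k \<omega>)) = distr M borel (\<lambda>\<omega>. real (T 1 \<omega>))" by (rule T_distr[OF k])
  fix F :: "nat \<Rightarrow> int \<Rightarrow> real"
  show "indep_var borel (W k) borel (\<lambda>\<omega>. F (T k \<omega>) (start k \<omega>))"
    using ind_W[OF k k, of 0 "\<lambda>_. 1" "\<lambda>l p _ _. F l p"] k by simp
next
  show "integrable M (W 1)" using W_transfer(2)[of "\<lambda>x. x" 1] W0 by simp
  show "expectation (W 1) = 0" using W_transfer(1)[of "\<lambda>x. x" 1] W0 by simp
  show "integrable M (\<lambda>\<omega>. (W 1 \<omega>)\<^sup>2)" using W_transfer(2)[of "\<lambda>x. x\<^sup>2" 1] W0 by simp
next
  fix j k :: nat and F assume "1 \<le> j" "1 \<le> k" "j \<noteq> k"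
  then show "indep_var borel (W j) borel (\<lambda>\<omega>. W k \<omega> * F (T j \<omega>) (start j \<omega>) (T k \<omega>) (start k \<omega>))"
    by (intro ind_W[where f="\<lambda>x. x"]) auto
next
  show "filterlim (tail_quantile tailT) at_top sequentially" by (rule tail_quantile_at_top[OF tailT alpha])
  show "(\<lambda>n. real n * tailT (tail_quantile tailT n)) \<longlonglongrightarrow> 1" by (rule tail_quantile_tendsto[OF tailT alpha])
qed (rule alpha mean_ge_1 W_meas T_int ind_T ind_WT tailT drift_TL tailT_def[symmetric] | assumption)+

lemma tl_X_meas [measurable]: "random_variable borel (tl_X S0 T W t)"
proof -
  have [measurable]: "tl_Sprev S0 T k \<in> M \<rightarrow>\<^sub>M count_space UNIV" for k
    unfolding tl_Sprev_def by (cases k) auto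
  show ?thesis unfolding tl_X_def by measurable
qed

text \<open>Two edge effects: block 0 contains at most \<open>S0\<close> of the observed times, and
  block 1 may contain time 0, which counts in its block sum but not in the transform.\<close>

definition boundary :: "'a \<Rightarrow> real" where "boundary \<omega> = \<bar>W 0 \<omega>\<bar> * real (S0 \<omega>) + \<bar>W 1 \<omega>\<bar>"

text \<open>Since every length is at least 1, block \<open>k\<close> starts at time
  \<open>k - 1\<close> or later. So only blocks up to index \<open>n + 1\<close> can meet the times
  up to \<open>n\<close>, and the series defining the process reduces to a finite sum that may be
  exchanged with the sum over time.\<close>

lemma tl_weighted_sum:
  assumes T1: "\<And>i. 1 \<le> i \<Longrightarrow> 1 \<le> T i \<omega>" and g: "\<And>x. \<bar>g x\<bar> \<le> B" and n: "1 \<le> n"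
  shows "\<bar>(\<Sum>t=1..n. tl_X S0 T W (int t) \<omega> * g (real t / real n)) - (\<Sum>k\<in>{1..n+1}. W k \<omega> * block_sum g n (T k \<omega>) (start k \<omega>))\<bar> \<le> B * boundary \<omega>"
proof -
  have B0: "0 \<le> B" using g[of 0] by linarith
  have S_ge: "int k \<le> tl_S S0 T k \<omega>" for k
  proof -
    have "(\<Sum>i\<in>{1..k}. (1::int)) \<le> (\<Sum>i\<in>{1..k}. int (T i \<omega>))" using T1 by (intro sum_mono) auto
    then show ?thesis by (simp add: tl_S_def)
  qed
  have S_Suc: "tl_S S0 T k \<omega> = tl_Sprev S0 T k \<omega> + int (T k \<omega>)" if "1 \<le> k" for k
    using that by (cases k) (auto simp: tl_S_def tl_Sprev_def)
  have Sp: "tl_Sprev S0 T k \<omega> = start k \<omega>" if "1 \<le> k" for k using that by (simp add: tl_Sprev_def start_def)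
  have start_ge: "int k - 1 \<le> start k \<omega>" if "1 \<le> k" for k
    using that S_ge[of "k - 1"] by (simp add: start_def of_nat_diff)
  define I where "I k t = (if tl_Sprev S0 T k \<omega> \<le> int t \<and> int t < tl_S S0 T k \<omega> then 1 else 0 :: real)" for k t :: nat
  have X: "tl_X S0 T W (int t) \<omega> = (\<Sum>k\<in>{0..n+1}. W k \<omega> * I k t)" if t: "t \<le> n" for t
    unfolding tl_X_def I_def
  proof (rule suminf_finite)
    fix k assume "k \<notin> {0..n+1}"
    then have "int n < start k \<omega>" "1 \<le> k" using start_ge[of k] by auto
    then show "W k \<omega> * (if tl_Sprev S0 T k \<omega> \<le> int t \<and> int t < tl_S S0 T k \<omega> then 1 else 0) = 0"
      using t Sp[of k] by simp
  qed simp
  have "(\<Sum>t=1..n. tl_X S0 T W (int t) \<omega> * g (real t / real n)) = (\<Sum>t=1..n. \<Sum>k\<in>{0..n+1}. W k \<omega> * (I k t * g (real t / real n)))"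
    by (intro sum.cong refl) (simp add: X sum_distrib_right mult.assoc del: sum.cl_ivl_Suc)
  also have "\<dots> = (\<Sum>k\<in>{0..n+1}. W k \<omega> * (\<Sum>t=1..n. I k t * g (real t / real n)))"
    by (subst sum.swap) (simp only: sum_distrib_left)
  also have "\<dots> = W 0 \<omega> * (\<Sum>t=1..n. I 0 t * g (real t / real n)) + (\<Sum>k\<in>{1..n+1}. W k \<omega> * (\<Sum>t=1..n. I k t * g (real t / real n)))"
    by (subst sum.atLeast_Suc_atMost) auto
  finally have e1: "(\<Sum>t=1..n. tl_X S0 T W (int t) \<omega> * g (real t / real n)) = \<dots>" .
  have bs: "block_sum g n (T k \<omega>) (start k \<omega>) = I k 0 * g 0 + (\<Sum>t=1..n. I k t * g (real t / real n))" if k: "1 \<le> k" for k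
  proof -
    have p0: "0 \<le> start k \<omega>" using start_ge[OF k] k by simp
    have "block_sum g n (T k \<omega>) (start k \<omega>) = (\<Sum>t\<in>{0..n}. I k t * g (real t / real n))"
      unfolding block_sum_alt[OF n p0] I_def
      using S_Suc[OF k] Sp[OF k] by (intro sum.cong refl) auto
    also have "\<dots> = I k 0 * g 0 + (\<Sum>t=1..n. I k t * g (real t / real n))"
      by (subst sum.atLeast_Suc_atMost) auto
    finally show ?thesis .
  qed
  have I0: "I k 0 = 0" if "2 \<le> k" for k
  proof -
    have "0 < start k \<omega>" using start_ge[of k] that by auto
    then show ?thesis using that Sp[of k] by (simp add: I_def)
  qed
  have "(\<Sum>k\<in>{1..n+1}. W k \<omega> * block_sum g n (T k \<omega>) (start k \<omega>)) =
     (\<Sum>k\<in>{1..n+1}. W k \<omega> * (I k 0 * g 0)) + (\<Sum>k\<in>{1..n+1}. W k \<omega> * (\<Sum>t=1..n. I k t * g (real t / real n)))"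
    unfolding sum.distrib[symmetric] by (intro sum.cong refl) (use bs in \<open>simp add: distrib_left\<close>)
  also have "(\<Sum>k\<in>{1..n+1}. W k \<omega> * (I k 0 * g 0)) = W 1 \<omega> * (I 1 0 * g 0)"
  proof -
    have "(\<Sum>k\<in>{1..n+1}. W k \<omega> * (I k 0 * g 0)) = (\<Sum>k\<in>{1}. W k \<omega> * (I k 0 * g 0))"
      by (rule sum.mono_neutral_right) (use I0 in auto)
    then show ?thesis by simp
  qed
  finally have e2: "(\<Sum>k\<in>{1..n+1}. W k \<omega> * block_sum g n (T k \<omega>) (start k \<omega>)) =
     W 1 \<omega> * (I 1 0 * g 0) + (\<Sum>k\<in>{1..n+1}. W k \<omega> * (\<Sum>t=1..n. I k t * g (real t / real n)))" .
  have b1: "\<bar>\<Sum>t=1..n. I 0 t * g (real t / real n)\<bar> \<le> B * real (S0 \<omega>)"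
  proof -
    have "\<bar>\<Sum>t=1..n. I 0 t * g (real t / real n)\<bar> \<le> (\<Sum>t=1..n. if t < S0 \<omega> then B else 0)"
      by (rule order_trans[OF sum_abs sum_mono]) (use g B0 in \<open>auto simp: I_def tl_S_def abs_mult\<close>)
    also have "\<dots> = (\<Sum>t\<in>{1..n} \<inter> {t. t < S0 \<omega>}. B)" by (simp only: sum.inter_restrict[OF finite_atLeastAtMost] mem_Collect_eq)
    also have "\<dots> = real (card ({1..n} \<inter> {t. t < S0 \<omega>})) * B" by simp
    also have "\<dots> \<le> real (card {..<S0 \<omega>}) * B" using B0 by (intro mult_right_mono of_nat_mono card_mono) auto
    finally show ?thesis by (simp add: mult.commute)
  qed
  have b2: "\<bar>I 1 0 * g 0\<bar> \<le> B" using g[of 0] B0 by (auto simp: I_def)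
  have "\<bar>W 0 \<omega> * (\<Sum>t=1..n. I 0 t * g (real t / real n)) - W 1 \<omega> * (I 1 0 * g 0)\<bar> \<le> \<bar>W 0 \<omega>\<bar> * (B * real (S0 \<omega>)) + \<bar>W 1 \<omega>\<bar> * B"
    by (rule order_trans[OF abs_triangle_ineq4], unfold abs_mult[of "W _ \<omega>"], intro add_mono mult_left_mono b1 b2) auto
  then show ?thesis unfolding e1 e2 by (simp add: boundary_def algebra_simps)
qed

theorem tl_cf_limit:
  assumes g: "\<And>x. \<bar>g x\<bar> \<le> B" "\<And>x y. \<bar>g x - g y\<bar> \<le> K * \<bar>x - y\<bar>"
  shows "(\<lambda>n. expectation (\<lambda>\<omega>. cis ((\<Sum>t=1..n. tl_X S0 T W (int t) \<omega> * g (real t / real n)) / tail_quantile tailT n)))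
    \<longlonglongrightarrow> exp ((1 / mean) *\<^sub>R (\<integral>s. indicator {0<..<1} s *\<^sub>R qlim (g s) \<partial>lborel))"
proof (rule cf_limit_remainder[OF g])
  show "random_variable borel (\<lambda>\<omega>. (\<Sum>t=1..n. tl_X S0 T W (int t) \<omega> * g (real t / real n)) / tail_quantile tailT n)" for n
    by measurable
  show "random_variable borel (\<lambda>\<omega>. B * boundary \<omega>)" unfolding boundary_def by measurable
  have "AE \<omega> in M. \<forall>i\<in>{1..}. 1 \<le> T i \<omega>" using T_ge by (simp add: AE_ball_countable)
  then show "AE \<omega> in M. \<forall>n\<ge>1. \<bar>(\<Sum>t=1..n. tl_X S0 T W (int t) \<omega> * g (real t / real n)) / tail_quantile tailT n
    - (\<Sum>k\<in>{1..n+1}. W k \<omega> * (block_sum g n (T k \<omega>) (start k \<omega>) / tail_quantile tailT n))\<bar> \<le> B * boundary \<omega> / \<bar>tail_quantile tailT n\<bar>"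
  proof eventually_elim
    case (elim \<omega>)
    show ?case
    proof (intro allI impI)
      fix n :: nat assume n: "1 \<le> n"
      let ?x = "(\<Sum>t=1..n. tl_X S0 T W (int t) \<omega> * g (real t / real n)) - (\<Sum>k\<in>{1..n+1}. W k \<omega> * block_sum g n (T k \<omega>) (start k \<omega>))"
      have "(\<Sum>t=1..n. tl_X S0 T W (int t) \<omega> * g (real t / real n)) / tail_quantile tailT n
        - (\<Sum>k\<in>{1..n+1}. W k \<omega> * (block_sum g n (T k \<omega>) (start k \<omega>) / tail_quantile tailT n)) = ?x / tail_quantile tailT n"
        by (simp only: times_divide_eq_right sum_divide_distrib[symmetric] diff_divide_distrib)
      moreover have "\<bar>?x\<bar> \<le> B * boundary \<omega>" using elim n by (intro tl_weighted_sum g) auto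
      ultimately show "\<bar>(\<Sum>t=1..n. tl_X S0 T W (int t) \<omega> * g (real t / real n)) / tail_quantile tailT n
        - (\<Sum>k\<in>{1..n+1}. W k \<omega> * (block_sum g n (T k \<omega>) (start k \<omega>) / tail_quantile tailT n))\<bar> \<le> B * boundary \<omega> / \<bar>tail_quantile tailT n\<bar>"
        by (simp only: abs_divide) (simp add: divide_right_mono)
    qed
  qed
qed

end

section \<open>Parke's process\<close>

locale parke_process = prob_space M for M :: "'a measure" +
  fixes eps :: "int \<Rightarrow> 'a \<Rightarrow> real" and nn :: "int \<Rightarrow> 'a \<Rightarrow> nat" and \<alpha> :: real and L :: "real \<Rightarrow> real"
  assumes alpha: "1 < \<alpha>" "\<alpha> < 2" and model: "parke_model M eps nn \<alpha> L"
begin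

lemma family_indep: "indep_vars (\<lambda>_. borel) (parke_family eps nn) UNIV"
  and eps_distr: "distr M borel (eps s) = distr M borel (eps 0)"
  and nn_distr: "distr M borel (\<lambda>\<omega>. real (nn s \<omega>)) = distr M borel (\<lambda>\<omega>. real (nn 0 \<omega>))"
  and eps0: "integrable M (eps 0)" "expectation (eps 0) = 0" "integrable M (\<lambda>\<omega>. (eps 0 \<omega>)\<^sup>2)"
  and L: "slowly_varying L" "1 \<le> j \<Longrightarrow> prob {\<omega>\<in>space M. j \<le> nn 0 \<omega>} = L (real j) * real j powr (- \<alpha>)"
  using model unfolding parke_model_def by blast+

lemma family_simps [simp]: "parke_family eps nn (Inl s) = eps s" "parke_family eps nn (Inr s) = (\<lambda>\<omega>. real (nn s \<omega>))"
  by (auto simp: parke_family_def fun_eq_iff)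

lemma fam_meas: "random_variable borel (parke_family eps nn i)"
  using family_indep by (auto simp: indep_vars_def)

lemma eps_meas [measurable]: "random_variable borel (eps s)"
  using fam_meas[of "Inl s"] by simp

lemma nn_real_meas: "random_variable borel (\<lambda>\<omega>. real (nn s \<omega>))"
  using fam_meas[of "Inr s"] by simp

lemma nn_meas [measurable]: "nn s \<in> M \<rightarrow>\<^sub>M count_space UNIV"
  by (rule measurable_nat_of_real[OF nn_real_meas])

definition tailN where "tailN x = prob {\<omega>\<in>space M. x < real (nn 0 \<omega>)}"

lemma tailN: "reg_tail \<alpha> tailN"
  unfolding tailN_def using alpha L nn_real_meas[of 0] prob_space_axioms by (intro reg_tail_of_model) auto

lemma tailN_any: "prob {\<omega>\<in>space M. x < real (nn s \<omega>)} = tailN x"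
proof -
  have "prob {\<omega>\<in>space M. x < real (nn s \<omega>)} = measure (distr M borel (\<lambda>\<omega>. real (nn s \<omega>))) {x<..}"
    by (subst measure_distr[OF nn_real_meas]) (auto intro!: arg_cong[where f=prob])
  also have "\<dots> = measure (distr M borel (\<lambda>\<omega>. real (nn 0 \<omega>))) {x<..}" by (simp only: nn_distr[of s])
  also have "\<dots> = tailN x"
    unfolding tailN_def by (subst measure_distr[OF nn_real_meas]) (auto intro!: arg_cong[where f=prob])
  finally show ?thesis .
qed

text \<open>A shock is active at both ends of the interval from \<open>s\<close> to
  \<open>s + nn s\<close>, hence the extra 1.\<close>

definition block_len :: "nat \<Rightarrow> 'a \<Rightarrow> nat" where "block_len k \<omega> = nn (int k) \<omega> + 1"

lemma block_len_real: "real (block_len k \<omega>) = real (nn (int k) \<omega>) + 1" by (simp add: block_len_def)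

text \<open>As for renewal blocks, \<open>f\<close> and \<open>k'\<close> make one statement serve
  single blocks and pairs; the starts are deterministic, so \<open>F\<close> takes lengths
  only.\<close>

lemma ind_eps:
  fixes F :: "nat \<Rightarrow> nat \<Rightarrow> real"
  assumes "j \<noteq> k'" and f: "f \<in> borel_measurable borel"
  shows "indep_var borel (eps j) borel (\<lambda>\<omega>. f (eps k' \<omega>) * F (nn j \<omega>) (nn k \<omega>))"
proof -
  let ?J = "UNIV - {Inl j} :: (int + int) set"
  let ?h = "\<lambda>x :: int + int \<Rightarrow> real. f (x (Inl k')) * F (nat \<lfloor>x (Inr j)\<rfloor>) (nat \<lfloor>x (Inr k)\<rfloor>)"
  have comp[measurable]: "(\<lambda>x. x i) \<in> borel_measurable (PiM ?J (\<lambda>_. borel :: real measure))" if "i \<in> ?J" for i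
    by (rule measurable_component_singleton[OF that])
  have nm: "(\<lambda>x. nat \<lfloor>x i\<rfloor>) \<in> PiM ?J (\<lambda>_. borel :: real measure) \<rightarrow>\<^sub>M count_space UNIV" if "i \<in> ?J" for i
    using comp[OF that] by measurable
  have hm: "?h \<in> borel_measurable (PiM ?J (\<lambda>_. borel))"
  proof (rule borel_measurable_times)
    show "(\<lambda>x. f (x (Inl k'))) \<in> borel_measurable (PiM ?J (\<lambda>_. borel))"
      using assms by (intro measurable_compose[OF comp f]) auto
    have Fm: "(\<lambda>x. F m (nat \<lfloor>x (Inr k)\<rfloor>)) \<in> borel_measurable (PiM ?J (\<lambda>_. borel :: real measure))" for m
      by (rule measurable_compose[OF nm[of "Inr k"], where g="F m" and L=borel]) auto
    show "(\<lambda>x. F (nat \<lfloor>x (Inr j)\<rfloor>) (nat \<lfloor>x (Inr k)\<rfloor>)) \<in> borel_measurable (PiM ?J (\<lambda>_. borel :: real measure))"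
      by (rule measurable_compose_countable[where f="\<lambda>m x. F m (nat \<lfloor>x (Inr k)\<rfloor>)" and g="\<lambda>x. nat \<lfloor>x (Inr j)\<rfloor>"])
         (rule Fm, rule nm, simp)
  qed
  have "indep_var borel (\<lambda>\<omega>. parke_family eps nn (Inl j) \<omega>) borel (\<lambda>\<omega>. ?h (restrict (\<lambda>i. parke_family eps nn i \<omega>) ?J))"
    by (rule indep_var_one_vs_rest[OF family_indep _ _ hm, where f="\<lambda>x. x"]) auto
  then show ?thesis using assms by simp
qed

text \<open>With deterministic starts, independence of length and start becomes independence from a
  constant.\<close>

lemma ind_nn_const: "indep_var borel (\<lambda>\<omega>. f (nn s \<omega>) :: real) borel (\<lambda>\<omega>. c :: real)"
proof -
  have "indep_var borel (\<lambda>\<omega>. f (nat \<lfloor>parke_family eps nn (Inr s) \<omega>\<rfloor>)) borel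
      (\<lambda>\<omega>. (\<lambda>_. c) (restrict (\<lambda>i. parke_family eps nn i \<omega>) (UNIV - {Inr s})))"
    by (rule indep_var_one_vs_rest[OF family_indep, where f="\<lambda>x. f (nat \<lfloor>x\<rfloor>)"]) auto
  then show ?thesis by simp
qed

lemma ind_prod: "indep_vars (\<lambda>_. borel) (\<lambda>k \<omega>. eps (int k) \<omega> * real (block_len k \<omega>)) {1..}"
proof -
  let ?K = "\<lambda>k. {Inl (int k), Inr (int k)} :: (int + int) set"
  have "indep_vars (\<lambda>k. PiM (?K k) (\<lambda>_. borel)) (\<lambda>k \<omega>. restrict (\<lambda>i. parke_family eps nn i \<omega>) (?K k)) {1..}"
    by (rule indep_vars_restrict[OF family_indep]) (auto simp: disjoint_family_on_def)
  then have "indep_vars (\<lambda>_. borel) (\<lambda>k \<omega>. (\<lambda>x. x (Inl (int k)) * (x (Inr (int k)) + 1)) (restrict (\<lambda>i. parke_family eps nn i \<omega>) (?K k))) {1..}"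
    by (rule indep_vars_compose2) (intro borel_measurable_times borel_measurable_add measurable_component_singleton borel_measurable_const, auto)
  then show ?thesis by (simp add: block_len_real)
qed

lemma eps_transfer:
  fixes f :: "real \<Rightarrow> real"
  assumes [measurable]: "f \<in> borel_measurable borel"
  shows "expectation (\<lambda>\<omega>. f (eps k \<omega>)) = expectation (\<lambda>\<omega>. f (eps 0 \<omega>))"
    "integrable M (\<lambda>\<omega>. f (eps k \<omega>)) \<longleftrightarrow> integrable M (\<lambda>\<omega>. f (eps 0 \<omega>))"
proof -
  have "expectation (\<lambda>\<omega>. f (eps k \<omega>)) = integral\<^sup>L (distr M borel (eps k)) f" by (simp add: integral_distr)
  also have "\<dots> = expectation (\<lambda>\<omega>. f (eps 0 \<omega>))" unfolding eps_distr[of k] by (simp add: integral_distr)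
  finally show "expectation (\<lambda>\<omega>. f (eps k \<omega>)) = expectation (\<lambda>\<omega>. f (eps 0 \<omega>))" .
  have "integrable M (\<lambda>\<omega>. f (eps k \<omega>)) \<longleftrightarrow> integrable (distr M borel (eps k)) f" by (simp add: integrable_distr_eq)
  also have "\<dots> \<longleftrightarrow> integrable M (\<lambda>\<omega>. f (eps 0 \<omega>))" unfolding eps_distr[of k] by (simp add: integrable_distr_eq)
  finally show "integrable M (\<lambda>\<omega>. f (eps k \<omega>)) \<longleftrightarrow> integrable M (\<lambda>\<omega>. f (eps 0 \<omega>))" .
qed

text \<open>The mean is the sum of the tail probabilities, which is finite because
  \<open>1 < \<alpha>\<close>.\<close>

lemma nn_int: "integrable M (\<lambda>\<omega>. real (nn s \<omega>))"
proof (rule integrableI_nonneg)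
  have "(\<integral>\<^sup>+\<omega>. ennreal (real (nn s \<omega>)) \<partial>M) = (\<integral>\<^sup>+\<omega>. of_nat (nn s \<omega>) \<partial>M)" by (simp add: ennreal_of_nat_eq_real_of_nat)
  also have "\<dots> = (\<Sum>t. emeasure M {\<omega>\<in>space M. t < nn s \<omega>})" by (rule nn_integral_nat_function) measurable
  also have "\<dots> = (\<Sum>t. ennreal (tailN (real t)))"
    using tailN_any[of "real _" s] by (simp add: emeasure_eq_measure)
  also have "\<dots> = ennreal (\<Sum>t. tailN (real t))"
    using summable_reg_tail[OF tailN alpha] by (intro suminf_ennreal2) (auto simp: tailN_def)
  also have "\<dots> < \<infinity>" by simp
  finally show "(\<integral>\<^sup>+\<omega>. ennreal (real (nn s \<omega>)) \<partial>M) < \<infinity>" .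
qed auto

text \<open>The scale is the quantile of \<open>nn 0\<close>, as in the theorem, while the lengths
  have the tail shifted by 1; the two are reconciled by the shift ratio tending to 1. Block
  \<open>k\<close> starts exactly at time \<open>k\<close>, so with \<open>\<mu> = 1\<close> the
  drift is zero.\<close>

sublocale stable_array M "\<lambda>k. eps (int k)" block_len "\<lambda>k \<omega>. int k" "tail_quantile tailN" "\<lambda>x. tailN (x - 1)" \<alpha> 1
proof
  fix k :: nat
  show "block_len k \<in> M \<rightarrow>\<^sub>M count_space UNIV" unfolding block_len_def[abs_def] by measurable
  show "distr M borel (eps (int k)) = distr M borel (eps (int 1))"
    using eps_distr[of "int k"] eps_distr[of "int 1"] by simp
  have db: "distr M borel (\<lambda>\<omega>. real (block_len k \<omega>)) = distr (distr M borel (\<lambda>\<omega>. real (nn (int k) \<omega>))) borel (\<lambda>x. x + 1)" for k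
    by (subst distr_distr) (auto simp: comp_def block_len_real)
  show "distr M borel (\<lambda>\<omega>. real (block_len k \<omega>)) = distr M borel (\<lambda>\<omega>. real (block_len 1 \<omega>))"
    by (simp only: db nn_distr[of "int k"] nn_distr[of "int 1"])
  fix F :: "nat \<Rightarrow> int \<Rightarrow> real"
  show "indep_var borel (eps (int k)) borel (\<lambda>\<omega>. F (block_len k \<omega>) (int k))"
    using ind_eps[of "int k" "int k + 1" "\<lambda>_. 1" "\<lambda>l _. F (l + 1) (int k)"] by (simp add: block_len_def)
next
  show "integrable M (eps (int 1))" using eps_transfer(2)[of "\<lambda>x. x" 1] eps0 by simp
  show "expectation (eps (int 1)) = 0" using eps_transfer(1)[of "\<lambda>x. x" 1] eps0 by simp
  show "integrable M (\<lambda>\<omega>. (eps (int 1) \<omega>)\<^sup>2)" using eps_transfer(2)[of "\<lambda>x. x\<^sup>2" 1] eps0 by simp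
  show "integrable M (\<lambda>\<omega>. real (block_len 1 \<omega>))" using nn_int[of 1] by (simp add: block_len_real)
next
  fix j k :: nat and F assume "j \<noteq> k"
  then show "indep_var borel (eps (int j)) borel (\<lambda>\<omega>. eps (int k) \<omega> * F (block_len j \<omega>) (int j) (block_len k \<omega>) (int k))"
    using ind_eps[of "int j" "int k" "\<lambda>x. x" "\<lambda>l l'. F (l + 1) (int j) (l' + 1) (int k)"] by (simp add: block_len_def)
next
  fix k :: nat and f :: "nat \<Rightarrow> real" and h :: "int \<Rightarrow> real"
  show "indep_var borel (\<lambda>\<omega>. f (block_len k \<omega>)) borel (\<lambda>\<omega>. h (int k))"
    unfolding block_len_def by (rule ind_nn_const[where f="\<lambda>l. f (l + 1)"])
next
  fix x :: real
  have "prob {\<omega>\<in>space M. x < real (block_len 1 \<omega>)} = prob {\<omega>\<in>space M. x - 1 < real (nn 1 \<omega>)}"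
    by (simp add: block_len_real less_diff_eq diff_less_eq)
  then show "prob {\<omega>\<in>space M. x < real (block_len 1 \<omega>)} = tailN (x - 1)" by (simp only: tailN_any)
next
  show top: "filterlim (tail_quantile tailN) at_top sequentially" by (rule tail_quantile_at_top[OF tailN alpha])
  have "(\<lambda>n. (real n * tailN (tail_quantile tailN n)) * (tailN (tail_quantile tailN n - 1) / tailN (tail_quantile tailN n))) \<longlonglongrightarrow> 1 * 1"
    by (intro tendsto_mult tail_quantile_tendsto[OF tailN alpha] filterlim_compose[OF reg_tail_shift_ratio[OF tailN] top])
  moreover have "tailN x \<noteq> 0" for x using reg_tailD(2)[OF tailN, of x] by simp
  ultimately show "(\<lambda>n. real n * tailN (tail_quantile tailN n - 1)) \<longlonglongrightarrow> 1" by simp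
next
  fix e :: real assume "0 < e"
  then show "\<forall>\<^sub>F n in sequentially. \<forall>k\<in>{1..n + 1}. expectation (\<lambda>\<omega>. min 1 (\<bar>real_of_int (int k) - real k * 1\<bar> / real n)) \<le> e"
    by simp
qed (use alpha ind_prod reg_tail_shift[OF tailN] in auto)

lemma parke_X_meas [measurable]: "random_variable borel (parke_X eps nn t)"
  unfolding parke_X_def by measurable

text \<open>Collects the blocks that start at a time \<open>- m \<le> 0\<close> and are still active
  at time 1; such a block contains at most \<open>nn (- m)\<close> of the observed times. Writing it
  as a series makes it measurable, and almost surely all but finitely many terms vanish.\<close>

definition boundary :: "'a \<Rightarrow> real" where
  "boundary \<omega> = (\<Sum>m. \<bar>eps (- int m) \<omega>\<bar> * (if m + 1 \<le> nn (- int m) \<omega> then real (nn (- int m) \<omega>) else 0))"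

lemma boundary_meas [measurable]: "random_variable borel boundary"
  unfolding boundary_def by measurable

text \<open>The block started at \<open>- m\<close> reaches time 1 with probability
  \<open>tailN m\<close>, which is summable in \<open>m\<close>, so Borel-Cantelli applies.\<close>

lemma AE_few_past: "AE \<omega> in M. \<exists>m0. \<forall>m\<ge>m0. nn (- int m) \<omega> \<le> m"
proof -
  have "AE \<omega> in M. eventually (\<lambda>m. \<omega> \<in> space M - {\<omega>\<in>space M. m < nn (- int m) \<omega>}) sequentially"
  proof (rule borel_cantelli_AE1)
    have "prob {\<omega>\<in>space M. m < nn (- int m) \<omega>} = tailN (real m)" for m
      using tailN_any[of "real m" "- int m"] by simp
    then show "summable (\<lambda>m. prob {\<omega>\<in>space M. m < nn (- int m) \<omega>})"
      using summable_reg_tail[OF tailN alpha] by simp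
  qed (auto simp: emeasure_eq_measure)
  then show ?thesis
    by eventually_elim (auto simp: eventually_sequentially not_less)
qed

text \<open>Almost surely only finitely many blocks start at a time \<open>s \<le> 0\<close> and reach time 1, and their
  total weight is bounded by a random variable that does not depend on \<open>n\<close>.\<close>

lemma parke_weighted_sum:
  assumes m0: "\<And>m. m0 \<le> m \<Longrightarrow> nn (- int m) \<omega> \<le> m" and g: "\<And>x. \<bar>g x\<bar> \<le> B" and n: "1 \<le> n"
  shows "\<bar>(\<Sum>t=1..n. parke_X eps nn (int t) \<omega> * g (real t / real n)) - (\<Sum>k\<in>{1..n+1}. eps (int k) \<omega> * block_sum g n (block_len k \<omega>) (int k))\<bar> \<le> B * boundary \<omega>"
proof -
  have B0: "0 \<le> B" using g[of 0] by linarith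
  define I where "I k t = (if int k \<le> int t \<and> int t < int k + int (block_len k \<omega>) then 1 else 0 :: real)" for k t :: nat
  define P where "P m t = (if t + m \<le> nn (- int m) \<omega> then 1 else 0 :: real)" for m t :: nat
  have X: "parke_X eps nn (int t) \<omega> = (\<Sum>k\<in>{1..n+1}. eps (int k) \<omega> * I k t) + (\<Sum>m<m0. eps (- int m) \<omega> * P m t)"
    if t: "t \<in> {1..n}" for t
  proof -
    \<comment> \<open>\<open>k\<close> counts backwards from \<open>t\<close>: the terms with
      \<open>k < t\<close> are blocks started within the sample, and \<open>k = t + m\<close> is the
      block started at \<open>- m\<close>.\<close>
    let ?a = "\<lambda>k. eps (int t - int k) \<omega> * (if k \<le> nn (int t - int k) \<omega> then 1 else 0)"
    have "parke_X eps nn (int t) \<omega> = (\<Sum>k<t + m0. ?a k)"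
      unfolding parke_X_def
    proof (rule suminf_finite)
      fix k assume "k \<notin> {..<t + m0}"
      then have k: "t + m0 \<le> k" by simp
      then have "nn (- int (k - t)) \<omega> \<le> k - t" by (intro m0) auto
      moreover have "- int (k - t) = int t - int k" using k by (simp add: of_nat_diff)
      ultimately have "nn (int t - int k) \<omega> < k" using k t by auto
      then show "?a k = 0" by simp
    qed simp
    also have "\<dots> = (\<Sum>k<t. ?a k) + (\<Sum>m<m0. ?a (t + m))"
    proof -
      have eqs: "{..<t + m0} = {..<t} \<union> {t..<t + m0}" by auto
      have "{..<t} \<inter> {t..<t + m0} = {}" by auto
      then have "(\<Sum>k<t + m0. ?a k) = (\<Sum>k<t. ?a k) + (\<Sum>k\<in>{t..<t + m0}. ?a k)"
        unfolding eqs by (intro sum.union_disjoint finite_lessThan finite_atLeastLessThan)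
      also have "(\<Sum>k\<in>{t..<t + m0}. ?a k) = (\<Sum>m<m0. ?a (t + m))"
        by (rule sum.reindex_bij_witness[of _ "\<lambda>m. t + m" "\<lambda>k. k - t"]) auto
      finally show ?thesis .
    qed
    also have "(\<Sum>m<m0. ?a (t + m)) = (\<Sum>m<m0. eps (- int m) \<omega> * P m t)" by (simp add: P_def)
    also have "(\<Sum>k<t. ?a k) = (\<Sum>s\<in>{1..t}. eps (int s) \<omega> * I s t)"
      by (rule sum.reindex_bij_witness[of _ "\<lambda>s. t - s" "\<lambda>k. t - k"]) (auto simp: I_def block_len_def of_nat_diff)
    \<comment> \<open>Blocks starting after \<open>t\<close> contribute 0, so the index set can be
      enlarged to one that is the same for all \<open>t\<close>.\<close>
    also have "\<dots> = (\<Sum>s\<in>{1..n+1}. eps (int s) \<omega> * I s t)"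
      by (rule sum.mono_neutral_left) (use t in \<open>auto simp: I_def\<close>)
    finally show ?thesis .
  qed
  have "(\<Sum>t=1..n. parke_X eps nn (int t) \<omega> * g (real t / real n)) =
     (\<Sum>t=1..n. \<Sum>k\<in>{1..n+1}. eps (int k) \<omega> * (I k t * g (real t / real n))) + (\<Sum>t=1..n. \<Sum>m<m0. eps (- int m) \<omega> * (P m t * g (real t / real n)))"
    unfolding sum.distrib[symmetric]
    by (intro sum.cong refl) (simp add: X distrib_right sum_distrib_right mult.assoc del: sum.cl_ivl_Suc)
  also have "(\<Sum>t=1..n. \<Sum>k\<in>{1..n+1}. eps (int k) \<omega> * (I k t * g (real t / real n))) = (\<Sum>k\<in>{1..n+1}. eps (int k) \<omega> * block_sum g n (block_len k \<omega>) (int k))"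
  proof -
    have bs: "block_sum g n (block_len k \<omega>) (int k) = (\<Sum>t=1..n. I k t * g (real t / real n))" if k: "k \<in> {1..n+1}" for k
    proof -
      have "block_sum g n (block_len k \<omega>) (int k) = (\<Sum>t\<in>{0..n}. I k t * g (real t / real n))"
        unfolding block_sum_alt[OF n of_nat_0_le_iff] I_def by (intro sum.cong refl) auto
      also have "\<dots> = (\<Sum>t=1..n. I k t * g (real t / real n))"
        using k by (subst sum.atLeast_Suc_atMost) (auto simp: I_def)
      finally show ?thesis .
    qed
    show ?thesis by (subst sum.swap) (intro sum.cong refl, simp only: bs sum_distrib_left)
  qed
  also have "(\<Sum>t=1..n. \<Sum>m<m0. eps (- int m) \<omega> * (P m t * g (real t / real n))) = (\<Sum>m<m0. eps (- int m) \<omega> * (\<Sum>t=1..n. P m t * g (real t / real n)))"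
    by (subst sum.swap) (simp only: sum_distrib_left)
  finally have e: "(\<Sum>t=1..n. parke_X eps nn (int t) \<omega> * g (real t / real n)) - (\<Sum>k\<in>{1..n+1}. eps (int k) \<omega> * block_sum g n (block_len k \<omega>) (int k))
     = (\<Sum>m<m0. eps (- int m) \<omega> * (\<Sum>t=1..n. P m t * g (real t / real n)))" by simp
  let ?r = "\<lambda>m. \<bar>eps (- int m) \<omega>\<bar> * (if m + 1 \<le> nn (- int m) \<omega> then real (nn (- int m) \<omega>) else 0)"
  have b: "\<bar>\<Sum>t=1..n. P m t * g (real t / real n)\<bar> \<le> B * (if m + 1 \<le> nn (- int m) \<omega> then real (nn (- int m) \<omega>) else 0)" for m
  proof -
    let ?N = "nn (- int m) \<omega>"
    have "\<bar>\<Sum>t=1..n. P m t * g (real t / real n)\<bar> \<le> (\<Sum>t=1..n. if t + m \<le> ?N then B else 0)"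
      by (rule order_trans[OF sum_abs sum_mono]) (use g in \<open>auto simp: P_def\<close>)
    also have "\<dots> = (\<Sum>t\<in>{1..n} \<inter> {t. t + m \<le> ?N}. B)" by (simp only: sum.inter_restrict[OF finite_atLeastAtMost] mem_Collect_eq)
    also have "\<dots> = B * real (card ({1..n} \<inter> {t. t + m \<le> ?N}))" by simp
    also have "\<dots> \<le> B * (if m + 1 \<le> ?N then real ?N else 0)"
    proof (rule mult_left_mono[OF _ B0])
      show "real (card ({1..n} \<inter> {t. t + m \<le> ?N})) \<le> (if m + 1 \<le> ?N then real ?N else 0)"
      proof (cases "m + 1 \<le> ?N")
        case True
        have "card ({1..n} \<inter> {t. t + m \<le> ?N}) \<le> card {1..?N}" by (intro card_mono) auto
        then show ?thesis using True by simp
      next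
        case False
        then have "{1..n} \<inter> {t. t + m \<le> ?N} = {}" by auto
        then show ?thesis using False by simp
      qed
    qed
    finally show ?thesis .
  qed
  have "\<bar>\<Sum>m<m0. eps (- int m) \<omega> * (\<Sum>t=1..n. P m t * g (real t / real n))\<bar> \<le> (\<Sum>m<m0. B * ?r m)"
  proof (rule order_trans[OF sum_abs sum_mono])
    fix m
    have "\<bar>eps (- int m) \<omega>\<bar> * \<bar>\<Sum>t=1..n. P m t * g (real t / real n)\<bar> \<le> \<bar>eps (- int m) \<omega>\<bar> * (B * (if m + 1 \<le> nn (- int m) \<omega> then real (nn (- int m) \<omega>) else 0))"
      by (rule mult_left_mono[OF b]) simp
    then show "\<bar>eps (- int m) \<omega> * (\<Sum>t=1..n. P m t * g (real t / real n))\<bar> \<le> B * ?r m" by (simp only: abs_mult mult.left_commute)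
  qed
  also have "\<dots> = B * (\<Sum>m<m0. ?r m)" by (simp only: sum_distrib_left)
  also have "(\<Sum>m<m0. ?r m) = boundary \<omega>"
    unfolding boundary_def
  proof (rule suminf_finite[symmetric])
    fix m assume "m \<notin> {..<m0}"
    then have "nn (- int m) \<omega> \<le> m" by (intro m0) auto
    then show "?r m = 0" by simp
  qed simp
  finally show ?thesis unfolding e .
qed

theorem parke_cf_limit:
  assumes g: "\<And>x. \<bar>g x\<bar> \<le> B" "\<And>x y. \<bar>g x - g y\<bar> \<le> K * \<bar>x - y\<bar>"
  shows "(\<lambda>n. expectation (\<lambda>\<omega>. cis ((\<Sum>t=1..n. parke_X eps nn (int t) \<omega> * g (real t / real n)) / tail_quantile tailN n)))
    \<longlonglongrightarrow> exp ((1 / 1) *\<^sub>R (\<integral>s. indicator {0<..<1} s *\<^sub>R qlim (g s) \<partial>lborel))"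
proof (rule cf_limit_remainder[OF g])
  show "random_variable borel (\<lambda>\<omega>. (\<Sum>t=1..n. parke_X eps nn (int t) \<omega> * g (real t / real n)) / tail_quantile tailN n)" for n
    by measurable
  show "random_variable borel (\<lambda>\<omega>. B * boundary \<omega>)" by measurable
  show "AE \<omega> in M. \<forall>n\<ge>1. \<bar>(\<Sum>t=1..n. parke_X eps nn (int t) \<omega> * g (real t / real n)) / tail_quantile tailN n
    - (\<Sum>k\<in>{1..n+1}. eps (int k) \<omega> * (block_sum g n (block_len k \<omega>) (int k) / tail_quantile tailN n))\<bar> \<le> B * boundary \<omega> / \<bar>tail_quantile tailN n\<bar>"
    using AE_few_past
  proof eventually_elim
    case (elim \<omega>)
    then obtain m0 where m0: "\<And>m. m0 \<le> m \<Longrightarrow> nn (- int m) \<omega> \<le> m" by auto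
    show ?case
    proof (intro allI impI)
      fix n :: nat assume n: "1 \<le> n"
      let ?x = "(\<Sum>t=1..n. parke_X eps nn (int t) \<omega> * g (real t / real n)) - (\<Sum>k\<in>{1..n+1}. eps (int k) \<omega> * block_sum g n (block_len k \<omega>) (int k))"
      have "(\<Sum>t=1..n. parke_X eps nn (int t) \<omega> * g (real t / real n)) / tail_quantile tailN n
        - (\<Sum>k\<in>{1..n+1}. eps (int k) \<omega> * (block_sum g n (block_len k \<omega>) (int k) / tail_quantile tailN n)) = ?x / tail_quantile tailN n"
        by (simp only: times_divide_eq_right sum_divide_distrib[symmetric] diff_divide_distrib)
      moreover have "\<bar>?x\<bar> \<le> B * boundary \<omega>" using n by (intro parke_weighted_sum[OF m0] g) auto
      ultimately show "\<bar>(\<Sum>t=1..n. parke_X eps nn (int t) \<omega> * g (real t / real n)) / tail_quantile tailN n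
        - (\<Sum>k\<in>{1..n+1}. eps (int k) \<omega> * (block_sum g n (block_len k \<omega>) (int k) / tail_quantile tailN n))\<bar> \<le> B * boundary \<omega> / \<bar>tail_quantile tailN n\<bar>"
        by (simp only: abs_divide) (simp add: divide_right_mono)
    qed
  qed
qed

end

section \<open>Stochastic integrals and the limit theorem\<close>

text \<open>The exponent of the Levy process per unit of time, with the sign that puts
  \<open>- stable_psi\<close> into the exponential.\<close>

definition stable_psi :: "real \<Rightarrow> real \<Rightarrow> real \<Rightarrow> real \<Rightarrow> complex" where
  "stable_psi \<alpha> c \<beta> u = of_real (\<bar>u\<bar> powr \<alpha> * c) * (1 - \<i> * of_real (\<beta> * sgn u * tan (pi * \<alpha> / 2)))"

text \<open>The discontinuous \<open>sgn u\<close> occurs only multiplied by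
  \<open>\<bar>u\<bar> powr \<alpha>\<close>, and this product is the difference of the powers of
  the positive and the negative part of \<open>u\<close>.\<close>

lemma stable_psi_continuous:
  assumes \<alpha>: "0 < \<alpha>"
  shows "continuous_on UNIV (stable_psi \<alpha> c \<beta>)"
proof -
  have "stable_psi \<alpha> c \<beta> = (\<lambda>u. of_real (c * \<bar>u\<bar> powr \<alpha>) - \<i> * of_real (c * \<beta> * tan (pi * \<alpha> / 2) * (max u 0 powr \<alpha> - max (- u) 0 powr \<alpha>)))"
    by (auto simp: stable_psi_def fun_eq_iff sgn_if max_def algebra_simps)
  moreover have "continuous_on UNIV (\<lambda>u. of_real (c * \<bar>u\<bar> powr \<alpha>) - \<i> * complex_of_real (c * \<beta> * tan (pi * \<alpha> / 2) * (max u 0 powr \<alpha> - max (- u) 0 powr \<alpha>)))"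
    using \<alpha> by (intro continuous_intros continuous_on_powr') auto
  ultimately show ?thesis by simp
qed

text \<open>Convergence in probability in the bounded form that passes to characteristic
  functions.\<close>

lemma conv_in_prob_min:
  assumes "prob_space M" and Y: "\<And>m. Y m \<in> borel_measurable M" and Z: "Z \<in> borel_measurable M"
    and conv: "conv_in_prob M Y Z" and c: "0 \<le> c"
  shows "(\<lambda>m. \<integral>\<omega>. min 2 (c * norm (Y m \<omega> - Z \<omega>)) \<partial>M) \<longlonglongrightarrow> 0"
proof -
  interpret prob_space M by fact
  note [measurable] = Y Z
  show ?thesis
  proof (rule LIMSEQ_I)
    fix r :: real assume r: "0 < r"
    define e where "e = r / (2 * (c + 1))"
    have e: "0 < e" "c * e < r / 2" using r c by (auto simp: e_def field_simps)
    have "(\<lambda>m. prob {\<omega>\<in>space M. e < norm (Y m \<omega> - Z \<omega>)}) \<longlonglongrightarrow> 0"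
      using conv e by (auto simp: conv_in_prob_def)
    then have "\<forall>\<^sub>F m in sequentially. prob {\<omega>\<in>space M. e < norm (Y m \<omega> - Z \<omega>)} < r / 4"
      using r by (intro order_tendstoD) auto
    then have "\<forall>\<^sub>F m in sequentially. norm ((\<integral>\<omega>. min 2 (c * norm (Y m \<omega> - Z \<omega>)) \<partial>M) - 0) < r"
    proof eventually_elim
      case (elim m)
      let ?E = "{\<omega>\<in>space M. e < norm (Y m \<omega> - Z \<omega>)}"
      have i: "integrable M (\<lambda>\<omega>. min 2 (c * norm (Y m \<omega> - Z \<omega>)))"
        using c by (intro integrable_const_bound[where B=2]) auto
      have "(\<integral>\<omega>. min 2 (c * norm (Y m \<omega> - Z \<omega>)) \<partial>M) \<le> (\<integral>\<omega>. c * e + 2 * indicator ?E \<omega> \<partial>M)"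
      proof (rule integral_mono[OF i])
        show "integrable M (\<lambda>\<omega>. c * e + 2 * indicator ?E \<omega>)" by (auto simp: emeasure_eq_measure)
        fix \<omega> assume \<omega>: "\<omega> \<in> space M"
        show "min 2 (c * norm (Y m \<omega> - Z \<omega>)) \<le> c * e + 2 * indicator ?E \<omega>"
        proof (cases "e < norm (Y m \<omega> - Z \<omega>)")
          case True
          then show ?thesis using \<omega> c e by (auto intro!: min.coboundedI1)
        next
          case False
          then have "c * norm (Y m \<omega> - Z \<omega>) \<le> c * e" using c by (intro mult_left_mono) auto
          then show ?thesis using False by (auto intro!: min.coboundedI2)
        qed
      qed
      also have "\<dots> = c * e + 2 * prob ?E"
        by (subst Bochner_Integration.integral_add) (auto simp: emeasure_eq_measure prob_space)
      finally have "(\<integral>\<omega>. min 2 (c * norm (Y m \<omega> - Z \<omega>)) \<partial>M) < r" using elim e by linarith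
      moreover have "0 \<le> (\<integral>\<omega>. min 2 (c * norm (Y m \<omega> - Z \<omega>)) \<partial>M)" using c by (intro integral_nonneg_AE) auto
      ultimately show ?case by simp
    qed
    then show "\<exists>no. \<forall>m\<ge>no. norm ((\<integral>\<omega>. min 2 (c * norm (Y m \<omega> - Z \<omega>)) \<partial>M) - 0) < r"
      by (simp add: eventually_sequentially)
  qed
qed

text \<open>Independence of the increments over cells of length \<open>1 / m\<close> makes the
  characteristic function a product, whose exponent is already a Riemann sum of
  \<open>stable_psi\<close>.\<close>

lemma stable_increment_sum_cf:
  assumes levy: "stable_levy M \<Lambda> \<alpha> c \<beta>" and m: "1 \<le> m"
  shows "(\<integral>\<omega>. cis (\<Sum>k<m. h k * (\<Lambda> (real (Suc k) / real m) \<omega> - \<Lambda> (real k / real m) \<omega>)) \<partial>M)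
    = exp (- ((1 / real m) *\<^sub>R (\<Sum>k<m. stable_psi \<alpha> c \<beta> (h k))))"
proof -
  interpret prob_space M using levy by (simp add: stable_levy_def)
  let ?t = "\<lambda>k. real k / real m"
  let ?X = "\<lambda>k \<omega>. h k * (\<Lambda> (?t (Suc k)) \<omega> - \<Lambda> (?t k) \<omega>)"
  have "incseq ?t" by (auto simp: incseq_def divide_right_mono)
  then have "indep_vars (\<lambda>_. borel) (\<lambda>i \<omega>. \<Lambda> (?t (Suc i)) \<omega> - \<Lambda> (?t i) \<omega>) {..<m}"
    using levy unfolding stable_levy_def by (auto elim!: allE[of _ ?t] allE[of _ m])
  then have iv: "indep_vars (\<lambda>_. borel) ?X {..<m}"
    by (rule indep_vars_compose2[where Y="\<lambda>k x. h k * x"]) auto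
  then have Xm: "random_variable borel (?X k)" if "k \<in> {..<m}" for k
    using that by (auto simp: indep_vars_def)
  then have Sm: "random_variable borel (\<lambda>\<omega>. \<Sum>k<m. ?X k \<omega>)" by (rule borel_measurable_sum)
  have "char (distr M borel (\<lambda>\<omega>. \<Sum>k\<in>{..<m}. ?X k \<omega>)) 1 = (\<Prod>k\<in>{..<m}. char (distr M borel (?X k)) 1)"
    by (rule char_distr_sum[OF iv])
  also have "char (distr M borel (\<lambda>\<omega>. \<Sum>k\<in>{..<m}. ?X k \<omega>)) 1 = expectation (\<lambda>\<omega>. cis (\<Sum>k<m. ?X k \<omega>))"
    unfolding char_def cis_conv_exp by (subst integral_distr[OF Sm]) auto
  also have "(\<Prod>k\<in>{..<m}. char (distr M borel (?X k)) 1) = (\<Prod>k\<in>{..<m}. exp (- ((1 / real m) *\<^sub>R stable_psi \<alpha> c \<beta> (h k))))"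
  proof (rule prod.cong[OF refl])
    fix k assume k: "k \<in> {..<m}"
    have "char (distr M borel (?X k)) 1 = expectation (\<lambda>\<omega>. cis (?X k \<omega>))"
      unfolding char_def cis_conv_exp by (subst integral_distr[OF Xm[OF k]]) auto
    also have "\<dots> = exp (- (of_real ((?t (Suc k) - ?t k) * \<bar>h k\<bar> powr \<alpha> * c) * (1 - \<i> * of_real (\<beta> * sgn (h k) * tan (pi * \<alpha> / 2)))))"
      using levy unfolding stable_levy_def by (auto simp: divide_right_mono)
    also have "?t (Suc k) - ?t k = 1 / real m" by (simp add: diff_divide_distrib[symmetric])
    also have "complex_of_real (1 / real m * \<bar>h k\<bar> powr \<alpha> * c) * (1 - \<i> * of_real (\<beta> * sgn (h k) * tan (pi * \<alpha> / 2)))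
       = (1 / real m) *\<^sub>R stable_psi \<alpha> c \<beta> (h k)"
      by (simp add: stable_psi_def scaleR_conv_of_real mult.assoc)
    finally show "char (distr M borel (?X k)) 1 = exp (- ((1 / real m) *\<^sub>R stable_psi \<alpha> c \<beta> (h k)))" .
  qed
  also have "\<dots> = exp (\<Sum>k<m. - ((1 / real m) *\<^sub>R stable_psi \<alpha> c \<beta> (h k)))" by (simp add: exp_sum)
  also have "(\<Sum>k<m. - ((1 / real m) *\<^sub>R stable_psi \<alpha> c \<beta> (h k))) = - ((1 / real m) *\<^sub>R (\<Sum>k<m. stable_psi \<alpha> c \<beta> (h k)))"
    by (simp add: scaleR_sum_right sum_negf)
  finally show ?thesis .
qed

text \<open>A linear functional of the integrals is the limit in probability of one
  Riemann-Stieltjes sum with a real integrand \<open>g\<close>, whose characteristic function is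
  explicit. Continuity of the exponent turns the limit into an integral.\<close>

lemma stable_integral_cf:
  fixes I :: "'q::finite \<Rightarrow> 'b \<Rightarrow> complex" and f :: "'q \<Rightarrow> real \<Rightarrow> complex" and \<theta> :: "'q \<Rightarrow> complex"
  assumes levy: "stable_levy M \<Lambda> \<alpha> c \<beta>" and \<alpha>: "0 < \<alpha>"
    and I: "\<And>q. stoch_integral M \<Lambda> (f q) (I q)"
    and f: "\<And>q. continuous_on UNIV (f q)" and fb: "\<And>q s. norm (f q s) \<le> 1"
  shows "(\<integral>\<omega>. cis (\<Sum>q\<in>UNIV. \<theta> q \<bullet> I q \<omega>) \<partial>M) =
    exp (- (\<integral>s. indicator {0<..<1} s *\<^sub>R stable_psi \<alpha> c \<beta> (\<Sum>q\<in>UNIV. \<theta> q \<bullet> f q s) \<partial>lborel))"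
proof -
  interpret prob_space M using levy by (simp add: stable_levy_def)
  let ?\<psi> = "stable_psi \<alpha> c \<beta>"
  define g where "g s = (\<Sum>q\<in>UNIV. \<theta> q \<bullet> f q s)" for s
  define R where "R m \<omega> = (\<Sum>q\<in>UNIV. \<theta> q \<bullet> riemann_sum \<Lambda> (f q) m \<omega>)" for m \<omega>
  define Z where "Z \<omega> = (\<Sum>q\<in>UNIV. \<theta> q \<bullet> I q \<omega>)" for \<omega>
  have \<Lambda>m: "random_variable borel (\<Lambda> t)" if "0 \<le> t" for t using levy that by (auto simp: stable_levy_def)
  have Rm[measurable]: "random_variable borel (riemann_sum \<Lambda> (f q) m)" for q m
  proof -
    have "random_variable borel (\<lambda>\<omega>. f q (real k / real m) * complex_of_real (\<Lambda> (real (Suc k) / real m) \<omega> - \<Lambda> (real k / real m) \<omega>))" for k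
      using \<Lambda>m[of "real (Suc k) / real m"] \<Lambda>m[of "real k / real m"] by measurable
    then show ?thesis unfolding riemann_sum_def[abs_def] by (rule borel_measurable_sum)
  qed
  have Im[measurable]: "random_variable borel (I q)" for q using I by (simp add: stoch_integral_def)
  have [measurable]: "random_variable borel (R m)" "random_variable borel Z" for m unfolding R_def Z_def by measurable
  have gc: "continuous_on UNIV g" unfolding g_def using f by (intro continuous_intros) auto
  have pc: "continuous_on UNIV (\<lambda>s. ?\<psi> (g s))"
    by (rule continuous_on_compose2[OF stable_psi_continuous[OF \<alpha>] gc]) auto
  have Rg: "R m \<omega> = (\<Sum>k<m. g (real k / real m) * (\<Lambda> (real (Suc k) / real m) \<omega> - \<Lambda> (real k / real m) \<omega>))" for m \<omega>
  proof -
    have "\<theta> q \<bullet> riemann_sum \<Lambda> (f q) m \<omega> = (\<Sum>k<m. (\<theta> q \<bullet> f q (real k / real m)) * (\<Lambda> (real (Suc k) / real m) \<omega> - \<Lambda> (real k / real m) \<omega>))" for q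
      unfolding riemann_sum_def inner_sum_right
      by (intro sum.cong refl) (simp only: mult.commute[of "f q _"] flip: scaleR_conv_of_real inner_scaleR_right, simp)
    then have "R m \<omega> = (\<Sum>q\<in>UNIV. \<Sum>k<m. (\<theta> q \<bullet> f q (real k / real m)) * (\<Lambda> (real (Suc k) / real m) \<omega> - \<Lambda> (real k / real m) \<omega>))"
      by (simp add: R_def)
    also have "\<dots> = (\<Sum>k<m. g (real k / real m) * (\<Lambda> (real (Suc k) / real m) \<omega> - \<Lambda> (real k / real m) \<omega>))"
      by (subst sum.swap) (simp add: g_def sum_distrib_right)
    finally show ?thesis .
  qed
  have gb: "\<bar>g s\<bar> \<le> (\<Sum>q\<in>UNIV. norm (\<theta> q))" for s
  proof -
    have "\<bar>g s\<bar> \<le> (\<Sum>q\<in>UNIV. norm (\<theta> q) * 1)"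
      unfolding g_def
    proof (rule order_trans[OF sum_abs sum_mono])
      fix q
      have "\<bar>\<theta> q \<bullet> f q s\<bar> \<le> norm (\<theta> q) * norm (f q s)" by (rule Cauchy_Schwarz_ineq2)
      also have "\<dots> \<le> norm (\<theta> q) * 1" by (intro mult_left_mono fb) auto
      finally show "\<bar>\<theta> q \<bullet> f q s\<bar> \<le> norm (\<theta> q) * 1" .
    qed
    then show ?thesis by simp
  qed
  obtain K where K: "\<And>s. norm (?\<psi> (g s)) \<le> K"
  proof -
    let ?B = "\<Sum>q\<in>UNIV. norm (\<theta> q)"
    have "compact (?\<psi> ` {- ?B..?B})"
      by (intro compact_continuous_image continuous_on_subset[OF stable_psi_continuous[OF \<alpha>]]) auto
    then obtain K where "\<And>x. x \<in> ?\<psi> ` {- ?B..?B} \<Longrightarrow> norm x \<le> K"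
      using compact_imp_bounded bounded_iff by metis
    moreover have "g s \<in> {- ?B..?B}" for s using gb[of s] by (simp add: abs_le_iff)
    ultimately show ?thesis using that by blast
  qed
  have "(\<lambda>m. (1 / real m) *\<^sub>R (\<Sum>k\<in>{1..m}. ?\<psi> (g (real k / real m)))) \<longlonglongrightarrow> (\<integral>s. indicator {0<..<1} s *\<^sub>R ?\<psi> (g s) \<partial>lborel)"
  proof (rule riemann_limit[where N=0 and K=K and e=0])
    fix s u assume "u \<longlonglongrightarrow> (s::real)"
    then show "(\<lambda>n. ?\<psi> (g (u n))) \<longlonglongrightarrow> ?\<psi> (g s)"
      by (rule continuous_on_tendsto_compose[OF pc]) auto
  qed (use K pc in \<open>auto intro: borel_measurable_continuous_onI\<close>)
  \<comment> \<open>The stochastic sums use left endpoints, \<open>riemann_limit\<close> right ones;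
    the two differ by the boundary values divided by \<open>m\<close>.\<close>
  moreover have "(\<lambda>m. (1 / real m) *\<^sub>R (?\<psi> (g 0) - ?\<psi> (g 1))) \<longlonglongrightarrow> 0 *\<^sub>R (?\<psi> (g 0) - ?\<psi> (g 1))"
    by (intro tendsto_scaleR lim_const_over_n tendsto_const)
  ultimately have "(\<lambda>m. (1 / real m) *\<^sub>R (\<Sum>k\<in>{1..m}. ?\<psi> (g (real k / real m))) + (1 / real m) *\<^sub>R (?\<psi> (g 0) - ?\<psi> (g 1)))
      \<longlonglongrightarrow> (\<integral>s. indicator {0<..<1} s *\<^sub>R ?\<psi> (g s) \<partial>lborel) + 0 *\<^sub>R (?\<psi> (g 0) - ?\<psi> (g 1))"
    by (rule tendsto_add)
  moreover have "\<forall>\<^sub>F m in sequentially. (1 / real m) *\<^sub>R (\<Sum>k\<in>{1..m}. ?\<psi> (g (real k / real m))) + (1 / real m) *\<^sub>R (?\<psi> (g 0) - ?\<psi> (g 1))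
     = (1 / real m) *\<^sub>R (\<Sum>k<m. ?\<psi> (g (real k / real m)))"
    using eventually_ge_at_top[of 1]
  proof eventually_elim
    case (elim m)
    let ?h = "\<lambda>k. ?\<psi> (g (real k / real m))"
    have "(\<Sum>k<m. ?h k) + ?h m = (\<Sum>k\<le>m. ?h k)" by (simp add: lessThan_Suc_atMost[symmetric])
    also have "\<dots> = ?h 0 + (\<Sum>k\<in>{1..m}. ?h k)"
      unfolding atMost_atLeast0 by (subst sum.atLeast_Suc_atMost) auto
    finally have "(\<Sum>k<m. ?h k) = (\<Sum>k\<in>{1..m}. ?h k) + (?\<psi> (g 0) - ?\<psi> (g 1))"
      using elim by (simp add: algebra_simps)
    then show ?case by (simp only: scaleR_add_right)
  qed
  ultimately have "(\<lambda>m. (1 / real m) *\<^sub>R (\<Sum>k<m. ?\<psi> (g (real k / real m)))) \<longlonglongrightarrow> (\<integral>s. indicator {0<..<1} s *\<^sub>R ?\<psi> (g s) \<partial>lborel)"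
    by (auto dest: Lim_transform_eventually)
  then have "(\<lambda>m. exp (- ((1 / real m) *\<^sub>R (\<Sum>k<m. ?\<psi> (g (real k / real m)))))) \<longlonglongrightarrow> exp (- (\<integral>s. indicator {0<..<1} s *\<^sub>R ?\<psi> (g s) \<partial>lborel))"
    by (intro tendsto_intros)
  moreover have "\<forall>\<^sub>F m in sequentially. exp (- ((1 / real m) *\<^sub>R (\<Sum>k<m. ?\<psi> (g (real k / real m))))) = expectation (\<lambda>\<omega>. cis (R m \<omega>))"
    using eventually_ge_at_top[of 1]
    by eventually_elim (simp only: Rg stable_increment_sum_cf[OF levy])
  ultimately have l1: "(\<lambda>m. expectation (\<lambda>\<omega>. cis (R m \<omega>))) \<longlonglongrightarrow> exp (- (\<integral>s. indicator {0<..<1} s *\<^sub>R ?\<psi> (g s) \<partial>lborel))"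
    by (rule Lim_transform_eventually)
  have l2: "(\<lambda>m. expectation (\<lambda>\<omega>. cis (R m \<omega>)) - expectation (\<lambda>\<omega>. cis (Z \<omega>))) \<longlonglongrightarrow> 0"
  proof (rule Lim_null_comparison)
    have mi: "integrable M (\<lambda>\<omega>. min 2 (norm (\<theta> q) * norm (riemann_sum \<Lambda> (f q) m \<omega> - I q \<omega>)))" for q m
      by (intro integrable_const_bound[where B=2]) auto
    have "norm (expectation (\<lambda>\<omega>. cis (R m \<omega>)) - expectation (\<lambda>\<omega>. cis (Z \<omega>)))
       \<le> (\<Sum>q\<in>UNIV. expectation (\<lambda>\<omega>. min 2 (norm (\<theta> q) * norm (riemann_sum \<Lambda> (f q) m \<omega> - I q \<omega>))))" for m
    proof -
      have "norm (expectation (\<lambda>\<omega>. cis (R m \<omega>)) - expectation (\<lambda>\<omega>. cis (Z \<omega>))) = norm (expectation (\<lambda>\<omega>. cis (R m \<omega>) - cis (Z \<omega>)))"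
        by (subst Bochner_Integration.integral_diff) (auto intro!: integrable_cis)
      also have "\<dots> \<le> expectation (\<lambda>\<omega>. norm (cis (R m \<omega>) - cis (Z \<omega>)))" by (rule integral_norm_bound)
      also have "\<dots> \<le> expectation (\<lambda>\<omega>. \<Sum>q\<in>UNIV. min 2 (norm (\<theta> q) * norm (riemann_sum \<Lambda> (f q) m \<omega> - I q \<omega>)))"
      proof (rule integral_mono)
        show "integrable M (\<lambda>\<omega>. norm (cis (R m \<omega>) - cis (Z \<omega>)))"
          by (intro integrable_norm Bochner_Integration.integrable_diff integrable_cis) auto
        show "integrable M (\<lambda>\<omega>. \<Sum>q\<in>UNIV. min 2 (norm (\<theta> q) * norm (riemann_sum \<Lambda> (f q) m \<omega> - I q \<omega>)))"
          by (intro Bochner_Integration.integrable_sum mi)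
        fix \<omega>
        let ?x = "\<lambda>q. norm (\<theta> q) * norm (riemann_sum \<Lambda> (f q) m \<omega> - I q \<omega>)"
        have "\<bar>R m \<omega> - Z \<omega>\<bar> \<le> (\<Sum>q\<in>UNIV. ?x q)"
          unfolding R_def Z_def sum_subtractf[symmetric] inner_diff_right[symmetric]
          by (rule order_trans[OF sum_abs sum_mono[OF Cauchy_Schwarz_ineq2]])
        then have "norm (cis (R m \<omega>) - cis (Z \<omega>)) \<le> min 2 (\<Sum>q\<in>UNIV. ?x q)"
          using cis_diff_le[of "R m \<omega>" "Z \<omega>"] by simp
        \<comment> \<open>Truncation is subadditive: either one summand already reaches 2, or no
          summand is truncated.\<close>
        also have "\<dots> \<le> (\<Sum>q\<in>UNIV. min 2 (?x q))"
        proof (cases "\<exists>q. 2 \<le> ?x q")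
          case True
          then obtain q where "2 \<le> ?x q" by blast
          then have "2 = min 2 (?x q)" by simp
          also have "\<dots> \<le> (\<Sum>q\<in>UNIV. min 2 (?x q))" by (rule member_le_sum) auto
          finally show ?thesis by (rule min.coboundedI1)
        next
          case False
          then have "min 2 (?x q) = ?x q" for q by (meson linear min.absorb2)
          then show ?thesis by (simp only: min.cobounded2)
        qed
        finally show "norm (cis (R m \<omega>) - cis (Z \<omega>)) \<le> (\<Sum>q\<in>UNIV. min 2 (?x q))" .
      qed
      also have "\<dots> = (\<Sum>q\<in>UNIV. expectation (\<lambda>\<omega>. min 2 (norm (\<theta> q) * norm (riemann_sum \<Lambda> (f q) m \<omega> - I q \<omega>))))"
        by (rule Bochner_Integration.integral_sum) (rule mi)
      finally show ?thesis .
    qed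
    then show "\<forall>\<^sub>F m in sequentially. norm (expectation (\<lambda>\<omega>. cis (R m \<omega>)) - expectation (\<lambda>\<omega>. cis (Z \<omega>)))
       \<le> (\<Sum>q\<in>UNIV. expectation (\<lambda>\<omega>. min 2 (norm (\<theta> q) * norm (riemann_sum \<Lambda> (f q) m \<omega> - I q \<omega>))))"
      by (simp add: always_eventually)
    have "(\<lambda>m. \<Sum>q\<in>UNIV. expectation (\<lambda>\<omega>. min 2 (norm (\<theta> q) * norm (riemann_sum \<Lambda> (f q) m \<omega> - I q \<omega>)))) \<longlonglongrightarrow> (\<Sum>q\<in>(UNIV::'q set). 0)"
      using I by (intro tendsto_sum conv_in_prob_min prob_space_axioms Rm Im) (auto simp: stoch_integral_def)
    then show "(\<lambda>m. \<Sum>q\<in>UNIV. expectation (\<lambda>\<omega>. min 2 (norm (\<theta> q) * norm (riemann_sum \<Lambda> (f q) m \<omega> - I q \<omega>)))) \<longlonglongrightarrow> 0" by simp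
  qed
  have "(\<lambda>m. expectation (\<lambda>\<omega>. cis (R m \<omega>))) \<longlonglongrightarrow> 0 + expectation (\<lambda>\<omega>. cis (Z \<omega>))"
    using tendsto_add[OF l2 tendsto_const[of "expectation (\<lambda>\<omega>. cis (Z \<omega>))"]] by simp
  then have "expectation (\<lambda>\<omega>. cis (Z \<omega>)) = exp (- (\<integral>s. indicator {0<..<1} s *\<^sub>R ?\<psi> (g s) \<partial>lborel))"
    using LIMSEQ_unique[OF l1] by simp
  then show ?thesis by (simp add: Z_def g_def)
qed

lemma borel_measurable_vec_lambda:
  fixes f :: "'a \<Rightarrow> 'q::finite \<Rightarrow> complex"
  assumes "\<And>q. (\<lambda>\<omega>. f \<omega> q) \<in> borel_measurable M"
  shows "(\<lambda>\<omega>. \<chi> q. f \<omega> q) \<in> borel_measurable M"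
proof (rule borel_measurable_euclidean_space[THEN iffD2], rule ballI)
  fix b :: "complex ^ 'q"
  note [measurable] = assms
  show "(\<lambda>\<omega>. (\<chi> q. f \<omega> q) \<bullet> b) \<in> borel_measurable M"
    unfolding inner_vec_def by simp
qed

text \<open>For a direction \<theta>, covering real and imaginary parts of all coordinates, the
  inner product with the transforms is the sum of \<open>X t\<close> against a single Lipschitz
  weight \<open>g (t / n)\<close>, and the same \<open>g\<close> is the integrand on the side of the
  limit. Hence each model enters only through its limit for such weights.\<close>

theorem theorem2:
  fixes M :: "'a measure" and M' :: "'b measure" and \<alpha> \<mu> :: real
    and X :: "int \<Rightarrow> 'a \<Rightarrow> real" and U :: "'a \<Rightarrow> nat" and \<xi> :: "'a \<Rightarrow> real"
    and js :: "'q::finite \<Rightarrow> nat"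
    and \<Lambda> :: "real \<Rightarrow> 'b \<Rightarrow> real" and I :: "'q \<Rightarrow> 'b \<Rightarrow> complex"
  assumes alpha: "1 < \<alpha>" "\<alpha> < 2"
    and model:
      "(\<exists>S0 T W L. taqqu_levy_model M S0 T W \<alpha> L \<and> X = tl_X S0 T W \<and> U = T 1 \<and> \<xi> = W 1
                   \<and> \<mu> = (\<integral>\<omega>. real (T 1 \<omega>) \<partial>M))
       \<or> (\<exists>eps nn L. parke_model M eps nn \<alpha> L \<and> X = parke_X eps nn \<and> U = nn 0 \<and> \<xi> = eps 1
                   \<and> \<mu> = 1)"
    and js: "inj js" "\<forall>q. 0 < js q"
    and levy: "stable_levy M' \<Lambda> \<alpha>
         ((\<integral>\<omega>. \<bar>\<xi> \<omega>\<bar> powr \<alpha> \<partial>M) / \<mu> * Gamma (1 - \<alpha>) * cos (pi * \<alpha> / 2))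
         (((\<integral>\<omega>. (max (\<xi> \<omega>) 0) powr \<alpha> \<partial>M) - (\<integral>\<omega>. (max (- \<xi> \<omega>) 0) powr \<alpha> \<partial>M))
            / (\<integral>\<omega>. \<bar>\<xi> \<omega>\<bar> powr \<alpha> \<partial>M))"
    and integrals: "\<forall>q. stoch_integral M' \<Lambda> (\<lambda>s. cis (2 * pi * real (js q) * s)) (I q)"
  shows "conv_distr M
           (\<lambda>n \<omega>. \<chi> q. complex_of_real (1 / (ell M U \<alpha> n * real n powr (1 / \<alpha>))) * dft X n (js q) \<omega>)
           M' (\<lambda>\<omega>. \<chi> q. I q \<omega>)"
proof -
  define c where "c = (\<integral>\<omega>. \<bar>\<xi> \<omega>\<bar> powr \<alpha> \<partial>M) / \<mu> * Gamma (1 - \<alpha>) * cos (pi * \<alpha> / 2)"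
  define \<beta> where "\<beta> = ((\<integral>\<omega>. (max (\<xi> \<omega>) 0) powr \<alpha> \<partial>M) - (\<integral>\<omega>. (max (- \<xi> \<omega>) 0) powr \<alpha> \<partial>M)) / (\<integral>\<omega>. \<bar>\<xi> \<omega>\<bar> powr \<alpha> \<partial>M)"
  define tq where "tq = tail_quantile (\<lambda>x. measure M {\<omega>\<in>space M. x < real (U \<omega>)})"
  have levy': "stable_levy M' \<Lambda> \<alpha> c \<beta>" using levy by (simp only: c_def \<beta>_def)
  \<comment> \<open>Each model has its own \<open>qlim\<close>; abstracting it to \<open>Q\<close>
    with the known closed form lets the match with the Levy exponent be made once. The factor
    \<open>1 / \<mu>\<close> moves into the constant \<open>c\<close>.\<close>
  have psi_eq: "(1 / \<mu>) *\<^sub>R (\<integral>s. indicator {0<..<1} s *\<^sub>R Q (g s) \<partial>lborel) = - (\<integral>s. indicator {0<..<1} s *\<^sub>R stable_psi \<alpha> c \<beta> (g s) \<partial>lborel)"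
    if Q: "\<And>u. Q u = - (of_real (\<bar>u\<bar> powr \<alpha> * ((\<integral>\<omega>. \<bar>\<xi> \<omega>\<bar> powr \<alpha> \<partial>M) * Gamma (1 - \<alpha>) * cos (pi * \<alpha> / 2)))
     * (1 - \<i> * of_real (((\<integral>\<omega>. max (\<xi> \<omega>) 0 powr \<alpha> \<partial>M) - (\<integral>\<omega>. max (- \<xi> \<omega>) 0 powr \<alpha> \<partial>M)) /
         (\<integral>\<omega>. \<bar>\<xi> \<omega>\<bar> powr \<alpha> \<partial>M) * sgn u * tan (pi * \<alpha> / 2))))" for Q :: "real \<Rightarrow> complex" and g :: "real \<Rightarrow> real"
  proof -
    have "(1 / \<mu>) *\<^sub>R Q u = - stable_psi \<alpha> c \<beta> u" for u
      unfolding Q stable_psi_def c_def \<beta>_def by (simp add: scaleR_conv_of_real mult_ac)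
    then have *: "of_real (1 / \<mu>) * Q u = - stable_psi \<alpha> c \<beta> u" for u by (simp only: scaleR_conv_of_real)
    have "(1 / \<mu>) *\<^sub>R (\<integral>s. indicator {0<..<1} s *\<^sub>R Q (g s) \<partial>lborel)
       = (\<integral>s. of_real (1 / \<mu>) * (indicator {0<..<1} s *\<^sub>R Q (g s)) \<partial>lborel)"
      by (simp only: scaleR_conv_of_real[of "1 / \<mu>"] integral_mult_right_zero)
    also have "\<dots> = (\<integral>s. - (indicator {0<..<1} s *\<^sub>R stable_psi \<alpha> c \<beta> (g s)) \<partial>lborel)"
      by (simp only: mult_scaleR_right * scaleR_minus_right)
    finally show ?thesis by simp
  qed
  \<comment> \<open>The common ground of the two cases: from here on no particular model is referred
    to.\<close>
  have core: "prob_space M \<and> (\<forall>t. X t \<in> borel_measurable M) \<and>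
    (\<forall>g B K. (\<forall>x. \<bar>g x\<bar> \<le> B) \<longrightarrow> (\<forall>x y. \<bar>g x - g y\<bar> \<le> K * \<bar>x - y\<bar>) \<longrightarrow>
      (\<lambda>n. \<integral>\<omega>. cis ((\<Sum>t=1..n. X (int t) \<omega> * g (real t / real n)) / tq n) \<partial>M)
         \<longlonglongrightarrow> exp (- (\<integral>s. indicator {0<..<1} s *\<^sub>R stable_psi \<alpha> c \<beta> (g s) \<partial>lborel)))"
    using model
  proof
    assume "\<exists>S0 T W L. taqqu_levy_model M S0 T W \<alpha> L \<and> X = tl_X S0 T W \<and> U = T 1 \<and> \<xi> = W 1 \<and> \<mu> = (\<integral>\<omega>. real (T 1 \<omega>) \<partial>M)"
    then obtain S0 T W L where m: "taqqu_levy_model M S0 T W \<alpha> L" and X: "X = tl_X S0 T W" and U: "U = T 1"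
      and \<xi>: "\<xi> = W 1" and mu_eq: "\<mu> = (\<integral>\<omega>. real (T 1 \<omega>) \<partial>M)" by blast
    interpret prob_space M using m by (simp add: taqqu_levy_model_def)
    interpret tl_model M S0 T W \<alpha> L by unfold_locales (use alpha m in auto)
    have tq: "tq = tail_quantile tailT" unfolding tq_def U tailT_def[abs_def] ..
    have \<mu>': "\<mu> = mean" by (simp only: mu_eq mean_def)
    show ?thesis
    proof (intro conjI allI impI)
      fix g :: "real \<Rightarrow> real" and B K assume "\<forall>x. \<bar>g x\<bar> \<le> B" "\<forall>x y. \<bar>g x - g y\<bar> \<le> K * \<bar>x - y\<bar>"
      then show "(\<lambda>n. \<integral>\<omega>. cis ((\<Sum>t=1..n. X (int t) \<omega> * g (real t / real n)) / tq n) \<partial>M)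
         \<longlonglongrightarrow> exp (- (\<integral>s. indicator {0<..<1} s *\<^sub>R stable_psi \<alpha> c \<beta> (g s) \<partial>lborel))"
        unfolding psi_eq[of qlim g, OF qlim_eq[folded \<xi>], symmetric] \<mu>' X tq by (intro tl_cf_limit) auto
    qed (simp_all add: prob_space_axioms X)
  next
    assume "\<exists>eps nn L. parke_model M eps nn \<alpha> L \<and> X = parke_X eps nn \<and> U = nn 0 \<and> \<xi> = eps 1 \<and> \<mu> = 1"
    \<comment> \<open>\<open>eps 1\<close> is written as \<open>eps (int 1)\<close>, the first mark
      of the array, so that \<open>qlim_eq\<close> applies literally.\<close>
    then obtain eps nn L where m: "parke_model M eps nn \<alpha> L" and X: "X = parke_X eps nn" and U: "U = nn 0"
      and \<xi>: "\<xi> = eps (int 1)" and mu_eq: "\<mu> = 1" by auto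
    interpret prob_space M using m by (simp add: parke_model_def)
    interpret parke_process M eps nn \<alpha> L by unfold_locales (use alpha m in auto)
    have tq: "tq = tail_quantile tailN" unfolding tq_def U tailN_def[abs_def] ..
    show ?thesis
    proof (intro conjI allI impI)
      fix g :: "real \<Rightarrow> real" and B K assume "\<forall>x. \<bar>g x\<bar> \<le> B" "\<forall>x y. \<bar>g x - g y\<bar> \<le> K * \<bar>x - y\<bar>"
      then show "(\<lambda>n. \<integral>\<omega>. cis ((\<Sum>t=1..n. X (int t) \<omega> * g (real t / real n)) / tq n) \<partial>M)
         \<longlonglongrightarrow> exp (- (\<integral>s. indicator {0<..<1} s *\<^sub>R stable_psi \<alpha> c \<beta> (g s) \<partial>lborel))"
        unfolding psi_eq[of qlim g, OF qlim_eq[folded \<xi>], symmetric] mu_eq X tq by (intro parke_cf_limit) auto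
    qed (simp_all add: prob_space_axioms X)
  qed
  have Xm[measurable]: "X t \<in> borel_measurable M" for t using core by blast
  have ps: "prob_space M" "prob_space M'" using core levy by (auto simp: stable_levy_def)
  have dm: "dft X n j \<in> borel_measurable M" for n j unfolding dft_def[abs_def] by measurable
  show ?thesis
  proof (rule cf_conv_imp_conv_distr[OF ps])
    show "(\<lambda>\<omega>. \<chi> q. complex_of_real (1 / (ell M U \<alpha> n * real n powr (1 / \<alpha>))) * dft X n (js q) \<omega>) \<in> borel_measurable M" for n
      using dm by (intro borel_measurable_vec_lambda) measurable
    show "(\<lambda>\<omega>. \<chi> q. I q \<omega>) \<in> borel_measurable M'"
      using integrals by (intro borel_measurable_vec_lambda) (simp add: stoch_integral_def)
    fix \<theta> :: "complex ^ 'q"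
    let ?f = "\<lambda>q s. cis (2 * pi * real (js q) * s)"
    define g where "g s = (\<Sum>q\<in>UNIV. \<theta> $ q \<bullet> ?f q s)" for s
    have gb: "\<bar>g x\<bar> \<le> (\<Sum>q\<in>UNIV. norm (\<theta> $ q))" for x
      unfolding g_def
    proof (rule order_trans[OF sum_abs sum_mono])
      fix q show "\<bar>\<theta> $ q \<bullet> ?f q x\<bar> \<le> norm (\<theta> $ q)"
        using Cauchy_Schwarz_ineq2[of "\<theta> $ q" "?f q x"] by simp
    qed
    have gl: "\<bar>g x - g y\<bar> \<le> (\<Sum>q\<in>UNIV. norm (\<theta> $ q) * (2 * pi * real (js q))) * \<bar>x - y\<bar>" for x y
      unfolding g_def sum_subtractf[symmetric] inner_diff_right[symmetric] sum_distrib_right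
    proof (rule order_trans[OF sum_abs sum_mono])
      fix q
      have "\<bar>\<theta> $ q \<bullet> (?f q x - ?f q y)\<bar> \<le> norm (\<theta> $ q) * norm (?f q x - ?f q y)" by (rule Cauchy_Schwarz_ineq2)
      also have "\<dots> \<le> norm (\<theta> $ q) * \<bar>2 * pi * real (js q) * x - 2 * pi * real (js q) * y\<bar>"
        using cis_diff_le[of "2 * pi * real (js q) * x" "2 * pi * real (js q) * y"] by (intro mult_left_mono) auto
      also have "\<dots> = norm (\<theta> $ q) * (2 * pi * real (js q)) * \<bar>x - y\<bar>"
        unfolding right_diff_distrib[symmetric] abs_mult by simp
      finally show "\<bar>\<theta> $ q \<bullet> (?f q x - ?f q y)\<bar> \<le> norm (\<theta> $ q) * (2 * pi * real (js q)) * \<bar>x - y\<bar>" .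
    qed
    have lim: "(\<lambda>n. \<integral>\<omega>. cis ((\<Sum>t=1..n. X (int t) \<omega> * g (real t / real n)) / tq n) \<partial>M)
         \<longlonglongrightarrow> exp (- (\<integral>s. indicator {0<..<1} s *\<^sub>R stable_psi \<alpha> c \<beta> (g s) \<partial>lborel))"
      using core gb gl by blast
    have rhs: "(\<integral>\<omega>. cis (\<theta> \<bullet> (\<chi> q. I q \<omega>)) \<partial>M') = exp (- (\<integral>s. indicator {0<..<1} s *\<^sub>R stable_psi \<alpha> c \<beta> (g s) \<partial>lborel))"
      unfolding inner_vec_def vec_lambda_beta g_def using alpha integrals
      by (intro stable_integral_cf[OF levy']) (auto intro!: continuous_intros)
    have lhs: "\<theta> \<bullet> (\<chi> q. complex_of_real (1 / (ell M U \<alpha> n * real n powr (1 / \<alpha>))) * dft X n (js q) \<omega>)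
       = (\<Sum>t=1..n. X (int t) \<omega> * g (real t / real n)) / tq n" if n: "1 \<le> n" for n \<omega>
    proof -
      have "\<theta> $ q \<bullet> (complex_of_real (1 / tq n) * dft X n (js q) \<omega>) = (\<Sum>t=1..n. X (int t) \<omega> * (\<theta> $ q \<bullet> ?f q (real t / real n))) / tq n" for q
      proof -
        have "dft X n (js q) \<omega> = (\<Sum>t=1..n. X (int t) \<omega> *\<^sub>R ?f q (real t / real n))"
          unfolding dft_def by (intro sum.cong refl) (simp add: scaleR_conv_of_real mult_ac)
        then have "complex_of_real (1 / tq n) * dft X n (js q) \<omega> = (1 / tq n) *\<^sub>R (\<Sum>t=1..n. X (int t) \<omega> *\<^sub>R ?f q (real t / real n))"
          by (simp add: scaleR_conv_of_real)
        then show ?thesis by (simp add: inner_sum_right)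
      qed
      moreover have "ell M U \<alpha> n * real n powr (1 / \<alpha>) = tq n"
        unfolding tq_def using n alpha by (intro ell_eq_quantile) auto
      ultimately have "\<theta> \<bullet> (\<chi> q. complex_of_real (1 / (ell M U \<alpha> n * real n powr (1 / \<alpha>))) * dft X n (js q) \<omega>)
         = (\<Sum>q\<in>UNIV. \<Sum>t=1..n. X (int t) \<omega> * (\<theta> $ q \<bullet> ?f q (real t / real n))) / tq n"
        unfolding inner_vec_def vec_lambda_beta by (simp only: sum_divide_distrib)
      also have "(\<Sum>q\<in>UNIV. \<Sum>t=1..n. X (int t) \<omega> * (\<theta> $ q \<bullet> ?f q (real t / real n))) = (\<Sum>t=1..n. X (int t) \<omega> * g (real t / real n))"
        by (subst sum.swap) (simp only: g_def sum_distrib_left)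
      finally show ?thesis .
    qed
    show "(\<lambda>n. \<integral>\<omega>. cis (\<theta> \<bullet> (\<chi> q. complex_of_real (1 / (ell M U \<alpha> n * real n powr (1 / \<alpha>))) * dft X n (js q) \<omega>)) \<partial>M)
       \<longlonglongrightarrow> (\<integral>\<omega>. cis (\<theta> \<bullet> (\<chi> q. I q \<omega>)) \<partial>M')"
      unfolding rhs
    proof (rule Lim_transform_eventually[OF lim])
      show "\<forall>\<^sub>F n in sequentially. (\<integral>\<omega>. cis ((\<Sum>t=1..n. X (int t) \<omega> * g (real t / real n)) / tq n) \<partial>M) =
         (\<integral>\<omega>. cis (\<theta> \<bullet> (\<chi> q. complex_of_real (1 / (ell M U \<alpha> n * real n powr (1 / \<alpha>))) * dft X n (js q) \<omega>)) \<partial>M)"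
        using eventually_ge_at_top[of 1] by eventually_elim (simp only: lhs)
    qed
  qed
qed

end
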